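(* Let $\Gamma$ be a Brauer tree of type $(m,n)$ and let $A_\Gamma$ be a basic Brauer tree algebra over $k$ whose tree is $\Gamma$. Then there are group isomorphisms $$\mathrm{Out}^K(A_\Gamma)\cong\mathrm{Aut}(k[x]/(x^{m+1}))\cong H_m.$$
   Context: $k$ is an algebraically closed field of positive characteristic; algebras are finite dimensional over $k$, modules are left modules. A Brauer tree $\Gamma$ of type $(m,n)$ is a finite connected planar tree with $n\ge 1$ edges, a distinguished exceptional vertex with multiplicity $m\ge1$, and at each vertex the counter-clockwise cyclic ordering of the adjacent edges. A symmetric algebra $A$ is a Brauer tree algebra of $\Gamma$ if its simple modules $S_j$ correspond to the edges $j$ of $\Gamma$, and, for the projective cover $P_j$ of $S_j$, $\mathrm{rad}\,P_j/\mathrm{soc}\,P_j$ is a direct sum of two (possibly zero) uniserial modules $U_v,U_w$, where $v,w$ are the vertices of $j$, and for $u\in\{v,w\}$ with cyclic ordering $j=j_0,j_1,\dots,j_r$ of the edges at $u$ the composition factors of $U_u$ from the top are $S_{j_1},\dots,S_{j_r},S_{j_0},S_{j_1},\dots$, ending with $S_{j_r}$, of total number $m(r+1)-1$ if $u$ is exceptional and $r$ otherwise. The basic such algebra $A_\Gamma$ is unique up to isomorphism. $\mathrm{Out}(A)$ is the group of $k$-algebra automorphisms of $A$ modulo inner automorphisms, and $\mathrm{Out}^K(A)$ is its subgroup of classes of automorphisms fixing the isomorphism classes of all simple $A$-modules. $\mathrm{Aut}(k[x]/(x^{m+1}))$ is the group of $k$-algebra automorphisms. $H_m$ is the group with underlying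 set $k^*\times k^{m-1}$ and multiplication $$\beta*\alpha=\Bigl(\sum_{i=1}^l\alpha_i\sum_{\substack{j_1+\dots+j_i=l\\ j_1,\dots,j_i>0}}\beta_{j_1}\beta_{j_2}\cdots\beta_{j_i}\Bigr)_{l=1}^m$$ for $\alpha=(\alpha_1,\dots,\alpha_m)$, $\beta=(\beta_1,\dots,\beta_m)$. *)

theory Defs
  imports "HOL-Algebra.Algebra" "HOL-Algebra.UnivPoly" "HOL-Algebra.Bij" "HOL-Combinatorics.Orbits"
begin

section \<open>Left modules over a ring\<close>

text \<open>
  The locale \<^locale>\<open>module\<close> of the library requires a commutative base ring; the axioms below are
  the same ones over an arbitrary ring.  The record type \<open>('a, 'b) module\<close> also has ring
  multiplication and unit fields; for modules they play no role.
  The library predicate \<^const>\<open>submodule\<close> does not need commutativity.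
\<close>

locale left_module = R?: ring R + M?: abelian_group M
  for R :: "('a, 'r) ring_scheme" (structure) and M :: "('a, 'b, 'm) module_scheme" (structure) +
  assumes smult_closed:
      "\<lbrakk>a \<in> carrier R; x \<in> carrier M\<rbrakk> \<Longrightarrow> a \<odot>\<^bsub>M\<^esub> x \<in> carrier M"
    and smult_l_distr:
      "\<lbrakk>a \<in> carrier R; b \<in> carrier R; x \<in> carrier M\<rbrakk> \<Longrightarrow>
      (a \<oplus> b) \<odot>\<^bsub>M\<^esub> x = a \<odot>\<^bsub>M\<^esub> x \<oplus>\<^bsub>M\<^esub> b \<odot>\<^bsub>M\<^esub> x"
    and smult_r_distr:
      "\<lbrakk>a \<in> carrier R; x \<in> carrier M; y \<in> carrier M\<rbrakk> \<Longrightarrow>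
      a \<odot>\<^bsub>M\<^esub> (x \<oplus>\<^bsub>M\<^esub> y) = a \<odot>\<^bsub>M\<^esub> x \<oplus>\<^bsub>M\<^esub> a \<odot>\<^bsub>M\<^esub> y"
    and smult_assoc1:
      "\<lbrakk>a \<in> carrier R; b \<in> carrier R; x \<in> carrier M\<rbrakk> \<Longrightarrow>
      (a \<otimes> b) \<odot>\<^bsub>M\<^esub> x = a \<odot>\<^bsub>M\<^esub> (b \<odot>\<^bsub>M\<^esub> x)"
    and smult_one:
      "x \<in> carrier M \<Longrightarrow> \<one> \<odot>\<^bsub>M\<^esub> x = x"

definition lmod_hom ::
  "('a, 'r) ring_scheme \<Rightarrow> ('a, 'b, 'm) module_scheme \<Rightarrow> ('a, 'c, 'n) module_scheme \<Rightarrow> ('b \<Rightarrow> 'c) set"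
  where "lmod_hom R M N =
    {h \<in> carrier M \<rightarrow> carrier N.
      (\<forall>x\<in>carrier M. \<forall>y\<in>carrier M. h (x \<oplus>\<^bsub>M\<^esub> y) = h x \<oplus>\<^bsub>N\<^esub> h y) \<and>
      (\<forall>a\<in>carrier R. \<forall>x\<in>carrier M. h (a \<odot>\<^bsub>M\<^esub> x) = a \<odot>\<^bsub>N\<^esub> h x)}"

definition lmod_iso ::
  "('a, 'r) ring_scheme \<Rightarrow> ('a, 'b, 'm) module_scheme \<Rightarrow> ('a, 'c, 'n) module_scheme \<Rightarrow> bool"
  where "lmod_iso R M N \<longleftrightarrow> (\<exists>h\<in>lmod_hom R M N. bij_betw h (carrier M) (carrier N))"

text \<open>
  The quotient \<open>M/N\<close>, with the induced scalar multiplication.  It serves both for a module \<open>M\<close> and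
  a submodule \<open>N\<close>, and for an algebra \<open>M\<close> and a two-sided ideal \<open>N\<close> (where the multiplication
  provided by \<^const>\<open>FactRing\<close> is meaningful).
\<close>

definition quot :: "('a, 'b, 'm) module_scheme \<Rightarrow> 'b set \<Rightarrow> ('a, 'b set) module"
  where "quot M N =
    ring.extend (M Quot N) (module.fields (\<lambda>a C. \<Union>x\<in>C. N +>\<^bsub>M\<^esub> (a \<odot>\<^bsub>M\<^esub> x)))"

definition simple_lmod :: "('a, 'r) ring_scheme \<Rightarrow> ('a, 'b, 'm) module_scheme \<Rightarrow> bool"
  where "simple_lmod R M \<longleftrightarrow> left_module R M \<and> carrier M \<noteq> {\<zero>\<^bsub>M\<^esub>} \<and>
    (\<forall>N. submodule N R M \<longrightarrow> N = {\<zero>\<^bsub>M\<^esub>} \<or> N = carrier M)"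

definition maximal_submodule ::
  "'b set \<Rightarrow> ('a, 'r) ring_scheme \<Rightarrow> ('a, 'b, 'm) module_scheme \<Rightarrow> bool"
  where "maximal_submodule N R M \<longleftrightarrow> submodule N R M \<and> N \<noteq> carrier M \<and>
    (\<forall>N'. submodule N' R M \<and> N \<subseteq> N' \<longrightarrow> N' = N \<or> N' = carrier M)"

definition lmod_rad :: "('a, 'r) ring_scheme \<Rightarrow> ('a, 'b, 'm) module_scheme \<Rightarrow> 'b set"
  where "lmod_rad R M = {x \<in> carrier M. \<forall>N. maximal_submodule N R M \<longrightarrow> x \<in> N}"

text \<open>The socle is the sum of all simple submodules, i.e. the smallest submodule containing them.\<close>

definition lmod_soc :: "('a, 'r) ring_scheme \<Rightarrow> ('a, 'b, 'm) module_scheme \<Rightarrow> 'b set"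
  where "lmod_soc R M =
    \<Inter>{L. submodule L R M \<and>
        (\<forall>N. submodule N R M \<and> simple_lmod R (M\<lparr>carrier := N\<rparr>) \<longrightarrow> N \<subseteq> L)}"

definition uniserial :: "('a, 'r) ring_scheme \<Rightarrow> ('a, 'b, 'm) module_scheme \<Rightarrow> bool"
  where "uniserial R M \<longleftrightarrow> left_module R M \<and>
    (\<forall>N N'. submodule N R M \<and> submodule N' R M \<longrightarrow> N \<subseteq> N' \<or> N' \<subseteq> N)"

text \<open>
  \<open>Ss\<close> lists the successive quotients of a descending chain of submodules from \<open>M\<close> to \<open>0\<close>.  If \<open>M\<close>
  is uniserial and the members of \<open>Ss\<close> are simple, then \<open>Ss\<close> is the list of composition factors
  of \<open>M\<close> from the top.
\<close>

definition factors_from_top ::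
  "('a, 'r) ring_scheme \<Rightarrow> ('a, 'b, 'm) module_scheme \<Rightarrow> ('a, 'c, 'n) module_scheme list \<Rightarrow> bool"
  where "factors_from_top R M Ss \<longleftrightarrow>
    (\<exists>F :: nat \<Rightarrow> 'b set.
      F 0 = carrier M \<and> F (length Ss) = {\<zero>\<^bsub>M\<^esub>} \<and>
      (\<forall>i\<le>length Ss. submodule (F i) R M) \<and>
      (\<forall>i<length Ss. F (Suc i) \<subseteq> F i \<and>
         lmod_iso R (quot (M\<lparr>carrier := F i\<rparr>) (F (Suc i))) (Ss ! i)))"

text \<open>The free left module \<open>R\<^sup>n\<close>.\<close>

definition free_lmod :: "('a, 'r) ring_scheme \<Rightarrow> nat \<Rightarrow> ('a, nat \<Rightarrow> 'a) module"
  where "free_lmod R n =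
    \<lparr>carrier = {..<n} \<rightarrow>\<^sub>E carrier R,
     monoid.mult = (\<lambda>x y. \<lambda>i\<in>{..<n}. x i \<otimes>\<^bsub>R\<^esub> y i),
     one = (\<lambda>i\<in>{..<n}. \<one>\<^bsub>R\<^esub>),
     ring.zero = (\<lambda>i\<in>{..<n}. \<zero>\<^bsub>R\<^esub>),
     ring.add = (\<lambda>x y. \<lambda>i\<in>{..<n}. x i \<oplus>\<^bsub>R\<^esub> y i),
     smult = (\<lambda>a x. \<lambda>i\<in>{..<n}. a \<otimes>\<^bsub>R\<^esub> x i)\<rparr>"

text \<open>
  Finitely generated projective modules: the direct summands of the modules \<open>R\<^sup>n\<close>.  (The
  lifting property would quantify over modules on arbitrary types.)
\<close>

definition fg_projective :: "('a, 'r) ring_scheme \<Rightarrow> ('a, 'b, 'm) module_scheme \<Rightarrow> bool"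
  where "fg_projective R P \<longleftrightarrow> left_module R P \<and>
    (\<exists>n. \<exists>f\<in>lmod_hom R P (free_lmod R n). \<exists>g\<in>lmod_hom R (free_lmod R n) P.
      \<forall>x\<in>carrier P. g (f x) = x)"

text \<open>A surjection from a projective module whose kernel is superfluous.\<close>

definition projective_cover ::
  "('a, 'r) ring_scheme \<Rightarrow> ('a, 'b, 'm) module_scheme \<Rightarrow> ('b \<Rightarrow> 'c) \<Rightarrow> ('a, 'c, 'n) module_scheme \<Rightarrow> bool"
  where "projective_cover R P \<pi> S \<longleftrightarrow>
    fg_projective R P \<and> \<pi> \<in> lmod_hom R P S \<and> \<pi> ` carrier P = carrier S \<and>
    (\<forall>N. submodule N R P \<and> N <+>\<^bsub>P\<^esub> a_kernel P S \<pi> = carrier P \<longrightarrow> N = carrier P)"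


section \<open>Finite dimensional algebras\<close>

locale fd_algebra = K?: field K + A?: ring A + module K A
  for K :: "('k, 'l) ring_scheme" (structure) and A :: "('k, 'a, 'm) module_scheme" (structure) +
  assumes smult_mult_l:
      "\<lbrakk>c \<in> carrier K; x \<in> carrier A; y \<in> carrier A\<rbrakk> \<Longrightarrow>
        (c \<odot>\<^bsub>A\<^esub> x) \<otimes>\<^bsub>A\<^esub> y = c \<odot>\<^bsub>A\<^esub> (x \<otimes>\<^bsub>A\<^esub> y)"
    and smult_mult_r:
      "\<lbrakk>c \<in> carrier K; x \<in> carrier A; y \<in> carrier A\<rbrakk> \<Longrightarrow>
        x \<otimes>\<^bsub>A\<^esub> (c \<odot>\<^bsub>A\<^esub> y) = c \<odot>\<^bsub>A\<^esub> (x \<otimes>\<^bsub>A\<^esub> y)"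
    and finite_dim:
      "\<exists>B. finite B \<and> B \<subseteq> carrier A \<and>
        (\<forall>x\<in>carrier A. \<exists>c\<in>B \<rightarrow> carrier K. x = (\<Oplus>\<^bsub>A\<^esub>b\<in>B. c b \<odot>\<^bsub>A\<^esub> b))"

text \<open>Symmetric algebras: those with a nondegenerate symmetric associative bilinear form.\<close>

definition symmetric_algebra :: "('k, 'l) ring_scheme \<Rightarrow> ('k, 'a, 'm) module_scheme \<Rightarrow> bool"
  where "symmetric_algebra K A \<longleftrightarrow> fd_algebra K A \<and>
    (\<exists>b. (\<forall>x\<in>carrier A. \<forall>y\<in>carrier A. b x y \<in> carrier K \<and> b x y = b y x) \<and>
      (\<forall>x\<in>carrier A. \<forall>y\<in>carrier A. \<forall>z\<in>carrier A.
         b (x \<oplus>\<^bsub>A\<^esub> y) z = b x z \<oplus>\<^bsub>K\<^esub> b y z \<and> b (x \<otimes>\<^bsub>A\<^esub> y) z = b x (y \<otimes>\<^bsub>A\<^esub> z)) \<and>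
      (\<forall>c\<in>carrier K. \<forall>x\<in>carrier A. \<forall>y\<in>carrier A. b (c \<odot>\<^bsub>A\<^esub> x) y = c \<otimes>\<^bsub>K\<^esub> b x y) \<and>
      (\<forall>x\<in>carrier A. (\<forall>y\<in>carrier A. b x y = \<zero>\<^bsub>K\<^esub>) \<longrightarrow> x = \<zero>\<^bsub>A\<^esub>))"

definition primitive_idempotent :: "('a, 'r) ring_scheme \<Rightarrow> 'a \<Rightarrow> bool"
  where "primitive_idempotent R e \<longleftrightarrow> e \<in> carrier R \<and> e \<otimes>\<^bsub>R\<^esub> e = e \<and> e \<noteq> \<zero>\<^bsub>R\<^esub> \<and>
    \<not> (\<exists>f\<in>carrier R. \<exists>g\<in>carrier R. f \<noteq> \<zero>\<^bsub>R\<^esub> \<and> g \<noteq> \<zero>\<^bsub>R\<^esub> \<and> e = f \<oplus>\<^bsub>R\<^esub> g \<and>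
         f \<otimes>\<^bsub>R\<^esub> f = f \<and> g \<otimes>\<^bsub>R\<^esub> g = g \<and> f \<otimes>\<^bsub>R\<^esub> g = \<zero>\<^bsub>R\<^esub> \<and> g \<otimes>\<^bsub>R\<^esub> f = \<zero>\<^bsub>R\<^esub>)"

text \<open>The left module \<open>Re\<close>.\<close>

definition left_ideal_lmod :: "('a, 'r) ring_scheme \<Rightarrow> 'a \<Rightarrow> ('a, 'a) module"
  where "left_ideal_lmod R e =
    \<lparr>carrier = {a \<otimes>\<^bsub>R\<^esub> e | a. a \<in> carrier R}, monoid.mult = (\<otimes>\<^bsub>R\<^esub>), one = \<one>\<^bsub>R\<^esub>,
     ring.zero = \<zero>\<^bsub>R\<^esub>, ring.add = (\<oplus>\<^bsub>R\<^esub>), smult = (\<otimes>\<^bsub>R\<^esub>)\<rparr>"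

text \<open>
  Basic: the indecomposable summands \<open>Re\<close> of the regular module, for \<open>e\<close> in a complete set \<open>E\<close> of
  primitive orthogonal idempotents, are pairwise non-isomorphic.
\<close>

definition basic_algebra :: "('a, 'r) ring_scheme \<Rightarrow> bool"
  where "basic_algebra R \<longleftrightarrow>
    (\<exists>E. finite E \<and> (\<forall>e\<in>E. primitive_idempotent R e) \<and>
      (\<forall>e\<in>E. \<forall>f\<in>E. e \<noteq> f \<longrightarrow> e \<otimes>\<^bsub>R\<^esub> f = \<zero>\<^bsub>R\<^esub>) \<and>
      (\<Oplus>\<^bsub>R\<^esub>e\<in>E. e) = \<one>\<^bsub>R\<^esub> \<and>
      (\<forall>e\<in>E. \<forall>f\<in>E. e \<noteq> f \<longrightarrow> \<not> lmod_iso R (left_ideal_lmod R e) (left_ideal_lmod R f)))"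


section \<open>Brauer trees\<close>

text \<open>
  A tree has no parallel edges, so an edge is represented by the set of its two end points.
  A planar embedding of a tree is recorded by the counter-clockwise cyclic ordering of the edges at
  each vertex (every choice of cyclic orderings comes from an embedding): \<open>rotation \<Gamma> v\<close> maps
  each edge at \<open>v\<close> to the next one.
\<close>

record 'v brauer_tree =
  vertices :: "'v set"
  edges :: "'v set set"
  rotation :: "'v \<Rightarrow> 'v set \<Rightarrow> 'v set"
  exceptional :: "'v"
  multiplicity :: nat

definition edges_at :: "'v brauer_tree \<Rightarrow> 'v \<Rightarrow> 'v set set"
  where "edges_at \<Gamma> v = {e \<in> edges \<Gamma>. v \<in> e}"

locale brauer_tree =
  fixes \<Gamma> :: "'v brauer_tree" and m n :: nat
  assumes finite_vertices: "finite (vertices \<Gamma>)"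
    and edges: "e \<in> edges \<Gamma> \<Longrightarrow> \<exists>v\<in>vertices \<Gamma>. \<exists>w\<in>vertices \<Gamma>. v \<noteq> w \<and> e = {v, w}"
    and connected: "v \<in> vertices \<Gamma> \<Longrightarrow> w \<in> vertices \<Gamma> \<Longrightarrow> (v, w) \<in> {(x, y). {x, y} \<in> edges \<Gamma>}\<^sup>*"
    and acyclic: "distinct vs \<Longrightarrow> length vs \<ge> 3 \<Longrightarrow>
      \<exists>i<length vs. {vs ! i, vs ! (Suc i mod length vs)} \<notin> edges \<Gamma>"
    and rotation_cyclic: "v \<in> vertices \<Gamma> \<Longrightarrow> cyclic_on (rotation \<Gamma> v) (edges_at \<Gamma> v)"
    and exceptional: "exceptional \<Gamma> \<in> vertices \<Gamma>"
    and multiplicity: "multiplicity \<Gamma> = m" "m \<ge> 1"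
    and card_edges: "card (edges \<Gamma>) = n" "n \<ge> 1"

definition branch_length :: "'v brauer_tree \<Rightarrow> 'v \<Rightarrow> nat"
  where "branch_length \<Gamma> v =
    (if v = exceptional \<Gamma> then multiplicity \<Gamma> * card (edges_at \<Gamma> v) - 1 else card (edges_at \<Gamma> v) - 1)"

text \<open>
  The edges \<open>j\<^sub>1, j\<^sub>2, \<dots>\<close> that follow \<open>j = j\<^sub>0\<close> in the cyclic ordering at \<open>v\<close>, as
  often around \<open>v\<close> as the composition factors of the uniserial module \<open>U\<^sub>v\<close> require.
\<close>

definition branch :: "'v brauer_tree \<Rightarrow> 'v set \<Rightarrow> 'v \<Rightarrow> 'v set list"
  where "branch \<Gamma> j v = map (\<lambda>i. (rotation \<Gamma> v ^^ Suc i) j) [0..<branch_length \<Gamma> v]"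


section \<open>Brauer tree algebras\<close>

text \<open>
  Every simple \<open>A\<close>-module is isomorphic to a quotient of the regular module, hence to a module whose
  elements are sets of elements of \<open>A\<close>; every projective cover of a simple module is isomorphic to a
  left ideal.  This justifies the types of \<open>S\<close> and \<open>P\<close>.

  The subquotient \<open>rad P/soc P\<close> presupposes \<open>soc P \<subseteq> rad P\<close>; this excludes simple projective
  modules \<open>P\<close>.
\<close>

definition brauer_tree_algebra ::
  "('k, 'l) ring_scheme \<Rightarrow> ('k, 'a, 'm) module_scheme \<Rightarrow> 'v brauer_tree \<Rightarrow> bool"
  where "brauer_tree_algebra K A \<Gamma> \<longleftrightarrow> symmetric_algebra K A \<and>
    (\<exists>(S :: 'v set \<Rightarrow> ('a, 'a set) module) (P :: 'v set \<Rightarrow> ('a, 'a) module).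
      (\<forall>j\<in>edges \<Gamma>. simple_lmod A (S j)) \<and>
      (\<forall>j\<in>edges \<Gamma>. \<forall>j'\<in>edges \<Gamma>. lmod_iso A (S j) (S j') \<longrightarrow> j = j') \<and>
      (\<forall>T :: ('a, 'a set) module. simple_lmod A T \<longrightarrow> (\<exists>j\<in>edges \<Gamma>. lmod_iso A T (S j))) \<and>
      (\<forall>j\<in>edges \<Gamma>.
        (\<exists>\<pi>. projective_cover A (P j) \<pi> (S j)) \<and>
        lmod_soc A (P j) \<subseteq> lmod_rad A (P j) \<and>
        (let Q = quot ((P j)\<lparr>carrier := lmod_rad A (P j)\<rparr>) (lmod_soc A (P j)) in
          \<exists>U v w. j = {v, w} \<and>
            U v <+>\<^bsub>Q\<^esub> U w = carrier Q \<and> U v \<inter> U w = {\<zero>\<^bsub>Q\<^esub>} \<and>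
            (\<forall>u\<in>{v, w}. submodule (U u) A Q \<and> uniserial A (Q\<lparr>carrier := U u\<rparr>) \<and>
               factors_from_top A (Q\<lparr>carrier := U u\<rparr>) (map S (branch \<Gamma> j u))))))"


section \<open>Automorphism groups\<close>

text \<open>As for \<^const>\<open>AutoGroup\<close>, automorphisms are extensional functions on the carrier.\<close>

definition alg_auts :: "('k, 'l) ring_scheme \<Rightarrow> ('k, 'a, 'm) module_scheme \<Rightarrow> ('a \<Rightarrow> 'a) set"
  where "alg_auts K A = {\<phi> \<in> ring_hom A A \<inter> Bij (carrier A).
    \<forall>c\<in>carrier K. \<forall>x\<in>carrier A. \<phi> (c \<odot>\<^bsub>A\<^esub> x) = c \<odot>\<^bsub>A\<^esub> \<phi> x}"

definition alg_aut_group :: "('k, 'l) ring_scheme \<Rightarrow> ('k, 'a, 'm) module_scheme \<Rightarrow> ('a \<Rightarrow> 'a) monoid"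
  where "alg_aut_group K A = BijGroup (carrier A)\<lparr>carrier := alg_auts K A\<rparr>"

definition inner_auts :: "('a, 'r) ring_scheme \<Rightarrow> ('a \<Rightarrow> 'a) set"
  where "inner_auts A = {(\<lambda>x\<in>carrier A. u \<otimes>\<^bsub>A\<^esub> x \<otimes>\<^bsub>A\<^esub> inv\<^bsub>A\<^esub> u) | u. u \<in> Units A}"

definition Out :: "('k, 'l) ring_scheme \<Rightarrow> ('k, 'a, 'm) module_scheme \<Rightarrow> ('a \<Rightarrow> 'a) set monoid"
  where "Out K A = alg_aut_group K A Mod inner_auts A"

text \<open>The module \<open>M\<close> with \<open>a\<close> acting as \<open>\<phi> a\<close>.\<close>

definition twist :: "('a \<Rightarrow> 'a) \<Rightarrow> ('a, 'b, 'm) module_scheme \<Rightarrow> ('a, 'b, 'm) module_scheme"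
  where "twist \<phi> M = M\<lparr>smult := (\<lambda>a x. \<phi> a \<odot>\<^bsub>M\<^esub> x)\<rparr>"

definition fixes_simples :: "('a, 'r) ring_scheme \<Rightarrow> ('a \<Rightarrow> 'a) \<Rightarrow> bool"
  where "fixes_simples A \<phi> \<longleftrightarrow>
    (\<forall>S :: ('a, 'a set) module. simple_lmod A S \<longrightarrow> lmod_iso A (twist \<phi> S) S)"

definition OutK :: "('k, 'l) ring_scheme \<Rightarrow> ('k, 'a, 'm) module_scheme \<Rightarrow> ('a \<Rightarrow> 'a) set monoid"
  where "OutK K A = (Out K A)\<lparr>carrier :=
    {inner_auts A #>\<^bsub>alg_aut_group K A\<^esub> \<phi> | \<phi>. \<phi> \<in> alg_auts K A \<and> fixes_simples A \<phi>}\<rparr>"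


section \<open>Truncated polynomials\<close>

text \<open>The algebra \<open>K[x]/(x\<^sup>d)\<close>.\<close>

definition trunc_poly_algebra :: "('k, 'l) ring_scheme \<Rightarrow> nat \<Rightarrow> ('k, (nat \<Rightarrow> 'k) set) module"
  where "trunc_poly_algebra K d = quot (UP K) (PIdl\<^bsub>UP K\<^esub> (monom (UP K) \<one>\<^bsub>K\<^esub> d))"

text \<open>The tuples \<open>(j\<^sub>1, \<dots>, j\<^sub>i)\<close> of positive integers with sum \<open>l\<close>.\<close>

definition compositions :: "nat \<Rightarrow> nat \<Rightarrow> nat list set"
  where "compositions i l = {js. length js = i \<and> (\<forall>j\<in>set js. j > 0) \<and> sum_list js = l}"

definition H_group :: "('k, 'l) ring_scheme \<Rightarrow> nat \<Rightarrow> (nat \<Rightarrow> 'k) monoid"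
  where "H_group K m =
    \<lparr>carrier = {\<alpha> \<in> {1..m} \<rightarrow>\<^sub>E carrier K. \<alpha> 1 \<noteq> \<zero>\<^bsub>K\<^esub>},
     monoid.mult = (\<lambda>\<beta> \<alpha>. \<lambda>l\<in>{1..m}. \<Oplus>\<^bsub>K\<^esub>i\<in>{1..l}. \<alpha> i \<otimes>\<^bsub>K\<^esub>
       (\<Oplus>\<^bsub>K\<^esub>js\<in>compositions i l. \<Otimes>\<^bsub>K\<^esub>s\<in>{..<i}. \<beta> (js ! s))),
     one = (\<lambda>l\<in>{1..m}. if l = 1 then \<one>\<^bsub>K\<^esub> else \<zero>\<^bsub>K\<^esub>)\<rparr>"

end

theory Submission
  imports Defs
begin

text \<open>
  Every class in \<open>Out\<^sup>K\<close> contains an automorphism that fixes the idempotents \<open>e\<^sub>j\<close>; such an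
  automorphism preserves the corner \<open>e\<^sub>jAe\<^sub>j\<close> of an edge \<open>j\<close> at the exceptional vertex, whose radical
  consists of the polynomials without constant term in the cycle \<open>c\<close> around this vertex, and
  \<open>c\<^sup>m \<noteq> 0 = c\<^sup>m\<^sup>+\<^sup>1\<close>.  The image of \<open>c\<close> is a polynomial \<open>\<alpha>\<^sub>1c + \<dots> + \<alpha>\<^sub>mc\<^sup>m\<close>, and composition of
  automorphisms becomes substitution of polynomials, the multiplication of \<open>H\<^sub>m\<close>.  Every such
  polynomial with \<open>\<alpha>\<^sub>1 \<noteq> 0\<close> occurs: multiply one arrow at each vertex by a unit so that all
  cycles still agree in the socle, up to the common factor \<open>\<alpha>\<^sub>1\<^sup>m\<close>.  An automorphism that
  fixes \<open>c\<close> is inner, because a conjugating unit can be built vertex by vertex along the tree.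
\<close>


section \<open>Left modules\<close>

text \<open>The definition of a Brauer tree algebra speaks of modules, the argument of elements, and
  there is no quiver with relations to start from. Algebraic closure and basicness make the simple
  modules one-dimensional, so they become characters; the composition series of the modules
  \<open>U\<close> are pulled back to chains of left ideals in \<open>Ae\<^sub>j\<close>, and the
  locale \<open>brauer_algebra\<close> records just these data. The relations are then recovered:
  arrows at different vertices multiply to zero because of the idempotents between which the product
  would lie, and the longest paths around the two ends of an edge are proportional in the socle.
  Because of this proportionality the paths are linearly dependent. An automorphism is therefore
  built as a linear relation spanned by pairs of paths, and it is single-valued because all socle
  paths are rescaled by one common factor. For innerness, a conjugating unit transported once around
  a vertex need not return to itself. The error is killed by the arrow that closes the turn: at
  ordinary vertices because the socle paths are fixed, at the exceptional one because the cycle is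
  fixed. In a tree no further closing conditions arise.\<close>

context left_module
begin

lemma smult_l_null: "x \<in> carrier M \<Longrightarrow> \<zero> \<odot>\<^bsub>M\<^esub> x = \<zero>\<^bsub>M\<^esub>"
proof -
  assume x: "x \<in> carrier M"
  have "\<zero> \<odot>\<^bsub>M\<^esub> x \<oplus>\<^bsub>M\<^esub> \<zero> \<odot>\<^bsub>M\<^esub> x = \<zero> \<odot>\<^bsub>M\<^esub> x"
    using x smult_l_distr[of \<zero> \<zero> x] by simp
  then show ?thesis
    using x smult_closed[of \<zero> x] by (metis M.add.r_cancel_one' R.zero_closed)
qed

lemma smult_r_null: "a \<in> carrier R \<Longrightarrow> a \<odot>\<^bsub>M\<^esub> \<zero>\<^bsub>M\<^esub> = \<zero>\<^bsub>M\<^esub>"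
proof -
  assume a: "a \<in> carrier R"
  have "a \<odot>\<^bsub>M\<^esub> \<zero>\<^bsub>M\<^esub> \<oplus>\<^bsub>M\<^esub> a \<odot>\<^bsub>M\<^esub> \<zero>\<^bsub>M\<^esub> = a \<odot>\<^bsub>M\<^esub> \<zero>\<^bsub>M\<^esub>"
    using a smult_r_distr[of a "\<zero>\<^bsub>M\<^esub>" "\<zero>\<^bsub>M\<^esub>"] by simp
  then show ?thesis
    using a smult_closed[of a "\<zero>\<^bsub>M\<^esub>"] by (metis M.add.r_cancel_one' M.zero_closed)
qed

lemma smult_l_minus: "\<lbrakk>a \<in> carrier R; x \<in> carrier M\<rbrakk> \<Longrightarrow> (\<ominus> a) \<odot>\<^bsub>M\<^esub> x = \<ominus>\<^bsub>M\<^esub> (a \<odot>\<^bsub>M\<^esub> x)"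
  by (metis M.minus_equality R.a_inv_closed R.l_neg smult_closed smult_l_distr smult_l_null)

lemma smult_diff_l: "\<lbrakk>a \<in> carrier R; b \<in> carrier R; x \<in> carrier M\<rbrakk> \<Longrightarrow>
    (a \<ominus> b) \<odot>\<^bsub>M\<^esub> x = a \<odot>\<^bsub>M\<^esub> x \<ominus>\<^bsub>M\<^esub> b \<odot>\<^bsub>M\<^esub> x"
  by (simp add: R.minus_eq M.minus_eq smult_l_distr smult_l_minus)

lemma diff_eq_zeroD: "\<lbrakk>x \<in> carrier M; y \<in> carrier M; x \<ominus>\<^bsub>M\<^esub> y = \<zero>\<^bsub>M\<^esub>\<rbrakk> \<Longrightarrow> x = y"
  by (metis M.minus_equality M.minus_minus M.a_inv_closed M.minus_eq)

lemma smult_finsum_l: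
  assumes "finite E" and "f \<in> E \<rightarrow> carrier R" and "x \<in> carrier M"
  shows "(\<Oplus>e\<in>E. f e) \<odot>\<^bsub>M\<^esub> x = (\<Oplus>\<^bsub>M\<^esub>e\<in>E. f e \<odot>\<^bsub>M\<^esub> x)"
  using assms
proof (induction E)
  case empty
  then show ?case by (simp add: smult_l_null)
next
  case (insert e E)
  have "(\<lambda>e. f e \<odot>\<^bsub>M\<^esub> x) \<in> E \<rightarrow> carrier M" and "f e \<odot>\<^bsub>M\<^esub> x \<in> carrier M"
    and "f \<in> E \<rightarrow> carrier R" and "f e \<in> carrier R"
    using insert.prems by (auto intro: smult_closed)
  moreover have "(\<Oplus>e\<in>E. f e) \<in> carrier R"
    using calculation by (intro R.finsum_closed) auto
  ultimately show ?case
    using insert by (simp add: smult_l_distr)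
qed

lemma submoduleI:
  assumes "N \<subseteq> carrier M" and "\<zero>\<^bsub>M\<^esub> \<in> N"
    and "\<And>x y. \<lbrakk>x \<in> N; y \<in> N\<rbrakk> \<Longrightarrow> x \<oplus>\<^bsub>M\<^esub> y \<in> N"
    and "\<And>a x. \<lbrakk>a \<in> carrier R; x \<in> N\<rbrakk> \<Longrightarrow> a \<odot>\<^bsub>M\<^esub> x \<in> N"
  shows "submodule N R M"
proof -
  have "\<ominus>\<^bsub>M\<^esub> x \<in> N" if "x \<in> N" for x
    using assms(1) assms(4)[of "\<ominus> \<one>" x] that smult_l_minus[of \<one> x] smult_one[of x] by auto
  then show ?thesis
    using assms by (intro submodule.intro subgroup.intro submodule_axioms.intro)
      (auto simp: a_inv_def)
qed

lemma submodule_iff: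
  "submodule N R M \<longleftrightarrow> N \<subseteq> carrier M \<and> \<zero>\<^bsub>M\<^esub> \<in> N \<and> (\<forall>x\<in>N. \<forall>y\<in>N. x \<oplus>\<^bsub>M\<^esub> y \<in> N) \<and>
    (\<forall>a\<in>carrier R. \<forall>x\<in>N. a \<odot>\<^bsub>M\<^esub> x \<in> N)"
proof
  assume "submodule N R M"
  then interpret N: submodule N R M .
  show "N \<subseteq> carrier M \<and> \<zero>\<^bsub>M\<^esub> \<in> N \<and> (\<forall>x\<in>N. \<forall>y\<in>N. x \<oplus>\<^bsub>M\<^esub> y \<in> N) \<and>
    (\<forall>a\<in>carrier R. \<forall>x\<in>N. a \<odot>\<^bsub>M\<^esub> x \<in> N)"
    using N.subset N.one_closed N.m_closed by auto
qed (blast intro: submoduleI)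

lemma submodule_minus_closed: "\<lbrakk>submodule N R M; x \<in> N; y \<in> N\<rbrakk> \<Longrightarrow> x \<ominus>\<^bsub>M\<^esub> y \<in> N"
  unfolding submodule_iff M.minus_eq
  using smult_l_minus[of \<one> y] smult_one[of y] by (metis R.a_inv_closed R.one_closed subsetD)

lemma submodule_left_module:
  assumes "submodule N R M"
  shows "left_module R (M\<lparr>carrier := N\<rparr>)"
proof -
  have N: "N \<subseteq> carrier M" using assms by (simp add: submodule_iff)
  have "\<exists>y\<in>N. y \<oplus>\<^bsub>M\<^esub> x = \<zero>\<^bsub>M\<^esub>" if "x \<in> N" for x
    using that N assms submodule_minus_closed[OF assms, of "\<zero>\<^bsub>M\<^esub>" x]
    by (intro bexI[of _ "\<zero>\<^bsub>M\<^esub> \<ominus>\<^bsub>M\<^esub> x"]) (auto simp: submodule_iff M.minus_eq M.l_neg subset_iff)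
  then have "abelian_group (M\<lparr>carrier := N\<rparr>)"
    using assms N unfolding submodule_iff
    by (intro abelian_groupI) (simp_all add: M.a_assoc M.a_lcomm M.a_comm subset_iff)
  then show ?thesis
    using assms N unfolding submodule_iff
    by (intro left_module.intro left_module_axioms.intro R.ring_axioms)
      (auto simp: smult_l_distr smult_r_distr smult_assoc1 smult_one subset_iff)
qed

lemma submodule_restrict_iff:
  assumes "submodule H R M"
  shows "submodule N R (M\<lparr>carrier := H\<rparr>) \<longleftrightarrow> submodule N R M \<and> N \<subseteq> H"
proof -
  interpret H: left_module R "M\<lparr>carrier := H\<rparr>" by (rule submodule_left_module[OF assms])
  show ?thesis using assms by (auto simp: submodule_iff H.submodule_iff)
qed

lemma submodule_cyclic:
  assumes "x \<in> carrier M"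
  shows "submodule {a \<odot>\<^bsub>M\<^esub> x | a. a \<in> carrier R} R M"
proof (rule submoduleI)
  show "\<zero>\<^bsub>M\<^esub> \<in> {a \<odot>\<^bsub>M\<^esub> x | a. a \<in> carrier R}"
    using assms smult_l_null by (metis (mono_tags, lifting) R.zero_closed mem_Collect_eq)
qed (use assms in \<open>auto intro: smult_closed simp: smult_l_distr[symmetric] smult_assoc1[symmetric];
      metis R.add.m_closed R.m_closed\<close>)+

lemma submodule_carrier: "submodule (carrier M) R M"
  by (rule submoduleI) (auto intro: smult_closed)

lemma submodule_zero: "submodule {\<zero>\<^bsub>M\<^esub>} R M"
  by (rule submoduleI) (auto simp: smult_r_null)

end

lemma simple_lmod_cyclic:
  assumes "simple_lmod R S" "s \<in> carrier S" "s \<noteq> \<zero>\<^bsub>S\<^esub>" "t \<in> carrier S"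
  shows "\<exists>a\<in>carrier R. t = a \<odot>\<^bsub>S\<^esub> s"
proof -
  interpret S: left_module R S using assms(1) by (simp add: simple_lmod_def)
  let ?N = "{a \<odot>\<^bsub>S\<^esub> s | a. a \<in> carrier R}"
  have "submodule ?N R S" by (rule S.submodule_cyclic[OF assms(2)])
  moreover have "s \<in> ?N" using assms(2) S.smult_one[of s] by (metis (mono_tags, lifting) S.R.one_closed mem_Collect_eq)
  ultimately have "?N = carrier S" using assms(1,3) unfolding simple_lmod_def by blast
  then show ?thesis using assms(4) by blast
qed

lemma lmod_homD:
  assumes "h \<in> lmod_hom R M N"
  shows "x \<in> carrier M \<Longrightarrow> h x \<in> carrier N"
    and "\<lbrakk>x \<in> carrier M; y \<in> carrier M\<rbrakk> \<Longrightarrow> h (x \<oplus>\<^bsub>M\<^esub> y) = h x \<oplus>\<^bsub>N\<^esub> h y"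
    and "\<lbrakk>a \<in> carrier R; x \<in> carrier M\<rbrakk> \<Longrightarrow> h (a \<odot>\<^bsub>M\<^esub> x) = a \<odot>\<^bsub>N\<^esub> h x"
  using assms by (auto simp: lmod_hom_def)

lemma lmod_hom_zero:
  assumes "left_module R M" "left_module R N" "h \<in> lmod_hom R M N"
  shows "h \<zero>\<^bsub>M\<^esub> = \<zero>\<^bsub>N\<^esub>"
proof -
  interpret M: left_module R M by fact
  interpret N: left_module R N by fact
  have "h (\<zero>\<^bsub>R\<^esub> \<odot>\<^bsub>M\<^esub> \<zero>\<^bsub>M\<^esub>) = \<zero>\<^bsub>R\<^esub> \<odot>\<^bsub>N\<^esub> h \<zero>\<^bsub>M\<^esub>"
    using lmod_homD(3)[OF assms(3)] by simp
  then show ?thesis using lmod_homD(1)[OF assms(3)] by (simp add: M.smult_l_null N.smult_l_null)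
qed

lemma lmod_hom_minus:
  assumes "left_module R M" "left_module R N" "h \<in> lmod_hom R M N" "x \<in> carrier M" "y \<in> carrier M"
  shows "h (x \<ominus>\<^bsub>M\<^esub> y) = h x \<ominus>\<^bsub>N\<^esub> h y"
proof -
  interpret M: left_module R M by fact
  interpret N: left_module R N by fact
  have "h (\<ominus>\<^bsub>M\<^esub> y) = \<ominus>\<^bsub>N\<^esub> h y"
    using lmod_homD(1)[OF assms(3)] lmod_homD(3)[OF assms(3), of "\<ominus>\<^bsub>R\<^esub> \<one>\<^bsub>R\<^esub>" y] assms(5)
    by (simp add: M.smult_l_minus N.smult_l_minus M.smult_one N.smult_one)
  then show ?thesis
    using assms(4,5) lmod_homD(1,2)[OF assms(3)] by (simp add: M.minus_eq N.minus_eq)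
qed

lemma lmod_iso_sym:
  assumes "left_module R M" "lmod_iso R M N"
  shows "lmod_iso R N M"
proof -
  interpret M: left_module R M by fact
  obtain h where h: "h \<in> lmod_hom R M N" "bij_betw h (carrier M) (carrier N)"
    using assms(2) by (auto simp: lmod_iso_def)
  let ?g = "inv_into (carrier M) h"
  have bij: "bij_betw ?g (carrier N) (carrier M)" by (rule bij_betw_inv_into[OF h(2)])
  have g: "?g x \<in> carrier M" "h (?g x) = x" if "x \<in> carrier N" for x
    using that h(2) bij by (auto simp: bij_betw_def f_inv_into_f)
  have gh: "?g (h x) = x" if "x \<in> carrier M" for x
    using that h(2) by (simp add: bij_betw_def)
  have "?g (x \<oplus>\<^bsub>N\<^esub> y) = ?g x \<oplus>\<^bsub>M\<^esub> ?g y" if "x \<in> carrier N" "y \<in> carrier N" for x y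
    using gh[of "?g x \<oplus>\<^bsub>M\<^esub> ?g y"] lmod_homD(2)[OF h(1), of "?g x" "?g y"] g that by simp
  moreover have "?g (a \<odot>\<^bsub>N\<^esub> x) = a \<odot>\<^bsub>M\<^esub> ?g x" if "a \<in> carrier R" "x \<in> carrier N" for a x
    using gh[of "a \<odot>\<^bsub>M\<^esub> ?g x"] lmod_homD(3)[OF h(1), of a "?g x"] g that by (simp add: M.smult_closed)
  ultimately show ?thesis
    using bij bij_betw_imp_funcset[OF bij] unfolding lmod_iso_def lmod_hom_def by blast
qed

lemma lmod_iso_trans:
  assumes "lmod_iso R L M" "lmod_iso R M N"
  shows "lmod_iso R L N"
proof -
  obtain g h where g: "g \<in> lmod_hom R L M" "bij_betw g (carrier L) (carrier M)"
    and h: "h \<in> lmod_hom R M N" "bij_betw h (carrier M) (carrier N)"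
    using assms by (auto simp: lmod_iso_def)
  have "h \<circ> g \<in> lmod_hom R L N"
    using lmod_homD[OF g(1)] lmod_homD[OF h(1)] by (auto simp: lmod_hom_def)
  then show ?thesis
    using bij_betw_trans[OF g(2) h(2)] by (auto simp: lmod_iso_def)
qed


subsection \<open>Quotients\<close>

lemma quot_simps:
  "carrier (quot M N) = a_rcosets\<^bsub>M\<^esub> N"
  "\<zero>\<^bsub>quot M N\<^esub> = N"
  "C \<oplus>\<^bsub>quot M N\<^esub> D = C <+>\<^bsub>M\<^esub> D"
  "C \<otimes>\<^bsub>quot M N\<^esub> D = rcoset_mult M N C D"
  "\<one>\<^bsub>quot M N\<^esub> = N +>\<^bsub>M\<^esub> \<one>\<^bsub>M\<^esub>"
  "a \<odot>\<^bsub>quot M N\<^esub> C = (\<Union>x\<in>C. N +>\<^bsub>M\<^esub> (a \<odot>\<^bsub>M\<^esub> x))"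
  by (simp_all add: quot_def ring.extend_def module.fields_def FactRing_def)

lemma a_r_coset_restrict [simp]: "N +>\<^bsub>M\<lparr>carrier := H\<rparr>\<^esub> x = N +>\<^bsub>M\<^esub> x"
  by (simp add: a_r_coset_def r_coset_def)

context left_module
begin

context
  fixes N
  assumes N: "submodule N R M"
begin

lemma submodule_abelian_subgroup: "abelian_subgroup N M"
  using N by (intro abelian_subgroupI3 additive_subgroup.intro M.abelian_group_axioms)
    (simp add: submodule_def)

lemma quot_carrier: "carrier (quot M N) = {N +>\<^bsub>M\<^esub> x | x. x \<in> carrier M}"
  by (auto simp: quot_simps A_RCOSETS_def')

lemma quot_add: "\<lbrakk>x \<in> carrier M; y \<in> carrier M\<rbrakk> \<Longrightarrow>
    (N +>\<^bsub>M\<^esub> x) \<oplus>\<^bsub>quot M N\<^esub> (N +>\<^bsub>M\<^esub> y) = N +>\<^bsub>M\<^esub> (x \<oplus>\<^bsub>M\<^esub> y)"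
  using abelian_subgroup.a_rcos_sum[OF submodule_abelian_subgroup] by (simp add: quot_simps)

lemma coset_eq_iff: "\<lbrakk>x \<in> carrier M; y \<in> carrier M\<rbrakk> \<Longrightarrow>
    N +>\<^bsub>M\<^esub> x = N +>\<^bsub>M\<^esub> y \<longleftrightarrow> x \<ominus>\<^bsub>M\<^esub> y \<in> N"
  using abelian_subgroup.a_repr_independence'[OF submodule_abelian_subgroup]
    abelian_subgroup.a_rcos_self[OF submodule_abelian_subgroup]
  by (metis abelian_subgroup.a_rcos_module_imp abelian_subgroup.a_rcos_module_rev a_minus_def
      submodule_abelian_subgroup)

lemma coset_zero: "N +>\<^bsub>M\<^esub> \<zero>\<^bsub>M\<^esub> = N"
  using N by (intro M.a_coset_add_zero) (simp add: submodule_iff)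

lemma coset_eq_zero_iff: "x \<in> carrier M \<Longrightarrow> N +>\<^bsub>M\<^esub> x = N \<longleftrightarrow> x \<in> N"
  using coset_eq_iff[of x "\<zero>\<^bsub>M\<^esub>"] M.minus_equality[of "\<zero>\<^bsub>M\<^esub>" "\<zero>\<^bsub>M\<^esub>"]
  by (simp add: coset_zero M.minus_eq)

lemma quot_smult:
  assumes a: "a \<in> carrier R" and x: "x \<in> carrier M"
  shows "a \<odot>\<^bsub>quot M N\<^esub> (N +>\<^bsub>M\<^esub> x) = N +>\<^bsub>M\<^esub> (a \<odot>\<^bsub>M\<^esub> x)"
proof -
  have "N +>\<^bsub>M\<^esub> (a \<odot>\<^bsub>M\<^esub> y) = N +>\<^bsub>M\<^esub> (a \<odot>\<^bsub>M\<^esub> x)" if y: "y \<in> N +>\<^bsub>M\<^esub> x" for y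
  proof -
    obtain z where z: "z \<in> N" "y = z \<oplus>\<^bsub>M\<^esub> x"
      using y by (auto simp: a_r_coset_def r_coset_def)
    have zM: "z \<in> carrier M" using z N by (auto simp: submodule_iff)
    have "a \<odot>\<^bsub>M\<^esub> y \<ominus>\<^bsub>M\<^esub> a \<odot>\<^bsub>M\<^esub> x = a \<odot>\<^bsub>M\<^esub> z"
      using z zM a x by (simp add: smult_r_distr smult_closed M.minus_eq M.a_assoc M.r_neg)
    then have "a \<odot>\<^bsub>M\<^esub> y \<ominus>\<^bsub>M\<^esub> a \<odot>\<^bsub>M\<^esub> x \<in> N"
      using N z a by (auto simp: submodule_iff)
    then show ?thesis
      using z zM a x by (simp add: coset_eq_iff smult_closed)
  qed
  moreover have "x \<in> N +>\<^bsub>M\<^esub> x"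
    by (rule abelian_subgroup.a_rcos_self[OF submodule_abelian_subgroup x])
  ultimately show ?thesis unfolding quot_simps by blast
qed

lemma quot_left_module: "left_module R (quot M N)"
proof -
  have "abelian_group (quot M N)"
  proof (rule abelian_groupI)
    fix C assume "C \<in> carrier (quot M N)"
    then obtain x where x: "x \<in> carrier M" "C = N +>\<^bsub>M\<^esub> x" by (auto simp: quot_carrier)
    have "(N +>\<^bsub>M\<^esub> \<ominus>\<^bsub>M\<^esub> x) \<oplus>\<^bsub>quot M N\<^esub> C = \<zero>\<^bsub>quot M N\<^esub>"
      using x coset_zero by (simp add: quot_add M.l_neg quot_simps(2))
    then show "\<exists>D\<in>carrier (quot M N). D \<oplus>\<^bsub>quot M N\<^esub> C = \<zero>\<^bsub>quot M N\<^esub>"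
      using x by (intro bexI[of _ "N +>\<^bsub>M\<^esub> \<ominus>\<^bsub>M\<^esub> x"]) (auto simp: quot_carrier)
    show "\<zero>\<^bsub>quot M N\<^esub> \<oplus>\<^bsub>quot M N\<^esub> C = C"
      using x quot_add[of "\<zero>\<^bsub>M\<^esub>" x] by (simp add: coset_zero quot_simps(2))
  next
    show "\<zero>\<^bsub>quot M N\<^esub> \<in> carrier (quot M N)"
      using coset_zero by (auto simp: quot_carrier quot_simps(2))
  next
    fix C D assume C: "C \<in> carrier (quot M N)" "D \<in> carrier (quot M N)"
    then obtain x y where xy: "x \<in> carrier M" "C = N +>\<^bsub>M\<^esub> x" "y \<in> carrier M" "D = N +>\<^bsub>M\<^esub> y"
      by (auto simp: quot_carrier)
    then show "C \<oplus>\<^bsub>quot M N\<^esub> D = D \<oplus>\<^bsub>quot M N\<^esub> C" "C \<oplus>\<^bsub>quot M N\<^esub> D \<in> carrier (quot M N)"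
      using M.a_comm[of x y] by (auto simp: quot_carrier quot_add)
    fix E assume "E \<in> carrier (quot M N)"
    then obtain z where "z \<in> carrier M" "E = N +>\<^bsub>M\<^esub> z"
      by (auto simp: quot_carrier)
    then show "(C \<oplus>\<^bsub>quot M N\<^esub> D) \<oplus>\<^bsub>quot M N\<^esub> E = C \<oplus>\<^bsub>quot M N\<^esub> (D \<oplus>\<^bsub>quot M N\<^esub> E)"
      using xy by (simp add: quot_add M.a_assoc)
  qed
  then show ?thesis
  proof (intro left_module.intro left_module_axioms.intro R.ring_axioms)
    fix a C assume "a \<in> carrier R" "C \<in> carrier (quot M N)"
    then show "a \<odot>\<^bsub>quot M N\<^esub> C \<in> carrier (quot M N)"
      by (auto simp: quot_carrier quot_smult intro: smult_closed)
  qed (auto simp: quot_carrier quot_smult quot_add smult_closed smult_l_distr smult_r_distr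
      smult_assoc1 smult_one)
qed

end

text \<open>Correspondence of submodules: \<open>H\<close> is determined by its preimage in
  \<open>M\<close>, which contains \<open>N\<close> and is therefore \<open>N\<close> or
  everything.\<close>

lemma simple_quot:
  assumes "maximal_submodule N R M"
  shows "simple_lmod R (quot M N)"
proof -
  have N: "submodule N R M" "N \<noteq> carrier M" using assms by (auto simp: maximal_submodule_def)
  interpret Q: left_module R "quot M N" by (rule quot_left_module[OF N(1)])
  obtain x where x: "x \<in> carrier M" "x \<notin> N"
    using N by (auto simp: submodule_iff)
  have "N +>\<^bsub>M\<^esub> x \<in> carrier (quot M N)" "N +>\<^bsub>M\<^esub> x \<noteq> N"
    using x coset_eq_zero_iff[OF N(1)] by (auto simp: quot_carrier[OF N(1)])
  then have ne: "carrier (quot M N) \<noteq> {\<zero>\<^bsub>quot M N\<^esub>}" by (auto simp: quot_simps(2))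
  have "H = {\<zero>\<^bsub>quot M N\<^esub>} \<or> H = carrier (quot M N)" if H: "submodule H R (quot M N)" for H
  proof -
    let ?H = "{x \<in> carrier M. N +>\<^bsub>M\<^esub> x \<in> H}"
    have sub: "H \<subseteq> carrier (quot M N)" and zero: "N \<in> H"
      using H by (auto simp: Q.submodule_iff quot_simps(2))
    have "submodule ?H R M"
      using H by (intro submoduleI)
        (auto simp: Q.submodule_iff quot_add[OF N(1), symmetric] quot_smult[OF N(1), symmetric]
          smult_closed coset_zero[OF N(1)] quot_simps(2))
    moreover have "N \<subseteq> ?H"
    proof
      fix y assume "y \<in> N"
      moreover have "y \<in> carrier M" using N(1) \<open>y \<in> N\<close> by (auto simp: submodule_iff)
      ultimately show "y \<in> ?H" using zero coset_eq_zero_iff[OF N(1), of y] by simp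
    qed
    ultimately consider "?H = N" | "?H = carrier M"
      using assms by (auto simp: maximal_submodule_def)
    then show ?thesis
    proof cases
      case 1
      have "C = N" if C: "C \<in> H" for C
      proof -
        obtain y where y: "y \<in> carrier M" "C = N +>\<^bsub>M\<^esub> y"
          using C sub by (auto simp: quot_carrier[OF N(1)])
        then have "y \<in> N" using 1 C by auto
        then show ?thesis using y coset_eq_zero_iff[OF N(1)] by simp
      qed
      then show ?thesis using zero unfolding quot_simps(2) by blast
    next
      case 2
      then have "carrier (quot M N) \<subseteq> H" unfolding quot_carrier[OF N(1)] by blast
      then show ?thesis using sub by blast
    qed
  qed
  then show ?thesis using ne Q.left_module_axioms unfolding simple_lmod_def by blast
qed

end

section \<open>Algebras over a field\<close>

text \<open>This is \<open>fd_algebra\<close> without the dimension axiom, so that the same lemmas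
  apply to \<open>trunc_poly_algebra\<close>, whose dimension is never computed. The algebra is the
  first structure, hence unsubscripted symbols refer to it.\<close>

locale kalg = A?: ring A + K?: field K + module K A
  for A :: "('k, 'a, 'm) module_scheme" (structure) and K :: "('k, 'l) ring_scheme" (structure) +
  assumes smult_mult_l:
      "\<lbrakk>c \<in> carrier K; x \<in> carrier A; y \<in> carrier A\<rbrakk> \<Longrightarrow> (c \<odot> x) \<otimes> y = c \<odot> (x \<otimes> y)"
    and smult_mult_r:
      "\<lbrakk>c \<in> carrier K; x \<in> carrier A; y \<in> carrier A\<rbrakk> \<Longrightarrow> x \<otimes> (c \<odot> y) = c \<odot> (x \<otimes> y)"

lemma (in fd_algebra) kalg: "kalg A K"
  by (intro kalg.intro kalg_axioms.intro A.ring_axioms K.field_axioms module_axioms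
      smult_mult_l smult_mult_r)

section \<open>Spans, linear dependence and polynomials in an element\<close>

context kalg
begin

lemma smult_comm: "\<lbrakk>c \<in> carrier K; d \<in> carrier K; x \<in> carrier A\<rbrakk> \<Longrightarrow> c \<odot> (d \<odot> x) = d \<odot> (c \<odot> x)"
  by (metis K.m_comm smult_assoc1)

lemma smult_one_mult: "\<lbrakk>c \<in> carrier K; x \<in> carrier A\<rbrakk> \<Longrightarrow> (c \<odot> \<one>) \<otimes> x = c \<odot> x"
  by (simp add: smult_mult_l)

lemma mult_smult_one: "\<lbrakk>c \<in> carrier K; x \<in> carrier A\<rbrakk> \<Longrightarrow> x \<otimes> (c \<odot> \<one>) = c \<odot> x"
  by (simp add: smult_mult_r)

lemma smult_eq_zeroD:
  assumes "c \<in> carrier K" "x \<in> carrier A" "c \<odot> x = \<zero>" "x \<noteq> \<zero>"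
  shows "c = \<zero>\<^bsub>K\<^esub>"
proof (rule ccontr)
  assume c: "c \<noteq> \<zero>\<^bsub>K\<^esub>"
  then have "x = (inv\<^bsub>K\<^esub> c \<otimes>\<^bsub>K\<^esub> c) \<odot> x"
    using assms by (simp add: K.field_Units)
  also have "\<dots> = inv\<^bsub>K\<^esub> c \<odot> (c \<odot> x)"
    using assms c by (intro smult_assoc1) (simp_all add: K.field_Units)
  finally show False
    using assms c by (simp add: K.field_Units)
qed

lemma smult_inv_cancel:
  assumes "c \<in> carrier K" "c \<noteq> \<zero>\<^bsub>K\<^esub>" "x \<in> carrier A"
  shows "inv\<^bsub>K\<^esub> c \<odot> (c \<odot> x) = x"
  using assms smult_assoc1[of "inv\<^bsub>K\<^esub> c" c x] by (simp add: K.field_Units)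

lemma minus_self: "x \<in> carrier A \<Longrightarrow> x \<ominus> x = \<zero>"
  by (simp add: A.minus_eq A.r_neg)

lemma diff_eq_zeroD: "\<lbrakk>x \<in> carrier A; y \<in> carrier A; x \<ominus> y = \<zero>\<rbrakk> \<Longrightarrow> x = y"
  by (metis A.minus_equality A.minus_minus A.a_inv_closed A.minus_eq)

lemma diff_add_cancel: "\<lbrakk>x \<in> carrier A; y \<in> carrier A\<rbrakk> \<Longrightarrow> (x \<ominus> y) \<oplus> y = x"
  by (simp add: A.minus_eq A.a_assoc A.l_neg)

lemma add_diff_add:
  assumes "x \<in> carrier A" "y \<in> carrier A" "z \<in> carrier A"
  shows "(z \<oplus> x) \<ominus> (z \<oplus> y) = x \<ominus> y"
proof -
  have "(z \<oplus> x) \<ominus> (z \<oplus> y) = (x \<oplus> z) \<oplus> (\<ominus> z \<oplus> \<ominus> y)"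
    using assms by (simp add: A.minus_eq A.minus_add A.a_comm)
  also have "\<dots> = x \<oplus> (z \<oplus> (\<ominus> z \<oplus> \<ominus> y))"
    using assms by (simp add: A.a_assoc)
  finally show ?thesis using assms by (simp add: A.r_neg2 A.minus_eq)
qed

text \<open>The linear span, generated by adding one scaled vector at a time: proofs go by rule
  induction, without index sets or coefficient functions.\<close>

inductive_set sp :: "'a set \<Rightarrow> 'a set" for V :: "'a set" where
  zero: "\<zero> \<in> sp V"
| step: "\<lbrakk>k \<in> carrier K; x \<in> V; y \<in> sp V\<rbrakk> \<Longrightarrow> k \<odot> x \<oplus> y \<in> sp V"

lemma sp_closed: "V \<subseteq> carrier A \<Longrightarrow> x \<in> sp V \<Longrightarrow> x \<in> carrier A"
  by (rotate_tac, induction rule: sp.induct) auto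

lemma sp_base: "V \<subseteq> carrier A \<Longrightarrow> x \<in> V \<Longrightarrow> x \<in> sp V"
  using sp.step[of "\<one>\<^bsub>K\<^esub>" x V \<zero>] by (auto simp: sp.zero subset_iff)

lemma sp_add:
  assumes "V \<subseteq> carrier A" "x \<in> sp V" "y \<in> sp V"
  shows "x \<oplus> y \<in> sp V"
  using assms(2,3)
proof induction
  case zero
  then show ?case using sp_closed[OF assms(1)] by simp
next
  case (step k x z)
  then show ?case
    using assms(1) sp_closed[OF assms(1)] sp.step[of k x V "z \<oplus> y"] by (simp add: A.a_assoc subset_iff)
qed

lemma sp_smult:
  assumes "V \<subseteq> carrier A" "c \<in> carrier K" "x \<in> sp V"
  shows "c \<odot> x \<in> sp V"
  using assms(3)
proof induction
  case zero
  then show ?case using assms(2) by (simp add: sp.zero)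
next
  case (step k x z)
  then show ?case
    using assms(1,2) sp_closed[OF assms(1)] sp.step[of "c \<otimes>\<^bsub>K\<^esub> k" x V "c \<odot> z"]
    by (simp add: smult_r_distr smult_assoc1 subset_iff)
qed

lemma sp_minus:
  assumes "V \<subseteq> carrier A" "x \<in> sp V" "y \<in> sp V"
  shows "x \<ominus> y \<in> sp V"
proof -
  have "\<ominus> y = (\<ominus>\<^bsub>K\<^esub> \<one>\<^bsub>K\<^esub>) \<odot> y"
    using sp_closed[OF assms(1,3)] by (simp add: smult_l_minus)
  then show ?thesis
    using sp_add[OF assms(1,2) sp_smult[OF assms(1) _ assms(3), of "\<ominus>\<^bsub>K\<^esub> \<one>\<^bsub>K\<^esub>"]]
    by (simp add: A.minus_eq)
qed

lemma sp_finsum: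
  assumes "finite B" "B \<subseteq> V" "V \<subseteq> carrier A" "c \<in> B \<rightarrow> carrier K"
  shows "(\<Oplus>b\<in>B. c b \<odot> b) \<in> sp V"
  using assms(1,2,4)
proof induction
  case empty
  then show ?case by (simp add: sp.zero)
next
  case (insert b B)
  then have "(\<lambda>b. c b \<odot> b) \<in> B \<rightarrow> carrier A" "c b \<odot> b \<in> carrier A"
    using assms(3) by auto
  then show ?case using insert by (auto intro: sp.step)
qed

lemma sp_insertE:
  assumes "insert b B \<subseteq> carrier A" "x \<in> sp (insert b B)"
  obtains k w where "k \<in> carrier K" "w \<in> sp B" "x = k \<odot> b \<oplus> w"
proof -
  have "\<exists>k\<in>carrier K. \<exists>w\<in>sp B. x = k \<odot> b \<oplus> w"
    using assms(2)
  proof induction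
    case zero
    then show ?case using assms(1) by (intro bexI[of _ "\<zero>\<^bsub>K\<^esub>"] bexI[of _ \<zero>]) (auto intro: sp.zero)
  next
    case (step c x y)
    then obtain k w where kw: "k \<in> carrier K" "w \<in> sp B" "y = k \<odot> b \<oplus> w" by auto
    have w: "w \<in> carrier A" using sp_closed kw(2) assms(1) by blast
    show ?case
    proof (cases "x = b")
      case True
      then show ?thesis
        using kw step assms(1) w
        by (intro bexI[of _ "c \<oplus>\<^bsub>K\<^esub> k"] bexI[of _ w]) (auto simp: smult_l_distr A.a_assoc)
    next
      case False
      then have "x \<in> B" using step by auto
      then have "c \<odot> x \<oplus> y = k \<odot> b \<oplus> (c \<odot> x \<oplus> w)"
        using kw step(1) assms(1) w by (simp add: A.a_lcomm subset_iff)
      then show ?thesis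
        using kw step(1) \<open>x \<in> B\<close> by (intro bexI[of _ k] bexI[of _ "c \<odot> x \<oplus> w"]) (auto intro: sp.step)
    qed
  qed
  then show ?thesis using that by blast
qed

text \<open>Gaussian elimination by induction on the spanning set: a vector with nonzero coefficient
  at \<open>b\<close> clears \<open>b\<close> from all later vectors, which then lie in the span of
  \<open>B\<close>. The vector found depends on its predecessors only, which later makes the
  annihilating polynomial monic.\<close>

lemma ex_dependent:
  assumes "finite B" "B \<subseteq> carrier A" "\<And>i. v i \<in> sp B"
  shows "\<exists>d::nat. v d \<in> sp (v ` {..<d})"
  using assms
proof (induction B arbitrary: v rule: finite_induct)
  case empty
  have "x = \<zero>" if "x \<in> sp {}" for x using that by cases auto
  then have "v 0 = \<zero>" using empty by blast
  then show ?case by (metis sp.zero)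
next
  case (insert b B)
  have v: "v i \<in> carrier A" for i using sp_closed[OF insert.prems] .
  have "\<forall>i. \<exists>k w. k \<in> carrier K \<and> w \<in> sp B \<and> v i = k \<odot> b \<oplus> w"
  proof
    fix i
    obtain k w where "k \<in> carrier K" "w \<in> sp B" "v i = k \<odot> b \<oplus> w"
      by (rule sp_insertE[OF insert.prems])
    then show "\<exists>k w. k \<in> carrier K \<and> w \<in> sp B \<and> v i = k \<odot> b \<oplus> w" by blast
  qed
  then obtain k w where kw: "\<And>i. k i \<in> carrier K" "\<And>i. w i \<in> sp B" "\<And>i. v i = k i \<odot> b \<oplus> w i"
    by metis
  have B: "B \<subseteq> carrier A" and b: "b \<in> carrier A" using insert.prems by auto
  have w: "w i \<in> carrier A" for i using sp_closed[OF B kw(2)] .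
  show ?case
  proof (cases "\<exists>i. k i \<noteq> \<zero>\<^bsub>K\<^esub>")
    case False
    then have "v i \<in> sp B" for i using kw b w by simp
    then show ?thesis using insert.IH[OF B] by blast
  next
    case True
    then obtain i0 where i0: "k i0 \<noteq> \<zero>\<^bsub>K\<^esub>" by auto
    \<comment> \<open>The pivot \<open>v i0\<close> is subtracted from the vectors after it;
      \<open>q i\<close> is the quotient of the coefficients at \<open>b\<close>.\<close>
    define q where "q i = k (Suc (i0 + i)) \<otimes>\<^bsub>K\<^esub> inv\<^bsub>K\<^esub> (k i0)" for i
    define u where "u i = v (Suc (i0 + i)) \<ominus> q i \<odot> v i0" for i
    have inv: "inv\<^bsub>K\<^esub> (k i0) \<in> carrier K" using kw(1) i0 by (simp add: K.field_Units)
    then have q: "q i \<in> carrier K" for i using kw(1) by (simp add: q_def)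
    have "q i \<otimes>\<^bsub>K\<^esub> k i0 = k (Suc (i0 + i))" for i
      using kw(1) i0 inv by (simp add: q_def K.m_assoc K.field_Units)
    then have "q i \<odot> v i0 = k (Suc (i0 + i)) \<odot> b \<oplus> q i \<odot> w i0" for i
      using kw(1) q b w by (simp add: kw(3)[of i0] smult_r_distr smult_assoc1[symmetric])
    then have "u i = w (Suc (i0 + i)) \<ominus> q i \<odot> w i0" for i
      unfolding u_def using q b w kw(1) kw(3)[of "Suc (i0 + i)"] by (simp add: add_diff_add)
    then have "u i \<in> sp B" for i
      using sp_minus[OF B kw(2) sp_smult[OF B q kw(2)]] by simp
    then obtain d where d: "u d \<in> sp (u ` {..<d})" using insert.IH[OF B] by blast
    let ?n = "Suc (i0 + d)"
    have vn: "v ` {..<?n} \<subseteq> carrier A" using v by auto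
    have vi: "v i \<in> sp (v ` {..<?n})" if "i < ?n" for i using sp_base[OF vn] that by auto
    have ui: "u i \<in> sp (v ` {..<?n})" if "i < d" for i
      unfolding u_def using that q by (intro sp_minus[OF vn] sp_smult[OF vn] vi) auto
    have "x \<in> sp (v ` {..<?n})" if "x \<in> sp (u ` {..<d})" for x
      using that
    proof induction
      case (step k x y)
      then show ?case using ui by (auto intro!: sp_add[OF vn] sp_smult[OF vn])
    qed (rule sp.zero)
    then have "u d \<oplus> q d \<odot> v i0 \<in> sp (v ` {..<?n})"
      using d q by (intro sp_add[OF vn] sp_smult[OF vn] vi) auto
    moreover have "u d \<oplus> q d \<odot> v i0 = v ?n"
      unfolding u_def using v q by (simp add: diff_add_cancel)
    ultimately show ?thesis by metis
  qed
qed


subsection \<open>Polynomials in an element\<close>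

text \<open>As in \<^theory>\<open>HOL-Algebra.Polynomials\<close>, the list of coefficients starts with the leading one.\<close>

definition lev :: "'k list \<Rightarrow> 'a \<Rightarrow> 'a"
  where "lev p x = foldl (\<lambda>y c. x \<otimes> y \<oplus> c \<odot> \<one>) \<zero> p"

lemma lev_Nil [simp]: "lev [] x = \<zero>"
  and lev_snoc [simp]: "lev (p @ [c]) x = x \<otimes> lev p x \<oplus> c \<odot> \<one>"
  by (simp_all add: lev_def)

lemma lev_closed: "\<lbrakk>set p \<subseteq> carrier K; x \<in> carrier A\<rbrakk> \<Longrightarrow> lev p x \<in> carrier A"
  by (induction p rule: rev_induct) auto

lemma lev_Cons: "\<lbrakk>c \<in> carrier K; set p \<subseteq> carrier K; x \<in> carrier A\<rbrakk> \<Longrightarrow>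
    lev (c # p) x = c \<odot> x [^] length p \<oplus> lev p x"
proof (induction p rule: rev_induct)
  case Nil
  then show ?case using lev_snoc[of "[]" c x] by simp
next
  case (snoc b p)
  then have "x \<otimes> x [^] length p = x [^] Suc (length p)"
    by (metis A.nat_pow_Suc2)
  then show ?case
    using snoc lev_snoc[of "c # p" b x]
    by (simp add: lev_closed A.r_distr smult_mult_r A.a_assoc)
qed

lemma lev_commute:
  assumes "set p \<subseteq> carrier K" "x \<in> carrier A" "y \<in> carrier A" "y \<otimes> x = x \<otimes> y"
  shows "y \<otimes> lev p x = lev p x \<otimes> y"
  using assms(1)
proof (induction p rule: rev_induct)
  case (snoc c p)
  then have "y \<otimes> (x \<otimes> lev p x) = x \<otimes> lev p x \<otimes> y"
    using assms by (metis A.m_assoc le_sup_iff lev_closed set_append)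
  then show ?case
    using snoc assms by (simp add: A.r_distr A.l_distr lev_closed smult_mult_l smult_mult_r)
qed (use assms in simp)

text \<open>Horner's scheme for division by the linear factor at \<open>r\<close>, with the value at
  \<open>r\<close> as remainder. Length and leading coefficient of the quotient are recorded so that
  it is again monic and the division can be repeated.\<close>

lemma lev_factor:
  assumes "c \<in> carrier K" "set p \<subseteq> carrier K" "x \<in> carrier A" "r \<in> carrier K"
  shows "\<exists>q. set q \<subseteq> carrier K \<and> length q = length p \<and> (p \<noteq> [] \<longrightarrow> hd q = c) \<and>
    lev (c # p) x = (x \<ominus> r \<odot> \<one>) \<otimes> lev q x \<oplus> K.eval (c # p) r \<odot> \<one>"
  using assms(2)
proof (induction p rule: rev_induct)
  case Nil
  have "lev [c] x = c \<odot> \<one>" using lev_snoc[of "[]" c x] assms by simp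
  then show ?case using assms by (intro exI[of _ "[]"]) simp
next
  case (snoc b p)
  then obtain q where q: "set q \<subseteq> carrier K" "length q = length p" "p \<noteq> [] \<longrightarrow> hd q = c"
    and eq: "lev (c # p) x = (x \<ominus> r \<odot> \<one>) \<otimes> lev q x \<oplus> K.eval (c # p) r \<odot> \<one>" by auto
  let ?e = "K.eval (c # p) r"
  have e: "?e \<in> carrier K" using K.eval_in_carrier[of "c # p" r] snoc.prems assms by auto
  have ev: "K.eval (c # p @ [b]) r = ?e \<otimes>\<^bsub>K\<^esub> r \<oplus>\<^bsub>K\<^esub> b"
    using K.eval_append_aux[of "c # p" b r] snoc.prems assms by simp
  have b: "b \<in> carrier K" using snoc.prems by simp
  let ?l = "lev q x" and ?r = "r \<odot> \<one>" and ?E = "?e \<odot> \<one>"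
  have l: "?l \<in> carrier A" using q assms by (simp add: lev_closed)
  have x: "x \<in> carrier A" and r: "?r \<in> carrier A" and E: "?E \<in> carrier A" using assms e by auto
  have c1: "x \<otimes> ?r = ?r \<otimes> x" using assms by (simp add: smult_mult_l smult_mult_r)
  have "lev (c # p @ [b]) x = x \<otimes> ((x \<ominus> ?r) \<otimes> ?l \<oplus> ?E) \<oplus> b \<odot> \<one>"
    using lev_snoc[of "c # p" b x] eq by simp
  also have "x \<otimes> ((x \<ominus> ?r) \<otimes> ?l \<oplus> ?E) = (x \<ominus> ?r) \<otimes> (x \<otimes> ?l \<oplus> ?E) \<oplus> ?r \<otimes> ?E"
  proof -
    have "x \<otimes> ((x \<ominus> ?r) \<otimes> ?l) = (x \<otimes> (x \<ominus> ?r)) \<otimes> ?l"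
      using x r l by (simp add: A.m_assoc)
    also have "x \<otimes> (x \<ominus> ?r) = (x \<ominus> ?r) \<otimes> x"
      using x r c1 by (simp add: A.minus_eq A.r_distr A.l_distr A.r_minus A.l_minus)
    finally have 1: "x \<otimes> ((x \<ominus> ?r) \<otimes> ?l) = (x \<ominus> ?r) \<otimes> (x \<otimes> ?l)"
      using x r l by (simp add: A.m_assoc)
    have "x \<otimes> ?E = (x \<ominus> ?r) \<otimes> ?E \<oplus> ?r \<otimes> ?E"
      using x r E by (simp add: A.l_distr[symmetric] diff_add_cancel)
    with 1 show ?thesis using x r l E by (simp add: A.r_distr A.a_assoc)
  qed
  also have "?r \<otimes> ?E = (?e \<otimes>\<^bsub>K\<^esub> r) \<odot> \<one>"
    using assms e by (simp add: smult_mult_l smult_assoc1[symmetric] K.m_comm)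
  finally have "lev (c # p @ [b]) x =
      (x \<ominus> ?r) \<otimes> lev (q @ [?e]) x \<oplus> K.eval (c # p @ [b]) r \<odot> \<one>"
    unfolding ev using x r l E b e assms(4)
    by (simp add: smult_l_distr A.a_assoc del: K.eval.simps)
  moreover have "hd (q @ [?e]) = c"
    using q assms by (cases "p = []") (auto simp: hd_append)
  ultimately show ?case
    using q e by (intro exI[of _ "q @ [?e]"]) auto
qed

text \<open>Leading zeros are allowed, so the length can be fixed as \<open>d\<close>; a coefficient
  put in front then belongs to the power \<open>d\<close>.\<close>

lemma sp_powers_lev:
  assumes "x \<in> carrier A" "y \<in> sp ((\<lambda>i. x [^] i) ` {..<d::nat})"
  shows "\<exists>p. set p \<subseteq> carrier K \<and> length p = d \<and> y = lev p x"
  using assms(2)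
proof (induction d arbitrary: y)
  case 0
  from 0 show ?case by cases auto
next
  case (Suc d)
  have sub: "(\<lambda>i. x [^] i) ` {..<n} \<subseteq> carrier A" for n :: nat using assms(1) by auto
  have "\<exists>c\<in>carrier K. \<exists>z\<in>sp ((\<lambda>i. x [^] i) ` {..<d}). y = x \<otimes> z \<oplus> c \<odot> \<one>"
    using Suc.prems
  proof induction
    case zero
    then show ?case using assms(1) by (intro bexI[of _ "\<zero>\<^bsub>K\<^esub>"] bexI[of _ \<zero>]) (auto intro: sp.zero)
  next
    case (step k u y)
    then obtain c z where cz: "c \<in> carrier K" "z \<in> sp ((\<lambda>i. x [^] i) ` {..<d})" "y = x \<otimes> z \<oplus> c \<odot> \<one>"
      by auto
    have z: "z \<in> carrier A" using sp_closed[OF sub cz(2)] .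
    obtain i where i: "i < Suc d" "u = x [^] i" using step by auto
    show ?case
    proof (cases i)
      case 0
      then have "k \<odot> u \<oplus> y = x \<otimes> z \<oplus> (k \<oplus>\<^bsub>K\<^esub> c) \<odot> \<one>"
        using i cz z assms(1) step(1) by (simp add: smult_l_distr A.a_ac)
      then show ?thesis using cz step(1) by blast
    next
      case (Suc i')
      then have "k \<odot> u \<oplus> y = x \<otimes> (k \<odot> x [^] i' \<oplus> z) \<oplus> c \<odot> \<one>"
        using i cz z assms(1) step(1) A.nat_pow_Suc2[OF assms(1), of i']
        by (simp add: A.r_distr smult_mult_r A.a_assoc)
      moreover have "k \<odot> x [^] i' \<oplus> z \<in> sp ((\<lambda>i. x [^] i) ` {..<d})"
        using cz step(1) i Suc by (intro sp.step) auto
      ultimately show ?thesis using cz(1) by blast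
    qed
  qed
  then obtain c z where cz: "c \<in> carrier K" "z \<in> sp ((\<lambda>i. x [^] i) ` {..<d})" "y = x \<otimes> z \<oplus> c \<odot> \<one>"
    by auto
  then obtain p where "set p \<subseteq> carrier K" "length p = d" "z = lev p x" using Suc.IH by blast
  then show ?case using cz by (intro exI[of _ "p @ [c]"]) simp
qed

end

text \<open>By finite dimension some power of \<open>x\<close> is a combination of lower powers; its
  own coefficient is one, hence the head of the list.\<close>

lemma (in fd_algebra) ex_annihilating_polynomial:
  assumes "x \<in> carrier A"
  shows "\<exists>p. set p \<subseteq> carrier K \<and> kalg.lev A (\<one>\<^bsub>K\<^esub> # p) x = \<zero>\<^bsub>A\<^esub>"
proof -
  interpret kalg A K by (rule kalg)
  obtain B where B: "finite B" "B \<subseteq> carrier A"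
    and "\<And>x. x \<in> carrier A \<Longrightarrow> \<exists>c\<in>B \<rightarrow> carrier K. x = (\<Oplus>\<^bsub>A\<^esub>b\<in>B. c b \<odot>\<^bsub>A\<^esub> b)"
    using finite_dim by auto
  then have "y \<in> sp B" if "y \<in> carrier A" for y
    using sp_finsum[OF B(1) order.refl B(2)] that by metis
  then obtain d :: nat where "x [^]\<^bsub>A\<^esub> d \<in> sp ((\<lambda>i. x [^]\<^bsub>A\<^esub> i) ` {..<d})"
    using ex_dependent[OF B, of "\<lambda>i. x [^]\<^bsub>A\<^esub> i"] assms by auto
  then have "(\<ominus>\<^bsub>K\<^esub> \<one>\<^bsub>K\<^esub>) \<odot>\<^bsub>A\<^esub> x [^]\<^bsub>A\<^esub> d \<in> sp ((\<lambda>i. x [^]\<^bsub>A\<^esub> i) ` {..<d})"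
    using assms by (intro sp_smult) auto
  then obtain p where p: "set p \<subseteq> carrier K" "length p = d"
    "(\<ominus>\<^bsub>K\<^esub> \<one>\<^bsub>K\<^esub>) \<odot>\<^bsub>A\<^esub> x [^]\<^bsub>A\<^esub> d = lev p x"
    using sp_powers_lev[OF assms] by blast
  have "lev (\<one>\<^bsub>K\<^esub> # p) x = \<one>\<^bsub>K\<^esub> \<odot>\<^bsub>A\<^esub> x [^]\<^bsub>A\<^esub> d \<oplus>\<^bsub>A\<^esub> (\<ominus>\<^bsub>K\<^esub> \<one>\<^bsub>K\<^esub>) \<odot>\<^bsub>A\<^esub> x [^]\<^bsub>A\<^esub> d"
    using lev_Cons[of "\<one>\<^bsub>K\<^esub>" p x] p assms by simp
  also have "\<dots> = \<zero>\<^bsub>A\<^esub>"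
    using assms by (simp add: smult_l_minus A.r_neg)
  finally show ?thesis using p(1) by blast
qed

text \<open>Algebraic closure is available as complete splitting: the multiset of roots has as many
  members as the degree, so it is nonempty.\<close>

lemma (in algebraically_closed) monic_has_root:
  assumes "set p \<subseteq> carrier L" "p \<noteq> []"
  shows "\<exists>r\<in>carrier L. eval (\<one> # p) r = \<zero>"
proof -
  have P: "\<one> # p \<in> carrier (poly_ring L)"
    using assms by (auto simp: univ_poly_carrier[symmetric] polynomial_def)
  then have "size (roots (\<one> # p)) = length p"
    using roots_over_carrier[OF P] by (simp add: splitted_def)
  then obtain r where "r \<in># roots (\<one> # p)"
    using assms(2) by (metis length_0_conv multiset_nonemptyE size_empty)
  then have "is_root (\<one> # p) r"
    using roots_mem_iff_is_root[OF P] by simp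
  then show ?thesis by (auto simp: is_root_def)
qed

text \<open>Linear factors are split off a polynomial that annihilates \<open>s\<close> until a
  quotient no longer does; that quotient applied to \<open>s\<close> is an eigenvector. As
  \<open>e\<close> commutes with \<open>x\<close>, it stays in the part fixed by
  \<open>e\<close>.\<close>

lemma (in fd_algebra) ex_eigenvector:
  assumes "algebraically_closed K" and "left_module A S"
    and x: "x \<in> carrier A" and e: "e \<in> carrier A" "e \<otimes>\<^bsub>A\<^esub> x = x \<otimes>\<^bsub>A\<^esub> e"
    and s: "s \<in> carrier S" "s \<noteq> \<zero>\<^bsub>S\<^esub>" "e \<odot>\<^bsub>S\<^esub> s = s"
  shows "\<exists>t\<in>carrier S. \<exists>r\<in>carrier K. t \<noteq> \<zero>\<^bsub>S\<^esub> \<and> e \<odot>\<^bsub>S\<^esub> t = t \<and>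
    (x \<ominus>\<^bsub>A\<^esub> r \<odot>\<^bsub>A\<^esub> \<one>\<^bsub>A\<^esub>) \<odot>\<^bsub>S\<^esub> t = \<zero>\<^bsub>S\<^esub>"
proof -
  interpret kalg A K by (rule kalg)
  interpret S: left_module A S by fact
  interpret C: algebraically_closed K by fact
  have "\<exists>t\<in>carrier S. \<exists>r\<in>carrier K. t \<noteq> \<zero>\<^bsub>S\<^esub> \<and> e \<odot>\<^bsub>S\<^esub> t = t \<and>
      (x \<ominus>\<^bsub>A\<^esub> r \<odot>\<^bsub>A\<^esub> \<one>\<^bsub>A\<^esub>) \<odot>\<^bsub>S\<^esub> t = \<zero>\<^bsub>S\<^esub>"
    if "length p = n" "set p \<subseteq> carrier K" "lev (\<one>\<^bsub>K\<^esub> # p) x \<odot>\<^bsub>S\<^esub> s = \<zero>\<^bsub>S\<^esub>" for n p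
    using that
  proof (induction n arbitrary: p)
    case 0
    then have "\<one>\<^bsub>A\<^esub> \<odot>\<^bsub>S\<^esub> s = \<zero>\<^bsub>S\<^esub>" using x lev_Cons[of "\<one>\<^bsub>K\<^esub>" "[]" x] by simp
    then show ?case using s by (simp add: S.smult_one)
  next
    case (Suc n)
    then have "p \<noteq> []" by auto
    obtain r where r: "r \<in> carrier K" "K.eval (\<one>\<^bsub>K\<^esub> # p) r = \<zero>\<^bsub>K\<^esub>"
      using C.monic_has_root[OF Suc.prems(2) \<open>p \<noteq> []\<close>] by auto
    obtain q where q: "set q \<subseteq> carrier K" "length q = Suc n" "hd q = \<one>\<^bsub>K\<^esub>"
      "lev (\<one>\<^bsub>K\<^esub> # p) x = (x \<ominus>\<^bsub>A\<^esub> r \<odot>\<^bsub>A\<^esub> \<one>\<^bsub>A\<^esub>) \<otimes>\<^bsub>A\<^esub> lev q x \<oplus>\<^bsub>A\<^esub> \<zero>\<^bsub>K\<^esub> \<odot>\<^bsub>A\<^esub> \<one>\<^bsub>A\<^esub>"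
      using lev_factor[OF K.one_closed Suc.prems(2) x r(1)] r(2) \<open>p \<noteq> []\<close> Suc.prems(1) by auto
    obtain q' where q': "q = \<one>\<^bsub>K\<^esub> # q'" using q(2,3) by (cases q) auto
    have l: "lev q x \<in> carrier A" using lev_closed q x by simp
    show ?case
    proof (cases "lev q x \<odot>\<^bsub>S\<^esub> s = \<zero>\<^bsub>S\<^esub>")
      case True
      then show ?thesis using Suc.IH[of q'] q q' by auto
    next
      case False
      have "e \<odot>\<^bsub>S\<^esub> (lev q x \<odot>\<^bsub>S\<^esub> s) = lev q x \<odot>\<^bsub>S\<^esub> (e \<odot>\<^bsub>S\<^esub> s)"
        using lev_commute[OF q(1) x e] e(1) s(1) l by (metis S.smult_assoc1)
      moreover have "(x \<ominus>\<^bsub>A\<^esub> r \<odot>\<^bsub>A\<^esub> \<one>\<^bsub>A\<^esub>) \<odot>\<^bsub>S\<^esub> (lev q x \<odot>\<^bsub>S\<^esub> s) = \<zero>\<^bsub>S\<^esub>"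
        using Suc.prems(3) q(4) l x r s by (simp add: S.smult_assoc1[symmetric])
      ultimately show ?thesis
        using False s l r by (intro bexI[of _ "lev q x \<odot>\<^bsub>S\<^esub> s"] bexI[of _ r]) (auto intro: S.smult_closed)
    qed
  qed
  moreover obtain p where "set p \<subseteq> carrier K" "lev (\<one>\<^bsub>K\<^esub> # p) x = \<zero>\<^bsub>A\<^esub>"
    using ex_annihilating_polynomial[OF x] by auto
  ultimately show ?thesis using S.smult_l_null[OF s(1)] by metis
qed

section \<open>Simple modules of a basic algebra\<close>

lemma left_ideal_lmod_simps:
  "carrier (left_ideal_lmod R e) = {a \<otimes>\<^bsub>R\<^esub> e | a. a \<in> carrier R}"
  "\<zero>\<^bsub>left_ideal_lmod R e\<^esub> = \<zero>\<^bsub>R\<^esub>"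
  "x \<oplus>\<^bsub>left_ideal_lmod R e\<^esub> y = x \<oplus>\<^bsub>R\<^esub> y"
  "a \<odot>\<^bsub>left_ideal_lmod R e\<^esub> x = a \<otimes>\<^bsub>R\<^esub> x"
  by (simp_all add: left_ideal_lmod_def)

lemma (in ring) left_ideal_left_module:
  assumes "e \<in> carrier R"
  shows "left_module R (left_ideal_lmod R e)"
proof -
  have "abelian_group (left_ideal_lmod R e)"
  proof (rule abelian_groupI; unfold left_ideal_lmod_simps)
    show "\<zero> \<in> {a \<otimes> e | a. a \<in> carrier R}"
      using assms by (metis (mono_tags, lifting) l_null mem_Collect_eq zero_closed)
    show "x \<oplus> y \<in> {a \<otimes> e | a. a \<in> carrier R}"
      if "x \<in> {a \<otimes> e | a. a \<in> carrier R}" "y \<in> {a \<otimes> e | a. a \<in> carrier R}" for x y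
      using that assms by clarsimp (metis l_distr add.m_closed)
    show "\<exists>y\<in>{a \<otimes> e | a. a \<in> carrier R}. y \<oplus> x = \<zero>" if "x \<in> {a \<otimes> e | a. a \<in> carrier R}" for x
      using that assms by clarsimp (metis l_minus l_neg a_inv_closed m_closed)
  qed (use assms in \<open>auto simp: a_ac\<close>)
  then show ?thesis
    by (intro left_module.intro left_module_axioms.intro ring_axioms)
      (use assms in \<open>auto simp: left_ideal_lmod_simps l_distr r_distr m_assoc; metis m_assoc m_closed\<close>)+
qed

lemma (in ring) left_ideal_carrier_iff:
  assumes "e \<in> carrier R" "e \<otimes> e = e"
  shows "x \<in> carrier (left_ideal_lmod R e) \<longleftrightarrow> x \<in> carrier R \<and> x \<otimes> e = x"
  using assms by (auto simp: left_ideal_lmod_simps m_assoc; metis)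

text \<open>Zorn's lemma: a submodule of \<open>Re\<close> is proper as soon as it avoids the
  generator \<open>e\<close>, and avoiding one element is preserved by unions of chains.\<close>

lemma (in ring) ex_maximal_submodule:
  assumes e: "e \<in> carrier R"
    and N: "submodule N R (left_ideal_lmod R e)" "e \<notin> N"
  shows "\<exists>M. maximal_submodule M R (left_ideal_lmod R e) \<and> N \<subseteq> M \<and> e \<notin> M"
proof -
  interpret L: left_module R "left_ideal_lmod R e" by (rule left_ideal_left_module[OF e])
  let ?L = "left_ideal_lmod R e"
  let ?\<A> = "{M. submodule M R ?L \<and> N \<subseteq> M \<and> e \<notin> M}"
  have "\<exists>M\<in>?\<A>. \<forall>H\<in>?\<A>. M \<subseteq> H \<longrightarrow> H = M"
  proof (rule subset_Zorn_nonempty)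
    show "?\<A> \<noteq> {}" using N by auto
    fix C assume C: "C \<noteq> {}" "subset.chain ?\<A> C"
    have mem: "submodule M R ?L" "N \<subseteq> M" "e \<notin> M" if "M \<in> C" for M
      using C(2) that by (auto simp: subset.chain_def)
    have "x \<oplus> y \<in> \<Union>C" if "x \<in> \<Union>C" "y \<in> \<Union>C" for x y
    proof -
      from that obtain M M' where M: "M \<in> C" "x \<in> M" "M' \<in> C" "y \<in> M'" by blast
      then have "M \<subseteq> M' \<or> M' \<subseteq> M" using C(2) by (auto simp: subset.chain_def)
      then show ?thesis using M mem(1) unfolding L.submodule_iff left_ideal_lmod_simps by blast
    qed
    moreover have "\<zero> \<in> \<Union>C"
      using C(1) mem(1) unfolding L.submodule_iff left_ideal_lmod_simps by blast
    moreover have "\<Union>C \<subseteq> carrier ?L" "\<And>a x. \<lbrakk>a \<in> carrier R; x \<in> \<Union>C\<rbrakk> \<Longrightarrow> a \<otimes> x \<in> \<Union>C"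
      using mem(1) unfolding L.submodule_iff left_ideal_lmod_simps by blast+
    ultimately have "submodule (\<Union>C) R ?L"
      unfolding L.submodule_iff left_ideal_lmod_simps by blast
    then show "\<Union>C \<in> ?\<A>" using mem(2,3) C(1) by blast
  qed
  then obtain M where "M \<in> ?\<A>" and max': "\<forall>H\<in>?\<A>. M \<subseteq> H \<longrightarrow> H = M" ..
  then have M: "submodule M R ?L" "N \<subseteq> M" "e \<notin> M" by auto
  have max: "H = M" if "submodule H R ?L" "N \<subseteq> H" "e \<notin> H" "M \<subseteq> H" for H
    using max' that by simp
  have eL: "e \<in> carrier ?L"
    using e unfolding left_ideal_lmod_simps by (metis (mono_tags, lifting) l_one mem_Collect_eq one_closed)
  have "H = M \<or> H = carrier ?L" if H: "submodule H R ?L" "M \<subseteq> H" for H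
  proof (cases "e \<in> H")
    case True
    then have "carrier ?L \<subseteq> H" using H(1) unfolding L.submodule_iff left_ideal_lmod_simps by blast
    then show ?thesis using H(1) unfolding L.submodule_iff by blast
  next
    case False
    then show ?thesis using max[OF H(1)] H(2) M(2) by blast
  qed
  then have "maximal_submodule M R ?L"
    using M eL unfolding maximal_submodule_def by blast
  then show ?thesis using M by blast
qed


subsection \<open>Projective covers\<close>

context
  fixes R :: "('a, 'r) ring_scheme" and P :: "('a, 'b, 'm) module_scheme"
    and S :: "('a, 'c, 'n) module_scheme" and \<pi> e s
  assumes cover: "projective_cover R P \<pi> S" and simple: "simple_lmod R S"
    and s: "s \<in> carrier S" "s \<noteq> \<zero>\<^bsub>S\<^esub>"
    and e: "e \<in> carrier R" "e \<otimes>\<^bsub>R\<^esub> e = e" "e \<odot>\<^bsub>S\<^esub> s = s"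
begin

interpretation P: left_module R P
  using cover by (simp add: projective_cover_def fg_projective_def)

interpretation S: left_module R S
  using simple by (simp add: simple_lmod_def)

lemma cover_hom: "\<pi> \<in> lmod_hom R P S"
  using cover by (simp add: projective_cover_def)

lemma cover_superfluous:
  assumes N: "submodule N R P" and x: "x \<in> N" "\<pi> x \<noteq> \<zero>\<^bsub>S\<^esub>"
  shows "N = carrier P"
proof -
  have NP: "N \<subseteq> carrier P" using N by (simp add: P.submodule_iff)
  then have x': "x \<in> carrier P" using x by auto
  have "N <+>\<^bsub>P\<^esub> a_kernel P S \<pi> = carrier P"
  proof
    show "N <+>\<^bsub>P\<^esub> a_kernel P S \<pi> \<subseteq> carrier P"
      using NP by (auto simp: set_add_def' a_kernel_def')
    show "carrier P \<subseteq> N <+>\<^bsub>P\<^esub> a_kernel P S \<pi>"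
    proof
      fix p assume p: "p \<in> carrier P"
      obtain a where a: "a \<in> carrier R" "\<pi> p = a \<odot>\<^bsub>S\<^esub> \<pi> x"
        using simple_lmod_cyclic[OF simple _ x(2)] lmod_homD(1)[OF cover_hom] x' p by blast
      let ?k = "p \<ominus>\<^bsub>P\<^esub> a \<odot>\<^bsub>P\<^esub> x"
      have ax: "a \<odot>\<^bsub>P\<^esub> x \<in> carrier P" using a x' by (simp add: P.smult_closed)
      have "\<pi> ?k = \<pi> p \<ominus>\<^bsub>S\<^esub> \<pi> p"
        using lmod_hom_minus[OF P.left_module_axioms S.left_module_axioms cover_hom p ax]
          lmod_homD(3)[OF cover_hom a(1) x'] a(2) by simp
      then have "\<pi> ?k = \<zero>\<^bsub>S\<^esub>"
        using lmod_homD(1)[OF cover_hom p] by (simp add: S.M.minus_eq S.M.r_neg)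
      moreover have "?k \<in> carrier P" using p ax by simp
      moreover have "p = a \<odot>\<^bsub>P\<^esub> x \<oplus>\<^bsub>P\<^esub> ?k"
        using p ax by (simp add: P.M.minus_eq P.M.a_lcomm P.M.r_neg)
      moreover have "a \<odot>\<^bsub>P\<^esub> x \<in> N" using N a x by (simp add: P.submodule_iff)
      ultimately show "p \<in> N <+>\<^bsub>P\<^esub> a_kernel P S \<pi>"
        unfolding set_add_def' a_kernel_def' by blast
    qed
  qed
  then show ?thesis using cover N by (simp add: projective_cover_def)
qed

text \<open>Any preimage of \<open>s\<close>, multiplied by \<open>e\<close>, generates
  \<open>P\<close>, since its image is still the nonzero element \<open>s\<close>.\<close>

lemma cover_generator:
  obtains y where "y \<in> carrier P" "e \<odot>\<^bsub>P\<^esub> y = y" "\<pi> y = s"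
    "\<And>p. p \<in> carrier P \<Longrightarrow> \<exists>a\<in>carrier R. p = a \<odot>\<^bsub>P\<^esub> y"
proof -
  obtain z where z: "z \<in> carrier P" "\<pi> z = s"
    using cover s unfolding projective_cover_def by (metis imageE)
  let ?y = "e \<odot>\<^bsub>P\<^esub> z"
  have y: "?y \<in> carrier P" using e z by (simp add: P.smult_closed)
  have ey: "e \<odot>\<^bsub>P\<^esub> ?y = ?y" using e z by (simp add: P.smult_assoc1[symmetric])
  have py: "\<pi> ?y = s" using lmod_homD(3)[OF cover_hom] e z by simp
  have "?y \<in> {a \<odot>\<^bsub>P\<^esub> ?y | a. a \<in> carrier R}"
    using P.smult_one[OF y] by (metis (mono_tags, lifting) P.R.one_closed mem_Collect_eq)
  then have "{a \<odot>\<^bsub>P\<^esub> ?y | a. a \<in> carrier R} = carrier P"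
    using cover_superfluous[OF P.submodule_cyclic[OF y]] py s by blast
  then show ?thesis using y ey py by (intro that[of ?y]) blast+
qed

text \<open>The lifting property for the surjection x \<mapsto> x y from \<open>Re\<close>, read off
  from \<open>P\<close> being a summand of a free module: each unit vector is lifted, and the
  coordinates of \<open>p\<close> serve as coefficients.\<close>

lemma projective_section:
  assumes y: "y \<in> carrier P" "e \<odot>\<^bsub>P\<^esub> y = y"
    and gen: "\<And>p. p \<in> carrier P \<Longrightarrow> \<exists>a\<in>carrier R. p = a \<odot>\<^bsub>P\<^esub> y"
  shows "\<exists>h\<in>lmod_hom R P (left_ideal_lmod R e). \<forall>p\<in>carrier P. h p \<odot>\<^bsub>P\<^esub> y = p"
proof -
  obtain n f g where f: "f \<in> lmod_hom R P (free_lmod R n)" and g: "g \<in> lmod_hom R (free_lmod R n) P"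
    and gf: "\<And>x. x \<in> carrier P \<Longrightarrow> g (f x) = x"
    using cover unfolding projective_cover_def fg_projective_def by blast
  let ?F = "free_lmod R n"
  have F: "carrier ?F = {..<n} \<rightarrow>\<^sub>E carrier R" "v \<oplus>\<^bsub>?F\<^esub> w = (\<lambda>i\<in>{..<n}. v i \<oplus>\<^bsub>R\<^esub> w i)"
    "a \<odot>\<^bsub>?F\<^esub> v = (\<lambda>i\<in>{..<n}. a \<otimes>\<^bsub>R\<^esub> v i)" for v w a
    by (simp_all add: free_lmod_def)
  define \<delta> where "\<delta> k = (\<lambda>i\<in>{..<n}. if i = k then \<one>\<^bsub>R\<^esub> else \<zero>\<^bsub>R\<^esub>)" for k
  have \<delta>: "\<delta> k \<in> carrier ?F" for k by (simp add: F \<delta>_def)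
  have "\<exists>z\<in>carrier R. g (\<delta> k) = z \<odot>\<^bsub>P\<^esub> y" for k
    using gen lmod_homD(1)[OF g \<delta>] by blast
  then obtain w where w: "\<And>k. w k \<in> carrier R" "\<And>k. g (\<delta> k) = w k \<odot>\<^bsub>P\<^esub> y" by metis
  \<comment> \<open>Multiplication by \<open>e\<close> moves the lift into \<open>Re\<close> without
    changing its product with \<open>y\<close>, as \<open>e\<close> fixes \<open>y\<close>.\<close>
  define z where "z k = w k \<otimes>\<^bsub>R\<^esub> e" for k
  have z: "z k \<in> carrier R" "z k \<otimes>\<^bsub>R\<^esub> e = z k" "g (\<delta> k) = z k \<odot>\<^bsub>P\<^esub> y" for k
    using w e y by (simp_all add: z_def P.R.m_assoc P.smult_assoc1)
  \<comment> \<open>Truncation to \<open>k\<close> coordinates allows an induction; for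
    \<open>k = n\<close> this expresses \<open>g\<close> by its values on the unit vectors.\<close>
  have g_sum: "g (\<lambda>i\<in>{..<n}. if i < k then v i else \<zero>\<^bsub>R\<^esub>) = (\<Oplus>\<^bsub>P\<^esub>i\<in>{..<k}. v i \<odot>\<^bsub>P\<^esub> g (\<delta> i))"
    if v: "v \<in> carrier ?F" and "k \<le> n" for v k
    using that(2)
  proof (induction k)
    case 0
    have "g (\<zero>\<^bsub>R\<^esub> \<odot>\<^bsub>?F\<^esub> \<delta> 0) = \<zero>\<^bsub>P\<^esub>"
      using lmod_homD(3)[OF g _ \<delta>] lmod_homD(1)[OF g \<delta>] by (simp add: P.smult_l_null)
    moreover have "\<zero>\<^bsub>R\<^esub> \<odot>\<^bsub>?F\<^esub> \<delta> 0 = (\<lambda>i\<in>{..<n}. \<zero>\<^bsub>R\<^esub>)"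
      by (auto simp: F \<delta>_def fun_eq_iff)
    ultimately have "g (\<lambda>i\<in>{..<n}. \<zero>\<^bsub>R\<^esub>) = \<zero>\<^bsub>P\<^esub>" by (rule subst[rotated])
    moreover have "(\<lambda>i\<in>{..<n}. if i < 0 then v i else \<zero>\<^bsub>R\<^esub>) = (\<lambda>i\<in>{..<n}. \<zero>\<^bsub>R\<^esub>)"
      by (auto simp: fun_eq_iff)
    ultimately show ?case by (metis P.M.finsum_empty lessThan_0)
  next
    case (Suc k)
    let ?t = "\<lambda>k. \<lambda>i\<in>{..<n}. if i < k then v i else \<zero>\<^bsub>R\<^esub>"
    have vi: "v i \<in> carrier R" if "i < n" for i using v that by (auto simp: F)
    then have t: "?t k \<in> carrier ?F" by (auto simp: F)
    have "?t (Suc k) = ?t k \<oplus>\<^bsub>?F\<^esub> v k \<odot>\<^bsub>?F\<^esub> \<delta> k"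
      using vi Suc.prems by (auto simp: F \<delta>_def fun_eq_iff less_Suc_eq)
    moreover have "v k \<odot>\<^bsub>?F\<^esub> \<delta> k \<in> carrier ?F" using vi Suc.prems by (auto simp: F \<delta>_def)
    ultimately have "g (?t (Suc k)) = g (?t k) \<oplus>\<^bsub>P\<^esub> v k \<odot>\<^bsub>P\<^esub> g (\<delta> k)"
      using lmod_homD(2,3)[OF g] t \<delta> vi Suc.prems by simp
    moreover have "(\<Oplus>\<^bsub>P\<^esub>i\<in>{..<Suc k}. v i \<odot>\<^bsub>P\<^esub> g (\<delta> i)) =
        (\<Oplus>\<^bsub>P\<^esub>i\<in>{..<k}. v i \<odot>\<^bsub>P\<^esub> g (\<delta> i)) \<oplus>\<^bsub>P\<^esub> v k \<odot>\<^bsub>P\<^esub> g (\<delta> k)"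
      using vi lmod_homD(1)[OF g \<delta>] Suc.prems unfolding lessThan_Suc
      by (subst P.M.finsum_insert) (auto intro!: P.smult_closed P.M.a_comm P.M.finsum_closed)
    ultimately show ?case using Suc.IH Suc_leD[OF Suc.prems] by metis
  qed
  define h where "h p = (\<Oplus>\<^bsub>R\<^esub>i\<in>{..<n}. f p i \<otimes>\<^bsub>R\<^esub> z i)" for p
  have fi: "f p i \<in> carrier R" if "p \<in> carrier P" "i < n" for p i
    using lmod_homD(1)[OF f that(1)] that(2) by (auto simp: F)
  have fz: "(\<lambda>i. f p i \<otimes>\<^bsub>R\<^esub> z i) \<in> {..<n} \<rightarrow> carrier R" if "p \<in> carrier P" for p
    using fi that z by auto
  have hR: "h p \<in> carrier R" if "p \<in> carrier P" for p
    unfolding h_def using fz that by (intro P.R.finsum_closed)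
  have "h p \<otimes>\<^bsub>R\<^esub> e = h p" if p: "p \<in> carrier P" for p
  proof -
    have "h p \<otimes>\<^bsub>R\<^esub> e = (\<Oplus>\<^bsub>R\<^esub>i\<in>{..<n}. f p i \<otimes>\<^bsub>R\<^esub> z i \<otimes>\<^bsub>R\<^esub> e)"
      unfolding h_def using fz[OF p] e by (intro P.R.finsum_ldistr) auto
    also have "\<dots> = h p"
      unfolding h_def using fi[OF p] z e by (intro P.R.finsum_cong') (auto simp: P.R.m_assoc)
    finally show ?thesis .
  qed
  then have hL: "h p \<in> carrier (left_ideal_lmod R e)" if "p \<in> carrier P" for p
    using hR that P.R.left_ideal_carrier_iff[OF e(1,2)] by simp
  have "h (p \<oplus>\<^bsub>P\<^esub> q) = h p \<oplus>\<^bsub>R\<^esub> h q" if "p \<in> carrier P" "q \<in> carrier P" for p q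
  proof -
    have "h (p \<oplus>\<^bsub>P\<^esub> q) = (\<Oplus>\<^bsub>R\<^esub>i\<in>{..<n}. f p i \<otimes>\<^bsub>R\<^esub> z i \<oplus>\<^bsub>R\<^esub> f q i \<otimes>\<^bsub>R\<^esub> z i)"
      unfolding h_def using that fi z lmod_homD(2)[OF f that]
      by (intro P.R.finsum_cong') (auto simp: F P.R.l_distr)
    then show ?thesis unfolding h_def using fz that by (simp add: P.R.finsum_addf)
  qed
  moreover have "h (a \<odot>\<^bsub>P\<^esub> p) = a \<otimes>\<^bsub>R\<^esub> h p" if "a \<in> carrier R" "p \<in> carrier P" for a p
  proof -
    have "h (a \<odot>\<^bsub>P\<^esub> p) = (\<Oplus>\<^bsub>R\<^esub>i\<in>{..<n}. a \<otimes>\<^bsub>R\<^esub> (f p i \<otimes>\<^bsub>R\<^esub> z i))"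
      unfolding h_def using that fi z lmod_homD(3)[OF f that]
      by (intro P.R.finsum_cong') (auto simp: F P.R.m_assoc)
    then show ?thesis unfolding h_def using fz that by (simp add: P.R.finsum_rdistr)
  qed
  ultimately have "h \<in> lmod_hom R P (left_ideal_lmod R e)"
    using hL by (simp add: lmod_hom_def left_ideal_lmod_simps(3,4))
  moreover have "h p \<odot>\<^bsub>P\<^esub> y = p" if p: "p \<in> carrier P" for p
  proof -
    have "h p \<odot>\<^bsub>P\<^esub> y = (\<Oplus>\<^bsub>P\<^esub>i\<in>{..<n}. (f p i \<otimes>\<^bsub>R\<^esub> z i) \<odot>\<^bsub>P\<^esub> y)"
      unfolding h_def using fz[OF p] y by (intro P.smult_finsum_l) auto
    also have "\<dots> = (\<Oplus>\<^bsub>P\<^esub>i\<in>{..<n}. f p i \<odot>\<^bsub>P\<^esub> g (\<delta> i))"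
      using fi[OF p] z y by (intro P.M.finsum_cong') (auto simp: P.smult_assoc1 intro: P.smult_closed)
    also have "\<dots> = g (\<lambda>i\<in>{..<n}. if i < n then f p i else \<zero>\<^bsub>R\<^esub>)"
      by (rule g_sum[symmetric]) (use lmod_homD(1)[OF f p] in auto)
    also have "(\<lambda>i\<in>{..<n}. if i < n then f p i else \<zero>\<^bsub>R\<^esub>) = f p"
      using lmod_homD(1)[OF f p] by (auto simp: F fun_eq_iff PiE_def extensional_def)
    finally show ?thesis using gf p by simp
  qed
  ultimately show ?thesis by blast
qed

text \<open>The section of x \<mapsto> x y sends \<open>y\<close> to an idempotent that splits
  \<open>e\<close> into two orthogonal ones. It is nonzero because \<open>y\<close> is, so by
  primitivity it equals \<open>e\<close>, and the section is a two-sided inverse.\<close>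

lemma projective_cover_iso:
  assumes prim: "primitive_idempotent R e"
  obtains y where "y \<in> carrier P" "e \<odot>\<^bsub>P\<^esub> y = y" "\<pi> y = s"
    "bij_betw (\<lambda>x. x \<odot>\<^bsub>P\<^esub> y) (carrier (left_ideal_lmod R e)) (carrier P)"
proof -
  obtain y where y: "y \<in> carrier P" "e \<odot>\<^bsub>P\<^esub> y = y" "\<pi> y = s"
    and gen: "\<And>p. p \<in> carrier P \<Longrightarrow> \<exists>a\<in>carrier R. p = a \<odot>\<^bsub>P\<^esub> y"
    by (rule cover_generator) blast
  obtain h where h: "h \<in> lmod_hom R P (left_ideal_lmod R e)"
    and hy: "\<And>p. p \<in> carrier P \<Longrightarrow> h p \<odot>\<^bsub>P\<^esub> y = p"
    using projective_section[OF y(1,2) gen] by blast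
  let ?L = "left_ideal_lmod R e"
  note L = P.R.left_ideal_carrier_iff[OF e(1,2)]
  let ?\<epsilon> = "h y"
  have \<epsilon>: "?\<epsilon> \<in> carrier R" "?\<epsilon> \<otimes>\<^bsub>R\<^esub> e = ?\<epsilon>" using lmod_homD(1)[OF h y(1)] L by auto
  have h_smult: "h (a \<odot>\<^bsub>P\<^esub> p) = a \<otimes>\<^bsub>R\<^esub> h p" if "a \<in> carrier R" "p \<in> carrier P" for a p
    using lmod_homD(3)[OF h that] by (simp add: left_ideal_lmod_simps)
  have \<epsilon>2: "e \<otimes>\<^bsub>R\<^esub> ?\<epsilon> = ?\<epsilon>" using h_smult[OF e(1) y(1)] y(2) by simp
  have \<epsilon>3: "?\<epsilon> \<otimes>\<^bsub>R\<^esub> ?\<epsilon> = ?\<epsilon>" using h_smult[OF \<epsilon>(1) y(1)] hy[OF y(1)] by simp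
  have "y \<noteq> \<zero>\<^bsub>P\<^esub>"
    using lmod_hom_zero[OF P.left_module_axioms S.left_module_axioms cover_hom] y(3) s by auto
  then have \<epsilon>0: "?\<epsilon> \<noteq> \<zero>\<^bsub>R\<^esub>" using hy[OF y(1)] P.smult_l_null[OF y(1)] by auto
  let ?g = "e \<ominus>\<^bsub>R\<^esub> ?\<epsilon>"
  have g: "?g \<in> carrier R" "e = ?\<epsilon> \<oplus>\<^bsub>R\<^esub> ?g" "?g \<otimes>\<^bsub>R\<^esub> ?g = ?g" "?\<epsilon> \<otimes>\<^bsub>R\<^esub> ?g = \<zero>\<^bsub>R\<^esub>" "?g \<otimes>\<^bsub>R\<^esub> ?\<epsilon> = \<zero>\<^bsub>R\<^esub>"
    using e \<epsilon> \<epsilon>2 \<epsilon>3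
    by (simp_all add: P.R.minus_eq P.R.l_distr P.R.r_distr P.R.l_minus P.R.r_minus P.R.r_neg P.R.a_lcomm)
  have "?g = \<zero>\<^bsub>R\<^esub>"
    using prim g \<epsilon>(1) \<epsilon>3 \<epsilon>0 unfolding primitive_idempotent_def by blast
  then have \<epsilon>e: "?\<epsilon> = e" using g(2) \<epsilon>(1) by simp
  have "inj_on (\<lambda>x. x \<odot>\<^bsub>P\<^esub> y) (carrier ?L)"
  proof (rule inj_onI)
    fix x x' assume x: "x \<in> carrier ?L" "x' \<in> carrier ?L" "x \<odot>\<^bsub>P\<^esub> y = x' \<odot>\<^bsub>P\<^esub> y"
    then have "x \<otimes>\<^bsub>R\<^esub> ?\<epsilon> = x' \<otimes>\<^bsub>R\<^esub> ?\<epsilon>"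
      using h_smult[of x y] h_smult[of x' y] y(1) L by simp
    then show "x = x'" using x L \<epsilon>e by simp
  qed
  moreover have "(\<lambda>x. x \<odot>\<^bsub>P\<^esub> y) ` carrier ?L = carrier P"
  proof
    show "(\<lambda>x. x \<odot>\<^bsub>P\<^esub> y) ` carrier ?L \<subseteq> carrier P"
      using L y(1) by (auto intro: P.smult_closed)
    show "carrier P \<subseteq> (\<lambda>x. x \<odot>\<^bsub>P\<^esub> y) ` carrier ?L"
      using lmod_homD(1)[OF h] hy by (metis image_eqI subsetI)
  qed
  ultimately show ?thesis using y by (intro that[of y]) (auto simp: bij_betw_def)
qed

lemma projective_cover_lmod_iso:
  assumes "primitive_idempotent R e"
  shows "lmod_iso R (left_ideal_lmod R e) P"
proof -
  obtain y where y: "y \<in> carrier P"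
    "bij_betw (\<lambda>x. x \<odot>\<^bsub>P\<^esub> y) (carrier (left_ideal_lmod R e)) (carrier P)"
    using projective_cover_iso[OF assms] by metis
  have "(\<lambda>x. x \<odot>\<^bsub>P\<^esub> y) \<in> lmod_hom R (left_ideal_lmod R e) P"
    using y(1) e P.R.left_ideal_carrier_iff[OF e(1,2)]
    by (auto simp: lmod_hom_def left_ideal_lmod_simps(3,4) P.smult_closed P.smult_l_distr P.smult_assoc1)
  then show ?thesis using y(2) by (auto simp: lmod_iso_def)
qed

text \<open>So \<open>Re\<close> has a unique maximal submodule, the annihilator of \<open>s\<close>.\<close>

lemma left_ideal_eq_carrier:
  assumes prim: "primitive_idempotent R e"
    and N: "submodule N R (left_ideal_lmod R e)" and x: "x \<in> N" "x \<odot>\<^bsub>S\<^esub> s \<noteq> \<zero>\<^bsub>S\<^esub>"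
  shows "e \<in> N"
proof -
  interpret L: left_module R "left_ideal_lmod R e" by (rule P.R.left_ideal_left_module[OF e(1)])
  note L = P.R.left_ideal_carrier_iff[OF e(1,2)]
  obtain y where y: "y \<in> carrier P" "e \<odot>\<^bsub>P\<^esub> y = y" "\<pi> y = s"
    "bij_betw (\<lambda>x. x \<odot>\<^bsub>P\<^esub> y) (carrier (left_ideal_lmod R e)) (carrier P)"
    using projective_cover_iso[OF prim] by metis
  have NR: "N \<subseteq> carrier (left_ideal_lmod R e)" "\<And>z. z \<in> N \<Longrightarrow> z \<in> carrier R"
    using N L unfolding L.submodule_iff by auto
  let ?N = "(\<lambda>x. x \<odot>\<^bsub>P\<^esub> y) ` N"
  have "submodule ?N R P"
  proof (rule P.submoduleI)
    show "\<zero>\<^bsub>P\<^esub> \<in> ?N"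
    proof (rule image_eqI)
      show "\<zero>\<^bsub>P\<^esub> = \<zero>\<^bsub>R\<^esub> \<odot>\<^bsub>P\<^esub> y" using P.smult_l_null[OF y(1)] by simp
      show "\<zero>\<^bsub>R\<^esub> \<in> N" using N by (simp add: L.submodule_iff left_ideal_lmod_simps)
    qed
    show "u \<oplus>\<^bsub>P\<^esub> v \<in> ?N" if "u \<in> ?N" "v \<in> ?N" for u v
    proof -
      from that obtain a b where "a \<in> N" "b \<in> N" "u = a \<odot>\<^bsub>P\<^esub> y" "v = b \<odot>\<^bsub>P\<^esub> y" by auto
      then show ?thesis using N NR y unfolding L.submodule_iff left_ideal_lmod_simps
        by (auto simp: P.smult_l_distr[symmetric])
    qed
    show "a \<odot>\<^bsub>P\<^esub> u \<in> ?N" if "a \<in> carrier R" "u \<in> ?N" for a u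
    proof -
      from that obtain b where "b \<in> N" "u = b \<odot>\<^bsub>P\<^esub> y" by auto
      then show ?thesis using N NR y that unfolding L.submodule_iff left_ideal_lmod_simps
        by (auto simp: P.smult_assoc1[symmetric])
    qed
  qed (use NR y in \<open>auto intro: P.smult_closed\<close>)
  moreover have "\<pi> (x \<odot>\<^bsub>P\<^esub> y) \<noteq> \<zero>\<^bsub>S\<^esub>"
    using lmod_homD(3)[OF cover_hom NR(2)[OF x(1)] y(1)] y(3) x(2) by simp
  ultimately have "?N = carrier P" using cover_superfluous x(1) by blast
  then obtain z where z: "z \<in> N" "z \<odot>\<^bsub>P\<^esub> y = y" using y(1) by (metis imageE)
  have "e \<in> carrier (left_ideal_lmod R e)" using e L by simp
  then have "z = e"
    using y(2,4) z NR(1) unfolding bij_betw_def by (metis inj_onD subsetD)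
  then show ?thesis using z by simp
qed

end

subsection \<open>Characters\<close>

text \<open>The bijection between the simple modules and the idempotents is not assumed;
  \<open>idem_inj\<close> and \<open>idem_surj\<close> derive it.\<close>

locale basic_simples = fd_algebra K A
  for A :: "('k, 'a, 'm) module_scheme" (structure) and K :: "('k, 'l) ring_scheme" (structure) +
  fixes J :: "'j set" and E :: "'a set"
    and S :: "'j \<Rightarrow> ('a, 'a set) module" and P :: "'j \<Rightarrow> ('a, 'b) module" and \<pi>
  assumes alg_closed: "algebraically_closed K"
    and finite_E: "finite E"
    and prim: "e \<in> E \<Longrightarrow> primitive_idempotent A e"
    and orth: "\<lbrakk>e \<in> E; f \<in> E; e \<noteq> f\<rbrakk> \<Longrightarrow> e \<otimes> f = \<zero>"
    and sum_E: "(\<Oplus>e\<in>E. e) = \<one>"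
    and noniso_E: "\<lbrakk>e \<in> E; f \<in> E; lmod_iso A (left_ideal_lmod A e) (left_ideal_lmod A f)\<rbrakk> \<Longrightarrow> e = f"
    and simple_S: "j \<in> J \<Longrightarrow> simple_lmod A (S j)"
    and noniso_S: "\<lbrakk>i \<in> J; j \<in> J; lmod_iso A (S i) (S j)\<rbrakk> \<Longrightarrow> i = j"
    and all_simple: "simple_lmod A (T :: ('a, 'a set) module) \<Longrightarrow> \<exists>j\<in>J. lmod_iso A T (S j)"
    and cover: "j \<in> J \<Longrightarrow> projective_cover A (P j) (\<pi> j) (S j)"
begin

lemma E_idem: "e \<in> E \<Longrightarrow> e \<in> carrier A" "e \<in> E \<Longrightarrow> e \<otimes> e = e"
  using prim by (auto simp: primitive_idempotent_def)

lemma S_left_module: "j \<in> J \<Longrightarrow> left_module A (S j)"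
  using simple_S by (simp add: simple_lmod_def)

lemma ex_idem_nonzero:
  assumes "left_module A T" "t \<in> carrier T" "t \<noteq> \<zero>\<^bsub>T\<^esub>"
  shows "\<exists>e\<in>E. e \<odot>\<^bsub>T\<^esub> t \<noteq> \<zero>\<^bsub>T\<^esub>"
proof (rule ccontr)
  interpret T: left_module A T by fact
  assume "\<not> ?thesis"
  then have "(\<Oplus>\<^bsub>T\<^esub>e\<in>E. e \<odot>\<^bsub>T\<^esub> t) = (\<Oplus>\<^bsub>T\<^esub>e\<in>E. \<zero>\<^bsub>T\<^esub>)"
    by (intro T.M.finsum_cong') auto
  moreover have "(\<Oplus>\<^bsub>T\<^esub>e\<in>E. e \<odot>\<^bsub>T\<^esub> t) = \<one> \<odot>\<^bsub>T\<^esub> t"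
    using T.smult_finsum_l[OF finite_E _ assms(2), of "\<lambda>e. e"] E_idem sum_E by auto
  ultimately show False using assms by (simp add: T.smult_one)
qed

definition idem :: "'j \<Rightarrow> 'a"
  where "idem j = (SOME e. e \<in> E \<and> (\<exists>s\<in>carrier (S j). s \<noteq> \<zero>\<^bsub>S j\<^esub> \<and> e \<odot>\<^bsub>S j\<^esub> s = s))"

definition gen :: "'j \<Rightarrow> 'a set"
  where "gen j = (SOME s. s \<in> carrier (S j) \<and> s \<noteq> \<zero>\<^bsub>S j\<^esub> \<and> idem j \<odot>\<^bsub>S j\<^esub> s = s)"

lemma idem_gen:
  assumes "j \<in> J"
  shows "idem j \<in> E" and "gen j \<in> carrier (S j)" and "gen j \<noteq> \<zero>\<^bsub>S j\<^esub>"
    and "idem j \<odot>\<^bsub>S j\<^esub> gen j = gen j"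
proof -
  interpret S: left_module A "S j" by (rule S_left_module[OF assms])
  have "carrier (S j) \<noteq> {\<zero>\<^bsub>S j\<^esub>}" using simple_S[OF assms] by (simp add: simple_lmod_def)
  then obtain t where t: "t \<in> carrier (S j)" "t \<noteq> \<zero>\<^bsub>S j\<^esub>" using S.M.zero_closed by blast
  obtain e where e: "e \<in> E" "e \<odot>\<^bsub>S j\<^esub> t \<noteq> \<zero>\<^bsub>S j\<^esub>"
    using ex_idem_nonzero[OF S.left_module_axioms t] by auto
  have "e \<odot>\<^bsub>S j\<^esub> (e \<odot>\<^bsub>S j\<^esub> t) = e \<odot>\<^bsub>S j\<^esub> t"
    using E_idem[OF e(1)] t by (simp add: S.smult_assoc1[symmetric])
  then have "\<exists>e. e \<in> E \<and> (\<exists>s\<in>carrier (S j). s \<noteq> \<zero>\<^bsub>S j\<^esub> \<and> e \<odot>\<^bsub>S j\<^esub> s = s)"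
    using e t E_idem by (metis S.smult_closed)
  from someI_ex[OF this] have *: "idem j \<in> E"
    "\<exists>s. s \<in> carrier (S j) \<and> s \<noteq> \<zero>\<^bsub>S j\<^esub> \<and> idem j \<odot>\<^bsub>S j\<^esub> s = s"
    unfolding idem_def by auto
  from someI_ex[OF *(2)] * show "idem j \<in> E" "gen j \<in> carrier (S j)" "gen j \<noteq> \<zero>\<^bsub>S j\<^esub>"
    "idem j \<odot>\<^bsub>S j\<^esub> gen j = gen j"
    unfolding gen_def by auto
qed

lemma idem_carrier: "j \<in> J \<Longrightarrow> idem j \<in> carrier A" "j \<in> J \<Longrightarrow> idem j \<otimes> idem j = idem j"
  using idem_gen(1) E_idem by auto

lemma idem_left_ideal: "j \<in> J \<Longrightarrow> left_module A (left_ideal_lmod A (idem j))"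
  using A.left_ideal_left_module idem_carrier(1) by blast

text \<open>If \<open>e\<close> acted nontrivially on \<open>S j\<close>, then \<open>Ae\<close>
  would be isomorphic to \<open>P j\<close>, as is the left ideal of \<open>idem j\<close>; in a
  basic algebra the two idempotents would coincide.\<close>

lemma idem_zero:
  assumes "j \<in> J" "e \<in> E" "e \<noteq> idem j" "t \<in> carrier (S j)"
  shows "e \<odot>\<^bsub>S j\<^esub> t = \<zero>\<^bsub>S j\<^esub>"
proof (rule ccontr)
  interpret S: left_module A "S j" by (rule S_left_module[OF assms(1)])
  note e = E_idem[OF assms(2)]
  assume n: "e \<odot>\<^bsub>S j\<^esub> t \<noteq> \<zero>\<^bsub>S j\<^esub>"
  have "e \<odot>\<^bsub>S j\<^esub> (e \<odot>\<^bsub>S j\<^esub> t) = e \<odot>\<^bsub>S j\<^esub> t"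
    using e assms(4) by (simp add: S.smult_assoc1[symmetric])
  then have "lmod_iso A (left_ideal_lmod A e) (P j)"
    using projective_cover_lmod_iso[OF cover[OF assms(1)] simple_S[OF assms(1)] _ n e _ prim[OF assms(2)]]
      e assms(4) by (simp add: S.smult_closed)
  moreover have "lmod_iso A (left_ideal_lmod A (idem j)) (P j)"
    using projective_cover_lmod_iso[OF cover[OF assms(1)] simple_S[OF assms(1)] idem_gen(2,3)[OF assms(1)]
        idem_carrier[OF assms(1)] idem_gen(4)[OF assms(1)] prim[OF idem_gen(1)[OF assms(1)]]] .
  ultimately have "lmod_iso A (left_ideal_lmod A e) (left_ideal_lmod A (idem j))"
    using lmod_iso_trans lmod_iso_sym[OF idem_left_ideal[OF assms(1)]] by blast
  then show False using noniso_E assms(2,3) idem_gen(1)[OF assms(1)] by blast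
qed

lemma left_ideal_full:
  assumes "j \<in> J" "submodule N A (left_ideal_lmod A (idem j))" "x \<in> N"
    "x \<odot>\<^bsub>S j\<^esub> gen j \<noteq> \<zero>\<^bsub>S j\<^esub>"
  shows "idem j \<in> N"
  using left_ideal_eq_carrier[OF cover[OF assms(1)] simple_S[OF assms(1)] idem_gen(2,3)[OF assms(1)]
        idem_carrier[OF assms(1)] idem_gen(4)[OF assms(1)] prim[OF idem_gen(1)[OF assms(1)]] assms(2-4)] .

lemma annihilator_submodule:
  assumes "j \<in> J" "left_module A T" "t \<in> carrier T"
  shows "submodule {x \<in> carrier (left_ideal_lmod A (idem j)). x \<odot>\<^bsub>T\<^esub> t = \<zero>\<^bsub>T\<^esub>} A (left_ideal_lmod A (idem j))"
proof -
  interpret L: left_module A "left_ideal_lmod A (idem j)" by (rule idem_left_ideal[OF assms(1)])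
  interpret T: left_module A T by fact
  note Lc = A.left_ideal_carrier_iff[OF idem_carrier[OF assms(1)]]
  show ?thesis
  proof (rule L.submoduleI)
    show "\<zero>\<^bsub>left_ideal_lmod A (idem j)\<^esub> \<in>
        {x \<in> carrier (left_ideal_lmod A (idem j)). x \<odot>\<^bsub>T\<^esub> t = \<zero>\<^bsub>T\<^esub>}"
      using L.M.zero_closed assms(3) by (simp add: T.smult_l_null left_ideal_lmod_simps(2))
    fix x y assume "x \<in> {x \<in> carrier (left_ideal_lmod A (idem j)). x \<odot>\<^bsub>T\<^esub> t = \<zero>\<^bsub>T\<^esub>}"
      "y \<in> {x \<in> carrier (left_ideal_lmod A (idem j)). x \<odot>\<^bsub>T\<^esub> t = \<zero>\<^bsub>T\<^esub>}"
    then show "x \<oplus>\<^bsub>left_ideal_lmod A (idem j)\<^esub> y \<in>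
        {x \<in> carrier (left_ideal_lmod A (idem j)). x \<odot>\<^bsub>T\<^esub> t = \<zero>\<^bsub>T\<^esub>}"
      using assms(3) L.M.add.m_closed[of x y] Lc by (simp add: T.smult_l_distr left_ideal_lmod_simps(3))
  next
    fix a x assume "a \<in> carrier A"
      "x \<in> {x \<in> carrier (left_ideal_lmod A (idem j)). x \<odot>\<^bsub>T\<^esub> t = \<zero>\<^bsub>T\<^esub>}"
    then show "a \<odot>\<^bsub>left_ideal_lmod A (idem j)\<^esub> x \<in>
        {x \<in> carrier (left_ideal_lmod A (idem j)). x \<odot>\<^bsub>T\<^esub> t = \<zero>\<^bsub>T\<^esub>}"
      using assms(3) L.smult_closed[of a x] Lc
      by (simp add: T.smult_assoc1 T.smult_r_null left_ideal_lmod_simps(4))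
  qed auto
qed

text \<open>One-dimensionality of \<open>S j\<close>. Take \<open>x\<close> in the corner of
  \<open>idem j\<close> with x s = t, where \<open>s\<close> is the generator, and an eigenvector
  \<open>u\<close> of \<open>x\<close> for \<open>r\<close>. Since x - r kills \<open>u\<close> but
  \<open>idem j\<close> does not, (x - r) e lies in a proper submodule of \<open>Ae\<close>, hence
  in the unique maximal one, which is the annihilator of \<open>s\<close>. Thus t = r s.\<close>

lemma gen_scalar:
  assumes j: "j \<in> J" and t: "t \<in> carrier (S j)"
  shows "\<exists>r\<in>carrier K. t = (r \<odot> \<one>) \<odot>\<^bsub>S j\<^esub> gen j"
proof -
  interpret S: left_module A "S j" by (rule S_left_module[OF j])
  let ?e = "idem j" and ?s = "gen j"
  note g = idem_gen[OF j] and e = idem_carrier[OF j]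
  note Lc = A.left_ideal_carrier_iff[OF e]
  have et: "?e \<odot>\<^bsub>S j\<^esub> t = t"
  proof -
    have "(\<Oplus>\<^bsub>S j\<^esub>f\<in>E. f \<odot>\<^bsub>S j\<^esub> t) = \<one> \<odot>\<^bsub>S j\<^esub> t"
      using S.smult_finsum_l[OF finite_E _ t, of "\<lambda>e. e"] E_idem sum_E by auto
    also have "(\<Oplus>\<^bsub>S j\<^esub>f\<in>E. f \<odot>\<^bsub>S j\<^esub> t) = (\<Oplus>\<^bsub>S j\<^esub>f\<in>E. if ?e = f then f \<odot>\<^bsub>S j\<^esub> t else \<zero>\<^bsub>S j\<^esub>)"
      using idem_zero[OF j _ _ t] t E_idem e by (intro S.M.finsum_cong') (auto intro: S.smult_closed)
    also have "\<dots> = ?e \<odot>\<^bsub>S j\<^esub> t"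
      using t E_idem by (intro S.M.add.finprod_singleton[OF g(1) finite_E]) (auto intro: S.smult_closed)
    finally show ?thesis using t by (simp add: S.smult_one)
  qed
  obtain a where a: "a \<in> carrier A" "t = a \<odot>\<^bsub>S j\<^esub> ?s"
    using simple_lmod_cyclic[OF simple_S[OF j] g(2,3) t] by auto
  define x where "x = ?e \<otimes> a \<otimes> ?e"
  have x: "x \<in> carrier A" "?e \<otimes> x = x" "x \<otimes> ?e = x"
    using a e by (auto simp: x_def A.m_assoc) (metis A.m_assoc A.m_closed)
  have xs: "x \<odot>\<^bsub>S j\<^esub> ?s = t"
    using a e g et by (simp add: x_def S.smult_assoc1 S.smult_closed)
  obtain u r where u: "u \<in> carrier (S j)" "u \<noteq> \<zero>\<^bsub>S j\<^esub>" "?e \<odot>\<^bsub>S j\<^esub> u = u" and r: "r \<in> carrier K"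
    and ev: "(x \<ominus> r \<odot> \<one>) \<odot>\<^bsub>S j\<^esub> u = \<zero>\<^bsub>S j\<^esub>"
    using ex_eigenvector[OF alg_closed S.left_module_axioms x(1) e(1) _ g(2,3,4)] x by auto
  let ?d = "x \<ominus> r \<odot> \<one>"
  have d: "?d \<in> carrier A" using x r by simp
  let ?N = "{z \<in> carrier (left_ideal_lmod A ?e). z \<odot>\<^bsub>S j\<^esub> u = \<zero>\<^bsub>S j\<^esub>}"
  have "?d \<otimes> ?e \<in> ?N"
    using d e u ev Lc by (simp add: S.smult_assoc1 A.m_assoc)
  moreover have "?e \<notin> ?N" using u by auto
  ultimately have "(?d \<otimes> ?e) \<odot>\<^bsub>S j\<^esub> ?s = \<zero>\<^bsub>S j\<^esub>"
    using left_ideal_full[OF j annihilator_submodule[OF j S.left_module_axioms u(1)]] by blast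
  then have "?d \<odot>\<^bsub>S j\<^esub> ?s = \<zero>\<^bsub>S j\<^esub>" using d e g by (simp add: S.smult_assoc1)
  then have "t \<ominus>\<^bsub>S j\<^esub> (r \<odot> \<one>) \<odot>\<^bsub>S j\<^esub> ?s = \<zero>\<^bsub>S j\<^esub>"
    using x(1) r g(2) xs by (simp add: S.smult_diff_l)
  then have "t = (r \<odot> \<one>) \<odot>\<^bsub>S j\<^esub> ?s"
    using t r g(2) by (intro S.diff_eq_zeroD[OF t]) (auto intro: S.smult_closed)
  then show ?thesis using r by blast
qed

lemma scalar_zero:
  assumes "left_module A T" "t \<in> carrier T" "t \<noteq> \<zero>\<^bsub>T\<^esub>" "r \<in> carrier K"
    "(r \<odot> \<one>) \<odot>\<^bsub>T\<^esub> t = \<zero>\<^bsub>T\<^esub>"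
  shows "r = \<zero>\<^bsub>K\<^esub>"
proof (rule ccontr)
  interpret kalg A K by (rule kalg)
  interpret T: left_module A T by fact
  assume r: "r \<noteq> \<zero>\<^bsub>K\<^esub>"
  then have i: "inv\<^bsub>K\<^esub> r \<in> carrier K" using assms(4) by (simp add: K.field_Units)
  have "(inv\<^bsub>K\<^esub> r \<odot> \<one>) \<otimes> (r \<odot> \<one>) = \<one>"
    using assms(4) r i by (simp add: smult_one_mult smult_inv_cancel)
  then have "t = (inv\<^bsub>K\<^esub> r \<odot> \<one>) \<odot>\<^bsub>T\<^esub> ((r \<odot> \<one>) \<odot>\<^bsub>T\<^esub> t)"
    using assms i by (metis T.smult_assoc1 T.smult_one A.one_closed smult_closed)
  then show False using assms i by (simp add: T.smult_r_null)
qed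

lemma scalar_unique:
  assumes j: "j \<in> J" and r: "r \<in> carrier K" "r' \<in> carrier K"
    and eq: "(r \<odot> \<one>) \<odot>\<^bsub>S j\<^esub> gen j = (r' \<odot> \<one>) \<odot>\<^bsub>S j\<^esub> gen j"
  shows "r = r'"
proof -
  interpret kalg A K by (rule kalg)
  interpret S: left_module A "S j" by (rule S_left_module[OF j])
  have "((r \<ominus>\<^bsub>K\<^esub> r') \<odot> \<one>) = r \<odot> \<one> \<ominus> r' \<odot> \<one>"
    using r by (simp add: K.minus_eq A.minus_eq smult_l_distr smult_l_minus)
  then have "((r \<ominus>\<^bsub>K\<^esub> r') \<odot> \<one>) \<odot>\<^bsub>S j\<^esub> gen j = \<zero>\<^bsub>S j\<^esub>"
    using r idem_gen(2)[OF j] eq S.smult_closed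
    by (simp add: S.smult_diff_l S.M.minus_eq S.M.r_neg)
  then have "r \<ominus>\<^bsub>K\<^esub> r' = \<zero>\<^bsub>K\<^esub>"
    using scalar_zero[OF S.left_module_axioms idem_gen(2,3)[OF j]] r by simp
  then show ?thesis using r by simp
qed

definition chr :: "'j \<Rightarrow> 'a \<Rightarrow> 'k"
  where "chr j a = (SOME r. r \<in> carrier K \<and> a \<odot>\<^bsub>S j\<^esub> gen j = (r \<odot> \<one>) \<odot>\<^bsub>S j\<^esub> gen j)"

lemma chr:
  assumes "j \<in> J" "a \<in> carrier A"
  shows "chr j a \<in> carrier K" and "a \<odot>\<^bsub>S j\<^esub> gen j = (chr j a \<odot> \<one>) \<odot>\<^bsub>S j\<^esub> gen j"
proof -
  interpret S: left_module A "S j" by (rule S_left_module[OF assms(1)])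
  have "\<exists>r. r \<in> carrier K \<and> a \<odot>\<^bsub>S j\<^esub> gen j = (r \<odot> \<one>) \<odot>\<^bsub>S j\<^esub> gen j"
    using gen_scalar[OF assms(1), of "a \<odot>\<^bsub>S j\<^esub> gen j"] S.smult_closed idem_gen(2)[OF assms(1)] assms(2)
    by blast
  from someI_ex[OF this] show "chr j a \<in> carrier K"
    "a \<odot>\<^bsub>S j\<^esub> gen j = (chr j a \<odot> \<one>) \<odot>\<^bsub>S j\<^esub> gen j"
    unfolding chr_def by auto
qed

lemma chr_eqI:
  assumes "j \<in> J" "a \<in> carrier A" "r \<in> carrier K"
    "a \<odot>\<^bsub>S j\<^esub> gen j = (r \<odot> \<one>) \<odot>\<^bsub>S j\<^esub> gen j"
  shows "chr j a = r"
  using scalar_unique[OF assms(1) chr(1)[OF assms(1,2)] assms(3)] chr(2)[OF assms(1,2)] assms(4) by simp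

lemma chr_add: "\<lbrakk>j \<in> J; a \<in> carrier A; b \<in> carrier A\<rbrakk> \<Longrightarrow> chr j (a \<oplus> b) = chr j a \<oplus>\<^bsub>K\<^esub> chr j b"
  using S_left_module[of j] idem_gen(2)[of j]
  by (intro chr_eqI) (auto simp: chr smult_l_distr left_module.smult_l_distr)

lemma chr_smult: "\<lbrakk>j \<in> J; c \<in> carrier K; a \<in> carrier A\<rbrakk> \<Longrightarrow> chr j (c \<odot> a) = c \<otimes>\<^bsub>K\<^esub> chr j a"
proof (rule chr_eqI)
  interpret kalg A K by (rule kalg)
  assume *: "j \<in> J" "c \<in> carrier K" "a \<in> carrier A"
  interpret S: left_module A "S j" by (rule S_left_module[OF *(1)])
  have "(c \<odot> a) \<odot>\<^bsub>S j\<^esub> gen j = (c \<odot> \<one>) \<odot>\<^bsub>S j\<^esub> (a \<odot>\<^bsub>S j\<^esub> gen j)"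
    using * idem_gen(2) by (simp add: S.smult_assoc1[symmetric] smult_one_mult)
  also have "\<dots> = ((c \<odot> \<one>) \<otimes> (chr j a \<odot> \<one>)) \<odot>\<^bsub>S j\<^esub> gen j"
    using * idem_gen(2) chr[of j a] by (simp add: S.smult_assoc1)
  also have "(c \<odot> \<one>) \<otimes> (chr j a \<odot> \<one>) = (c \<otimes>\<^bsub>K\<^esub> chr j a) \<odot> \<one>"
    using * chr(1) by (simp add: smult_one_mult smult_assoc1)
  finally show "(c \<odot> a) \<odot>\<^bsub>S j\<^esub> gen j = ((c \<otimes>\<^bsub>K\<^esub> chr j a) \<odot> \<one>) \<odot>\<^bsub>S j\<^esub> gen j" .
qed (auto simp: chr)

lemma chr_mult: "\<lbrakk>j \<in> J; a \<in> carrier A; b \<in> carrier A\<rbrakk> \<Longrightarrow> chr j (a \<otimes> b) = chr j a \<otimes>\<^bsub>K\<^esub> chr j b"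
proof (rule chr_eqI)
  interpret kalg A K by (rule kalg)
  assume *: "j \<in> J" "a \<in> carrier A" "b \<in> carrier A"
  interpret S: left_module A "S j" by (rule S_left_module[OF *(1)])
  have "(a \<otimes> b) \<odot>\<^bsub>S j\<^esub> gen j = (a \<otimes> (chr j b \<odot> \<one>)) \<odot>\<^bsub>S j\<^esub> gen j"
    using * idem_gen(2) chr[of j b] by (simp add: S.smult_assoc1)
  also have "a \<otimes> (chr j b \<odot> \<one>) = (chr j b \<odot> \<one>) \<otimes> a"
    using * chr(1) by (simp add: smult_one_mult mult_smult_one)
  also have "\<dots> \<odot>\<^bsub>S j\<^esub> gen j = ((chr j b \<odot> \<one>) \<otimes> (chr j a \<odot> \<one>)) \<odot>\<^bsub>S j\<^esub> gen j"
    using * idem_gen(2) chr[of j a] chr(1)[of j b] by (simp add: S.smult_assoc1)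
  also have "(chr j b \<odot> \<one>) \<otimes> (chr j a \<odot> \<one>) = (chr j a \<otimes>\<^bsub>K\<^esub> chr j b) \<odot> \<one>"
    using * chr(1) by (simp add: smult_one_mult smult_assoc1[symmetric] K.m_comm)
  finally show "(a \<otimes> b) \<odot>\<^bsub>S j\<^esub> gen j = ((chr j a \<otimes>\<^bsub>K\<^esub> chr j b) \<odot> \<one>) \<odot>\<^bsub>S j\<^esub> gen j" .
qed (auto simp: chr)

lemma chr_one: "j \<in> J \<Longrightarrow> chr j \<one> = \<one>\<^bsub>K\<^esub>"
  by (intro chr_eqI) simp_all

lemma simple_char:
  assumes T: "simple_lmod A (T :: ('a, 'a set) module)"
  shows "\<exists>j\<in>J. \<exists>h\<in>lmod_hom A T (S j). bij_betw h (carrier T) (carrier (S j))"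
  using all_simple[OF T] by (auto simp: lmod_iso_def)

text \<open>With a common idempotent \<open>e\<close>, both generators have the unique maximal
  submodule of \<open>Ae\<close> as annihilator. Hence the characters agree, and one-dimensional
  modules with the same character are isomorphic.\<close>

lemma idem_inj:
  assumes ij: "i \<in> J" "j \<in> J" and eq: "idem i = idem j"
  shows "i = j"
proof -
  interpret Si: left_module A "S i" by (rule S_left_module[OF ij(1)])
  interpret Sj: left_module A "S j" by (rule S_left_module[OF ij(2)])
  note gi = idem_gen[OF ij(1)] and gj = idem_gen[OF ij(2)] and e = idem_carrier[OF ij(2)]
  note Lc = A.left_ideal_carrier_iff[OF e]
  let ?L = "carrier (left_ideal_lmod A (idem j))"
  have 1: "x \<odot>\<^bsub>S j\<^esub> gen j = \<zero>\<^bsub>S j\<^esub>" if "x \<in> ?L" "x \<odot>\<^bsub>S i\<^esub> gen i = \<zero>\<^bsub>S i\<^esub>" for x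
    using left_ideal_full[OF ij(2) annihilator_submodule[OF ij(2) Si.left_module_axioms gi(2)], of x]
      that gi eq by auto
  have 2: "x \<odot>\<^bsub>S i\<^esub> gen i = \<zero>\<^bsub>S i\<^esub>" if "x \<in> ?L" "x \<odot>\<^bsub>S j\<^esub> gen j = \<zero>\<^bsub>S j\<^esub>" for x
    using left_ideal_full[OF ij(1) annihilator_submodule[OF ij(1) Sj.left_module_axioms gj(2)], of x]
      that gj eq by auto
  have chr_eq: "chr i a = chr j a" if a: "a \<in> carrier A" for a
  proof -
    let ?x = "(a \<ominus> chr i a \<odot> \<one>) \<otimes> idem j"
    note c = chr(1)[OF ij(1) a]
    have d: "a \<ominus> chr i a \<odot> \<one> \<in> carrier A" using a c by simp
    have x: "?x \<in> ?L" using d e Lc by (simp add: A.m_assoc)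
    have "?x \<odot>\<^bsub>S i\<^esub> gen i = \<zero>\<^bsub>S i\<^esub>"
      using d e gi eq a c chr(2)[OF ij(1) a]
      by (simp add: Si.smult_assoc1 Si.smult_diff_l Si.smult_closed Si.M.minus_eq Si.M.r_neg)
    then have "?x \<odot>\<^bsub>S j\<^esub> gen j = \<zero>\<^bsub>S j\<^esub>" using 1 x by blast
    then have "(a \<ominus> chr i a \<odot> \<one>) \<odot>\<^bsub>S j\<^esub> gen j = \<zero>\<^bsub>S j\<^esub>"
      using d e gj by (simp add: Sj.smult_assoc1)
    then have "a \<odot>\<^bsub>S j\<^esub> gen j \<ominus>\<^bsub>S j\<^esub> (chr i a \<odot> \<one>) \<odot>\<^bsub>S j\<^esub> gen j = \<zero>\<^bsub>S j\<^esub>"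
      using a c gj(2) by (simp add: Sj.smult_diff_l)
    then have "a \<odot>\<^bsub>S j\<^esub> gen j = (chr i a \<odot> \<one>) \<odot>\<^bsub>S j\<^esub> gen j"
      by (rule Sj.diff_eq_zeroD[rotated 2]) (use a c gj(2) in \<open>auto intro: Sj.smult_closed\<close>)
    then show ?thesis using chr_eqI[OF ij(2) a c] by simp
  qed
  define h where "h t = (THE u. \<exists>r\<in>carrier K. t = (r \<odot> \<one>) \<odot>\<^bsub>S i\<^esub> gen i \<and>
      u = (r \<odot> \<one>) \<odot>\<^bsub>S j\<^esub> gen j)" for t
  have h: "h ((r \<odot> \<one>) \<odot>\<^bsub>S i\<^esub> gen i) = (r \<odot> \<one>) \<odot>\<^bsub>S j\<^esub> gen j"
    if r: "r \<in> carrier K" for r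
    unfolding h_def
    using r by (intro the_equality) (auto dest: scalar_unique[OF ij(1), rotated 2])
  have ha: "h (a \<odot>\<^bsub>S i\<^esub> gen i) = a \<odot>\<^bsub>S j\<^esub> gen j" if a: "a \<in> carrier A" for a
    using h[OF chr(1)[OF ij(1) a]] chr(2)[OF ij(1) a] chr(2)[OF ij(2) a] chr_eq[OF a] by simp
  have cyc: "\<exists>a\<in>carrier A. t = a \<odot>\<^bsub>S i\<^esub> gen i" if "t \<in> carrier (S i)" for t
    using simple_lmod_cyclic[OF simple_S[OF ij(1)] gi(2,3) that] .
  have "h \<in> lmod_hom A (S i) (S j)"
    unfolding lmod_hom_def
  proof (intro CollectI conjI ballI)
    show "h \<in> carrier (S i) \<rightarrow> carrier (S j)"
      using cyc ha gj(2) by (metis Pi_I Sj.smult_closed)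
    show "h (t \<oplus>\<^bsub>S i\<^esub> u) = h t \<oplus>\<^bsub>S j\<^esub> h u" if tu: "t \<in> carrier (S i)" "u \<in> carrier (S i)" for t u
    proof -
      obtain a b where ab: "a \<in> carrier A" "b \<in> carrier A" "t = a \<odot>\<^bsub>S i\<^esub> gen i" "u = b \<odot>\<^bsub>S i\<^esub> gen i"
        using cyc tu by metis
      then show ?thesis using ha gi(2) gj(2)
        by (simp add: Si.smult_l_distr[symmetric] Sj.smult_l_distr[symmetric])
    qed
    show "h (b \<odot>\<^bsub>S i\<^esub> t) = b \<odot>\<^bsub>S j\<^esub> h t" if bt: "b \<in> carrier A" "t \<in> carrier (S i)" for b t
    proof -
      obtain a where ab: "a \<in> carrier A" "t = a \<odot>\<^bsub>S i\<^esub> gen i"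
        using cyc bt by metis
      then show ?thesis using ha gi(2) gj(2) bt
        by (simp add: Si.smult_assoc1[symmetric] Sj.smult_assoc1[symmetric])
    qed
  qed
  moreover have "bij_betw h (carrier (S i)) (carrier (S j))"
    unfolding bij_betw_def
  proof
    show "inj_on h (carrier (S i))"
    proof (rule inj_onI)
      fix t u assume tu: "t \<in> carrier (S i)" "u \<in> carrier (S i)" "h t = h u"
      obtain r r' where r: "r \<in> carrier K" "r' \<in> carrier K" "t = (r \<odot> \<one>) \<odot>\<^bsub>S i\<^esub> gen i"
        "u = (r' \<odot> \<one>) \<odot>\<^bsub>S i\<^esub> gen i"
        using gen_scalar[OF ij(1)] tu by metis
      then show "t = u" using h tu(3) scalar_unique[OF ij(2) r(1,2)] by simp
    qed
    show "h ` carrier (S i) = carrier (S j)"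
    proof
      show "h ` carrier (S i) \<subseteq> carrier (S j)" using cyc ha gj(2) by (metis image_subsetI Sj.smult_closed)
      show "carrier (S j) \<subseteq> h ` carrier (S i)"
      proof
        fix u assume "u \<in> carrier (S j)"
        then obtain a where "a \<in> carrier A" "u = a \<odot>\<^bsub>S j\<^esub> gen j"
          using simple_lmod_cyclic[OF simple_S[OF ij(2)] gj(2,3)] by blast
        then show "u \<in> h ` carrier (S i)"
          using ha gi(2) by (metis image_eqI Si.smult_closed)
      qed
    qed
  qed
  ultimately show ?thesis using noniso_S[OF ij] by (auto simp: lmod_iso_def)
qed

text \<open>A maximal left ideal containing \<open>N\<close> yields a simple quotient, hence a character.\<close>

lemma ex_char_killing:
  assumes e: "e \<in> carrier A" "e \<otimes> e = e" and N: "submodule N A (left_ideal_lmod A e)" "e \<notin> N"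
  shows "\<exists>j\<in>J. \<exists>t\<in>carrier (S j). t \<noteq> \<zero>\<^bsub>S j\<^esub> \<and> e \<odot>\<^bsub>S j\<^esub> t = t \<and> (\<forall>x\<in>N. x \<odot>\<^bsub>S j\<^esub> t = \<zero>\<^bsub>S j\<^esub>)"
proof -
  let ?L = "left_ideal_lmod A e"
  interpret L: left_module A ?L by (rule A.left_ideal_left_module[OF e(1)])
  note Lc = A.left_ideal_carrier_iff[OF e]
  obtain M where M: "maximal_submodule M A ?L" "N \<subseteq> M" "e \<notin> M"
    using A.ex_maximal_submodule[OF e(1) N] by auto
  have sM: "submodule M A ?L" using M(1) by (simp add: maximal_submodule_def)
  obtain j h where j: "j \<in> J" and h: "h \<in> lmod_hom A (quot ?L M) (S j)"
    "bij_betw h (carrier (quot ?L M)) (carrier (S j))"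
    using simple_char[OF L.simple_quot[OF M(1)]] by auto
  interpret S: left_module A "S j" by (rule S_left_module[OF j])
  let ?c = "\<lambda>x. M +>\<^bsub>?L\<^esub> x"
  have eL: "e \<in> carrier ?L" using e Lc by simp
  have c: "?c e \<in> carrier (quot ?L M)" using eL L.quot_carrier[OF sM] by blast
  have hz: "h \<zero>\<^bsub>quot ?L M\<^esub> = \<zero>\<^bsub>S j\<^esub>"
    using lmod_hom_zero[OF L.quot_left_module[OF sM] S.left_module_axioms h(1)] .
  have "?c e \<noteq> \<zero>\<^bsub>quot ?L M\<^esub>"
    using L.coset_eq_zero_iff[OF sM eL] M(3) by (simp add: quot_simps(2))
  then have "h (?c e) \<noteq> \<zero>\<^bsub>S j\<^esub>"
    using h(2) hz c abelian_group.axioms(1)[OF left_module.axioms(2)[OF L.quot_left_module[OF sM]]]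
    unfolding bij_betw_def by (metis inj_onD abelian_monoid.zero_closed)
  moreover have hx: "x \<odot>\<^bsub>S j\<^esub> h (?c e) = h (?c (x \<otimes> e))" if "x \<in> carrier A" for x
    using lmod_homD(3)[OF h(1) that c] L.quot_smult[OF sM that eL]
    by (simp add: left_ideal_lmod_simps(4))
  moreover have "x \<odot>\<^bsub>S j\<^esub> h (?c e) = \<zero>\<^bsub>S j\<^esub>" if x: "x \<in> N" for x
  proof -
    have xL: "x \<in> carrier ?L" using x N(1) by (auto simp: L.submodule_iff)
    then have "?c x = \<zero>\<^bsub>quot ?L M\<^esub>"
      using L.coset_eq_zero_iff[OF sM xL] x M(2) by (auto simp: quot_simps(2))
    then show ?thesis using hx hz xL Lc by simp
  qed
  ultimately show ?thesis
    using j hx[OF e(1)] e(2) lmod_homD(1)[OF h(1) c] by (intro bexI[of _ j] bexI[of _ "h (?c e)"]) auto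
qed

text \<open>The zero submodule does not contain \<open>e\<close>, so some simple module has a
  nonzero vector fixed by \<open>e\<close>; by \<open>idem_zero\<close> its idempotent must be
  \<open>e\<close>.\<close>

lemma idem_surj: "idem ` J = E"
proof
  show "idem ` J \<subseteq> E" using idem_gen(1) by auto
  show "E \<subseteq> idem ` J"
  proof
    fix e assume e: "e \<in> E"
    interpret L: left_module A "left_ideal_lmod A e" by (rule A.left_ideal_left_module[OF E_idem(1)[OF e]])
    have "e \<notin> {\<zero>\<^bsub>left_ideal_lmod A e\<^esub>}"
      using prim[OF e] by (simp add: primitive_idempotent_def left_ideal_lmod_simps)
    then obtain j t where "j \<in> J" "t \<in> carrier (S j)" "t \<noteq> \<zero>\<^bsub>S j\<^esub>" "e \<odot>\<^bsub>S j\<^esub> t = t"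
      using ex_char_killing[OF E_idem[OF e] L.submodule_zero] by blast
    then have "e = idem j" using idem_zero[OF _ e] by metis
    then show "e \<in> idem ` J" using \<open>j \<in> J\<close> by auto
  qed
qed

lemma finite_J: "finite J"
  using finite_imageD[of idem J] idem_surj finite_E idem_inj by (metis inj_onI)

lemma sum_idem: "(\<Oplus>j\<in>J. idem j) = \<one>"
proof -
  have "(\<Oplus>e\<in>idem ` J. e) = (\<Oplus>j\<in>J. idem j)"
    using idem_inj idem_carrier(1) by (intro A.finsum_reindex) (auto intro: inj_onI)
  then show ?thesis using idem_surj sum_E by simp
qed

lemma idem_orth: "\<lbrakk>i \<in> J; j \<in> J; i \<noteq> j\<rbrakk> \<Longrightarrow> idem i \<otimes> idem j = \<zero>"
  using orth idem_gen(1) idem_inj by metis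

lemma chr_idem: "\<lbrakk>i \<in> J; j \<in> J\<rbrakk> \<Longrightarrow> chr i (idem j) = (if i = j then \<one>\<^bsub>K\<^esub> else \<zero>\<^bsub>K\<^esub>)"
proof (rule chr_eqI)
  assume ij: "i \<in> J" "j \<in> J"
  interpret S: left_module A "S i" by (rule S_left_module[OF ij(1)])
  show "idem j \<odot>\<^bsub>S i\<^esub> gen i = ((if i = j then \<one>\<^bsub>K\<^esub> else \<zero>\<^bsub>K\<^esub>) \<odot> \<one>) \<odot>\<^bsub>S i\<^esub> gen i"
  proof (cases "i = j")
    case True
    then show ?thesis using idem_gen(4)[OF ij(1)] S.smult_one[OF idem_gen(2)[OF ij(1)]] by simp
  next
    case False
    then have "idem j \<noteq> idem i" using idem_inj ij by blast
    then have "idem j \<odot>\<^bsub>S i\<^esub> gen i = \<zero>\<^bsub>S i\<^esub>"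
      using idem_zero ij idem_gen by blast
    then show ?thesis using False idem_gen(2)[OF ij(1)] by (simp add: S.smult_l_null)
  qed
qed (simp_all add: idem_carrier)

text \<open>If the left ideal \<open>Ax\<close> were proper, it would annihilate a nonzero vector of
  some \<open>S j\<close>, and the character of \<open>S j\<close> would vanish at
  \<open>x\<close>.\<close>

lemma left_inverse:
  assumes x: "x \<in> carrier A" and "\<And>j. j \<in> J \<Longrightarrow> chr j x \<noteq> \<zero>\<^bsub>K\<^esub>"
  shows "\<exists>y\<in>carrier A. y \<otimes> x = \<one>"
proof (rule ccontr)
  assume no: "\<not> ?thesis"
  interpret L: left_module A "left_ideal_lmod A \<one>" by (rule A.left_ideal_left_module) simp
  have N: "submodule {a \<odot>\<^bsub>left_ideal_lmod A \<one>\<^esub> x | a. a \<in> carrier A} A (left_ideal_lmod A \<one>)"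
    using x A.left_ideal_carrier_iff[of "\<one>" x] by (intro L.submodule_cyclic) simp
  have n1: "\<one> \<notin> {a \<odot>\<^bsub>left_ideal_lmod A \<one>\<^esub> x | a. a \<in> carrier A}"
    using no by (auto simp: left_ideal_lmod_simps(4))
  obtain j t where jt: "j \<in> J" "t \<in> carrier (S j)" "t \<noteq> \<zero>\<^bsub>S j\<^esub>"
    "\<And>y. y \<in> {a \<odot>\<^bsub>left_ideal_lmod A \<one>\<^esub> x | a. a \<in> carrier A} \<Longrightarrow> y \<odot>\<^bsub>S j\<^esub> t = \<zero>\<^bsub>S j\<^esub>"
    using ex_char_killing[OF A.one_closed A.l_one[OF A.one_closed] N n1] by blast
  interpret S: left_module A "S j" by (rule S_left_module[OF jt(1)])
  interpret kalg A K by (rule kalg)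
  have "\<one> \<otimes> x \<in> {a \<odot>\<^bsub>left_ideal_lmod A \<one>\<^esub> x | a. a \<in> carrier A}"
    using x unfolding left_ideal_lmod_simps by blast
  then have xt: "x \<odot>\<^bsub>S j\<^esub> t = \<zero>\<^bsub>S j\<^esub>" using jt(4)[of "\<one> \<otimes> x"] x by simp
  obtain r where r: "r \<in> carrier K" "t = (r \<odot> \<one>) \<odot>\<^bsub>S j\<^esub> gen j" using gen_scalar[OF jt(1,2)] by auto
  note g = idem_gen[OF jt(1)] and c = chr[OF jt(1) x]
  have "x \<odot>\<^bsub>S j\<^esub> t = (x \<otimes> (r \<odot> \<one>)) \<odot>\<^bsub>S j\<^esub> gen j"
    using r x g by (simp add: S.smult_assoc1)
  also have "x \<otimes> (r \<odot> \<one>) = (r \<odot> \<one>) \<otimes> x"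
    using r x by (simp add: smult_one_mult mult_smult_one)
  also have "\<dots> \<odot>\<^bsub>S j\<^esub> gen j = ((r \<odot> \<one>) \<otimes> (chr j x \<odot> \<one>)) \<odot>\<^bsub>S j\<^esub> gen j"
    using r x g c by (simp add: S.smult_assoc1)
  also have "(r \<odot> \<one>) \<otimes> (chr j x \<odot> \<one>) = (chr j x \<odot> \<one>) \<otimes> (r \<odot> \<one>)"
    using r c by (simp add: smult_one_mult smult_comm)
  also have "\<dots> \<odot>\<^bsub>S j\<^esub> gen j = (chr j x \<odot> \<one>) \<odot>\<^bsub>S j\<^esub> t"
    using r c g by (simp add: S.smult_assoc1)
  finally have "chr j x = \<zero>\<^bsub>K\<^esub>"
    using scalar_zero[OF S.left_module_axioms jt(2,3) c(1)] xt by simp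
  then show False using assms(2) jt(1) by blast
qed

text \<open>Scalars pass through module homomorphisms, so an isomorphic copy of \<open>S j\<close>
  affords the same character. The copies met later are factors of chains and twisted
  modules.\<close>

lemma chr_iso_invariant:
  assumes j: "j \<in> J" and T: "left_module A T" and h: "h \<in> lmod_hom A T (S j)"
    "bij_betw h (carrier T) (carrier (S j))" and a: "a \<in> carrier A" "t \<in> carrier T"
  shows "a \<odot>\<^bsub>T\<^esub> t = (chr j a \<odot> \<one>) \<odot>\<^bsub>T\<^esub> t"
proof -
  interpret kalg A K by (rule kalg)
  interpret S: left_module A "S j" by (rule S_left_module[OF j])
  interpret T: left_module A T by fact
  note g = idem_gen[OF j] and c = chr[OF j a(1)]
  obtain r where r: "r \<in> carrier K" "h t = (r \<odot> \<one>) \<odot>\<^bsub>S j\<^esub> gen j"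
    using gen_scalar[OF j] lmod_homD(1)[OF h(1) a(2)] by auto
  have "h (a \<odot>\<^bsub>T\<^esub> t) = (a \<otimes> (r \<odot> \<one>)) \<odot>\<^bsub>S j\<^esub> gen j"
    using r a g lmod_homD(3)[OF h(1) a] by (simp add: S.smult_assoc1)
  also have "a \<otimes> (r \<odot> \<one>) = (r \<odot> \<one>) \<otimes> a"
    using r a by (simp add: smult_one_mult mult_smult_one)
  also have "\<dots> \<odot>\<^bsub>S j\<^esub> gen j = ((r \<odot> \<one>) \<otimes> (chr j a \<odot> \<one>)) \<odot>\<^bsub>S j\<^esub> gen j"
    using r a g c by (simp add: S.smult_assoc1)
  also have "(r \<odot> \<one>) \<otimes> (chr j a \<odot> \<one>) = (chr j a \<odot> \<one>) \<otimes> (r \<odot> \<one>)"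
    using r c by (simp add: smult_one_mult smult_comm)
  also have "\<dots> \<odot>\<^bsub>S j\<^esub> gen j = h ((chr j a \<odot> \<one>) \<odot>\<^bsub>T\<^esub> t)"
    using r c g a lmod_homD(3)[OF h(1) _ a(2)] by (simp add: S.smult_assoc1)
  finally show ?thesis
    using h(2) a c(1) unfolding bij_betw_def
    by (metis inj_onD T.smult_closed A.one_closed smult_closed)
qed

lemma iso_scalar:
  assumes j: "j \<in> J" and T: "left_module A T" and h: "h \<in> lmod_hom A T (S j)"
    "bij_betw h (carrier T) (carrier (S j))" and t: "t \<in> carrier T" "t \<noteq> \<zero>\<^bsub>T\<^esub>" "u \<in> carrier T"
  shows "\<exists>r\<in>carrier K. u = (r \<odot> \<one>) \<odot>\<^bsub>T\<^esub> t"
proof -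
  interpret S: left_module A "S j" by (rule S_left_module[OF j])
  interpret T: left_module A T by fact
  have "h t \<noteq> \<zero>\<^bsub>S j\<^esub>"
    using h(2) t lmod_hom_zero[OF T S.left_module_axioms h(1)] T.M.zero_closed
    unfolding bij_betw_def by (metis inj_onD)
  then obtain a where a: "a \<in> carrier A" "h u = a \<odot>\<^bsub>S j\<^esub> h t"
    using simple_lmod_cyclic[OF simple_S[OF j]] lmod_homD(1)[OF h(1)] t by metis
  then have "u = a \<odot>\<^bsub>T\<^esub> t"
    using h(2) t lmod_homD(3)[OF h(1) a(1) t(1)] T.smult_closed unfolding bij_betw_def
    by (metis inj_onD)
  then show ?thesis
    using chr_iso_invariant[OF j T h a(1) t(1)] chr(1)[OF j a(1)] by metis
qed

end

subsection \<open>Filtrations of projective modules\<close>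

text \<open>Submodules of \<open>Re\<close> as plain sets of ring elements, so that no module record
  has to be carried along.\<close>

definition (in ring) left_sub :: "'a \<Rightarrow> 'a set \<Rightarrow> bool"
  where "left_sub e N \<longleftrightarrow> N \<subseteq> {x \<in> carrier R. x \<otimes> e = x} \<and> \<zero> \<in> N \<and>
    (\<forall>x\<in>N. \<forall>y\<in>N. x \<oplus> y \<in> N) \<and> (\<forall>a\<in>carrier R. \<forall>x\<in>N. a \<otimes> x \<in> N)"

lemma (in ring) left_sub_iff_submodule:
  assumes "e \<in> carrier R" "e \<otimes> e = e"
  shows "left_sub e N \<longleftrightarrow> submodule N R (left_ideal_lmod R e)"
proof -
  interpret L: left_module R "left_ideal_lmod R e" by (rule left_ideal_left_module[OF assms(1)])
  have "carrier (left_ideal_lmod R e) = {x \<in> carrier R. x \<otimes> e = x}"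
    using left_ideal_carrier_iff[OF assms] by blast
  then show ?thesis
    unfolding left_sub_def L.submodule_iff left_ideal_lmod_simps(2-4) by simp
qed

text \<open>
  \<open>F\<close> is a composition series of the left ideal \<open>F 0\<close>, with factors afforded by the characters \<open>cs\<close>,
  and \<open>F 1\<close> is the only maximal submodule of \<open>F 0\<close>.
\<close>

definition (in kalg) filtration :: "'a \<Rightarrow> ('a \<Rightarrow> 'k) list \<Rightarrow> (nat \<Rightarrow> 'a set) \<Rightarrow> bool"
  where "filtration e cs F \<longleftrightarrow>
    (\<forall>t\<le>length cs. A.left_sub e (F t)) \<and> F (length cs) = {\<zero>} \<and>
    (\<forall>t<length cs. F (Suc t) \<subseteq> F t \<and> (\<exists>x\<in>F t. x \<notin> F (Suc t)) \<and>
      (\<forall>a\<in>carrier A. (cs ! t) a = \<zero>\<^bsub>K\<^esub> \<longrightarrow> (\<forall>x\<in>F t. a \<otimes> x \<in> F (Suc t))) \<and>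
      (\<forall>x\<in>F t. x \<notin> F (Suc t) \<longrightarrow> (\<forall>y\<in>F t. \<exists>r\<in>carrier K. y \<ominus> r \<odot> x \<in> F (Suc t)))) \<and>
    (\<forall>x\<in>F 0. x \<notin> F 1 \<longrightarrow> (\<forall>y\<in>F 0. \<exists>a\<in>carrier A. y = a \<otimes> x))"

text \<open>The linear form behind the bilinear form of a symmetric algebra, b(x, y) = \<tau>(x y):
  associativity of b is absorbed into the product, and symmetry becomes the trace property.\<close>

definition (in kalg) symmetrizing :: "('a \<Rightarrow> 'k) \<Rightarrow> bool"
  where "symmetrizing \<tau> \<longleftrightarrow> (\<forall>x\<in>carrier A. \<tau> x \<in> carrier K) \<and>
    (\<forall>x\<in>carrier A. \<forall>y\<in>carrier A. \<tau> (x \<oplus> y) = \<tau> x \<oplus>\<^bsub>K\<^esub> \<tau> y \<and> \<tau> (x \<otimes> y) = \<tau> (y \<otimes> x)) \<and>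
    (\<forall>c\<in>carrier K. \<forall>x\<in>carrier A. \<tau> (c \<odot> x) = c \<otimes>\<^bsub>K\<^esub> \<tau> x) \<and>
    (\<forall>x\<in>carrier A. x \<noteq> \<zero> \<longrightarrow> (\<exists>y\<in>carrier A. \<tau> (y \<otimes> x) \<noteq> \<zero>\<^bsub>K\<^esub>))"

lemma (in fd_algebra) ex_symmetrizing:
  assumes "symmetric_algebra K A"
  shows "\<exists>\<tau>. kalg.symmetrizing A K \<tau>"
proof -
  interpret alg: kalg A K by (rule kalg)
  obtain b where b': "(\<forall>x\<in>carrier A. \<forall>y\<in>carrier A. b x y \<in> carrier K \<and> b x y = b y x) \<and>
      (\<forall>x\<in>carrier A. \<forall>y\<in>carrier A. \<forall>z\<in>carrier A.
         b (x \<oplus>\<^bsub>A\<^esub> y) z = b x z \<oplus>\<^bsub>K\<^esub> b y z \<and> b (x \<otimes>\<^bsub>A\<^esub> y) z = b x (y \<otimes>\<^bsub>A\<^esub> z)) \<and>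
      (\<forall>c\<in>carrier K. \<forall>x\<in>carrier A. \<forall>y\<in>carrier A. b (c \<odot>\<^bsub>A\<^esub> x) y = c \<otimes>\<^bsub>K\<^esub> b x y) \<and>
      (\<forall>x\<in>carrier A. (\<forall>y\<in>carrier A. b x y = \<zero>\<^bsub>K\<^esub>) \<longrightarrow> x = \<zero>\<^bsub>A\<^esub>)"
    using assms unfolding symmetric_algebra_def by (elim conjE exE) (rule that, intro conjI)
  have b: "\<And>x y. \<lbrakk>x \<in> carrier A; y \<in> carrier A\<rbrakk> \<Longrightarrow> b x y \<in> carrier K \<and> b x y = b y x"
    "\<And>x y z. \<lbrakk>x \<in> carrier A; y \<in> carrier A; z \<in> carrier A\<rbrakk> \<Longrightarrow>
      b (x \<oplus>\<^bsub>A\<^esub> y) z = b x z \<oplus>\<^bsub>K\<^esub> b y z \<and> b (x \<otimes>\<^bsub>A\<^esub> y) z = b x (y \<otimes>\<^bsub>A\<^esub> z)"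
    "\<And>c x y. \<lbrakk>c \<in> carrier K; x \<in> carrier A; y \<in> carrier A\<rbrakk> \<Longrightarrow> b (c \<odot>\<^bsub>A\<^esub> x) y = c \<otimes>\<^bsub>K\<^esub> b x y"
    "\<And>x. \<lbrakk>x \<in> carrier A; \<forall>y\<in>carrier A. b x y = \<zero>\<^bsub>K\<^esub>\<rbrakk> \<Longrightarrow> x = \<zero>\<^bsub>A\<^esub>"
    using b' by auto
  have xy: "b (x \<otimes>\<^bsub>A\<^esub> y) \<one>\<^bsub>A\<^esub> = b x y" if "x \<in> carrier A" "y \<in> carrier A" for x y
    using b(2)[of x y "\<one>\<^bsub>A\<^esub>"] that by simp
  have "\<exists>y\<in>carrier A. b (y \<otimes>\<^bsub>A\<^esub> x) \<one>\<^bsub>A\<^esub> \<noteq> \<zero>\<^bsub>K\<^esub>" if "x \<in> carrier A" "x \<noteq> \<zero>\<^bsub>A\<^esub>" for x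
    using b(1,4) that xy by metis
  then show ?thesis
    unfolding alg.symmetrizing_def using b xy by (intro exI[of _ "\<lambda>x. b x \<one>\<^bsub>A\<^esub>"]) auto
qed

context basic_simples
begin

interpretation alg: kalg A K by (rule kalg)

text \<open>Here \<open>T\<close> may have any carrier type, whereas \<open>all_simple\<close>
  covers a single one. If r t were nonzero, then t = a r t for some a, and 1 - a r would annihilate
  \<open>t\<close>. The annihilator of \<open>t\<close> kills a nonzero vector \<open>u\<close> of
  some \<open>S j\<close>, on which \<open>r\<close> acts as zero, so \<open>u\<close> would
  vanish.\<close>

lemma rad_kills_simple:
  assumes T: "simple_lmod A T" and r: "r \<in> carrier A" "\<And>i. i \<in> J \<Longrightarrow> chr i r = \<zero>\<^bsub>K\<^esub>"
    and t: "t \<in> carrier T"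
  shows "r \<odot>\<^bsub>T\<^esub> t = \<zero>\<^bsub>T\<^esub>"
proof (rule ccontr)
  interpret T: left_module A T using T by (simp add: simple_lmod_def)
  interpret L: left_module A "left_ideal_lmod A \<one>" by (rule A.left_ideal_left_module) simp
  assume n: "r \<odot>\<^bsub>T\<^esub> t \<noteq> \<zero>\<^bsub>T\<^esub>"
  let ?N = "{x \<in> carrier A. x \<odot>\<^bsub>T\<^esub> t = \<zero>\<^bsub>T\<^esub>}"
  have "A.left_sub \<one> ?N"
    using t by (auto simp: A.left_sub_def T.smult_l_null T.smult_r_null T.smult_l_distr T.smult_assoc1)
  then have N: "submodule ?N A (left_ideal_lmod A \<one>)"
    by (simp add: A.left_sub_iff_submodule)
  have "t \<noteq> \<zero>\<^bsub>T\<^esub>" using n r(1) by (auto simp: T.smult_r_null)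
  then have n1: "\<one> \<notin> ?N" using t by (simp add: T.smult_one)
  obtain j u where u: "j \<in> J" "u \<in> carrier (S j)" "u \<noteq> \<zero>\<^bsub>S j\<^esub>" "\<And>x. x \<in> ?N \<Longrightarrow> x \<odot>\<^bsub>S j\<^esub> u = \<zero>\<^bsub>S j\<^esub>"
    using ex_char_killing[OF A.one_closed A.l_one[OF A.one_closed] N n1] by blast
  interpret S: left_module A "S j" by (rule S_left_module[OF u(1)])
  obtain a where a: "a \<in> carrier A" "t = a \<odot>\<^bsub>T\<^esub> (r \<odot>\<^bsub>T\<^esub> t)"
    using simple_lmod_cyclic[OF T _ n t] r t T.smult_closed by blast
  have ar: "a \<otimes> r \<in> carrier A" using a r by simp
  have "(\<one> \<ominus> a \<otimes> r) \<odot>\<^bsub>T\<^esub> t = t \<ominus>\<^bsub>T\<^esub> a \<odot>\<^bsub>T\<^esub> (r \<odot>\<^bsub>T\<^esub> t)"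
    using a(1) r(1) t by (simp add: T.smult_diff_l T.smult_one T.smult_assoc1)
  also have "\<dots> = \<zero>\<^bsub>T\<^esub>" using a(2) t by (metis T.M.minus_eq T.M.r_neg)
  finally have "\<one> \<ominus> a \<otimes> r \<in> ?N" using ar by simp
  then have "(\<one> \<ominus> a \<otimes> r) \<odot>\<^bsub>S j\<^esub> u = \<zero>\<^bsub>S j\<^esub>" by (rule u(4))
  then have "u \<ominus>\<^bsub>S j\<^esub> a \<odot>\<^bsub>S j\<^esub> (r \<odot>\<^bsub>S j\<^esub> u) = \<zero>\<^bsub>S j\<^esub>"
    using a(1) r(1) u(2) by (simp add: S.smult_diff_l S.smult_one S.smult_assoc1)
  moreover have "r \<odot>\<^bsub>S j\<^esub> u = \<zero>\<^bsub>S j\<^esub>"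
  proof -
    obtain k where k: "k \<in> carrier K" "u = (k \<odot> \<one>) \<odot>\<^bsub>S j\<^esub> gen j" using gen_scalar[OF u(1,2)] by auto
    note g = idem_gen[OF u(1)]
    have "r \<odot>\<^bsub>S j\<^esub> u = (r \<otimes> (k \<odot> \<one>)) \<odot>\<^bsub>S j\<^esub> gen j"
      using k r(1) g by (simp add: S.smult_assoc1)
    also have "r \<otimes> (k \<odot> \<one>) = (k \<odot> \<one>) \<otimes> r"
      using k r(1) by (simp add: alg.smult_one_mult alg.mult_smult_one)
    also have "\<dots> \<odot>\<^bsub>S j\<^esub> gen j = (k \<odot> \<one>) \<odot>\<^bsub>S j\<^esub> (r \<odot>\<^bsub>S j\<^esub> gen j)"
      using k r(1) g by (simp add: S.smult_assoc1)
    also have "\<dots> = \<zero>\<^bsub>S j\<^esub>"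
      using chr(2)[OF u(1) r(1)] r(2)[OF u(1)] k g by (simp add: S.smult_l_null S.smult_r_null)
    finally show ?thesis .
  qed
  ultimately have "u \<ominus>\<^bsub>S j\<^esub> \<zero>\<^bsub>S j\<^esub> = \<zero>\<^bsub>S j\<^esub>" using a(1) by (simp add: S.smult_r_null)
  then have "u = \<zero>\<^bsub>S j\<^esub>" using S.diff_eq_zeroD u(2) by blast
  then show False using u(3) by simp
qed

text \<open>Turns the isomorphism of a factor with \<open>S i\<close> into three statements about
  elements, the form in which a composition series enters \<open>filtration\<close>.\<close>

lemma chain_factor:
  assumes M: "left_module A M" and F: "submodule F A M" "submodule F' A M" "F' \<subseteq> F" and i: "i \<in> J"
    and iso: "lmod_iso A (quot (M\<lparr>carrier := F\<rparr>) F') (S i)"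
  shows "\<lbrakk>a \<in> carrier A; chr i a = \<zero>\<^bsub>K\<^esub>; x \<in> F\<rbrakk> \<Longrightarrow> a \<odot>\<^bsub>M\<^esub> x \<in> F'"
    and "\<exists>x\<in>F. x \<notin> F'"
    and "\<lbrakk>x \<in> F; x \<notin> F'; y \<in> F\<rbrakk> \<Longrightarrow> \<exists>r\<in>carrier K. y \<ominus>\<^bsub>M\<^esub> (r \<odot> \<one>) \<odot>\<^bsub>M\<^esub> x \<in> F'"
proof -
  interpret M: left_module A M by fact
  interpret Fm: left_module A "M\<lparr>carrier := F\<rparr>" by (rule M.submodule_left_module[OF F(1)])
  have F': "submodule F' A (M\<lparr>carrier := F\<rparr>)" using F M.submodule_restrict_iff by blast
  let ?Q = "quot (M\<lparr>carrier := F\<rparr>) F'"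
  interpret Q: left_module A ?Q by (rule Fm.quot_left_module[OF F'])
  interpret Si: left_module A "S i" by (rule S_left_module[OF i])
  have FM: "F \<subseteq> carrier M" using F(1) by (simp add: M.submodule_iff)
  obtain h where h: "h \<in> lmod_hom A ?Q (S i)" "bij_betw h (carrier ?Q) (carrier (S i))"
    using iso by (auto simp: lmod_iso_def)
  have c: "F' +>\<^bsub>M\<^esub> x \<in> carrier ?Q" if "x \<in> F" for x
    using that Fm.quot_carrier[OF F'] by auto
  have sm: "a \<odot>\<^bsub>?Q\<^esub> (F' +>\<^bsub>M\<^esub> x) = F' +>\<^bsub>M\<^esub> (a \<odot>\<^bsub>M\<^esub> x)" if "a \<in> carrier A" "x \<in> F" for a x
    using Fm.quot_smult[OF F' that(1), of x] that by simp
  have z: "F' +>\<^bsub>M\<^esub> x = \<zero>\<^bsub>?Q\<^esub> \<longleftrightarrow> x \<in> F'" if "x \<in> F" for x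
    using Fm.coset_eq_zero_iff[OF F', of x] that by (simp add: quot_simps(2))
  have Fs: "a \<odot>\<^bsub>M\<^esub> x \<in> F" if "a \<in> carrier A" "x \<in> F" for a x
    using F(1) that by (simp add: M.submodule_iff)
  show "a \<odot>\<^bsub>M\<^esub> x \<in> F'" if a: "a \<in> carrier A" "chr i a = \<zero>\<^bsub>K\<^esub>" "x \<in> F"
  proof -
    have "a \<odot>\<^bsub>?Q\<^esub> (F' +>\<^bsub>M\<^esub> x) = \<zero>\<^bsub>?Q\<^esub>"
      using chr_iso_invariant[OF i Q.left_module_axioms h a(1) c[OF a(3)]] a(2) c[OF a(3)]
      by (simp add: Q.smult_l_null)
    then show ?thesis using sm[OF a(1,3)] z[OF Fs[OF a(1,3)]] by simp
  qed
  show "\<exists>x\<in>F. x \<notin> F'"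
  proof (rule ccontr)
    assume "\<not> ?thesis"
    then have "\<forall>C\<in>carrier ?Q. C = \<zero>\<^bsub>?Q\<^esub>"
      using z by (auto simp: Fm.quot_carrier[OF F'])
    moreover have "gen i \<in> h ` carrier ?Q" using h(2) idem_gen(2)[OF i] by (simp add: bij_betw_def)
    then obtain C where "C \<in> carrier ?Q" "h C = gen i" by blast
    ultimately have "gen i = \<zero>\<^bsub>S i\<^esub>"
      using lmod_hom_zero[OF Q.left_module_axioms Si.left_module_axioms h(1)] by auto
    then show False using idem_gen(3)[OF i] by simp
  qed
  show "\<exists>r\<in>carrier K. y \<ominus>\<^bsub>M\<^esub> (r \<odot> \<one>) \<odot>\<^bsub>M\<^esub> x \<in> F'" if x: "x \<in> F" "x \<notin> F'" "y \<in> F"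
  proof -
    obtain r where r: "r \<in> carrier K" "F' +>\<^bsub>M\<^esub> y = (r \<odot> \<one>) \<odot>\<^bsub>?Q\<^esub> (F' +>\<^bsub>M\<^esub> x)"
      using iso_scalar[OF i Q.left_module_axioms h c[OF x(1)] _ c[OF x(3)]] z[OF x(1)] x(2) by auto
    then have "F' +>\<^bsub>M\<^esub> y = F' +>\<^bsub>M\<^esub> ((r \<odot> \<one>) \<odot>\<^bsub>M\<^esub> x)" using sm x by simp
    then have "y \<ominus>\<^bsub>M\<lparr>carrier := F\<rparr>\<^esub> ((r \<odot> \<one>) \<odot>\<^bsub>M\<^esub> x) \<in> F'"
      using Fm.coset_eq_iff[OF F', of y "(r \<odot> \<one>) \<odot>\<^bsub>M\<^esub> x"] x Fs r by simp
    moreover have "y \<ominus>\<^bsub>M\<lparr>carrier := F\<rparr>\<^esub> u = y \<ominus>\<^bsub>M\<^esub> u" if u: "u \<in> F" for u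
    proof -
      have "\<ominus>\<^bsub>M\<lparr>carrier := F\<rparr>\<^esub> u \<in> F" using Fm.M.a_inv_closed[of u] u by simp
      moreover have "\<ominus>\<^bsub>M\<lparr>carrier := F\<rparr>\<^esub> u \<oplus>\<^bsub>M\<^esub> u = \<zero>\<^bsub>M\<^esub>" using Fm.M.l_neg[of u] u by simp
      ultimately have "\<ominus>\<^bsub>M\<^esub> u = \<ominus>\<^bsub>M\<lparr>carrier := F\<rparr>\<^esub> u" using M.M.minus_equality u FM by blast
      then show ?thesis by (simp add: a_minus_def)
    qed
    ultimately show ?thesis using r Fs x by auto
  qed
qed

end

section \<open>Radical and socle of a symmetric algebra\<close>

locale symmetric_simples = basic_simples A K J E S P \<pi>
  for A :: "('k, 'a, 'm) module_scheme" (structure) and K :: "('k, 'l) ring_scheme" (structure)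
    and J :: "'j set" and E S and P :: "'j \<Rightarrow> ('a, 'b) module" and \<pi> +
  fixes \<tau> :: "'a \<Rightarrow> 'k"
  assumes tau: "kalg.symmetrizing A K \<tau>"
begin

interpretation alg: kalg A K by (rule kalg)

lemma tau_closed: "x \<in> carrier A \<Longrightarrow> \<tau> x \<in> carrier K"
  and tau_comm: "\<lbrakk>x \<in> carrier A; y \<in> carrier A\<rbrakk> \<Longrightarrow> \<tau> (x \<otimes> y) = \<tau> (y \<otimes> x)"
  and tau_add: "\<lbrakk>x \<in> carrier A; y \<in> carrier A\<rbrakk> \<Longrightarrow> \<tau> (x \<oplus> y) = \<tau> x \<oplus>\<^bsub>K\<^esub> \<tau> y"
  and tau_smult: "\<lbrakk>c \<in> carrier K; x \<in> carrier A\<rbrakk> \<Longrightarrow> \<tau> (c \<odot> x) = c \<otimes>\<^bsub>K\<^esub> \<tau> x"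
  and tau_nondeg: "\<lbrakk>x \<in> carrier A; x \<noteq> \<zero>\<rbrakk> \<Longrightarrow> \<exists>y\<in>carrier A. \<tau> (y \<otimes> x) \<noteq> \<zero>\<^bsub>K\<^esub>"
  using tau unfolding alg.symmetrizing_def by blast+

text \<open>The Jacobson radical: the simple modules are one-dimensional, so their annihilators are
  the kernels of the characters.\<close>

definition jrad :: "'a set"
  where "jrad = {r \<in> carrier A. \<forall>i\<in>J. chr i r = \<zero>\<^bsub>K\<^esub>}"

text \<open>The socle of \<open>A\<close> as a left module over itself.\<close>

definition annih :: "'a set"
  where "annih = {x \<in> carrier A. \<forall>r\<in>jrad. r \<otimes> x = \<zero>}"

lemma jrad_closed: "r \<in> jrad \<Longrightarrow> r \<in> carrier A"
  by (simp add: jrad_def)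

lemma annih_closed: "x \<in> annih \<Longrightarrow> x \<in> carrier A"
  by (simp add: annih_def)

lemma jrad_r: "\<lbrakk>r \<in> jrad; a \<in> carrier A\<rbrakk> \<Longrightarrow> r \<otimes> a \<in> jrad"
  using chr(1) by (auto simp: jrad_def chr_mult)

lemma annih_left: "\<lbrakk>x \<in> annih; a \<in> carrier A\<rbrakk> \<Longrightarrow> a \<otimes> x \<in> annih"
  using jrad_r jrad_closed by (auto simp: annih_def A.m_assoc[symmetric])

lemma annih_minus_smult:
  assumes "x \<in> annih" "y \<in> annih" "c \<in> carrier K"
  shows "x \<ominus> c \<odot> y \<in> annih"
  using assms jrad_closed
  by (auto simp: annih_def A.minus_eq A.r_distr A.r_minus alg.smult_mult_r)

text \<open>All characters agree on \<open>a \<otimes> idem i\<close> and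
  \<open>chr i a \<odot> idem i\<close>, so the difference is in the radical and kills
  \<open>x\<close>.\<close>

lemma annih_idem:
  assumes "i \<in> J" "x \<in> annih" "idem i \<otimes> x = x" "a \<in> carrier A"
  shows "a \<otimes> x = chr i a \<odot> x"
proof -
  note e = idem_carrier[OF assms(1)] and x = annih_closed[OF assms(2)] and c = chr(1)[OF assms(1,4)]
  let ?r = "a \<otimes> idem i \<ominus> chr i a \<odot> idem i"
  have "chr k ?r = \<zero>\<^bsub>K\<^esub>" if k: "k \<in> J" for k
  proof -
    have "?r = a \<otimes> idem i \<oplus> (\<ominus>\<^bsub>K\<^esub> chr i a) \<odot> idem i"
      using e c by (simp add: A.minus_eq smult_l_minus)
    then show ?thesis
      using k assms(1,4) e c chr(1)[OF k assms(4)]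
      by (simp add: chr_add chr_mult chr_smult chr_idem K.r_neg)
  qed
  then have "?r \<in> jrad" using e c assms(4) by (simp add: jrad_def)
  then have "?r \<otimes> x = \<zero>" using assms(2) by (simp add: annih_def)
  moreover have "?r \<otimes> x = a \<otimes> x \<ominus> chr i a \<odot> x"
    using e c assms(3,4) x by (simp add: A.minus_eq A.l_distr A.l_minus alg.smult_mult_l A.m_assoc)
  ultimately show ?thesis using alg.diff_eq_zeroD x c assms(4) by (metis A.m_closed smult_closed)
qed

lemma ex_idem_component:
  assumes "x \<in> carrier A" "x \<noteq> \<zero>"
  shows "\<exists>i\<in>J. idem i \<otimes> x \<noteq> \<zero>"
proof (rule ccontr)
  assume "\<not> ?thesis"
  then have "(\<Oplus>i\<in>J. idem i \<otimes> x) = (\<Oplus>i\<in>J. \<zero>)"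
    by (intro A.finsum_cong') auto
  moreover have "(\<Oplus>i\<in>J. idem i \<otimes> x) = \<one> \<otimes> x"
    using A.finsum_ldistr[OF finite_J assms(1), of idem] idem_carrier(1) sum_idem by auto
  ultimately show False using assms by simp
qed

text \<open>By nondegeneracy of \<open>\<tau>\<close>, the annihilator of the radical in \<open>Ae\<^sub>j\<close> lies in \<open>e\<^sub>jAe\<^sub>j\<close>.\<close>

lemma annih_component:
  assumes "j \<in> J" "i \<in> J" "x \<in> annih" "x \<otimes> idem j = x" "idem i \<otimes> x \<noteq> \<zero>"
  shows "i = j" and "\<tau> (idem i \<otimes> x) \<noteq> \<zero>\<^bsub>K\<^esub>"
proof -
  note ei = idem_carrier[OF assms(2)] and ej = idem_carrier[OF assms(1)] and x = annih_closed[OF assms(3)]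
  let ?y = "idem i \<otimes> x"
  have y: "?y \<in> carrier A" "?y \<in> annih" using x ei annih_left[OF assms(3)] by auto
  have ey: "idem i \<otimes> ?y = ?y" using ei x by (simp add: A.m_assoc[symmetric])
  obtain a where a: "a \<in> carrier A" "\<tau> (a \<otimes> ?y) \<noteq> \<zero>\<^bsub>K\<^esub>" using tau_nondeg[OF y(1) assms(5)] by auto
  have "a \<otimes> ?y = chr i a \<odot> ?y" by (rule annih_idem[OF assms(2) y(2) ey a(1)])
  then show t: "\<tau> ?y \<noteq> \<zero>\<^bsub>K\<^esub>"
    using a y chr(1)[OF assms(2) a(1)] by (auto simp: tau_smult)
  \<comment> \<open>The trace property moves \<open>idem j\<close> to the left of
    \<open>idem i\<close>, where distinct idempotents give zero.\<close>
  have "?y = ?y \<otimes> idem j" using x ei ej assms(4) by (simp add: A.m_assoc)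
  then have "\<tau> ?y = \<tau> (idem j \<otimes> ?y)" using tau_comm[OF y(1) ej(1)] by simp
  also have "idem j \<otimes> ?y = (idem j \<otimes> idem i) \<otimes> x" using x ei ej by (simp add: A.m_assoc)
  finally show "i = j"
    using t idem_orth[OF assms(1,2)] x tau_smult[of "\<zero>\<^bsub>K\<^esub>" "\<zero>"] tau_closed by (cases "i = j") auto
qed

lemma annih_idem_self:
  assumes j: "j \<in> J" and x: "x \<in> annih" "x \<otimes> idem j = x"
  shows "idem j \<otimes> x = x" and "x \<noteq> \<zero> \<Longrightarrow> \<tau> x \<noteq> \<zero>\<^bsub>K\<^esub>"
proof -
  note e = idem_carrier[OF j] and xc = annih_closed[OF x(1)]
  let ?y = "x \<ominus> idem j \<otimes> x"
  have y: "?y \<in> carrier A" using e xc by simp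
  have "idem i \<otimes> ?y = \<zero>" if i: "i \<in> J" for i
  proof (cases "i = j")
    case True
    then show ?thesis using e xc by (simp add: A.minus_eq A.r_distr A.r_minus A.m_assoc[symmetric] A.r_neg)
  next
    case False
    then have "idem i \<otimes> x = \<zero>" using annih_component(1)[OF j i x] by blast
    then show ?thesis using idem_carrier(1)[OF i] e xc idem_orth[OF i j False]
      by (simp add: A.minus_eq A.r_distr A.r_minus A.m_assoc[symmetric] A.r_neg)
  qed
  then have "?y = \<zero>" using ex_idem_component[OF y] by blast
  then show ex: "idem j \<otimes> x = x" using alg.diff_eq_zeroD[of x "idem j \<otimes> x"] e xc by simp
  show "\<tau> x \<noteq> \<zero>\<^bsub>K\<^esub>" if "x \<noteq> \<zero>"
    using annih_component(2)[OF j j x] ex that by simp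
qed

text \<open>By \<open>annih_idem_self\<close> the linear form \<tau> is injective on the socle of
  \<open>Ae\<^sub>j\<close>, so the scalar is the ratio of the two values of \<tau>.\<close>

lemma annih_one_dim:
  assumes j: "j \<in> J" and x: "x \<in> annih" "x \<otimes> idem j = x" "x \<noteq> \<zero>"
    and y: "y \<in> annih" "y \<otimes> idem j = y"
  shows "\<exists>r\<in>carrier K. y = r \<odot> x"
proof -
  note xc = annih_closed[OF x(1)] and yc = annih_closed[OF y(1)] and e = idem_carrier[OF j]
  have tx: "\<tau> x \<noteq> \<zero>\<^bsub>K\<^esub>" by (rule annih_idem_self(2)[OF j x])
  define r where "r = \<tau> y \<otimes>\<^bsub>K\<^esub> inv\<^bsub>K\<^esub> (\<tau> x)"
  have inv: "inv\<^bsub>K\<^esub> (\<tau> x) \<in> carrier K" using tx tau_closed[OF xc] by (simp add: K.field_Units)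
  have r: "r \<in> carrier K" "r \<otimes>\<^bsub>K\<^esub> \<tau> x = \<tau> y"
    using tau_closed[OF xc] tau_closed[OF yc] tx inv by (auto simp: r_def K.m_assoc K.field_Units)
  let ?z = "y \<ominus> r \<odot> x"
  have z: "?z \<in> annih" by (rule annih_minus_smult[OF y(1) x(1) r(1)])
  have "?z \<otimes> idem j = ?z"
    using xc yc e r x(2) y(2) by (simp add: A.minus_eq A.l_distr A.l_minus alg.smult_mult_l)
  moreover have "\<tau> ?z = \<zero>\<^bsub>K\<^esub>"
  proof -
    have "?z = y \<oplus> (\<ominus>\<^bsub>K\<^esub> r) \<odot> x" using xc r by (simp add: A.minus_eq smult_l_minus)
    then show ?thesis using xc yc r tau_closed[OF xc] tau_closed[OF yc]
      by (simp add: tau_add tau_smult K.l_minus K.r_neg)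
  qed
  ultimately have "?z = \<zero>" using annih_idem_self(2)[OF j z] by blast
  then show ?thesis using alg.diff_eq_zeroD[of y "r \<odot> x"] xc yc r by blast
qed

end

context basic_simples
begin

lemma lmod_rad_cover:
  assumes j: "j \<in> J"
  shows "lmod_rad A (P j) = {p \<in> carrier (P j). \<pi> j p = \<zero>\<^bsub>S j\<^esub>}" (is "_ = ?k")
    and "submodule (lmod_rad A (P j)) A (P j)"
proof -
  interpret P: left_module A "P j" using cover[OF j] by (simp add: projective_cover_def fg_projective_def)
  interpret S: left_module A "S j" by (rule S_left_module[OF j])
  note h = cover_hom[OF cover[OF j] simple_S[OF j] idem_gen(2,3)[OF j] idem_carrier[OF j] idem_gen(4)[OF j]]
  note full = cover_superfluous[OF cover[OF j] simple_S[OF j] idem_gen(2,3)[OF j] idem_carrier[OF j]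
      idem_gen(4)[OF j]]
  have k: "submodule ?k A (P j)"
    using lmod_homD[OF h] lmod_hom_zero[OF P.left_module_axioms S.left_module_axioms h]
    by (intro P.submoduleI) (auto simp: S.smult_r_null intro: P.smult_closed)
  have "gen j \<in> \<pi> j ` carrier (P j)"
    using cover[OF j] idem_gen(2)[OF j] by (simp add: projective_cover_def)
  then have "?k \<noteq> carrier (P j)" using idem_gen(3)[OF j] by auto
  moreover have "N = ?k \<or> N = carrier (P j)" if N: "submodule N A (P j)" "?k \<subseteq> N" for N
  proof (cases "\<exists>x\<in>N. \<pi> j x \<noteq> \<zero>\<^bsub>S j\<^esub>")
    case True
    then show ?thesis using full[OF N(1)] by blast
  next
    case False
    then have "N \<subseteq> ?k" using N(1) unfolding P.submodule_iff by blast
    then show ?thesis using N(2) by blast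
  qed
  ultimately have mk: "maximal_submodule ?k A (P j)" using k unfolding maximal_submodule_def by blast
  have "N = ?k" if N: "maximal_submodule N A (P j)" for N
  proof -
    have sN: "submodule N A (P j)" "N \<noteq> carrier (P j)" using N by (auto simp: maximal_submodule_def)
    have "N \<subseteq> ?k"
    proof
      fix x assume x: "x \<in> N"
      then show "x \<in> ?k" using full[OF sN(1) x] sN(1,2) unfolding P.submodule_iff by blast
    qed
    then show ?thesis using N k \<open>?k \<noteq> carrier (P j)\<close> unfolding maximal_submodule_def by blast
  qed
  then show "lmod_rad A (P j) = ?k" using mk unfolding lmod_rad_def by blast
  then show "submodule (lmod_rad A (P j)) A (P j)" using k by simp
qed

end

context left_module
begin

lemma lmod_soc_submodule: "submodule (lmod_soc R M) R M"
proof -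
  have c: "carrier M \<in> {L. submodule L R M \<and>
      (\<forall>N. submodule N R M \<and> simple_lmod R (M\<lparr>carrier := N\<rparr>) \<longrightarrow> N \<subseteq> L)}"
    using submodule_carrier by (auto simp: submodule_iff)
  then have "lmod_soc R M \<subseteq> carrier M" unfolding lmod_soc_def by blast
  then show ?thesis
    by (rule submoduleI) (auto simp: lmod_soc_def submodule_iff)
qed

lemma lmod_soc_least:
  assumes "submodule L R M" "\<And>N. \<lbrakk>submodule N R M; simple_lmod R (M\<lparr>carrier := N\<rparr>)\<rbrakk> \<Longrightarrow> N \<subseteq> L"
  shows "lmod_soc R M \<subseteq> L"
  unfolding lmod_soc_def using assms by blast

lemma lmod_soc_upper: "\<lbrakk>submodule N R M; simple_lmod R (M\<lparr>carrier := N\<rparr>)\<rbrakk> \<Longrightarrow> N \<subseteq> lmod_soc R M"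
  unfolding lmod_soc_def by blast

end

section \<open>From subquotients of projective covers to chains of left ideals\<close>

context symmetric_simples
begin

interpretation alg: kalg A K by (rule kalg)

text \<open>Together with \<open>soc_part\<close>, the copy inside \<open>Ae\<^sub>j\<close> of the
  radical and the socle of \<open>P j\<close> under the isomorphism of
  \<open>projective_cover_iso\<close>.\<close>

definition rad_part :: "'j \<Rightarrow> 'a set"
  where "rad_part j = {x \<in> carrier A. x \<otimes> idem j = x \<and> chr j x = \<zero>\<^bsub>K\<^esub>}"

definition soc_part :: "'j \<Rightarrow> 'a set"
  where "soc_part j = {x \<in> annih. x \<otimes> idem j = x}"

lemma soc_part_smult_simple:
  assumes j: "j \<in> J" and M: "left_module A M" and y: "y \<in> carrier M" and s: "s \<in> soc_part j"
    and ne: "s \<odot>\<^bsub>M\<^esub> y \<noteq> \<zero>\<^bsub>M\<^esub>"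
  shows "s \<odot>\<^bsub>M\<^esub> y \<in> lmod_soc A M"
proof -
  interpret M: left_module A M by fact
  have sa: "s \<in> annih" "s \<otimes> idem j = s" using s by (auto simp: soc_part_def)
  then have sc: "s \<in> carrier A" using annih_closed by blast
  let ?t = "s \<odot>\<^bsub>M\<^esub> y"
  let ?N = "{a \<odot>\<^bsub>M\<^esub> ?t | a. a \<in> carrier A}"
  have t: "?t \<in> carrier M" using sc y by (simp add: M.smult_closed)
  have N: "submodule ?N A M" by (rule M.submodule_cyclic[OF t])
  interpret N: left_module A "M\<lparr>carrier := ?N\<rparr>" by (rule M.submodule_left_module[OF N])
  have tN: "?t \<in> ?N" using M.smult_one[OF t] by (metis (mono_tags, lifting) A.one_closed mem_Collect_eq)
  have as: "a \<otimes> s = chr j a \<odot> s" if "a \<in> carrier A" for a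
    using annih_idem[OF j sa(1) annih_idem_self(1)[OF j sa] that] .
  have at: "a \<odot>\<^bsub>M\<^esub> ?t = (chr j a \<odot> \<one>) \<odot>\<^bsub>M\<^esub> ?t" if a: "a \<in> carrier A" for a
  proof -
    have "a \<odot>\<^bsub>M\<^esub> ?t = (chr j a \<odot> s) \<odot>\<^bsub>M\<^esub> y"
      using a sc y as[OF a] by (simp add: M.smult_assoc1[symmetric])
    also have "chr j a \<odot> s = (chr j a \<odot> \<one>) \<otimes> s"
      using chr(1)[OF j a] sc by (simp add: alg.smult_one_mult)
    finally show ?thesis using chr(1)[OF j a] sc y by (simp add: M.smult_assoc1)
  qed
  have "H = {\<zero>\<^bsub>M\<^esub>} \<or> H = ?N" if H: "submodule H A M" "H \<subseteq> ?N" for H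
  proof (cases "H \<subseteq> {\<zero>\<^bsub>M\<^esub>}")
    case True
    then show ?thesis using H(1) by (auto simp: M.submodule_iff)
  next
    case False
    then obtain u where u: "u \<in> H" "u \<noteq> \<zero>\<^bsub>M\<^esub>" by auto
    then obtain a where a: "a \<in> carrier A" "u = a \<odot>\<^bsub>M\<^esub> ?t" using H(2) by auto
    let ?c = "chr j a"
    have c: "?c \<in> carrier K" "u = (?c \<odot> \<one>) \<odot>\<^bsub>M\<^esub> ?t" using chr(1)[OF j a(1)] a at by auto
    have c0: "?c \<noteq> \<zero>\<^bsub>K\<^esub>" using u(2) c(2) t by (auto simp: M.smult_l_null)
    then have i: "inv\<^bsub>K\<^esub> ?c \<in> carrier K" using c by (simp add: K.field_Units)
    have "(inv\<^bsub>K\<^esub> ?c \<odot> \<one>) \<otimes> (?c \<odot> \<one>) = \<one>"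
      using c c0 i by (simp add: alg.smult_one_mult alg.smult_inv_cancel)
    then have "(inv\<^bsub>K\<^esub> ?c \<odot> \<one>) \<odot>\<^bsub>M\<^esub> u = ?t"
      using c i t by (metis M.smult_assoc1 M.smult_one A.one_closed smult_closed)
    then have "?t \<in> H" using H(1) u(1) i unfolding M.submodule_iff by (metis A.one_closed smult_closed)
    then have "?N \<subseteq> H" using H(1) unfolding M.submodule_iff by blast
    then show ?thesis using H(2) by blast
  qed
  then have "simple_lmod A (M\<lparr>carrier := ?N\<rparr>)"
    using tN ne N.left_module_axioms M.submodule_restrict_iff[OF N]
    unfolding simple_lmod_def by auto
  then show ?thesis using M.lmod_soc_upper[OF N] tN by blast
qed

text \<open>The composite of the isomorphism of \<open>Ae\<^sub>j\<close> with \<open>P j\<close>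
  and the projection onto rad/soc, restricted to the radical. Stating its properties hides the
  generator of \<open>P j\<close> from later proofs.\<close>

definition rad_projection where
  "rad_projection j Q q \<longleftrightarrow>
    (\<forall>x\<in>rad_part j. q x \<in> carrier Q) \<and>
      (\<forall>x\<in>rad_part j. \<forall>y\<in>rad_part j. q (x \<oplus> y) = q x \<oplus>\<^bsub>Q\<^esub> q y) \<and>
      (\<forall>a\<in>carrier A. \<forall>x\<in>rad_part j. q (a \<otimes> x) = a \<odot>\<^bsub>Q\<^esub> q x) \<and>
      (\<forall>C\<in>carrier Q. \<exists>x\<in>rad_part j. q x = C) \<and>
      (\<forall>x\<in>rad_part j. q x = \<zero>\<^bsub>Q\<^esub> \<longleftrightarrow> x \<in> soc_part j)"

text \<open>For the kernel two inclusions meet: simple submodules are killed by the radical, and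
  elements of \<open>Ae\<^sub>j\<close> killed by the radical generate simple submodules of
  \<open>P j\<close>.\<close>

lemma ex_projection:
  assumes j: "j \<in> J" and soc: "lmod_soc A (P j) \<subseteq> lmod_rad A (P j)"
    and Q: "Q = quot ((P j)\<lparr>carrier := lmod_rad A (P j)\<rparr>) (lmod_soc A (P j))"
  shows "left_module A Q"
    and "soc_part j \<subseteq> rad_part j"
    and "\<exists>q. rad_projection j Q q"
proof -
  interpret P: left_module A "P j" using cover[OF j] by (simp add: projective_cover_def fg_projective_def)
  interpret S: left_module A "S j" by (rule S_left_module[OF j])
  let ?rd = "lmod_rad A (P j)" and ?sc = "lmod_soc A (P j)"
  note rad = lmod_rad_cover[OF j]
  interpret R: left_module A "(P j)\<lparr>carrier := ?rd\<rparr>" by (rule P.submodule_left_module[OF rad(2)])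
  have sc: "submodule ?sc A ((P j)\<lparr>carrier := ?rd\<rparr>)"
    using P.lmod_soc_submodule soc P.submodule_restrict_iff[OF rad(2)] by blast
  show "left_module A Q" unfolding Q by (rule R.quot_left_module[OF sc])
  note e = idem_carrier[OF j] and g = idem_gen[OF j]
  note h = cover_hom[OF cover[OF j] simple_S[OF j] g(2,3) e g(4)]
  obtain y where y: "y \<in> carrier (P j)" "idem j \<odot>\<^bsub>P j\<^esub> y = y" "\<pi> j y = gen j"
    "bij_betw (\<lambda>x. x \<odot>\<^bsub>P j\<^esub> y) (carrier (left_ideal_lmod A (idem j))) (carrier (P j))"
    using projective_cover_iso[OF cover[OF j] simple_S[OF j] g(2,3) e g(4) prim[OF g(1)]] by metis
  note Lc = A.left_ideal_carrier_iff[OF e]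
  have \<pi>: "\<pi> j (x \<odot>\<^bsub>P j\<^esub> y) = (chr j x \<odot> \<one>) \<odot>\<^bsub>S j\<^esub> gen j" if "x \<in> carrier A" for x
    using lmod_homD(3)[OF h that y(1)] y(3) chr(2)[OF j that] by simp
  have xy_rad: "x \<odot>\<^bsub>P j\<^esub> y \<in> ?rd \<longleftrightarrow> chr j x = \<zero>\<^bsub>K\<^esub>" if x: "x \<in> carrier A" for x
  proof
    assume "x \<odot>\<^bsub>P j\<^esub> y \<in> ?rd"
    then have "(chr j x \<odot> \<one>) \<odot>\<^bsub>S j\<^esub> gen j = \<zero>\<^bsub>S j\<^esub>" using \<pi>[OF x] by (simp add: rad(1))
    then show "chr j x = \<zero>\<^bsub>K\<^esub>" by (rule scalar_zero[OF S.left_module_axioms g(2,3) chr(1)[OF j x]])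
  next
    assume "chr j x = \<zero>\<^bsub>K\<^esub>"
    then have "\<pi> j (x \<odot>\<^bsub>P j\<^esub> y) = \<zero>\<^bsub>S j\<^esub>" using \<pi>[OF x] g(2) by (simp add: S.smult_l_null)
    then show "x \<odot>\<^bsub>P j\<^esub> y \<in> ?rd" using x y(1) by (simp add: rad(1) P.smult_closed)
  qed
  have soc_annih: "?sc \<subseteq> {p \<in> carrier (P j). \<forall>r\<in>jrad. r \<odot>\<^bsub>P j\<^esub> p = \<zero>\<^bsub>P j\<^esub>}"
  proof (rule P.lmod_soc_least)
    show "submodule {p \<in> carrier (P j). \<forall>r\<in>jrad. r \<odot>\<^bsub>P j\<^esub> p = \<zero>\<^bsub>P j\<^esub>} A (P j)"
      using jrad_r jrad_closed
      by (intro P.submoduleI) (auto simp: P.smult_r_null P.smult_r_distr P.smult_assoc1[symmetric] P.smult_closed)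
    fix N assume N: "submodule N A (P j)" "simple_lmod A ((P j)\<lparr>carrier := N\<rparr>)"
    show "N \<subseteq> {p \<in> carrier (P j). \<forall>r\<in>jrad. r \<odot>\<^bsub>P j\<^esub> p = \<zero>\<^bsub>P j\<^esub>}"
      using N(1) rad_kills_simple[OF N(2)] by (auto simp: P.submodule_iff jrad_def)
  qed
  have xy_soc: "x \<odot>\<^bsub>P j\<^esub> y \<in> ?sc \<longleftrightarrow> x \<in> soc_part j" if x: "x \<in> carrier A" "x \<otimes> idem j = x" for x
  proof
    assume "x \<in> soc_part j"
    then show "x \<odot>\<^bsub>P j\<^esub> y \<in> ?sc"
      using soc_part_smult_simple[OF j P.left_module_axioms y(1)] P.lmod_soc_submodule
      by (cases "x \<odot>\<^bsub>P j\<^esub> y = \<zero>\<^bsub>P j\<^esub>") (auto simp: P.submodule_iff)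
  next
    assume s: "x \<odot>\<^bsub>P j\<^esub> y \<in> ?sc"
    have "r \<otimes> x = \<zero>" if r: "r \<in> jrad" for r
    proof -
      have rc: "r \<in> carrier A" using jrad_closed[OF r] .
      have "(r \<otimes> x) \<odot>\<^bsub>P j\<^esub> y = \<zero> \<odot>\<^bsub>P j\<^esub> y"
        using s soc_annih r rc x y(1) by (auto simp: P.smult_assoc1 P.smult_l_null)
      moreover have "r \<otimes> x \<in> carrier (left_ideal_lmod A (idem j))" "\<zero> \<in> carrier (left_ideal_lmod A (idem j))"
        using rc x e Lc by (auto simp: A.m_assoc)
      ultimately show ?thesis using y(4) unfolding bij_betw_def by (auto dest: inj_onD)
    qed
    then show "x \<in> soc_part j" using x by (simp add: soc_part_def annih_def)
  qed
  show sr: "soc_part j \<subseteq> rad_part j"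
  proof
    fix x assume x: "x \<in> soc_part j"
    then have "x \<in> carrier A" "x \<otimes> idem j = x" using annih_closed by (auto simp: soc_part_def)
    then show "x \<in> rad_part j" using x xy_soc xy_rad soc by (auto simp: rad_part_def)
  qed
  let ?q = "\<lambda>x. ?sc +>\<^bsub>P j\<^esub> (x \<odot>\<^bsub>P j\<^esub> y)"
  have rp: "x \<in> carrier A" "x \<otimes> idem j = x" "x \<odot>\<^bsub>P j\<^esub> y \<in> ?rd" if "x \<in> rad_part j" for x
    using that xy_rad by (auto simp: rad_part_def)
  have "?q x \<in> carrier Q" if "x \<in> rad_part j" for x
    unfolding Q using R.quot_carrier[OF sc] rp[OF that] by auto
  moreover have "?q (x \<oplus> x') = ?q x \<oplus>\<^bsub>Q\<^esub> ?q x'" if "x \<in> rad_part j" "x' \<in> rad_part j" for x x'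
    unfolding Q using R.quot_add[OF sc, of "x \<odot>\<^bsub>P j\<^esub> y" "x' \<odot>\<^bsub>P j\<^esub> y"] rp that y(1)
    by (simp add: P.smult_l_distr)
  moreover have "?q (a \<otimes> x) = a \<odot>\<^bsub>Q\<^esub> ?q x" if "a \<in> carrier A" "x \<in> rad_part j" for a x
    unfolding Q using R.quot_smult[OF sc that(1), of "x \<odot>\<^bsub>P j\<^esub> y"] rp that y(1)
    by (simp add: P.smult_assoc1)
  moreover have "\<exists>x\<in>rad_part j. ?q x = C" if "C \<in> carrier Q" for C
  proof -
    from that obtain p where p: "p \<in> ?rd" "C = ?sc +>\<^bsub>P j\<^esub> p"
      unfolding Q R.quot_carrier[OF sc] by auto
    have "p \<in> (\<lambda>x. x \<odot>\<^bsub>P j\<^esub> y) ` carrier (left_ideal_lmod A (idem j))"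
      using p(1) rad(1) y(4) by (simp add: bij_betw_def)
    then obtain x where x: "x \<in> carrier (left_ideal_lmod A (idem j))" "p = x \<odot>\<^bsub>P j\<^esub> y" by blast
    then have "x \<in> rad_part j" using p(1) xy_rad Lc by (simp add: rad_part_def)
    then show ?thesis using x p by blast
  qed
  moreover have "?q x = \<zero>\<^bsub>Q\<^esub> \<longleftrightarrow> x \<in> soc_part j" if "x \<in> rad_part j" for x
    unfolding Q using R.coset_eq_zero_iff[OF sc, of "x \<odot>\<^bsub>P j\<^esub> y"] rp[OF that] xy_soc
    by (simp add: quot_simps(2))
  ultimately show "\<exists>q. rad_projection j Q q"
    unfolding rad_projection_def by (intro exI[of _ ?q]) blast
qed

end

context symmetric_simples
begin

interpretation alg: kalg A K by (rule kalg)

definition branch_filtrations where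
  "branch_filtrations j br v w F \<longleftrightarrow>
    (\<forall>u\<in>{v, w}. alg.filtration (idem j) (map chr (br u @ [j])) (F u) \<and>
        F u 0 \<subseteq> rad_part j \<and> F u (length (br u)) = soc_part j) \<and>
      (\<forall>x\<in>rad_part j. \<exists>a\<in>F v 0. \<exists>b\<in>F w 0. x = a \<oplus> b) \<and> F v 0 \<inter> F w 0 \<subseteq> soc_part j"

text \<open>The chains of \<open>U v\<close> and \<open>U w\<close> are pulled back along the
  projection. The preimage of zero is the socle, and one more factor, afforded by
  \<open>chr j\<close>, leads from there to zero. Uniseriality is what makes each element of
  \<open>F u 0\<close> outside \<open>F u 1\<close> a generator.\<close>

theorem ex_filtrations:
  assumes j: "j \<in> J" and soc: "lmod_soc A (P j) \<subseteq> lmod_rad A (P j)"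
    and Q: "Q = quot ((P j)\<lparr>carrier := lmod_rad A (P j)\<rparr>) (lmod_soc A (P j))"
    and Usum: "U v <+>\<^bsub>Q\<^esub> U w = carrier Q" and Uint: "U v \<inter> U w = {\<zero>\<^bsub>Q\<^esub>}"
    and U: "\<And>u. u \<in> {v, w} \<Longrightarrow> submodule (U u) A Q \<and> uniserial A (Q\<lparr>carrier := U u\<rparr>) \<and>
      factors_from_top A (Q\<lparr>carrier := U u\<rparr>) (map S (br u))"
    and br: "\<And>u. u \<in> {v, w} \<Longrightarrow> set (br u) \<subseteq> J"
  shows "\<exists>F. branch_filtrations j br v w F"
proof -
  interpret Q: left_module A Q by (rule ex_projection(1)[OF j soc Q])
  note sr = ex_projection(2)[OF j soc Q]
  note e = idem_carrier[OF j]
  obtain q where q: "rad_projection j Q q"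
    by (rule exE[OF ex_projection(3)[OF j soc Q]])
  have q_closed: "\<And>x. x \<in> rad_part j \<Longrightarrow> q x \<in> carrier Q"
    and q_add: "\<And>x y. \<lbrakk>x \<in> rad_part j; y \<in> rad_part j\<rbrakk> \<Longrightarrow> q (x \<oplus> y) = q x \<oplus>\<^bsub>Q\<^esub> q y"
    and q_smult: "\<And>a x. \<lbrakk>a \<in> carrier A; x \<in> rad_part j\<rbrakk> \<Longrightarrow> q (a \<otimes> x) = a \<odot>\<^bsub>Q\<^esub> q x"
    and q_surj: "\<And>C. C \<in> carrier Q \<Longrightarrow> \<exists>x\<in>rad_part j. q x = C"
    and q_zero: "\<And>x. x \<in> rad_part j \<Longrightarrow> q x = \<zero>\<^bsub>Q\<^esub> \<longleftrightarrow> x \<in> soc_part j"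
    using q unfolding rad_projection_def by simp_all
  have rp: "x \<in> carrier A" "x \<otimes> idem j = x" "chr j x = \<zero>\<^bsub>K\<^esub>" if "x \<in> rad_part j" for x
    using that by (auto simp: rad_part_def)
  have rp_add: "x \<oplus> y \<in> rad_part j" if "x \<in> rad_part j" "y \<in> rad_part j" for x y
    using that j e by (auto simp: rad_part_def A.l_distr chr_add)
  have rp_left: "a \<otimes> x \<in> rad_part j" if "a \<in> carrier A" "x \<in> rad_part j" for a x
    using that j e chr(1) by (auto simp: rad_part_def A.m_assoc chr_mult)
  have smult_left: "r \<odot> x = (r \<odot> \<one>) \<otimes> x" if "r \<in> carrier K" "x \<in> carrier A" for r x
    using that by (simp add: alg.smult_one_mult)
  have rp_minus: "x \<ominus> y \<in> rad_part j" "q (x \<ominus> y) = q x \<ominus>\<^bsub>Q\<^esub> q y"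
    if "x \<in> rad_part j" "y \<in> rad_part j" for x y
  proof -
    have m: "\<ominus> y = (\<ominus> \<one>) \<otimes> y" using rp(1)[OF that(2)] by (simp add: A.l_minus)
    then have "q (\<ominus> y) = \<ominus>\<^bsub>Q\<^esub> q y" and "\<ominus> y \<in> rad_part j"
      using q_smult[of "\<ominus> \<one>" y] q_closed[OF that(2)] that(2) rp_left[of "\<ominus> \<one>" y]
      by (simp_all add: Q.smult_l_minus Q.smult_one)
    then show "x \<ominus> y \<in> rad_part j" "q (x \<ominus> y) = q x \<ominus>\<^bsub>Q\<^esub> q y"
      using that rp_add q_add by (simp_all add: A.minus_eq Q.M.minus_eq)
  qed
  have Uc: "U u \<subseteq> carrier Q" if "u \<in> {v, w}" for u using U[OF that] by (simp add: Q.submodule_iff)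
  have "\<exists>G. G 0 = U u \<and> G (length (br u)) = {\<zero>\<^bsub>Q\<^esub>} \<and> (\<forall>i\<le>length (br u). submodule (G i) A Q \<and> G i \<subseteq> U u) \<and>
      (\<forall>i<length (br u). G (Suc i) \<subseteq> G i \<and> lmod_iso A (quot (Q\<lparr>carrier := G i\<rparr>) (G (Suc i))) (S (br u ! i)))"
    if u: "u \<in> {v, w}" for u
  proof -
    have sub: "submodule (U u) A Q" using U[OF u] by simp
    obtain G where G: "G 0 = carrier (Q\<lparr>carrier := U u\<rparr>)" "G (length (map S (br u))) = {\<zero>\<^bsub>Q\<lparr>carrier := U u\<rparr>\<^esub>}"
      "\<forall>i\<le>length (map S (br u)). submodule (G i) A (Q\<lparr>carrier := U u\<rparr>)"
      "\<forall>i<length (map S (br u)). G (Suc i) \<subseteq> G i \<and>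
        lmod_iso A (quot (Q\<lparr>carrier := U u, carrier := G i\<rparr>) (G (Suc i))) (map S (br u) ! i)"
      using U[OF u] unfolding factors_from_top_def by (elim conjE exE) (rule that, assumption+)
    then show ?thesis
      using Q.submodule_restrict_iff[OF sub] by (intro exI[of _ G]) auto
  qed
  then have "\<forall>u\<in>{v, w}. \<exists>G. G 0 = U u \<and> G (length (br u)) = {\<zero>\<^bsub>Q\<^esub>} \<and>
      (\<forall>i\<le>length (br u). submodule (G i) A Q \<and> G i \<subseteq> U u) \<and>
      (\<forall>i<length (br u). G (Suc i) \<subseteq> G i \<and> lmod_iso A (quot (Q\<lparr>carrier := G i\<rparr>) (G (Suc i))) (S (br u ! i)))"
    by (rule ballI)
  from bchoice[OF this] obtain G where G': "\<forall>u\<in>{v, w}. G u 0 = U u \<and> G u (length (br u)) = {\<zero>\<^bsub>Q\<^esub>} \<and>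
      (\<forall>i\<le>length (br u). submodule (G u i) A Q \<and> G u i \<subseteq> U u) \<and>
      (\<forall>i<length (br u). G u (Suc i) \<subseteq> G u i \<and>
        lmod_iso A (quot (Q\<lparr>carrier := G u i\<rparr>) (G u (Suc i))) (S (br u ! i)))"
    by (rule exE)
  have G: "\<And>u. u \<in> {v, w} \<Longrightarrow> G u 0 = U u"
    "\<And>u. u \<in> {v, w} \<Longrightarrow> G u (length (br u)) = {\<zero>\<^bsub>Q\<^esub>}"
    "\<And>u i. \<lbrakk>u \<in> {v, w}; i \<le> length (br u)\<rbrakk> \<Longrightarrow> submodule (G u i) A Q"
    "\<And>u i. \<lbrakk>u \<in> {v, w}; i < length (br u)\<rbrakk> \<Longrightarrow> G u (Suc i) \<subseteq> G u i"
    "\<And>u i. \<lbrakk>u \<in> {v, w}; i < length (br u)\<rbrakk> \<Longrightarrow>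
      lmod_iso A (quot (Q\<lparr>carrier := G u i\<rparr>) (G u (Suc i))) (S (br u ! i))"
    using G' by blast+
  \<comment> \<open>Index \<open>length (br u)\<close> gives the whole socle and only the next index
    gives zero: the chain is one step longer than that of \<open>U u\<close>.\<close>
  define F where "F u t = (if t \<le> length (br u) then {x \<in> rad_part j. q x \<in> G u t} else {\<zero>})" for u t
  have Fl: "F u (length (br u)) = soc_part j" if "u \<in> {v, w}" for u
    using G(2)[OF that] q_zero sr by (auto simp: F_def)
  have Fsub: "A.left_sub (idem j) (F u t)" if u: "u \<in> {v, w}" for u t
  proof (cases "t \<le> length (br u)")
    case True
    have q0: "q \<zero> = \<zero>\<^bsub>Q\<^esub>" "\<zero> \<in> rad_part j"
    proof -
      show z: "\<zero> \<in> rad_part j" using e chr_smult[OF j, of "\<zero>\<^bsub>K\<^esub>" "\<zero>"] chr(1)[OF j] by (simp add: rad_part_def)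
      show "q \<zero> = \<zero>\<^bsub>Q\<^esub>" using q_smult[of "\<zero>" "\<zero>"] z q_closed by (simp add: Q.smult_l_null)
    qed
    show ?thesis
      using True G(3)[OF u True] rp q0 q_add q_smult rp_add rp_left
      unfolding A.left_sub_def Q.submodule_iff F_def by (simp add: subset_iff)
  next
    case False
    then show ?thesis using e by (simp add: A.left_sub_def F_def)
  qed
  have Fc: "x \<in> carrier A" "x \<otimes> idem j = x" if "u \<in> {v, w}" "x \<in> F u t" for u t x
    using Fsub[OF that(1)] that(2) unfolding A.left_sub_def by blast+
  have Frp: "F u t \<subseteq> rad_part j" if "u \<in> {v, w}" "t \<le> length (br u)" for u t
    using that by (auto simp: F_def)
  have step: "F u (Suc t) \<subseteq> F u t" "\<exists>x\<in>F u t. x \<notin> F u (Suc t)"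
    "\<And>a x. \<lbrakk>a \<in> carrier A; chr (br u ! t) a = \<zero>\<^bsub>K\<^esub>; x \<in> F u t\<rbrakk> \<Longrightarrow> a \<otimes> x \<in> F u (Suc t)"
    "\<And>x y. \<lbrakk>x \<in> F u t; x \<notin> F u (Suc t); y \<in> F u t\<rbrakk> \<Longrightarrow> \<exists>r\<in>carrier K. y \<ominus> r \<odot> x \<in> F u (Suc t)"
    if u: "u \<in> {v, w}" and t: "t < length (br u)" for u t
  proof -
    have i: "br u ! t \<in> J" using br[OF u] t by auto
    have Ft: "F u t = {x \<in> rad_part j. q x \<in> G u t}" "F u (Suc t) = {x \<in> rad_part j. q x \<in> G u (Suc t)}"
      using t by (auto simp: F_def)
    note c = chain_factor[OF Q.left_module_axioms G(3)[OF u less_imp_le[OF t]] G(3)[OF u Suc_leI[OF t]]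
        G(4)[OF u t] i G(5)[OF u t]]
    have Gc: "G u t \<subseteq> carrier Q" using G(3)[OF u less_imp_le[OF t]] by (simp add: Q.submodule_iff)
    show "F u (Suc t) \<subseteq> F u t" unfolding Ft using G(4)[OF u t] by auto
    show "\<exists>x\<in>F u t. x \<notin> F u (Suc t)" unfolding Ft using c(2) q_surj Gc by blast
    show "a \<otimes> x \<in> F u (Suc t)" if "a \<in> carrier A" "chr (br u ! t) a = \<zero>\<^bsub>K\<^esub>" "x \<in> F u t" for a x
      using that c(1)[OF that(1,2)] rp_left q_smult unfolding Ft by simp
    show "\<exists>r\<in>carrier K. y \<ominus> r \<odot> x \<in> F u (Suc t)" if x: "x \<in> F u t" "x \<notin> F u (Suc t)" "y \<in> F u t" for x y
    proof -
      have xr: "x \<in> rad_part j" "y \<in> rad_part j" "q x \<in> G u t" "q x \<notin> G u (Suc t)" "q y \<in> G u t"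
        using x unfolding Ft by auto
      obtain r where r: "r \<in> carrier K" "q y \<ominus>\<^bsub>Q\<^esub> (r \<odot> \<one>) \<odot>\<^bsub>Q\<^esub> q x \<in> G u (Suc t)"
        using c(3)[OF xr(3-5)] by auto
      have r1: "r \<odot> \<one> \<in> carrier A" using r(1) by simp
      have "y \<ominus> (r \<odot> \<one>) \<otimes> x \<in> F u (Suc t)"
        unfolding Ft using rp_minus[OF xr(2) rp_left[OF r1 xr(1)]] q_smult[OF r1 xr(1)] r(2) by simp
      then show ?thesis using r(1) smult_left[OF r(1) rp(1)[OF xr(1)]] by (intro bexI[of _ r]) simp_all
    qed
  qed
  have soc_closed: "a \<otimes> x \<in> soc_part j" if "a \<in> carrier A" "x \<in> soc_part j" for a x
    using that annih_left annih_closed e by (auto simp: soc_part_def A.m_assoc)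
  have soc_add: "x \<oplus> y \<in> soc_part j" if "x \<in> soc_part j" "y \<in> soc_part j" for x y
    using that jrad_closed e by (auto simp: soc_part_def annih_def A.r_distr A.l_distr)
  have jrad_soc: "r \<otimes> x = \<zero>" if "r \<in> jrad" "x \<in> soc_part j" for r x
    using that by (simp add: soc_part_def annih_def)
  have jrad_step: "r \<otimes> x \<in> F u (min (Suc t) (length (br u)))"
    if r: "r \<in> jrad" and u: "u \<in> {v, w}" and x: "x \<in> F u (min t (length (br u)))" for r x u t
  proof (cases "t < length (br u)")
    case True
    then have "br u ! t \<in> J" using br[OF u] by auto
    then show ?thesis using step(3)[OF u True, of r x] r x True by (simp add: jrad_def min_def)
  next
    case False
    then show ?thesis using x soc_closed[of r x] Fl[OF u] jrad_closed[OF r] by simp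
  qed
  have rad_sum: "\<exists>a\<in>F v 0. \<exists>b\<in>F w 0. x = a \<oplus> b" if x: "x \<in> rad_part j" for x
  proof -
    have "q x \<in> U v <+>\<^bsub>Q\<^esub> U w" using Usum q_closed[OF x] by simp
    then obtain C D where CD: "C \<in> U v" "D \<in> U w" "q x = C \<oplus>\<^bsub>Q\<^esub> D" unfolding set_add_def' by auto
    then have CDQ: "C \<in> carrier Q" "D \<in> carrier Q" using Uc by auto
    obtain b where b: "b \<in> rad_part j" "q b = D" using q_surj CDQ by blast
    have "q (x \<ominus> b) = C"
      using rp_minus(2)[OF x b(1)] b(2) CD(3) CDQ by (simp add: Q.M.minus_eq Q.M.a_assoc Q.M.r_neg)
    then have "x \<ominus> b \<in> F v 0" "b \<in> F w 0"
      using rp_minus(1)[OF x b(1)] b CD G(1) by (auto simp: F_def)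
    moreover have "x = (x \<ominus> b) \<oplus> b" using rp(1) x b(1) by (simp add: alg.diff_add_cancel)
    ultimately show ?thesis by blast
  qed
  \<comment> \<open>An element outside the socle can be multiplied by a radical element without
    becoming zero. Each multiplication pushes both summands one level down their chains, so after
    finitely many steps they lie in the socle.\<close>
  have ex_soc: "\<exists>s\<in>N. s \<in> soc_part j \<and> s \<noteq> \<zero>" if N: "A.left_sub (idem j) N" "z \<in> N" "z \<noteq> \<zero>" for N z
  proof (rule ccontr)
    assume no: "\<not> ?thesis"
    have Nc: "x \<in> carrier A" "x \<otimes> idem j = x" if "x \<in> N" for x
      using N(1) that unfolding A.left_sub_def by blast+
    have Nl: "a \<otimes> x \<in> N" if "a \<in> carrier A" "x \<in> N" for a x
      using N(1) that unfolding A.left_sub_def by blast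
    have go: "\<exists>r\<in>jrad. r \<otimes> x \<noteq> \<zero>" if "x \<in> N" "x \<noteq> \<zero>" for x
      using no that Nc[OF that(1)] by (auto simp: soc_part_def annih_def)
    have "\<exists>x\<in>N. x \<noteq> \<zero> \<and> (\<exists>a\<in>F v (min k (length (br v))). \<exists>b\<in>F w (min k (length (br w))). x = a \<oplus> b)" for k
    proof (induction k)
      case 0
      obtain r where r: "r \<in> jrad" "r \<otimes> z \<noteq> \<zero>" using go[OF N(2,3)] by auto
      have "r \<otimes> z \<in> rad_part j"
        using r(1) Nc[OF N(2)] jrad_closed[OF r(1)] e chr(1)[OF j] j
        by (simp add: rad_part_def A.m_assoc chr_mult) (simp add: jrad_def)
      then show ?case using rad_sum r(2) Nl[OF jrad_closed[OF r(1)] N(2)] by auto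
    next
      case (Suc k)
      then obtain x a b where x: "x \<in> N" "x \<noteq> \<zero>" "a \<in> F v (min k (length (br v)))"
        "b \<in> F w (min k (length (br w)))" "x = a \<oplus> b" by auto
      obtain r where r: "r \<in> jrad" "r \<otimes> x \<noteq> \<zero>" using go[OF x(1,2)] by auto
      have "r \<otimes> x = r \<otimes> a \<oplus> r \<otimes> b"
      proof -
        have "a \<in> carrier A" "b \<in> carrier A" using x(3,4) Fc(1)[of v] Fc(1)[of w] by auto
        then show ?thesis using x(5) jrad_closed[OF r(1)] by (simp add: A.r_distr)
      qed
      moreover have "r \<otimes> a \<in> F v (min (Suc k) (length (br v)))"
        "r \<otimes> b \<in> F w (min (Suc k) (length (br w)))"
        using jrad_step[OF r(1)] x by auto
      ultimately show ?case using r Nl[OF jrad_closed[OF r(1)] x(1)] by blast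
    qed
    from this[of "length (br v) + length (br w)"] obtain x where x: "x \<in> N" "x \<noteq> \<zero>"
      "x \<in> soc_part j"
      using Fl soc_add by (auto simp: min_absorb2)
    then show False using no by blast
  qed
  obtain s where s: "s \<in> soc_part j" "s \<noteq> \<zero>"
  proof -
    have "A.left_sub (idem j) {x \<in> carrier A. x \<otimes> idem j = x}"
      using e by (auto simp: A.left_sub_def A.l_distr A.m_assoc)
    moreover have "idem j \<in> {x \<in> carrier A. x \<otimes> idem j = x}" using e by simp
    moreover have "idem j \<noteq> \<zero>" using prim[OF idem_gen(1)[OF j]] by (simp add: primitive_idempotent_def)
    ultimately show ?thesis using ex_soc that by blast
  qed
  have soc_dim: "\<exists>r\<in>carrier K. y = r \<odot> x" if "x \<in> soc_part j" "x \<noteq> \<zero>" "y \<in> soc_part j" for x y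
    using annih_one_dim[OF j, of x y] that by (simp add: soc_part_def)
  have soc_in: "soc_part j \<subseteq> N" if N: "A.left_sub (idem j) N" "z \<in> N" "z \<noteq> \<zero>" for N z
  proof
    fix y assume y: "y \<in> soc_part j"
    obtain x where x: "x \<in> N" "x \<in> soc_part j" "x \<noteq> \<zero>" using ex_soc[OF N] by auto
    then have xc: "x \<in> carrier A" using sr rp(1) by blast
    obtain r where r: "r \<in> carrier K" "y = r \<odot> x" using soc_dim[OF x(2,3) y] by auto
    have "y = (r \<odot> \<one>) \<otimes> x" using r(2) smult_left[OF r(1) xc] by (rule trans)
    then show "y \<in> N" using N(1) x(1) r(1) unfolding A.left_sub_def by simp
  qed
  have filt: "alg.filtration (idem j) (map chr (br u @ [j])) (F u)" if u: "u \<in> {v, w}" for u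
    unfolding alg.filtration_def
  proof (intro conjI allI impI)
    show "A.left_sub (idem j) (F u t)" for t by (rule Fsub[OF u])
    show "F u (length (map chr (br u @ [j]))) = {\<zero>}" by (simp add: F_def)
    fix t assume t: "t < length (map chr (br u @ [j]))"
    have FS: "F u (Suc (length (br u))) = {\<zero>}" by (simp add: F_def)
    have z: "\<zero> \<in> soc_part j" using Fsub[OF u, of "length (br u)"] Fl[OF u] by (simp add: A.left_sub_def)
    consider "t < length (br u)" | "t = length (br u)" using t by fastforce
    note t_cases = this
    show "F u (Suc t) \<subseteq> F u t" using t_cases step(1)[OF u] FS Fl[OF u] z by cases auto
    show "\<exists>x\<in>F u t. x \<notin> F u (Suc t)" using t_cases step(2)[OF u] FS Fl[OF u] s by cases auto
    show "\<forall>a\<in>carrier A. (map chr (br u @ [j]) ! t) a = \<zero>\<^bsub>K\<^esub> \<longrightarrow> (\<forall>x\<in>F u t. a \<otimes> x \<in> F u (Suc t))"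
      using t_cases
    proof cases
      case 1
      then show ?thesis using step(3)[OF u 1] by (simp add: nth_append)
    next
      case 2
      have "a \<otimes> x = \<zero>" if "a \<in> carrier A" "chr j a = \<zero>\<^bsub>K\<^esub>" "x \<in> soc_part j" for a x
      proof -
        have xx: "x \<in> annih" "x \<otimes> idem j = x" using that(3) by (auto simp: soc_part_def)
        then show ?thesis
          using annih_idem[OF j xx(1) annih_idem_self(1)[OF j xx] that(1)] that(2) annih_closed by simp
      qed
      then show ?thesis using 2 FS Fl[OF u] by (simp add: nth_append)
    qed
    show "\<forall>x\<in>F u t. x \<notin> F u (Suc t) \<longrightarrow> (\<forall>y\<in>F u t. \<exists>r\<in>carrier K. y \<ominus> r \<odot> x \<in> F u (Suc t))"
      using t_cases
    proof cases
      case 1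
      then show ?thesis using step(4)[OF u 1] by blast
    next
      case 2
      have "\<exists>r\<in>carrier K. y \<ominus> r \<odot> x = \<zero>" if "x \<in> soc_part j" "x \<noteq> \<zero>" "y \<in> soc_part j" for x y
        using soc_dim[OF that] rp(1) sr that(3) alg.minus_self by blast
      then show ?thesis using 2 FS Fl[OF u] by simp
    qed
  next
    show "\<forall>x\<in>F u 0. x \<notin> F u 1 \<longrightarrow> (\<forall>y\<in>F u 0. \<exists>a\<in>carrier A. y = a \<otimes> x)"
    proof (intro ballI impI)
      fix x y assume x: "x \<in> F u 0" "x \<notin> F u 1" and y: "y \<in> F u 0"
      have xc: "x \<in> carrier A" "x \<otimes> idem j = x" "x \<in> rad_part j" and yc: "y \<in> carrier A" "y \<in> rad_part j"
        using x y Fc[OF u] Frp[OF u, of 0] by auto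
      have "\<zero> \<in> F u 1" using Fsub[OF u] by (simp add: A.left_sub_def)
      then have x0: "x \<noteq> \<zero>" using x by auto
      let ?N = "{a \<otimes> x | a. a \<in> carrier A}"
      have N: "A.left_sub (idem j) ?N"
        unfolding A.left_sub_def
      proof (intro conjI ballI)
        show "\<zero> \<in> ?N" using xc by (metis (mono_tags, lifting) A.l_null A.zero_closed mem_Collect_eq)
        show "a \<oplus> b \<in> ?N" if ab: "a \<in> ?N" "b \<in> ?N" for a b
        proof -
          from ab obtain c d where "c \<in> carrier A" "d \<in> carrier A" "a = c \<otimes> x" "b = d \<otimes> x" by blast
          then show ?thesis using xc A.l_distr[of c d x] A.add.m_closed[of c d] by (metis (mono_tags, lifting) mem_Collect_eq)
        qed
        show "a \<otimes> b \<in> ?N" if ab: "a \<in> carrier A" "b \<in> ?N" for a b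
        proof -
          from ab obtain d where "d \<in> carrier A" "b = d \<otimes> x" by blast
          then show ?thesis using xc ab A.m_assoc[of a d x] A.m_closed[of a d] by (metis (mono_tags, lifting) mem_Collect_eq)
        qed
      qed (use xc e in \<open>auto simp: A.m_assoc\<close>)
      have xN: "x \<in> ?N" using xc by (metis (mono_tags, lifting) A.l_one A.one_closed mem_Collect_eq)
      have socN: "soc_part j \<subseteq> ?N" by (rule soc_in[OF N xN x0])
      have "y \<in> ?N"
      proof (cases "length (br u) = 0")
        case True
        then show ?thesis using y Fl[OF u] socN by auto
      next
        case False
        then have l: "0 < length (br u)" by simp
        obtain r where r: "r \<in> carrier K" "y \<ominus> r \<odot> x \<in> F u (Suc 0)"
          using step(4)[OF u l x(1) _ y] x(2) by auto
        let ?z = "y \<ominus> r \<odot> x"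
        have z: "?z \<in> rad_part j" "q ?z \<in> G u 1" using r(2) l by (auto simp: F_def)
        let ?H = "{a \<odot>\<^bsub>Q\<^esub> q x | a. a \<in> carrier A}"
        have xG: "q x \<in> G u 0" "q x \<notin> G u 1" using x xc l by (auto simp: F_def)
        have H: "submodule ?H A Q" by (rule Q.submodule_cyclic[OF q_closed[OF xc(3)]])
        have HU: "?H \<subseteq> U u"
          using xG(1) G(1)[OF u] G(3)[OF u, of 0] unfolding Q.submodule_iff by auto
        have GU: "G u 1 \<subseteq> U u" using G(4)[OF u l] G(1)[OF u] by simp
        \<comment> \<open>Uniseriality compares the submodule generated by \<open>q x\<close> with
          \<open>G u 1\<close>, and \<open>q x\<close> itself excludes the first inclusion. So
          \<open>q ?z\<close> is a multiple of \<open>q x\<close>, and the error left over lies in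
          the socle, which \<open>?N\<close> contains.\<close>
        have "?H \<subseteq> G u 1 \<or> G u 1 \<subseteq> ?H"
          using U[OF u] H HU GU G(3)[OF u, of 1] l Q.submodule_restrict_iff[of "U u"]
          unfolding uniserial_def by auto
        moreover have "q x \<in> ?H"
          using Q.smult_one[OF q_closed[OF xc(3)]] by (metis (mono_tags, lifting) A.one_closed mem_Collect_eq)
        ultimately have "q ?z \<in> ?H" using z(2) xG(2) by blast
        then obtain a where a: "a \<in> carrier A" "q ?z = a \<odot>\<^bsub>Q\<^esub> q x" by blast
        have ax: "a \<otimes> x \<in> rad_part j" by (rule rp_left[OF a(1) xc(3)])
        have "q (?z \<ominus> a \<otimes> x) = \<zero>\<^bsub>Q\<^esub>"
          using rp_minus(2)[OF z(1) ax] q_smult[OF a(1) xc(3)] a(2) q_closed[OF z(1)]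
          by (simp add: Q.M.minus_eq Q.M.r_neg)
        then have m1: "?z \<ominus> a \<otimes> x \<in> ?N" using q_zero[OF rp_minus(1)[OF z(1) ax]] socN by blast
        have y_eq: "y = (?z \<ominus> a \<otimes> x) \<oplus> (a \<otimes> x \<oplus> (r \<odot> \<one>) \<otimes> x)"
        proof -
          have 1: "?z \<in> carrier A" "a \<otimes> x \<in> carrier A" "r \<odot> x \<in> carrier A" using xc yc a r by auto
          have "(?z \<ominus> a \<otimes> x) \<oplus> (a \<otimes> x \<oplus> r \<odot> x) = ?z \<oplus> r \<odot> x"
            using 1 alg.diff_add_cancel[OF 1(1,2)] by (simp add: A.a_assoc[symmetric])
          also have "\<dots> = y" using 1 yc by (simp add: alg.diff_add_cancel)
          finally show ?thesis using smult_left[OF r(1) xc(1)] by simp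
        qed
        have Nadd: "b \<oplus> c \<in> ?N" if "b \<in> ?N" "c \<in> ?N" for b c
          using N that unfolding A.left_sub_def by blast
        have Nl: "b \<otimes> x \<in> ?N" if "b \<in> carrier A" for b using that by blast
        have r1: "r \<odot> \<one> \<in> carrier A" using r(1) by simp
        show ?thesis by (subst y_eq) (rule Nadd[OF m1 Nadd[OF Nl[OF a(1)] Nl[OF r1]]])
      qed
      then show "\<exists>a\<in>carrier A. y = a \<otimes> x" by blast
    qed
  qed
  have int: "F v 0 \<inter> F w 0 \<subseteq> soc_part j"
  proof
    fix x assume "x \<in> F v 0 \<inter> F w 0"
    then have x: "x \<in> rad_part j" "q x \<in> U v \<inter> U w" using G(1) by (auto simp: F_def)
    then have "q x = \<zero>\<^bsub>Q\<^esub>" unfolding Uint by simp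
    then show "x \<in> soc_part j" using q_zero x(1) by simp
  qed
  show ?thesis
    unfolding branch_filtrations_def using filt Fl Frp rad_sum int by (intro exI[of _ F]) auto
qed

end

section \<open>Arrows and paths\<close>

text \<open>The orbit of \<open>s\<close> is all of \<open>S\<close> and its first return time is
  the cardinality, so iterates only matter modulo \<open>card S\<close>.\<close>

lemma cyclic_on_funpow:
  assumes c: "cyclic_on f S" and s: "s \<in> S"
  shows "(f ^^ t) s \<in> S" and "(f ^^ card S) s = s"
    and "(f ^^ t) s = (f ^^ t') s \<longleftrightarrow> t mod card S = t' mod card S"
    and "x \<in> S \<Longrightarrow> \<exists>t<card S. x = (f ^^ t) s"
proof -
  show "(f ^^ t) s \<in> S" for t using cyclic_on_funpow_in[OF c s] .
  have orb: "orbit f s = S" using orbit_cyclic_eq3[OF c s] .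
  then have self: "s \<in> orbit f s" using s by simp
  let ?d = "funpow_dist1 f s s"
  have d: "(f ^^ ?d) s = s" by (rule funpow_dist1_prop[OF self])
  have "orbit f s = {(f ^^ m) s | m. m < ?d}"
    by (rule orbit_altdef_bounded[OF d]) simp
  then have S: "S = (\<lambda>m. (f ^^ m) s) ` {..<?d}" using orb by auto
  have inj: "inj_on (\<lambda>m. (f ^^ m) s) {..<?d}"
    using inj_on_funpow_dist1[OF self] by (simp add: lessThan_atLeast0)
  have card: "card S = ?d" by (subst S) (simp add: card_image[OF inj])
  then show "(f ^^ card S) s = s" using d by simp
  have m: "(f ^^ t) s = (f ^^ (t mod ?d)) s" for t
    using funpow_mod_eq[OF d, of t] by simp
  show "(f ^^ t) s = (f ^^ t') s \<longleftrightarrow> t mod card S = t' mod card S"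
    unfolding card using m[of t] m[of t'] inj by (auto simp: inj_on_def)
  show "\<exists>t<card S. x = (f ^^ t) s" if "x \<in> S"
    using that S card by auto
qed

text \<open>The interface to the modules; arguments inside this locale use elements of
  \<open>A\<close> only. \<open>F u j\<close> is the chain in \<open>Ae\<^sub>j\<close> belonging to
  the vertex \<open>u\<close> of \<open>j\<close>, with the socle at index
  \<open>branch_length \<Gamma> u\<close> and zero one step later. By \<open>filt_inter\<close> and
  \<open>filt_soc\<close> the two chains of an edge meet in their common last nonzero term.\<close>

locale brauer_algebra = kalg A K + brauer_tree \<Gamma> m n
  for A :: "('k, 'a, 'm) module_scheme" (structure) and K :: "('k, 'l) ring_scheme" (structure)
    and \<Gamma> :: "'v brauer_tree" and m n :: nat +
  fixes e :: "'v set \<Rightarrow> 'a" and \<chi> :: "'v set \<Rightarrow> 'a \<Rightarrow> 'k" and \<tau> :: "'a \<Rightarrow> 'k"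
    and F :: "'v \<Rightarrow> 'v set \<Rightarrow> nat \<Rightarrow> 'a set"
  assumes e_closed [simp]: "j \<in> edges \<Gamma> \<Longrightarrow> e j \<in> carrier A"
    and e_idem [simp]: "j \<in> edges \<Gamma> \<Longrightarrow> e j \<otimes> e j = e j"
    and e_orth: "\<lbrakk>i \<in> edges \<Gamma>; j \<in> edges \<Gamma>; i \<noteq> j\<rbrakk> \<Longrightarrow> e i \<otimes> e j = \<zero>"
    and finite_edges: "finite (edges \<Gamma>)"
    and e_sum: "(\<Oplus>j\<in>edges \<Gamma>. e j) = \<one>"
    and chi_closed [simp]: "\<lbrakk>j \<in> edges \<Gamma>; x \<in> carrier A\<rbrakk> \<Longrightarrow> \<chi> j x \<in> carrier K"
    and chi_add: "\<lbrakk>j \<in> edges \<Gamma>; x \<in> carrier A; y \<in> carrier A\<rbrakk> \<Longrightarrow> \<chi> j (x \<oplus> y) = \<chi> j x \<oplus>\<^bsub>K\<^esub> \<chi> j y"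
    and chi_mult: "\<lbrakk>j \<in> edges \<Gamma>; x \<in> carrier A; y \<in> carrier A\<rbrakk> \<Longrightarrow> \<chi> j (x \<otimes> y) = \<chi> j x \<otimes>\<^bsub>K\<^esub> \<chi> j y"
    and chi_smult: "\<lbrakk>j \<in> edges \<Gamma>; c \<in> carrier K; x \<in> carrier A\<rbrakk> \<Longrightarrow> \<chi> j (c \<odot> x) = c \<otimes>\<^bsub>K\<^esub> \<chi> j x"
    and chi_e: "\<lbrakk>i \<in> edges \<Gamma>; j \<in> edges \<Gamma>\<rbrakk> \<Longrightarrow> \<chi> i (e j) = (if i = j then \<one>\<^bsub>K\<^esub> else \<zero>\<^bsub>K\<^esub>)"
    and chi_one: "j \<in> edges \<Gamma> \<Longrightarrow> \<chi> j \<one> = \<one>\<^bsub>K\<^esub>"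
    and left_inverse: "\<lbrakk>x \<in> carrier A; \<And>j. j \<in> edges \<Gamma> \<Longrightarrow> \<chi> j x \<noteq> \<zero>\<^bsub>K\<^esub>\<rbrakk> \<Longrightarrow>
      \<exists>y\<in>carrier A. y \<otimes> x = \<one>"
    and tau: "symmetrizing \<tau>"
    and filt: "\<lbrakk>j \<in> edges \<Gamma>; u \<in> j\<rbrakk> \<Longrightarrow> filtration (e j) (map \<chi> (branch \<Gamma> j u @ [j])) (F u j)"
    and filt_rad: "\<lbrakk>j \<in> edges \<Gamma>; u \<in> j; x \<in> F u j 0\<rbrakk> \<Longrightarrow> \<chi> j x = \<zero>\<^bsub>K\<^esub>"
    and rad_sum: "\<lbrakk>j \<in> edges \<Gamma>; j = {u, w}; x \<in> carrier A; x \<otimes> e j = x; \<chi> j x = \<zero>\<^bsub>K\<^esub>\<rbrakk> \<Longrightarrow>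
      \<exists>a\<in>F u j 0. \<exists>b\<in>F w j 0. x = a \<oplus> b"
    and filt_inter: "\<lbrakk>j \<in> edges \<Gamma>; j = {u, w}; u \<noteq> w\<rbrakk> \<Longrightarrow>
      F u j 0 \<inter> F w j 0 \<subseteq> F u j (branch_length \<Gamma> u)"
    and filt_soc: "\<lbrakk>j \<in> edges \<Gamma>; u \<in> j; w \<in> j\<rbrakk> \<Longrightarrow>
      F u j (branch_length \<Gamma> u) = F w j (branch_length \<Gamma> w)"
begin

abbreviation rho :: "'v \<Rightarrow> 'v set \<Rightarrow> 'v set" ("\<rho>") where "\<rho> \<equiv> rotation \<Gamma>"
abbreviation val :: "'v \<Rightarrow> nat" where "val u \<equiv> card (edges_at \<Gamma> u)"

text \<open>The composition length of the preimage of \<open>U\<^sub>u\<close> in \<open>rad P\<^sub>j\<close>.\<close>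

definition len :: "'v \<Rightarrow> nat"
  where "len u = Suc (branch_length \<Gamma> u)"

lemma edge_vertices: "\<lbrakk>j \<in> edges \<Gamma>; u \<in> j\<rbrakk> \<Longrightarrow> u \<in> vertices \<Gamma>"
  using edges by fastforce

lemma edge_other:
  assumes "j \<in> edges \<Gamma>" "u \<in> j"
  obtains w where "w \<noteq> u" "j = {u, w}" "w \<in> j"
  using edges[OF assms(1)] assms(2) by (metis insertE insertI1 insert_commute singletonD)

lemma edge_at: "j \<in> edges_at \<Gamma> u \<longleftrightarrow> j \<in> edges \<Gamma> \<and> u \<in> j"
  by (simp add: edges_at_def)

lemma edge_unique: "\<lbrakk>i \<in> edges \<Gamma>; j \<in> edges \<Gamma>; u \<in> i; w \<in> i; u \<in> j; w \<in> j; u \<noteq> w\<rbrakk> \<Longrightarrow> i = j"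
  using edges[of i] edges[of j] by auto

lemma rot:
  assumes "j \<in> edges \<Gamma>" "u \<in> j"
  shows rot_edge: "(\<rho> u ^^ t) j \<in> edges \<Gamma>" and rot_vertex: "u \<in> (\<rho> u ^^ t) j"
    and rot_deg: "(\<rho> u ^^ val u) j = j"
    and rot_eq_iff: "(\<rho> u ^^ t) j = (\<rho> u ^^ t') j \<longleftrightarrow> t mod val u = t' mod val u"
    and rot_surj: "\<lbrakk>i \<in> edges \<Gamma>; u \<in> i\<rbrakk> \<Longrightarrow> \<exists>t<val u. i = (\<rho> u ^^ t) j"
  using cyclic_on_funpow[OF rotation_cyclic[OF edge_vertices[OF assms]], of j] assms
  by (auto simp: edge_at)

lemma rot_closed [simp]: "\<lbrakk>j \<in> edges \<Gamma>; u \<in> j\<rbrakk> \<Longrightarrow> \<rho> u j \<in> edges \<Gamma>" "\<lbrakk>j \<in> edges \<Gamma>; u \<in> j\<rbrakk> \<Longrightarrow> u \<in> \<rho> u j"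
  using rot_edge[of j u 1] rot_vertex[of j u 1] by auto

lemma deg_pos: "\<lbrakk>j \<in> edges \<Gamma>; u \<in> j\<rbrakk> \<Longrightarrow> 0 < val u"
  using finite_edges by (auto simp: card_gt_0_iff edges_at_def)

lemma len_eq: "\<lbrakk>j \<in> edges \<Gamma>; u \<in> j\<rbrakk> \<Longrightarrow> len u = (if u = exceptional \<Gamma> then m * val u else val u)"
  using deg_pos[of j u] multiplicity nat_0_less_mult_iff[of m "val u"]
  by (auto simp: len_def branch_length_def)

lemma len_pos: "0 < len u"
  by (simp add: len_def)

lemma rot_len: "\<lbrakk>j \<in> edges \<Gamma>; u \<in> j\<rbrakk> \<Longrightarrow> (\<rho> u ^^ len u) j = j"
  using rot_eq_iff[of j u "len u" 0] len_eq by simp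

lemma deg_le_len: "\<lbrakk>j \<in> edges \<Gamma>; u \<in> j\<rbrakk> \<Longrightarrow> val u \<le> len u"
  using len_eq[of j u] multiplicity(2) by auto

lemma rot_fixed: "\<lbrakk>j \<in> edges \<Gamma>; u \<in> j; \<rho> u j = j\<rbrakk> \<Longrightarrow> val u = 1"
  using rot_eq_iff[of j u 1 0] by simp

lemma chi_zero: "j \<in> edges \<Gamma> \<Longrightarrow> \<chi> j \<zero> = \<zero>\<^bsub>K\<^esub>"
  using chi_smult[of j "\<zero>\<^bsub>K\<^esub>" \<zero>] by simp

lemma chi_minus: "\<lbrakk>j \<in> edges \<Gamma>; x \<in> carrier A; y \<in> carrier A\<rbrakk> \<Longrightarrow> \<chi> j (x \<ominus> y) = \<chi> j x \<ominus>\<^bsub>K\<^esub> \<chi> j y"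
  using chi_add[of j x "(\<ominus>\<^bsub>K\<^esub> \<one>\<^bsub>K\<^esub>) \<odot> y"] chi_smult[of j "\<ominus>\<^bsub>K\<^esub> \<one>\<^bsub>K\<^esub>" y]
  by (simp add: smult_l_minus A.minus_eq K.minus_eq K.l_minus)

lemma chi_off:
  assumes "i \<in> edges \<Gamma>" "j \<in> edges \<Gamma>" "i \<noteq> j" "x \<in> carrier A" "x \<otimes> e j = x"
  shows "\<chi> i x = \<zero>\<^bsub>K\<^esub>"
  using chi_mult[of i x "e j"] chi_e[of i j] assms by simp

lemma length_chars: "length (map \<chi> (branch \<Gamma> j u @ [j])) = len u"
  by (simp add: len_def branch_def)

text \<open>The factor \<open>j\<close> appended for the socle continues the cyclic pattern, since
  \<open>len u\<close> is a multiple of the valency.\<close>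

lemma nth_chars:
  assumes "j \<in> edges \<Gamma>" "u \<in> j" "t < len u"
  shows "map \<chi> (branch \<Gamma> j u @ [j]) ! t = \<chi> ((\<rho> u ^^ Suc t) j)"
proof (cases "t < branch_length \<Gamma> u")
  case True
  then show ?thesis by (simp add: branch_def nth_append)
next
  case False
  then have "Suc t = len u" using assms(3) by (simp add: len_def)
  then show ?thesis using rot_len[OF assms(1,2)] False assms(3)
    by (simp add: branch_def nth_append len_def del: funpow.simps)
qed

context
  fixes j u
  assumes ju: "j \<in> edges \<Gamma>" "u \<in> j"
begin

lemma F_sub: "t \<le> len u \<Longrightarrow> A.left_sub (e j) (F u j t)"
  using filt[OF ju] unfolding filtration_def length_chars by blast

lemma F_closed: "\<lbrakk>t \<le> len u; x \<in> F u j t\<rbrakk> \<Longrightarrow> x \<in> carrier A"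
  and F_e: "\<lbrakk>t \<le> len u; x \<in> F u j t\<rbrakk> \<Longrightarrow> x \<otimes> e j = x"
  and F_zero: "t \<le> len u \<Longrightarrow> \<zero> \<in> F u j t"
  and F_add: "\<lbrakk>t \<le> len u; x \<in> F u j t; y \<in> F u j t\<rbrakk> \<Longrightarrow> x \<oplus> y \<in> F u j t"
  and F_left: "\<lbrakk>t \<le> len u; a \<in> carrier A; x \<in> F u j t\<rbrakk> \<Longrightarrow> a \<otimes> x \<in> F u j t"
  using F_sub[of t] unfolding A.left_sub_def by blast+

lemma F_smult: "\<lbrakk>t \<le> len u; c \<in> carrier K; x \<in> F u j t\<rbrakk> \<Longrightarrow> c \<odot> x \<in> F u j t"
  using F_left[of t "c \<odot> \<one>" x] F_closed[of t x] by (simp add: smult_one_mult)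

lemma F_minus: "\<lbrakk>t \<le> len u; x \<in> F u j t; y \<in> F u j t\<rbrakk> \<Longrightarrow> x \<ominus> y \<in> F u j t"
  using F_add[of t x "(\<ominus>\<^bsub>K\<^esub> \<one>\<^bsub>K\<^esub>) \<odot> y"] F_smult[of t "\<ominus>\<^bsub>K\<^esub> \<one>\<^bsub>K\<^esub>" y] F_closed[of t y]
  by (simp add: smult_l_minus A.minus_eq)

lemma F_len: "F u j (len u) = {\<zero>}"
  using filt[OF ju] unfolding filtration_def length_chars by blast

lemma F_Suc: "t < len u \<Longrightarrow> F u j (Suc t) \<subseteq> F u j t"
  using filt[OF ju] unfolding filtration_def length_chars by blast

lemma F_mono: "\<lbrakk>s \<le> t; t \<le> len u\<rbrakk> \<Longrightarrow> F u j t \<subseteq> F u j s"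
proof (induction t rule: dec_induct)
  case (step t)
  then show ?case using F_Suc[of t] by auto
qed simp

lemma F_ex: "t < len u \<Longrightarrow> \<exists>x\<in>F u j t. x \<notin> F u j (Suc t)"
  using filt[OF ju] unfolding filtration_def length_chars by blast

lemma F_kill: "\<lbrakk>t < len u; a \<in> carrier A; \<chi> ((\<rho> u ^^ Suc t) j) a = \<zero>\<^bsub>K\<^esub>; x \<in> F u j t\<rbrakk> \<Longrightarrow>
    a \<otimes> x \<in> F u j (Suc t)"
  using filt[OF ju] nth_chars[OF ju, of t] unfolding filtration_def length_chars by metis

lemma F_dim: "\<lbrakk>t < len u; x \<in> F u j t; x \<notin> F u j (Suc t); y \<in> F u j t\<rbrakk> \<Longrightarrow>
    \<exists>r\<in>carrier K. y \<ominus> r \<odot> x \<in> F u j (Suc t)"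
  using filt[OF ju] unfolding filtration_def length_chars by blast

lemma F_gen: "\<lbrakk>x \<in> F u j 0; x \<notin> F u j 1; y \<in> F u j 0\<rbrakk> \<Longrightarrow> \<exists>a\<in>carrier A. y = a \<otimes> x"
  using filt[OF ju] unfolding filtration_def length_chars by blast

lemma F_smult_mem:
  assumes "t \<le> len u" "c \<in> carrier K" "x \<in> carrier A" "x \<notin> F u j t" "c \<odot> x \<in> F u j t"
  shows "c = \<zero>\<^bsub>K\<^esub>"
proof (rule ccontr)
  assume c: "c \<noteq> \<zero>\<^bsub>K\<^esub>"
  then have "inv\<^bsub>K\<^esub> c \<odot> (c \<odot> x) \<in> F u j t"
    using assms by (intro F_smult[OF _ _ assms(5)]) (simp_all add: K.field_Units)
  then show False using smult_inv_cancel[OF assms(2) c assms(3)] assms(4) by simp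
qed

lemma e_F_step:
  assumes "t < len u" "i \<in> edges \<Gamma>" "i \<noteq> (\<rho> u ^^ Suc t) j" "x \<in> F u j t"
  shows "e i \<otimes> x \<in> F u j (Suc t)"
  using assms rot_edge[OF ju, of "Suc t"] chi_e[of "(\<rho> u ^^ Suc t) j" i] by (intro F_kill) auto

text \<open>Being idempotent, \<open>e i\<close> may be applied once per level, and at each level
  whose factor does not belong to the edge \<open>i\<close> it moves the element one step
  down.\<close>

lemma e_F_zero:
  assumes "t \<le> len u" "i \<in> edges \<Gamma>" "\<And>s. \<lbrakk>t < s; s \<le> len u\<rbrakk> \<Longrightarrow> (\<rho> u ^^ s) j \<noteq> i" "x \<in> F u j t"
  shows "e i \<otimes> x = \<zero>"
proof -
  have "e i \<otimes> x \<in> F u j s" if "t \<le> s" "s \<le> len u" for s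
    using that
  proof (induction s rule: dec_induct)
    case base
    then show ?case using F_left assms by simp
  next
    case (step s)
    then have "e i \<otimes> (e i \<otimes> x) \<in> F u j (Suc s)"
      using assms(3)[of "Suc s"] assms(2) by (intro e_F_step) auto
    moreover have "e i \<otimes> (e i \<otimes> x) = e i \<otimes> x"
      using assms(2) F_closed[OF assms(1,4)] by (simp add: A.m_assoc[symmetric])
    ultimately show ?case by simp
  qed
  from this[OF assms(1) order.refl] show ?thesis using F_len by simp
qed

lemma e_F0_zero:
  assumes "i \<in> edges \<Gamma>" "u \<notin> i" "x \<in> F u j 0"
  shows "e i \<otimes> x = \<zero>"
  using assms rot_vertex[OF ju] by (intro e_F_zero[of 0]) auto

text \<open>The top factor belongs to the next edge, whose character kills
  \<open>\<one> \<ominus> e (\<rho> u j)\<close>; an element outside \<open>F u j 1\<close> may thus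
  be replaced by its component at that edge.\<close>

lemma ex_arrow: "\<exists>a. a \<in> F u j 0 \<and> a \<notin> F u j 1 \<and> e (\<rho> u j) \<otimes> a = a"
proof -
  obtain b where b: "b \<in> F u j 0" "b \<notin> F u j (Suc 0)" using F_ex[of 0] len_pos by auto
  have bc: "b \<in> carrier A" using F_closed b(1) by blast
  let ?e = "e (\<rho> u j)"
  have ec: "?e \<in> carrier A" using ju by simp
  have "\<chi> (\<rho> u j) (\<one> \<ominus> ?e) = \<zero>\<^bsub>K\<^esub>"
    using ju ec by (simp add: chi_minus chi_e chi_one)
  then have "(\<one> \<ominus> ?e) \<otimes> b \<in> F u j (Suc 0)" using F_kill[of 0 "\<one> \<ominus> ?e" b] ec b(1) len_pos by simp
  moreover have "(\<one> \<ominus> ?e) \<otimes> b = b \<ominus> ?e \<otimes> b"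
    using bc ec by (simp add: A.minus_eq A.l_distr A.l_minus)
  ultimately have d: "b \<ominus> ?e \<otimes> b \<in> F u j (Suc 0)" by simp
  have "?e \<otimes> b \<notin> F u j 1"
  proof
    assume "?e \<otimes> b \<in> F u j 1"
    then have "(b \<ominus> ?e \<otimes> b) \<oplus> ?e \<otimes> b \<in> F u j (Suc 0)" using d F_add[OF Suc_leI[OF len_pos]] by simp
    then show False using b bc ec by (simp add: diff_add_cancel)
  qed
  moreover have "?e \<otimes> b \<in> F u j 0" using F_left[of 0] ec b by simp
  moreover have "?e \<otimes> (?e \<otimes> b) = ?e \<otimes> b" using ec bc ju by (simp add: A.m_assoc[symmetric])
  ultimately show ?thesis by blast
qed

end

primrec path :: "('v \<Rightarrow> 'v set \<Rightarrow> 'a) \<Rightarrow> 'v \<Rightarrow> 'v set \<Rightarrow> nat \<Rightarrow> 'a"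
  where "path a u j 0 = e j"
  | "path a u j (Suc t) = a u ((\<rho> u ^^ t) j) \<otimes> path a u j t"

text \<open>
  For a vertex \<open>u\<close> of valency one that is not exceptional, the arrow \<open>a u j\<close> is a loop that generates the
  socle of \<open>Ae\<^sub>j\<close>.
\<close>

definition arrow_system :: "('v \<Rightarrow> 'v set \<Rightarrow> 'a) \<Rightarrow> bool"
  where "arrow_system a \<longleftrightarrow>
    (\<forall>j\<in>edges \<Gamma>. \<forall>u\<in>j. a u j \<in> carrier A \<and> e (\<rho> u j) \<otimes> a u j = a u j \<and> a u j \<otimes> e j = a u j \<and>
      (\<forall>t<len u. path a u j (Suc t) \<in> F u j t \<and> path a u j (Suc t) \<notin> F u j (Suc t)) \<and>
      (\<forall>w\<in>\<rho> u j. w \<noteq> u \<longrightarrow> a w (\<rho> u j) \<otimes> a u j = \<zero>))"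

text \<open>The chains control multiplication from the left only. The trace property of \<tau>
  brings \<open>x\<close> to the left of \<open>s\<close>, where the last factor of the chain yields
  zero.\<close>

lemma soc_mult_rad:
  assumes i: "i \<in> edges \<Gamma>" "w \<in> i" and s: "s \<in> F w i (branch_length \<Gamma> w)" and x: "x \<in> carrier A" "\<chi> i x = \<zero>\<^bsub>K\<^esub>"
  shows "s \<otimes> x = \<zero>"
proof (rule ccontr)
  have sc: "s \<in> carrier A" using F_closed[OF i, of "branch_length \<Gamma> w" s] s by (simp add: len_def)
  assume "s \<otimes> x \<noteq> \<zero>"
  then obtain y where y: "y \<in> carrier A" "\<tau> (y \<otimes> (s \<otimes> x)) \<noteq> \<zero>\<^bsub>K\<^esub>"
    using tau sc x unfolding symmetrizing_def by (metis A.m_closed)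
  have "\<tau> (y \<otimes> (s \<otimes> x)) = \<tau> ((x \<otimes> y) \<otimes> s)"
    using tau sc x y unfolding symmetrizing_def by (metis A.m_assoc A.m_closed)
  moreover have "(x \<otimes> y) \<otimes> s \<in> F w i (Suc (branch_length \<Gamma> w))"
  proof (rule F_kill[OF i])
    have "(\<rho> w ^^ Suc (branch_length \<Gamma> w)) i = i" using rot_len[OF i] by (simp add: len_def)
    then show "\<chi> ((\<rho> w ^^ Suc (branch_length \<Gamma> w)) i) (x \<otimes> y) = \<zero>\<^bsub>K\<^esub>"
      using i x y chi_mult by simp
  qed (use s x y in \<open>auto simp: len_def\<close>)
  ultimately have "\<tau> (y \<otimes> (s \<otimes> x)) = \<tau> \<zero>" using F_len[OF i] by (simp add: len_def)
  moreover have "\<tau> (\<zero>\<^bsub>K\<^esub> \<odot> \<zero>) = \<zero>\<^bsub>K\<^esub> \<otimes>\<^bsub>K\<^esub> \<tau> \<zero>" "\<tau> \<zero> \<in> carrier K"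
    using tau unfolding symmetrizing_def by blast+
  ultimately show False using y(2) by simp
qed

text \<open>
  Arrows at different vertices multiply to zero, because the product would have to lie in a component
  \<open>e\<^sub>iAe\<^sub>j\<close> that does not meet the second filtration.
\<close>

lemma arrow_orth:
  assumes j: "j \<in> edges \<Gamma>" "u \<in> j" and w: "w \<in> \<rho> u j" "w \<noteq> u"
    and a: "a \<in> F u j 0" "e (\<rho> u j) \<otimes> a = a"
    and b: "b \<in> F w (\<rho> u j) 0" "e (\<rho> w (\<rho> u j)) \<otimes> b = b"
  shows "b \<otimes> a = \<zero>"
proof -
  let ?i = "\<rho> u j" and ?i' = "\<rho> w (\<rho> u j)"
  have i: "?i \<in> edges \<Gamma>" "u \<in> ?i" using j by auto
  have i': "?i' \<in> edges \<Gamma>" "w \<in> ?i'" using i w by auto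
  have ac: "a \<in> carrier A" "a \<otimes> e j = a" using F_closed[OF j] F_e[OF j] a by auto
  have bc: "b \<in> carrier A" using F_closed[OF i(1) w(1)] b by auto
  have ba: "b \<otimes> a \<in> F u j 0" using F_left[OF j] bc a(1) by simp
  have eba: "e ?i' \<otimes> (b \<otimes> a) = b \<otimes> a" using i' ac bc b(2) by (simp add: A.m_assoc[symmetric])
  \<comment> \<open>For \<open>len w = 1\<close> the element \<open>b\<close> lies in the socle. If
    \<open>w\<close> has several edges, the one reached there misses \<open>u\<close>. Otherwise
    \<open>w\<close> is an exceptional leaf; then \<open>u\<close> is not exceptional, and the edge
    at which the product ends occurs only once in the chain at \<open>u\<close>.\<close>
  consider "len w = 1" | "val w \<noteq> 1" | "val w = 1" "len w \<noteq> 1" by blast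
  then show ?thesis
  proof cases
    case 1
    have "\<chi> ?i a = \<zero>\<^bsub>K\<^esub>"
      using filt_rad[OF j a(1)] chi_off[OF i(1) j(1) _ ac] by (cases "?i = j") auto
    then show ?thesis using soc_mult_rad[OF i(1) w(1) _ ac(1)] b(1) 1 by (simp add: len_def)
  next
    case 2
    then have "?i' \<noteq> ?i" using rot_fixed[OF i(1) w(1)] by auto
    then have "u \<notin> ?i'" using edge_unique[OF i'(1) i(1) _ i'(2) i(2) w(1)] w(2) by blast
    then show ?thesis using e_F0_zero[OF j i'(1) _ ba] eba by simp
  next
    case 3
    then have wx: "w = exceptional \<Gamma>" using len_eq[OF i(1) w(1)] by (auto split: if_splits)
    then have lu: "len u = val u" using len_eq[OF j] w(2) by simp
    have ii: "?i' = ?i" using rot_deg[OF i(1) w(1)] 3(1) by simp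
    have ba1: "b \<otimes> a \<in> F u j (Suc 0)"
      using F_kill[OF j, of 0 b a] filt_rad[OF i(1) w(1) b(1)] bc a(1) len_pos by simp
    have ne: "(\<rho> u ^^ s) j \<noteq> ?i" if "Suc 0 < s" "s \<le> len u" for s
    proof
      assume "(\<rho> u ^^ s) j = ?i"
      then have "s mod val u = 1 mod val u" using rot_eq_iff[OF j, of s 1] by simp
      then show False using that lu by (cases "s = val u") auto
    qed
    have "e ?i \<otimes> (b \<otimes> a) = \<zero>" using e_F_zero[OF j Suc_leI[OF len_pos] i(1) ne ba1] .
    then show ?thesis using eba ii by simp
  qed
qed

text \<open>Arrows are generators of the chains. The work lies in showing that the path of length t
  + 1 generates \<open>F u j t\<close>: its left factors in the next step can be taken from the
  radical at the edge reached, that radical is generated by two arrows, and the arrow at the other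
  vertex kills the path by \<open>arrow_orth\<close>.\<close>

lemma ex_arrow_system: "\<exists>a. arrow_system a"
proof -
  have "\<forall>u j. \<exists>a. j \<in> edges \<Gamma> \<and> u \<in> j \<longrightarrow> a \<in> F u j 0 \<and> a \<notin> F u j 1 \<and> e (\<rho> u j) \<otimes> a = a"
    using ex_arrow by blast
  then obtain a where a: "\<And>u j. \<lbrakk>j \<in> edges \<Gamma>; u \<in> j\<rbrakk> \<Longrightarrow>
      a u j \<in> F u j 0 \<and> a u j \<notin> F u j 1 \<and> e (\<rho> u j) \<otimes> a u j = a u j" by metis
  have ac: "a u j \<in> carrier A" "a u j \<otimes> e j = a u j" "\<chi> j (a u j) = \<zero>\<^bsub>K\<^esub>"
    if "j \<in> edges \<Gamma>" "u \<in> j" for u j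
    using a[OF that] F_closed[OF that] F_e[OF that] filt_rad[OF that] by auto
  have orth: "a w (\<rho> u j) \<otimes> a u j = \<zero>" if "j \<in> edges \<Gamma>" "u \<in> j" "w \<in> \<rho> u j" "w \<noteq> u" for u j w
    using arrow_orth[OF that] a that by simp
  have pc: "path a u j t \<in> carrier A" "e ((\<rho> u ^^ t) j) \<otimes> path a u j t = path a u j t"
    if ju: "j \<in> edges \<Gamma>" "u \<in> j" for u j t
  proof (induction t)
    case (Suc t)
    case 1 show ?case using Suc ac(1) rot_edge[OF ju, of t] rot_vertex[OF ju, of t] by simp
    case 2 show ?case using Suc a ac(1) rot_edge[OF ju, of t] rot_vertex[OF ju, of t] by (simp add: A.m_assoc[symmetric])
  qed (use ju in simp_all)
  have gen: "path a u j (Suc t) \<in> F u j t \<and> path a u j (Suc t) \<notin> F u j (Suc t) \<and>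
      (\<forall>x\<in>F u j t. \<exists>y\<in>carrier A. x = y \<otimes> path a u j (Suc t))"
    if ju: "j \<in> edges \<Gamma>" "u \<in> j" and "t < len u" for u j t
    using that(3)
  proof (induction t)
    case 0
    have "path a u j (Suc 0) = a u j" using ac[OF ju] by simp
    then show ?case using a[OF ju] F_gen[OF ju] by simp
  next
    case (Suc t)
    let ?i = "(\<rho> u ^^ Suc t) j" and ?p = "path a u j (Suc t)"
    have i: "?i \<in> edges \<Gamma>" "u \<in> ?i" using rot_edge[OF ju, of "Suc t"] rot_vertex[OF ju, of "Suc t"] by auto
    have t: "t < len u" using Suc by simp
    have p: "?p \<in> F u j t" "?p \<notin> F u j (Suc t)" using Suc by auto
    have pcl: "?p \<in> carrier A" "e ?i \<otimes> ?p = ?p" using pc[OF ju, of "Suc t"] by auto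
    have p': "path a u j (Suc (Suc t)) = a u ?i \<otimes> ?p" by simp
    have in1: "path a u j (Suc (Suc t)) \<in> F u j (Suc t)"
      unfolding p' using F_kill[OF ju t ac(1)[OF i] ac(3)[OF i] p(1)] .
    have gen: "\<exists>y\<in>carrier A. x = y \<otimes> path a u j (Suc (Suc t))" if x: "x \<in> F u j (Suc t)" for x
    proof -
      have "x \<in> F u j t" using F_Suc[OF ju t] x by blast
      then obtain y where y: "y \<in> carrier A" "x = y \<otimes> ?p" using Suc t by auto
      \<comment> \<open>The scalar part of the left factor is split off. It vanishes, because
        \<open>c \<odot> ?p\<close> turns out to lie in \<open>F u j (Suc t)\<close> although
        \<open>?p\<close> does not.\<close>
      define c where "c = \<chi> ?i y"
      define r where "r = y \<otimes> e ?i \<ominus> c \<odot> e ?i"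
      have c: "c \<in> carrier K" using i y by (simp add: c_def del: funpow.simps)
      have ei: "e ?i \<in> carrier A" "e ?i \<otimes> e ?i = e ?i" using i by (simp_all del: funpow.simps)
      have rc: "r \<in> carrier A" "r \<otimes> e ?i = r"
        using y c ei by (simp_all add: r_def A.minus_eq A.l_distr A.l_minus A.m_assoc smult_mult_l)
      have "\<chi> ?i r = \<zero>\<^bsub>K\<^esub>"
        using y c ei i by (simp add: r_def chi_minus chi_mult chi_smult chi_e c_def del: funpow.simps)
      note chir = this
      have "r \<otimes> ?p = x \<ominus> c \<odot> ?p"
        using y c ei pcl by (simp add: r_def A.minus_eq A.l_distr A.l_minus A.m_assoc smult_mult_l del: path.simps)
      moreover have rp: "r \<otimes> ?p \<in> F u j (Suc t)" using F_kill[OF ju t rc(1) chir p(1)] .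
      ultimately have "x \<ominus> (x \<ominus> c \<odot> ?p) \<in> F u j (Suc t)"
        using F_minus[OF ju _ x rp] t by simp
      moreover have "x \<ominus> (x \<ominus> c \<odot> ?p) = c \<odot> ?p"
        using y c pcl by (simp add: A.minus_eq A.minus_add A.r_neg A.a_assoc[symmetric] del: path.simps)
      ultimately have "c = \<zero>\<^bsub>K\<^esub>" using F_smult_mem[OF ju _ c pcl(1) p(2)] t by simp
      then have "x = r \<otimes> ?p"
        using y c ei pcl by (simp add: r_def A.minus_eq A.m_assoc del: path.simps)
      obtain w where w: "w \<noteq> u" "?i = {u, w}" "w \<in> ?i" using edge_other[OF i] .
      obtain f g where fg: "f \<in> F u ?i 0" "g \<in> F w ?i 0" "r = f \<oplus> g"
        using rad_sum[OF i(1) w(2) rc chir] by auto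
      obtain y1 where y1: "y1 \<in> carrier A" "f = y1 \<otimes> a u ?i" using F_gen[OF i _ _ fg(1)] a[OF i] by auto
      obtain y2 where y2: "y2 \<in> carrier A" "g = y2 \<otimes> a w ?i"
        using F_gen[OF i(1) w(3) _ _ fg(2)] a[OF i(1) w(3)] by auto
      let ?h = "(\<rho> u ^^ t) j"
      have h: "?h \<in> edges \<Gamma>" "u \<in> ?h" using rot_edge[OF ju, of t] rot_vertex[OF ju, of t] by auto
      have "a w ?i \<otimes> ?p = (a w ?i \<otimes> a u ?h) \<otimes> path a u j t"
        using ac(1)[OF i(1) w(3)] ac(1)[OF h] pc[OF ju] by (simp add: A.m_assoc)
      also have "a w ?i \<otimes> a u ?h = \<zero>" using orth[OF h] w by simp
      finally have z: "a w ?i \<otimes> ?p = \<zero>" using pc[OF ju] by simp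
      have "x = (y1 \<otimes> a u ?i \<oplus> y2 \<otimes> a w ?i) \<otimes> ?p" using \<open>x = r \<otimes> ?p\<close> fg y1 y2 by simp
      also have "\<dots> = y1 \<otimes> (a u ?i \<otimes> ?p) \<oplus> y2 \<otimes> (a w ?i \<otimes> ?p)"
        using y1(1) y2(1) ac(1)[OF i] ac(1)[OF i(1) w(3)] pcl(1) by (simp add: A.l_distr A.m_assoc del: path.simps funpow.simps)
      also have "\<dots> = y1 \<otimes> path a u j (Suc (Suc t))"
        unfolding z p'[symmetric] using y1(1) y2(1) pc[OF ju] by (simp del: path.simps)
      finally show ?thesis using y1(1) by blast
    qed
    \<comment> \<open>Otherwise all of \<open>F u j (Suc t)\<close>, which it generates, would lie
      in the next term, but the chain is strict.\<close>
    have "path a u j (Suc (Suc t)) \<notin> F u j (Suc (Suc t))"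
    proof
      assume *: "path a u j (Suc (Suc t)) \<in> F u j (Suc (Suc t))"
      obtain x where x: "x \<in> F u j (Suc t)" "x \<notin> F u j (Suc (Suc t))" using F_ex[OF ju Suc.prems] by auto
      obtain y where "y \<in> carrier A" "x = y \<otimes> path a u j (Suc (Suc t))" using gen[OF x(1)] by auto
      then show False using F_left[OF ju _ _ *] Suc.prems x(2) by simp
    qed
    then show ?case using in1 gen by blast
  qed
  show ?thesis
    unfolding arrow_system_def using a ac orth gen by (intro exI[of _ a]) simp
qed

end

section \<open>Automorphisms from arrow systems\<close>

context kalg
begin

text \<open>The subspace of pairs spanned by \<open>B\<close>. A map is treated as a relation here
  because the paths on which it is prescribed are linearly dependent; well-definedness becomes a
  statement about pairs with first entry zero.\<close>

inductive_set psp :: "('a \<times> 'a) set \<Rightarrow> ('a \<times> 'a) set" for B :: "('a \<times> 'a) set" where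
  zero: "(\<zero>, \<zero>) \<in> psp B"
| step: "\<lbrakk>k \<in> carrier K; (b, b') \<in> B; (x, y) \<in> psp B\<rbrakk> \<Longrightarrow> (k \<odot> b \<oplus> x, k \<odot> b' \<oplus> y) \<in> psp B"

context
  fixes B
  assumes B: "B \<subseteq> carrier A \<times> carrier A"
begin

lemma psp_closed: "(x, y) \<in> psp B \<Longrightarrow> x \<in> carrier A \<and> y \<in> carrier A"
  by (induction rule: psp.induct) (use B in auto)

lemma psp_base: "(b, b') \<in> B \<Longrightarrow> (b, b') \<in> psp B"
  using psp.step[of "\<one>\<^bsub>K\<^esub>" b b' B \<zero> \<zero>] B by (auto simp: psp.zero)

lemma psp_add:
  assumes "(x, y) \<in> psp B" "(x', y') \<in> psp B"
  shows "(x \<oplus> x', y \<oplus> y') \<in> psp B"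
  using assms(1)
proof induction
  case zero
  then show ?case using psp_closed[OF assms(2)] assms(2) by simp
next
  case (step k b b' x y)
  have "b \<in> carrier A" "b' \<in> carrier A" using step(2) B by auto
  then show ?case
    using psp.step[OF step(1,2,4)] psp_closed[OF assms(2)] psp_closed[OF step(3)] step(1)
    by (simp add: A.a_assoc)
qed

lemma psp_smult:
  assumes "c \<in> carrier K" "(x, y) \<in> psp B"
  shows "(c \<odot> x, c \<odot> y) \<in> psp B"
  using assms(2)
proof induction
  case zero
  then show ?case using assms(1) by (simp add: psp.zero)
next
  case (step k b b' x y)
  have "b \<in> carrier A" "b' \<in> carrier A" using step(2) B by auto
  then show ?case
    using psp.step[OF _ step(2,4), of "c \<otimes>\<^bsub>K\<^esub> k"] psp_closed[OF step(3)] step(1) assms(1)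
    by (simp add: smult_r_distr smult_assoc1)
qed

lemma psp_minus:
  assumes "(x, y) \<in> psp B" "(x', y') \<in> psp B"
  shows "(x \<ominus> x', y \<ominus> y') \<in> psp B"
  using psp_add[OF assms(1) psp_smult[OF _ assms(2), of "\<ominus>\<^bsub>K\<^esub> \<one>\<^bsub>K\<^esub>"]] psp_closed[OF assms(2)]
  by (simp add: smult_l_minus A.minus_eq)

lemma psp_subset: "C \<subseteq> psp B \<Longrightarrow> psp C \<subseteq> psp B"
proof -
  assume C: "C \<subseteq> psp B"
  have "(x, y) \<in> psp B" if "(x, y) \<in> psp C" for x y
    using that by induction (use C in \<open>auto intro: psp.zero psp_add psp_smult\<close>)
  then show ?thesis by auto
qed

lemma psp_mult_right:
  assumes c: "c \<in> carrier A" "c' \<in> carrier A"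
    and C: "C \<subseteq> carrier A \<times> carrier A" and bc: "\<And>b b'. (b, b') \<in> C \<Longrightarrow> (b \<otimes> c, b' \<otimes> c') \<in> psp B"
    and "(x, y) \<in> psp C"
  shows "(x \<otimes> c, y \<otimes> c') \<in> psp B"
  using assms(5)
proof induction
  case zero
  then show ?case using c by (simp add: psp.zero)
next
  case (step k b b' x y)
  have "b \<in> carrier A" "b' \<in> carrier A" using step(2) C by auto
  moreover have "x \<in> carrier A" "y \<in> carrier A"
    using kalg.psp_closed[OF kalg_axioms C step(3)] by auto
  ultimately show ?case
    using psp_add[OF psp_smult[OF step(1) bc[OF step(2)]] step(4)] c step(1)
    by (simp add: A.l_distr smult_mult_l)
qed

lemma psp_mult_left:
  assumes c: "c \<in> carrier A" "c' \<in> carrier A"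
    and C: "C \<subseteq> carrier A \<times> carrier A" and bc: "\<And>b b'. (b, b') \<in> C \<Longrightarrow> (c \<otimes> b, c' \<otimes> b') \<in> psp B"
    and "(x, y) \<in> psp C"
  shows "(c \<otimes> x, c' \<otimes> y) \<in> psp B"
  using assms(5)
proof induction
  case zero
  then show ?case using c by (simp add: psp.zero)
next
  case (step k b b' x y)
  have "b \<in> carrier A" "b' \<in> carrier A" using step(2) C by auto
  moreover have "x \<in> carrier A" "y \<in> carrier A"
    using kalg.psp_closed[OF kalg_axioms C step(3)] by auto
  ultimately show ?case
    using psp_add[OF psp_smult[OF step(1) bc[OF step(2)]] step(4)] c step(1)
    by (simp add: A.r_distr smult_mult_r)
qed

lemma psp_mult:
  assumes BB: "\<And>b b' c c'. \<lbrakk>(b, b') \<in> B; (c, c') \<in> B\<rbrakk> \<Longrightarrow> (b \<otimes> c, b' \<otimes> c') \<in> psp B"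
    and "(x, x') \<in> psp B" "(y, y') \<in> psp B"
  shows "(x \<otimes> y, x' \<otimes> y') \<in> psp B"
proof (rule psp_mult_left[OF _ _ B _ assms(3)])
  show "x \<in> carrier A" "x' \<in> carrier A" using psp_closed[OF assms(2)] by auto
  fix b b' assume b: "(b, b') \<in> B"
  show "(x \<otimes> b, x' \<otimes> b') \<in> psp B"
    by (rule psp_mult_right[OF _ _ B _ assms(2)]) (use b B BB in auto)
qed

end

lemma psp_converse: "(x, y) \<in> psp B \<Longrightarrow> (y, x) \<in> psp (B\<inverse>)"
  by (induction rule: psp.induct) (auto intro: psp.intros)

lemma psp_insertE:
  assumes B: "insert (b, b') B \<subseteq> carrier A \<times> carrier A" and "(x, y) \<in> psp (insert (b, b') B)"
  obtains k x' y' where "k \<in> carrier K" "(x', y') \<in> psp B" "x = k \<odot> b \<oplus> x'" "y = k \<odot> b' \<oplus> y'"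
proof -
  have B': "B \<subseteq> carrier A \<times> carrier A" and b: "b \<in> carrier A" "b' \<in> carrier A" using B by auto
  have "\<exists>k\<in>carrier K. \<exists>(x', y')\<in>psp B. x = k \<odot> b \<oplus> x' \<and> y = k \<odot> b' \<oplus> y'"
    using assms(2)
  proof induction
    case zero
    show ?case using b by (intro bexI[of _ "\<zero>\<^bsub>K\<^esub>"] bexI[of _ "(\<zero>, \<zero>)"]) (auto intro: psp.zero)
  next
    case (step c d d' x y)
    then obtain k x' y' where k: "k \<in> carrier K" "(x', y') \<in> psp B" "x = k \<odot> b \<oplus> x'" "y = k \<odot> b' \<oplus> y'"
      by auto
    have xy: "x' \<in> carrier A" "y' \<in> carrier A" using psp_closed[OF B' k(2)] by auto
    show ?case
    proof (cases "(d, d') = (b, b')")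
      case True
      then show ?thesis using k b xy step(1)
        by (intro bexI[of _ "c \<oplus>\<^bsub>K\<^esub> k"] bexI[of _ "(x', y')"]) (auto simp: smult_l_distr A.a_assoc)
    next
      case False
      then have d: "(d, d') \<in> B" using step(2) by auto
      then have "d \<in> carrier A" "d' \<in> carrier A" using B' by auto
      then show ?thesis using k b xy step(1) psp.step[OF step(1) d k(2)]
        by (intro bexI[of _ k] bexI[of _ "(c \<odot> d \<oplus> x', c \<odot> d' \<oplus> y')"]) (auto simp: A.a_lcomm)
    qed
  qed
  then show ?thesis using that by blast
qed

lemma psp_UnE:
  assumes B: "B \<union> C \<subseteq> carrier A \<times> carrier A" and "(x, y) \<in> psp (B \<union> C)"
  obtains x1 y1 x2 y2 where "(x1, y1) \<in> psp B" "(x2, y2) \<in> psp C" "x = x1 \<oplus> x2" "y = y1 \<oplus> y2"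
proof -
  have BC: "B \<subseteq> carrier A \<times> carrier A" "C \<subseteq> carrier A \<times> carrier A" using B by auto
  have "\<exists>x1 y1 x2 y2. (x1, y1) \<in> psp B \<and> (x2, y2) \<in> psp C \<and> x = x1 \<oplus> x2 \<and> y = y1 \<oplus> y2"
    using assms(2)
  proof induction
    case zero
    show ?case by (intro exI[of _ \<zero>]) (auto intro: psp.zero)
  next
    case (step k d d' x y)
    then obtain x1 y1 x2 y2 where s: "(x1, y1) \<in> psp B" "(x2, y2) \<in> psp C" "x = x1 \<oplus> x2" "y = y1 \<oplus> y2"
      by auto
    have c: "x1 \<in> carrier A" "y1 \<in> carrier A" "x2 \<in> carrier A" "y2 \<in> carrier A"
      using psp_closed[OF BC(1) s(1)] psp_closed[OF BC(2) s(2)] by auto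
    have d: "d \<in> carrier A" "d' \<in> carrier A" using step(2) B by auto
    consider "(d, d') \<in> B" | "(d, d') \<in> C" using step(2) by auto
    then show ?case
    proof cases
      case 1
      then show ?thesis using psp.step[OF step(1) 1 s(1)] s c d step(1)
        by (intro exI[of _ "k \<odot> d \<oplus> x1"] exI[of _ "k \<odot> d' \<oplus> y1"] exI[of _ x2] exI[of _ y2])
          (simp add: A.a_assoc)
    next
      case 2
      then show ?thesis using psp.step[OF step(1) 2 s(2)] s c d step(1)
        by (intro exI[of _ x1] exI[of _ y1] exI[of _ "k \<odot> d \<oplus> x2"] exI[of _ "k \<odot> d' \<oplus> y2"])
          (simp add: A.a_lcomm)
    qed
  qed
  then show ?thesis using that by blast
qed

text \<open>A linear relation that is multiplicative and single-valued in both directions is an automorphism.\<close>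

lemma psp_automorphism:
  assumes B: "B \<subseteq> carrier A \<times> carrier A"
    and mult: "\<And>b b' c c'. \<lbrakk>(b, b') \<in> B; (c, c') \<in> B\<rbrakk> \<Longrightarrow> (b \<otimes> c, b' \<otimes> c') \<in> psp B"
    and total: "\<And>x. x \<in> carrier A \<Longrightarrow> \<exists>y. (x, y) \<in> psp B"
      "\<And>y. y \<in> carrier A \<Longrightarrow> \<exists>x. (x, y) \<in> psp B"
    and single: "\<And>y. (\<zero>, y) \<in> psp B \<Longrightarrow> y = \<zero>" "\<And>x. (x, \<zero>) \<in> psp B \<Longrightarrow> x = \<zero>"
    and one: "(\<one>, \<one>) \<in> psp B"
  shows "\<exists>\<phi>\<in>alg_auts K A. \<forall>(b, b')\<in>psp B. \<phi> b = b'"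
proof -
  have uniq: "y = y'" if "(x, y) \<in> psp B" "(x, y') \<in> psp B" for x y y'
    using psp_minus[OF B that] single(1)[of "y \<ominus> y'"] psp_closed[OF B] that minus_self diff_eq_zeroD
    by metis
  have uniq': "x = x'" if "(x, y) \<in> psp B" "(x', y) \<in> psp B" for x x' y
    using psp_minus[OF B that] single(2)[of "x \<ominus> x'"] psp_closed[OF B] that minus_self diff_eq_zeroD
    by metis
  define \<phi> where "\<phi> = (\<lambda>x\<in>carrier A. THE y. (x, y) \<in> psp B)"
  have \<phi>: "\<phi> x = y" if "(x, y) \<in> psp B" for x y
    using that uniq psp_closed[OF B that] by (auto simp: \<phi>_def intro!: the_equality)
  have \<phi>p: "(x, \<phi> x) \<in> psp B" if "x \<in> carrier A" for x
    using total(1)[OF that] \<phi> by metis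
  have "bij_betw \<phi> (carrier A) (carrier A)"
    unfolding bij_betw_def
  proof
    show "inj_on \<phi> (carrier A)" using \<phi>p uniq' by (metis inj_onI)
    show "\<phi> ` carrier A = carrier A"
    proof
      show "\<phi> ` carrier A \<subseteq> carrier A" using \<phi>p psp_closed[OF B] by blast
      show "carrier A \<subseteq> \<phi> ` carrier A"
      proof
        fix y assume "y \<in> carrier A"
        then obtain x where x: "(x, y) \<in> psp B" using total(2) by blast
        then show "y \<in> \<phi> ` carrier A" using \<phi>[OF x] psp_closed[OF B x] by blast
      qed
    qed
  qed
  moreover have "\<phi> (x \<otimes> y) = \<phi> x \<otimes> \<phi> y" "\<phi> (x \<oplus> y) = \<phi> x \<oplus> \<phi> y" if "x \<in> carrier A" "y \<in> carrier A" for x y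
    using psp_mult[OF B mult \<phi>p[OF that(1)] \<phi>p[OF that(2)]] psp_add[OF B \<phi>p[OF that(1)] \<phi>p[OF that(2)]] \<phi>
    by auto
  moreover have "\<phi> (c \<odot> x) = c \<odot> \<phi> x" if "c \<in> carrier K" "x \<in> carrier A" for c x
    using psp_smult[OF B that(1) \<phi>p[OF that(2)]] \<phi> by simp
  moreover have "\<phi> x \<in> carrier A" if "x \<in> carrier A" for x using \<phi>p[OF that] psp_closed[OF B] by blast
  moreover have "\<phi> \<one> = \<one>" using \<phi>[OF one] .
  moreover have "\<phi> \<in> extensional (carrier A)" by (simp add: \<phi>_def)
  ultimately have "\<phi> \<in> alg_auts K A"
    by (auto simp: alg_auts_def ring_hom_def Bij_def)
  then show ?thesis using \<phi> by (intro bexI[of _ \<phi>]) auto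
qed

end

section \<open>Multiplication of paths and comparison of two arrow systems\<close>

context brauer_algebra
begin

context
  fixes a
  assumes as: "arrow_system a"
begin

lemma arrow:
  assumes "j \<in> edges \<Gamma>" "u \<in> j"
  shows arrow_closed: "a u j \<in> carrier A"
    and arrow_e_left: "e (\<rho> u j) \<otimes> a u j = a u j"
    and arrow_e_right: "a u j \<otimes> e j = a u j"
  using as assms unfolding arrow_system_def by auto

lemma arrow_mult_zero: "\<lbrakk>j \<in> edges \<Gamma>; u \<in> j; w \<in> \<rho> u j; w \<noteq> u\<rbrakk> \<Longrightarrow> a w (\<rho> u j) \<otimes> a u j = \<zero>"
  using as unfolding arrow_system_def by auto

lemma path_mem: "\<lbrakk>j \<in> edges \<Gamma>; u \<in> j; t < len u\<rbrakk> \<Longrightarrow> path a u j (Suc t) \<in> F u j t"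
  and path_notin: "\<lbrakk>j \<in> edges \<Gamma>; u \<in> j; t < len u\<rbrakk> \<Longrightarrow> path a u j (Suc t) \<notin> F u j (Suc t)"
  using as unfolding arrow_system_def by blast+

lemma path_1: "\<lbrakk>j \<in> edges \<Gamma>; u \<in> j\<rbrakk> \<Longrightarrow> path a u j (Suc 0) = a u j"
  using arrow by simp

lemma arrow_mem: "\<lbrakk>j \<in> edges \<Gamma>; u \<in> j\<rbrakk> \<Longrightarrow> a u j \<in> F u j 0"
  using path_mem[of j u 0] path_1 len_pos by simp

lemma chi_arrow: "\<lbrakk>i \<in> edges \<Gamma>; j \<in> edges \<Gamma>; u \<in> j\<rbrakk> \<Longrightarrow> \<chi> i (a u j) = \<zero>\<^bsub>K\<^esub>"
  using filt_rad[of j u "a u j"] arrow_mem[of j u] chi_off[of i j "a u j"] arrow[of j u]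
  by (cases "i = j") auto

lemma path:
  assumes "j \<in> edges \<Gamma>" "u \<in> j"
  shows path_closed: "path a u j t \<in> carrier A"
    and path_e_left: "e ((\<rho> u ^^ t) j) \<otimes> path a u j t = path a u j t"
    and path_e_right: "path a u j t \<otimes> e j = path a u j t"
proof (induction t)
  case (Suc t)
  note r = rot_edge[OF assms, of t] rot_vertex[OF assms, of t]
  case 1 show ?case using Suc arrow(1)[OF r] by simp
  case 2 show ?case using Suc arrow[OF r] r by (simp add: A.m_assoc[symmetric])
  case 3 show ?case using Suc arrow[OF r] r assms by (simp add: A.m_assoc)
qed (use assms in simp_all)

lemma path_comp:
  assumes "j \<in> edges \<Gamma>" "u \<in> j"
  shows "path a u ((\<rho> u ^^ s) j) t \<otimes> path a u j s = path a u j (s + t)"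
proof (induction t)
  case 0
  then show ?case using path_e_left[OF assms] by simp
next
  case (Suc t)
  note r = rot_edge[OF assms, of s] rot_vertex[OF assms, of s]
  note r' = rot_edge[OF assms, of "s + t"] rot_vertex[OF assms, of "s + t"]
  have "(\<rho> u ^^ t) ((\<rho> u ^^ s) j) = (\<rho> u ^^ (s + t)) j" by (metis add.commute comp_apply funpow_add)
  then show ?case
    using Suc arrow(1)[OF r'] path_closed[OF r] path_closed[OF assms] by (simp add: A.m_assoc)
qed

text \<open>The path of length \<open>len u\<close> lies in the socle, which every further arrow
  kills.\<close>

lemma path_beyond:
  assumes "j \<in> edges \<Gamma>" "u \<in> j" "len u < t"
  shows "path a u j t = \<zero>"
proof -
  obtain l where l: "len u = Suc l" by (simp add: len_def)
  have p: "path a u j (Suc l) \<in> F u j l" using path_mem[OF assms(1,2)] l by simp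
  note r = rot_edge[OF assms(1,2), of "Suc l"] rot_vertex[OF assms(1,2), of "Suc l"]
  have "path a u j (Suc (Suc l)) \<in> F u j (Suc l)"
    unfolding path.simps(2)[of a u j "Suc l"]
    by (rule F_kill[OF assms(1,2) _ arrow(1)[OF r] chi_arrow[OF r(1) r] p]) (simp add: l)
  then have z: "path a u j (Suc (len u)) = \<zero>" using F_len[OF assms(1,2)] l by simp
  obtain s where "t = Suc (len u) + s" using assms(3) less_iff_Suc_add by auto
  then have "path a u j t = path a u ((\<rho> u ^^ Suc (len u)) j) s \<otimes> path a u j (Suc (len u))"
    using path_comp[OF assms(1,2)] by metis
  moreover have "path a u ((\<rho> u ^^ Suc (len u)) j) s \<in> carrier A"
    by (rule path_closed[OF rot_edge[OF assms(1,2)] rot_vertex[OF assms(1,2)]])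
  ultimately show ?thesis unfolding z by (simp del: funpow.simps)
qed

lemma path_orth:
  assumes j: "j \<in> edges \<Gamma>" "u \<in> j" and w: "w \<in> (\<rho> u ^^ s) j" "w \<noteq> u" and "0 < s" "0 < t"
  shows "path a w ((\<rho> u ^^ s) j) t \<otimes> path a u j s = \<zero>"
proof -
  obtain s' t' where st: "s = Suc s'" "t = Suc t'" using assms by (metis gr0_implies_Suc)
  let ?i = "(\<rho> u ^^ s) j" and ?h = "(\<rho> u ^^ s') j"
  note h = rot_edge[OF j, of s'] rot_vertex[OF j, of s']
  have i: "?i \<in> edges \<Gamma>" using rot_edge[OF j] .
  have ih: "?i = \<rho> u ?h" using st by simp
  note r = rot_edge[OF i w(1), of 1] rot_vertex[OF i w(1), of 1]
  have "path a w ?i t = path a w ((\<rho> w ^^ 1) ?i) t' \<otimes> path a w ?i 1"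
    using path_comp[OF i w(1), of 1 t'] st by simp
  moreover have "path a w ?i 1 = a w ?i" using path_1[OF i w(1)] by simp
  moreover have "path a u j s = a u ?h \<otimes> path a u j s'" using st by simp
  ultimately have "path a w ?i t \<otimes> path a u j s =
      path a w ((\<rho> w ^^ 1) ?i) t' \<otimes> a w ?i \<otimes> (a u ?h \<otimes> path a u j s')"
    by simp
  also have "\<dots> = path a w ((\<rho> w ^^ 1) ?i) t' \<otimes> ((a w ?i \<otimes> a u ?h) \<otimes> path a u j s')"
    using arrow(1)[OF i w(1)] arrow(1)[OF h] path_closed[OF j, of s'] path_closed[OF r, of t']
    by (simp add: A.m_assoc del: funpow.simps)
  also have "a w ?i \<otimes> a u ?h = \<zero>" using arrow_mult_zero[OF h] w ih by metis
  finally show ?thesis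
    using path_closed[OF j, of s'] path_closed[OF r, of t'] by simp
qed

lemma F_decomp:
  assumes j: "j \<in> edges \<Gamma>" "u \<in> j" and t: "t < len u" "x \<in> F u j t"
  obtains r x' where "r \<in> carrier K" "x' \<in> F u j (Suc t)" "x = r \<odot> path a u j (Suc t) \<oplus> x'"
proof -
  obtain r where r: "r \<in> carrier K" "x \<ominus> r \<odot> path a u j (Suc t) \<in> F u j (Suc t)"
    using F_dim[OF j t(1) path_mem[OF j t(1)] path_notin[OF j t(1)] t(2)] by auto
  have p: "r \<odot> path a u j (Suc t) \<in> carrier A" using path_closed[OF j] r(1) by (simp del: path.simps)
  have x: "x \<in> carrier A" by (rule F_closed[OF j less_imp_le[OF t(1)] t(2)])
  show ?thesis
    using that[OF r] diff_add_cancel[OF x p] A.a_comm[of "r \<odot> path a u j (Suc t)"] p x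
    by (metis A.minus_closed)
qed

end

lemma sum_comp: "x \<in> carrier A \<Longrightarrow> (\<Oplus>j\<in>edges \<Gamma>. x \<otimes> e j) = x"
  using A.finsum_rdistr[OF finite_edges, of x e] e_sum by (simp add: Pi_iff)

lemma zero_if_comp_zero:
  assumes "x \<in> carrier A" "\<And>j. j \<in> edges \<Gamma> \<Longrightarrow> x \<otimes> e j = \<zero>"
  shows "x = \<zero>"
proof -
  have "(\<Oplus>j\<in>edges \<Gamma>. x \<otimes> e j) = (\<Oplus>j\<in>edges \<Gamma>. \<zero>)"
    using assms by (intro A.finsum_cong') auto
  then show ?thesis using sum_comp[OF assms(1)] by simp
qed

text \<open>The path of length \<open>t\<close> lies in \<open>F u j (t - 1)\<close>, hence the
  strict inequality: the first entries span \<open>F u j s\<close>, and the idempotent is left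
  out.\<close>

definition gens where
  "gens a a' j u s = {(path a u j t, path a' u j t) | t. s < t \<and> t \<le> len u}"

definition gens_all where
  "gens_all a a' = {(path a u j t, path a' u j t) | u j t. j \<in> edges \<Gamma> \<and> u \<in> j \<and> t \<le> len u}"

lemma gens_all_converse: "(gens_all a a')\<inverse> = gens_all a' a"
  by (auto simp: gens_all_def)

context
  fixes a a'
  assumes as: "arrow_system a" and as': "arrow_system a'"
begin

lemma gens_closed: "\<lbrakk>j \<in> edges \<Gamma>; u \<in> j\<rbrakk> \<Longrightarrow> gens a a' j u s \<subseteq> carrier A \<times> carrier A"
  using path_closed[OF as] path_closed[OF as'] by (auto simp: gens_def)

lemma gens_all_closed: "gens_all a a' \<subseteq> carrier A \<times> carrier A"
  using path_closed[OF as] path_closed[OF as'] by (auto simp: gens_all_def)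

lemma gens_insert: "s < len u \<Longrightarrow>
    gens a a' j u s = insert (path a u j (Suc s), path a' u j (Suc s)) (gens a a' j u (Suc s))"
proof -
  assume "s < len u"
  then have "s < t \<and> t \<le> len u \<longleftrightarrow> t = Suc s \<or> Suc s < t \<and> t \<le> len u" for t by auto
  then show ?thesis unfolding gens_def by (auto simp del: path.simps)
qed

lemma gens_F:
  assumes "j \<in> edges \<Gamma>" "u \<in> j" "(x, y) \<in> psp (gens a a' j u s)" "s \<le> len u"
  shows "x \<in> F u j s" "y \<in> F u j s"
proof -
  have mem: "b \<in> F u j s \<and> b' \<in> F u j s" if "(b, b') \<in> gens a a' j u s" for b b'
  proof -
    obtain t where t: "s < t" "t \<le> len u" "b = path a u j t" "b' = path a' u j t"
      using \<open>(b, b') \<in> _\<close> by (auto simp: gens_def)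
    then obtain t' where t': "t = Suc t'" by (metis gr0_implies_Suc gr_implies_not0 neq0_conv)
    have "F u j t' \<subseteq> F u j s" using F_mono[OF assms(1,2), of s t'] t t' by simp
    then show ?thesis
      using t t' path_mem[OF as assms(1,2), of t'] path_mem[OF as' assms(1,2), of t'] by auto
  qed
  have "x \<in> F u j s \<and> y \<in> F u j s"
    using assms(3)
    by induction (use F_zero[OF assms(1,2,4)] F_add[OF assms(1,2,4)] F_smult[OF assms(1,2,4)] mem in auto)
  then show "x \<in> F u j s" "y \<in> F u j s" by auto
qed

lemma gens_total:
  assumes j: "j \<in> edges \<Gamma>" "u \<in> j" and "s \<le> len u" "x \<in> F u j s"
  shows "\<exists>y. (x, y) \<in> psp (gens a a' j u s)"
  using assms(3,4)
proof (induction s arbitrary: x rule: inc_induct)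
  case base
  then show ?case using F_len[OF j] psp.zero by auto
next
  case (step s)
  obtain r x' where r: "r \<in> carrier K" "x' \<in> F u j (Suc s)" "x = r \<odot> path a u j (Suc s) \<oplus> x'"
    using F_decomp[OF as j _ step.prems] step by auto
  obtain y where y: "(x', y) \<in> psp (gens a a' j u (Suc s))" using step.IH[OF r(2)] by auto
  have "gens a a' j u s = insert (path a u j (Suc s), path a' u j (Suc s)) (gens a a' j u (Suc s))"
    using gens_insert step by simp
  moreover have "psp (gens a a' j u (Suc s)) \<subseteq> psp (gens a a' j u s)"
    using psp_base[OF gens_closed[OF j, of s]] calculation by (intro psp_subset[OF gens_closed[OF j]]) auto
  ultimately show ?case using psp.step[OF r(1), of "path a u j (Suc s)" "path a' u j (Suc s)" "gens a a' j u s" x' y] y r(3)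
    by (auto simp del: path.simps)
qed

lemma gens_sub_all: "\<lbrakk>j \<in> edges \<Gamma>; u \<in> j\<rbrakk> \<Longrightarrow> psp (gens a a' j u s) \<subseteq> psp (gens_all a a')"
  by (intro psp_subset[OF gens_all_closed] subsetI)
    (auto simp: gens_def gens_all_def intro!: psp_base[OF gens_all_closed, unfolded gens_all_def])

lemma idem_gens: "j \<in> edges \<Gamma> \<Longrightarrow> (e j, e j) \<in> psp (gens_all a a')"
proof -
  assume j: "j \<in> edges \<Gamma>"
  obtain u where "u \<in> j" using edges[OF j] by auto
  then have "(path a u j 0, path a' u j 0) \<in> gens_all a a'" using j unfolding gens_all_def by blast
  then show ?thesis using psp_base[OF gens_all_closed] by simp
qed

lemma sum_gens:
  assumes "D \<subseteq> edges \<Gamma>" "\<And>j. j \<in> D \<Longrightarrow> f j \<in> carrier A" "\<And>j. j \<in> D \<Longrightarrow> \<exists>y. (f j, y) \<in> psp (gens_all a a')"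
  shows "\<exists>y. ((\<Oplus>j\<in>D. f j), y) \<in> psp (gens_all a a')"
proof -
  have "finite D" using assms(1) finite_edges finite_subset by blast
  then show ?thesis using assms
  proof (induction D)
    case empty
    then show ?case using psp.zero by auto
  next
    case (insert j D)
    then obtain y y' where "((\<Oplus>j\<in>D. f j), y) \<in> psp (gens_all a a')" "(f j, y') \<in> psp (gens_all a a')"
      by (meson insertCI insert_subset)
    moreover have "f \<in> D \<rightarrow> carrier A" "f j \<in> carrier A" using insert.prems(2) by auto
    ultimately show ?case
      using psp_add[OF gens_all_closed, of "f j" y'] insert.hyps by (metis A.finsum_insert)
  qed
qed

text \<open>Each component of \<open>x\<close> is a multiple of an idempotent plus a radical part,
  and the latter splits into the two chains of the edge, which paths span.\<close>

lemma gens_all_total: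
  assumes x: "x \<in> carrier A"
  shows "\<exists>y. (x, y) \<in> psp (gens_all a a')"
proof -
  have "\<exists>y. (x \<otimes> e j, y) \<in> psp (gens_all a a')" if j: "j \<in> edges \<Gamma>" for j
  proof -
    obtain u where "u \<in> j" using edges[OF j] by auto
    then obtain w where w: "w \<noteq> u" "j = {u, w}" "w \<in> j" using edge_other[OF j] by blast
    define c where "c = \<chi> j x"
    have c: "c \<in> carrier K" using j x by (simp add: c_def)
    let ?r = "x \<otimes> e j \<ominus> c \<odot> e j"
    have r: "?r \<in> carrier A" "?r \<otimes> e j = ?r" using x j c
      by (simp_all add: A.minus_eq A.l_distr A.l_minus A.m_assoc smult_mult_l)
    have "\<chi> j ?r = \<zero>\<^bsub>K\<^esub>"
      using x j c by (simp add: chi_minus chi_mult chi_smult chi_e c_def)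
    then obtain f g where fg: "f \<in> F u j 0" "g \<in> F w j 0" "?r = f \<oplus> g"
      using rad_sum[OF j w(2) r] by auto
    obtain y z where yz: "(f, y) \<in> psp (gens_all a a')" "(g, z) \<in> psp (gens_all a a')"
      using gens_total[OF j \<open>u \<in> j\<close> _ fg(1)] gens_total[OF j w(3) _ fg(2)]
        gens_sub_all[OF j \<open>u \<in> j\<close>] gens_sub_all[OF j w(3)] by blast
    have "x \<otimes> e j = ?r \<oplus> c \<odot> e j" using x j c by (simp add: diff_add_cancel)
    then have "x \<otimes> e j = (f \<oplus> g) \<oplus> c \<odot> e j" using fg(3) by simp
    then show ?thesis
      using psp_add[OF gens_all_closed psp_add[OF gens_all_closed yz] psp_smult[OF gens_all_closed c idem_gens[OF j]]]
      by auto
  qed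
  then show ?thesis using sum_gens[of "edges \<Gamma>" "\<lambda>j. x \<otimes> e j"] sum_comp[OF x] x by auto
qed

text \<open>A product of two paths is their concatenation or zero, and which of these occurs depends
  on edges, vertices and lengths but not on the arrow system.\<close>

lemma gens_all_mult:
  assumes "(b, b') \<in> gens_all a a'" "(c, c') \<in> gens_all a a'"
  shows "(b \<otimes> c, b' \<otimes> c') \<in> psp (gens_all a a')"
proof -
  obtain u i t where b: "i \<in> edges \<Gamma>" "u \<in> i" "t \<le> len u" "b = path a u i t" "b' = path a' u i t"
    using assms(1) by (auto simp: gens_all_def)
  obtain w j s where c: "j \<in> edges \<Gamma>" "w \<in> j" "s \<le> len w" "c = path a w j s" "c' = path a' w j s"
    using assms(2) by (auto simp: gens_all_def)
  let ?h = "(\<rho> w ^^ s) j"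
  have h: "?h \<in> edges \<Gamma>" using rot_edge[OF c(1,2)] .
  have zero: "path d u i t \<otimes> path d w j s = \<zero>" if d: "arrow_system d" and ne: "i \<noteq> ?h" for d
  proof -
    note p = path[OF d b(1,2), of t] and q = path[OF d c(1,2), of s]
    have "path d u i t \<otimes> path d w j s = (path d u i t \<otimes> e i) \<otimes> (e ?h \<otimes> path d w j s)"
      using p q by simp
    also have "\<dots> = path d u i t \<otimes> ((e i \<otimes> e ?h) \<otimes> path d w j s)"
      using p(1) q(1) b(1) h by (simp add: A.m_assoc)
    finally show ?thesis using e_orth[OF b(1) h ne] p(1) q(1) by simp
  qed
  consider "i \<noteq> ?h" | "i = ?h" "u = w" | "i = ?h" "u \<noteq> w" "s = 0" | "i = ?h" "u \<noteq> w" "t = 0"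
    | "i = ?h" "u \<noteq> w" "0 < s" "0 < t" by blast
  then show ?thesis
  proof cases
    case 1
    then show ?thesis using zero as as' b c psp.zero by simp
  next
    case 2
    then have "b \<otimes> c = path a w j (s + t)" "b' \<otimes> c' = path a' w j (s + t)"
      using path_comp[OF as c(1,2)] path_comp[OF as' c(1,2)] b c by auto
    moreover have "(path a w j (s + t), path a' w j (s + t)) \<in> psp (gens_all a a')"
    proof (cases "s + t \<le> len w")
      case True
      then have "(path a w j (s + t), path a' w j (s + t)) \<in> gens_all a a'"
        using c unfolding gens_all_def by blast
      then show ?thesis by (rule psp_base[OF gens_all_closed])
    next
      case False
      then show ?thesis using path_beyond[OF as c(1,2)] path_beyond[OF as' c(1,2)] psp.zero by simp
    qed
    ultimately show ?thesis by simp
  next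
    case 3
    then have "b \<otimes> c = b" "b' \<otimes> c' = b'"
      using path_e_right[OF as b(1,2)] path_e_right[OF as' b(1,2)] b c by auto
    then show ?thesis using psp_base[OF gens_all_closed assms(1)] by simp
  next
    case 4
    then have "b \<otimes> c = c" "b' \<otimes> c' = c'"
      using path_e_left[OF as c(1,2)] path_e_left[OF as' c(1,2)] b c by auto
    then show ?thesis using psp_base[OF gens_all_closed assms(2)] by simp
  next
    case 5
    then show ?thesis
      using path_orth[OF as c(1,2), of u s t] path_orth[OF as' c(1,2), of u s t] b c psp.zero by simp
  qed
qed

lemma gens_all_one: "(\<one>, \<one>) \<in> psp (gens_all a a')"
proof -
  have "((\<Oplus>j\<in>D. e j), (\<Oplus>j\<in>D. e j)) \<in> psp (gens_all a a')" if "D \<subseteq> edges \<Gamma>" for D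
  proof -
    have "finite D" using that finite_edges finite_subset by blast
    then show ?thesis using that
    proof (induction D)
      case empty
      then show ?case using psp.zero by auto
    next
      case (insert j D)
      then have "e \<in> D \<rightarrow> carrier A" "e j \<in> carrier A" by auto
      then show ?case using insert psp_add[OF gens_all_closed idem_gens] by simp
    qed
  qed
  then show ?thesis using e_sum by (metis order.refl)
qed

context
  fixes \<kappa>
  assumes kappa: "\<kappa> \<in> carrier K"
    and soc_eq: "\<And>j u. \<lbrakk>j \<in> edges \<Gamma>; u \<in> j\<rbrakk> \<Longrightarrow> path a' u j (len u) = \<kappa> \<odot> path a u j (len u)"
begin

text \<open>The coefficients of shorter paths vanish one by one, because such a path lies outside
  the next term of the chain while the socle element lies in it. Only a multiple of the longest path
  remains.\<close>

lemma gens_soc: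
  assumes j: "j \<in> edges \<Gamma>" "u \<in> j" and s: "s \<le> branch_length \<Gamma> u"
    and "(x, y) \<in> psp (gens a a' j u s)" "x \<in> F u j (branch_length \<Gamma> u)"
  shows "y = \<kappa> \<odot> x"
  using s assms(4,5)
proof (induction s arbitrary: x y rule: inc_induct)
  case base
  let ?l = "branch_length \<Gamma> u"
  have g: "gens a a' j u ?l = insert (path a u j (len u), path a' u j (len u)) {}"
    by (auto simp: gens_def len_def simp del: path.simps dest: le_antisym intro: le_antisym)
  obtain k x' y' where k: "k \<in> carrier K" "(x', y') \<in> psp {}" "x = k \<odot> path a u j (len u) \<oplus> x'"
    "y = k \<odot> path a' u j (len u) \<oplus> y'"
    using base(1) gens_closed[OF j, of ?l] unfolding g by (elim psp_insertE) auto
  from k(2) have "x' = \<zero>" "y' = \<zero>" by (auto elim: psp.cases)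
  then show ?case using k path_closed[OF as j] kappa soc_eq[OF j] by (simp add: smult_comm)
next
  case (step s)
  have s: "s < len u" using step by (simp add: len_def)
  note g = gens_insert[OF s, of j]
  obtain k x' y' where k: "k \<in> carrier K" "(x', y') \<in> psp (gens a a' j u (Suc s))"
    "x = k \<odot> path a u j (Suc s) \<oplus> x'" "y = k \<odot> path a' u j (Suc s) \<oplus> y'"
    using step.prems(1) gens_closed[OF j, of s] unfolding g by (elim psp_insertE) auto
  have x': "x' \<in> F u j (Suc s)" "y' \<in> F u j (Suc s)" using gens_F[OF j k(2)] s by auto
  have xs: "x \<in> F u j (Suc s)"
    using step F_mono[OF j, of "Suc s" "branch_length \<Gamma> u"] by (auto simp: len_def)
  have c: "x' \<in> carrier A" "y' \<in> carrier A" "path a u j (Suc s) \<in> carrier A" "path a' u j (Suc s) \<in> carrier A"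
    using x' F_closed[OF j, of "Suc s"] s path_closed[OF as j, of "Suc s"] path_closed[OF as' j, of "Suc s"] by auto
  have "k \<odot> path a u j (Suc s) = x \<ominus> x'"
    using k(1,3) c by (simp add: A.minus_eq A.a_assoc A.r_neg del: path.simps)
  then have "k \<odot> path a u j (Suc s) \<in> F u j (Suc s)" using F_minus[OF j _ xs x'(1)] s by simp
  then have "k = \<zero>\<^bsub>K\<^esub>"
    using F_smult_mem[OF j _ k(1) c(3) path_notin[OF as j s]] s by simp
  then have "x = x'" "y = y'" using k c by (simp_all del: path.simps)
  then show ?case using step.IH[of x' y'] k(2) step.prems by simp
qed

text \<open>The character removes the idempotent, and then x1 = -x2 lies in both chains, hence in
  the socle. There the relations of both chains are multiplication by the same \<kappa>, so the
  images cancel as well.\<close>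

lemma gens_at_single:
  assumes j: "j \<in> edges \<Gamma>" "u \<in> j" "w \<in> j" "j = {u, w}" "u \<noteq> w"
    and xy: "(\<zero>, y) \<in> psp (insert (e j, e j) (gens a a' j u 0 \<union> gens a a' j w 0))"
  shows "y = \<zero>"
proof -
  have cl: "insert (e j, e j) (gens a a' j u 0 \<union> gens a a' j w 0) \<subseteq> carrier A \<times> carrier A"
    using gens_closed[OF j(1,2), of 0] gens_closed[OF j(1,3), of 0] j by auto
  obtain k x' y' where k: "k \<in> carrier K" "(x', y') \<in> psp (gens a a' j u 0 \<union> gens a a' j w 0)"
    "\<zero> = k \<odot> e j \<oplus> x'" "y = k \<odot> e j \<oplus> y'"
    using psp_insertE[OF cl xy] by metis
  obtain x1 y1 x2 y2 where s: "(x1, y1) \<in> psp (gens a a' j u 0)" "(x2, y2) \<in> psp (gens a a' j w 0)"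
    "x' = x1 \<oplus> x2" "y' = y1 \<oplus> y2"
    using psp_UnE[OF _ k(2)] cl by (metis insert_subset)
  have F1: "x1 \<in> F u j 0" "y1 \<in> F u j 0" and F2: "x2 \<in> F w j 0" "y2 \<in> F w j 0"
    using gens_F[OF j(1,2) s(1)] gens_F[OF j(1,3) s(2)] by auto
  have c: "x1 \<in> carrier A" "y1 \<in> carrier A" "x2 \<in> carrier A" "y2 \<in> carrier A"
    using F1 F2 F_closed[OF j(1,2)] F_closed[OF j(1,3)] by auto
  have "\<chi> j \<zero> = k"
    unfolding k(3) s(3) using c k(1) j filt_rad[OF j(1,2) F1(1)] filt_rad[OF j(1,3) F2(1)]
    by (simp add: chi_add chi_smult chi_e)
  then have "k = \<zero>\<^bsub>K\<^esub>" using chi_zero[OF j(1)] by simp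
  then have x12: "x1 \<oplus> x2 = \<zero>" and y: "y = y1 \<oplus> y2" using k s c j(1) by simp_all
  have "x1 = \<ominus> x2" using x12 c by (simp add: A.minus_equality A.a_comm)
  moreover have "\<ominus> x2 \<in> F w j 0" using F_minus[OF j(1,3) _ F_zero[OF j(1,3)] F2(1), of] c by (simp add: A.minus_eq)
  ultimately have "x1 \<in> F u j (branch_length \<Gamma> u)" using filt_inter[OF j(1,4,5)] F1(1) by auto
  moreover have "x2 = \<ominus> x1" using x12 c by (metis A.minus_equality A.a_comm)
  moreover have "\<ominus> x1 \<in> F u j 0" using F_minus[OF j(1,2) _ F_zero[OF j(1,2)] F1(1)] c by (simp add: A.minus_eq)
  moreover have "F w j 0 \<inter> F u j 0 \<subseteq> F w j (branch_length \<Gamma> w)"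
  proof (rule filt_inter[OF j(1)])
    show "j = {w, u}" using j(4) by (rule trans) (rule insert_commute)
  qed (use j(5) in simp)
  ultimately have "x1 \<in> F u j (branch_length \<Gamma> u)" "x2 \<in> F w j (branch_length \<Gamma> w)"
    using F2(1) by auto
  then have "y1 = \<kappa> \<odot> x1" "y2 = \<kappa> \<odot> x2"
    using gens_soc[OF j(1,2) _ s(1)] gens_soc[OF j(1,3) _ s(2)] by auto
  then have "y = \<kappa> \<odot> (x1 \<oplus> x2)" using y c kappa by (simp add: smult_r_distr)
  then show ?thesis using x12 kappa by simp
qed

text \<open>Right multiplication by \<open>e j\<close> isolates the paths that start at
  \<open>j\<close>, which reduces the claim to one edge.\<close>

lemma gens_all_single:
  assumes "(\<zero>, y) \<in> psp (gens_all a a')"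
  shows "y = \<zero>"
proof (rule zero_if_comp_zero)
  show "y \<in> carrier A" using psp_closed[OF gens_all_closed assms] by simp
  fix j assume j: "j \<in> edges \<Gamma>"
  obtain u where u: "u \<in> j" using edges[OF j] by auto
  then obtain w where w: "w \<noteq> u" "j = {u, w}" "w \<in> j" using edge_other[OF j] by blast
  let ?B = "insert (e j, e j) (gens a a' j u 0 \<union> gens a a' j w 0)"
  have cl: "?B \<subseteq> carrier A \<times> carrier A"
    using gens_closed[OF j u, of 0] gens_closed[OF j w(3), of 0] j by auto
  have "(\<zero> \<otimes> e j, y \<otimes> e j) \<in> psp ?B"
  proof (rule psp_mult_right[OF cl _ _ gens_all_closed _ assms])
    fix b b' assume "(b, b') \<in> gens_all a a'"
    then obtain v i t where b: "i \<in> edges \<Gamma>" "v \<in> i" "t \<le> len v" "b = path a v i t" "b' = path a' v i t"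
      by (auto simp: gens_all_def)
    note p = path[OF as b(1,2), of t] path[OF as' b(1,2), of t]
    show "(b \<otimes> e j, b' \<otimes> e j) \<in> psp ?B"
    proof (cases "i = j")
      case True
      then have "v = u \<or> v = w" using b(2) w(2) by auto
      then have "(b, b') \<in> ?B" using b True by (cases "t = 0") (auto simp: gens_def)
      then show ?thesis using psp_base[OF cl] p b True by simp
    next
      case False
      have "path d v i t \<otimes> e j = \<zero>" if d: "arrow_system d" for d
      proof -
        have "path d v i t \<otimes> e j = path d v i t \<otimes> (e i \<otimes> e j)"
          using path[OF d b(1,2), of t] b(1) j by (metis A.m_assoc e_closed)
        then show ?thesis using e_orth[OF b(1) j False] path_closed[OF d b(1,2)] by simp
      qed
      then show ?thesis using as as' b psp.zero by simp
    qed
  qed (use j in simp_all)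
  then have "(\<zero>, y \<otimes> e j) \<in> psp ?B" using j by simp
  then show "y \<otimes> e j = \<zero>" using gens_at_single[OF j u w(3,2)] w(1) by blast
qed

end

end

theorem ex_automorphism:
  assumes as: "arrow_system a" "arrow_system a'" and kappa: "\<kappa> \<in> carrier K" "\<kappa> \<noteq> \<zero>\<^bsub>K\<^esub>"
    and soc: "\<And>j u. \<lbrakk>j \<in> edges \<Gamma>; u \<in> j\<rbrakk> \<Longrightarrow> path a' u j (len u) = \<kappa> \<odot> path a u j (len u)"
  shows "\<exists>\<phi>\<in>alg_auts K A. \<forall>j\<in>edges \<Gamma>. \<forall>u\<in>j. \<forall>t\<le>len u. \<phi> (path a u j t) = path a' u j t"
proof -
  have inv: "inv\<^bsub>K\<^esub> \<kappa> \<in> carrier K" using kappa by (simp add: K.field_Units)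
  \<comment> \<open>Injectivity is single-valuedness of the converse relation, for which the socles
    are rescaled by the inverse of \<kappa>.\<close>
  have soc': "path a u j (len u) = inv\<^bsub>K\<^esub> \<kappa> \<odot> path a' u j (len u)" if "j \<in> edges \<Gamma>" "u \<in> j" for j u
    using soc[OF that] kappa path_closed[OF as(1) that] by (simp add: smult_inv_cancel)
  have conv: "(x, y) \<in> psp (gens_all a a') \<Longrightarrow> (y, x) \<in> psp (gens_all a' a)" for x y a a'
    using psp_converse[of x y "gens_all a a'"] by (simp add: gens_all_converse)
  obtain \<phi> where \<phi>: "\<phi> \<in> alg_auts K A" "\<forall>(b, b')\<in>psp (gens_all a a'). \<phi> b = b'"
  proof -
    have "\<exists>\<phi>\<in>alg_auts K A. \<forall>(b, b')\<in>psp (gens_all a a'). \<phi> b = b'"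
    proof (rule psp_automorphism[OF gens_all_closed[OF as]])
      show "y = \<zero>" if "(\<zero>, y) \<in> psp (gens_all a a')" for y
        by (rule gens_all_single[OF as kappa(1) soc that])
      show "x = \<zero>" if "(x, \<zero>) \<in> psp (gens_all a a')" for x
        by (rule gens_all_single[OF as(2,1) inv soc' conv[OF that]])
      show "\<exists>x. (x, y) \<in> psp (gens_all a a')" if "y \<in> carrier A" for y
        using gens_all_total[OF as(2,1) that] conv by blast
    qed (use gens_all_mult[OF as] gens_all_total[OF as] gens_all_one[OF as] in auto)
    then show ?thesis using that by blast
  qed
  have "\<phi> (path a u j t) = path a' u j t" if "j \<in> edges \<Gamma>" "u \<in> j" "t \<le> len u" for j u t
  proof -
    have "(path a u j t, path a' u j t) \<in> gens_all a a'" using that unfolding gens_all_def by blast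
    then have "(path a u j t, path a' u j t) \<in> psp (gens_all a a')" by (rule psp_base[OF gens_all_closed[OF as]])
    then show ?thesis using \<phi>(2) by auto
  qed
  then show ?thesis using \<phi>(1) by blast
qed

end

section \<open>The group of coefficients\<close>

text \<open>Serves both for the cycle at the exceptional vertex, in an algebra that it need not
  generate, and for the class of the variable in the truncated polynomial algebra. Generation by
  \<open>x\<close> is therefore a separate hypothesis of the lemmas that use it.\<close>

locale nilpotent_element = kalg A K
  for A :: "('k, 'a, 'm) module_scheme" (structure) and K :: "('k, 'l) ring_scheme" (structure) +
  fixes x :: 'a and m :: nat
  assumes x [simp]: "x \<in> carrier A" and x_Suc: "x [^] Suc m = \<zero>" and x_pow: "x [^] m \<noteq> \<zero>"
    and m: "1 \<le> m"
begin

text \<open>Coefficient functions are total and values beyond \<open>m\<close> are ignored, so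
  formulas for products need no truncation.\<close>

definition ps :: "(nat \<Rightarrow> 'k) \<Rightarrow> 'a"
  where "ps c = (\<Oplus>l\<in>{..m}. c l \<odot> x [^] l)"

lemma pow_zero: "m < l \<Longrightarrow> x [^] l = \<zero>"
  by (metis A.l_null A.nat_pow_closed A.nat_pow_mult less_iff_Suc_add add_Suc x x_Suc)

lemma ps_closed [simp]: "(\<And>l. c l \<in> carrier K) \<Longrightarrow> ps c \<in> carrier A"
  unfolding ps_def by (intro A.finsum_closed) auto

lemma ps_cong: "(\<And>l. l \<le> m \<Longrightarrow> c l = d l) \<Longrightarrow> (\<And>l. d l \<in> carrier K) \<Longrightarrow> ps c = ps d"
  unfolding ps_def by (intro A.finsum_cong') auto

lemma ps_add: "(\<And>l. c l \<in> carrier K) \<Longrightarrow> (\<And>l. d l \<in> carrier K) \<Longrightarrow> ps c \<oplus> ps d = ps (\<lambda>l. c l \<oplus>\<^bsub>K\<^esub> d l)"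
  unfolding ps_def by (subst A.finsum_addf[symmetric]) (auto simp: smult_l_distr)

lemma ps_smult: "k \<in> carrier K \<Longrightarrow> (\<And>l. c l \<in> carrier K) \<Longrightarrow> k \<odot> ps c = ps (\<lambda>l. k \<otimes>\<^bsub>K\<^esub> c l)"
  unfolding ps_def by (subst finsum_smult_ldistr) (auto simp: smult_assoc1)

lemma ps_zero: "ps (\<lambda>l. \<zero>\<^bsub>K\<^esub>) = \<zero>"
  unfolding ps_def by simp

lemma ps_single:
  assumes "i \<le> m" "k \<in> carrier K"
  shows "ps (\<lambda>l. if i = l then k else \<zero>\<^bsub>K\<^esub>) = k \<odot> x [^] i"
proof -
  have "ps (\<lambda>l. if i = l then k else \<zero>\<^bsub>K\<^esub>) = (\<Oplus>l\<in>{..m}. if i = l then k \<odot> x [^] l else \<zero>)"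
    unfolding ps_def using assms by (intro A.finsum_cong') auto
  then show ?thesis using A.finsum_singleton[of i "{..m}" "\<lambda>l. k \<odot> x [^] l"] assms by auto
qed

lemma finsum_smult_scalar:
  assumes "finite I" "c \<in> I \<rightarrow> carrier K" "y \<in> carrier A"
  shows "(\<Oplus>\<^bsub>K\<^esub>i\<in>I. c i) \<odot> y = (\<Oplus>i\<in>I. c i \<odot> y)"
  using assms(1,2)
proof (induction I)
  case (insert i I)
  then have "c \<in> I \<rightarrow> carrier K" "c i \<in> carrier K" "(\<lambda>i. c i \<odot> y) \<in> I \<rightarrow> carrier A" using assms(3) by auto
  then show ?case using insert assms(3) by (simp add: smult_l_distr)
qed (use assms(3) in simp)

lemma ps_mult:
  assumes c: "\<And>l. c l \<in> carrier K" and d: "\<And>l. d l \<in> carrier K"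
  shows "ps c \<otimes> ps d = ps (\<lambda>l. \<Oplus>\<^bsub>K\<^esub>i\<in>{..l}. c i \<otimes>\<^bsub>K\<^esub> d (l - i))"
proof -
  let ?f = "\<lambda>i. c i \<odot> x [^] i" and ?g = "\<lambda>i. d i \<odot> x [^] i"
  have "ps c \<otimes> ps d = (\<Oplus>k\<in>{..m + m}. \<Oplus>i\<in>{..k}. ?f i \<otimes> ?g (k - i))"
    unfolding ps_def
    by (rule A.cauchy_product[symmetric]) (use c d pow_zero in \<open>auto intro!: bound.intro\<close>)
  also have "\<dots> = (\<Oplus>k\<in>{..m + m}. (\<Oplus>\<^bsub>K\<^esub>i\<in>{..k}. c i \<otimes>\<^bsub>K\<^esub> d (k - i)) \<odot> x [^] k)"
  proof (rule A.finsum_cong')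
    fix k
    have "(\<Oplus>i\<in>{..k}. ?f i \<otimes> ?g (k - i)) = (\<Oplus>i\<in>{..k}. (c i \<otimes>\<^bsub>K\<^esub> d (k - i)) \<odot> x [^] k)"
      using c d by (intro A.finsum_cong')
        (auto simp: smult_mult_l smult_mult_r smult_assoc1 A.nat_pow_mult intro: smult_comm)
    also have "\<dots> = (\<Oplus>\<^bsub>K\<^esub>i\<in>{..k}. c i \<otimes>\<^bsub>K\<^esub> d (k - i)) \<odot> x [^] k"
      using c d by (intro finsum_smult_scalar[symmetric]) auto
    finally show "(\<Oplus>i\<in>{..k}. ?f i \<otimes> ?g (k - i)) = (\<Oplus>\<^bsub>K\<^esub>i\<in>{..k}. c i \<otimes>\<^bsub>K\<^esub> d (k - i)) \<odot> x [^] k" .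
  qed (use c d in \<open>auto intro!: K.finsum_closed smult_closed\<close>)
  also have "\<dots> = ps (\<lambda>l. \<Oplus>\<^bsub>K\<^esub>i\<in>{..l}. c i \<otimes>\<^bsub>K\<^esub> d (l - i))"
    unfolding ps_def
    by (rule A.add.finprod_mono_neutral_cong_right)
      (use c d pow_zero in \<open>auto intro!: K.finsum_closed smult_closed\<close>)
  finally show ?thesis .
qed

text \<open>Multiplication by \<open>x [^] (m - l)\<close> annihilates the terms of degree above
  \<open>l\<close>, and those below vanish by induction; the coefficient at \<open>l\<close> is left
  alone in front of the nonzero power \<open>x [^] m\<close>.\<close>

lemma ps_eq_zeroD:
  assumes c: "\<And>l. c l \<in> carrier K" and z: "ps c = \<zero>" and "l \<le> m"
  shows "c l = \<zero>\<^bsub>K\<^esub>"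
  using assms(3)
proof (induction l rule: less_induct)
  case (less l)
  let ?d = "\<lambda>i. if m - l = i then \<one>\<^bsub>K\<^esub> else \<zero>\<^bsub>K\<^esub>"
  have "x [^] (m - l) \<otimes> ps c = (\<Oplus>i\<in>{..m}. x [^] (m - l) \<otimes> (c i \<odot> x [^] i))"
    unfolding ps_def using c by (intro A.finsum_rdistr) auto
  also have "\<dots> = (\<Oplus>i\<in>{..m}. if l = i then c i \<odot> x [^] m else \<zero>)"
  proof (rule A.finsum_cong')
    fix i assume "i \<in> {..m}"
    have "x [^] (m - l) \<otimes> (c i \<odot> x [^] i) = c i \<odot> x [^] (m - l + i)"
      using c by (simp add: smult_mult_r A.nat_pow_mult)
    then show "x [^] (m - l) \<otimes> (c i \<odot> x [^] i) = (if l = i then c i \<odot> x [^] m else \<zero>)"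
      using less c pow_zero[of "m - l + i"] by (cases i l rule: linorder_cases) auto
  qed (use c in auto)
  also have "\<dots> = c l \<odot> x [^] m"
    using A.finsum_singleton[of l "{..m}" "\<lambda>i. c i \<odot> x [^] m"] less.prems c by auto
  finally have "c l \<odot> x [^] m = \<zero>" using z by simp
  then show ?case using smult_eq_zeroD[OF c _ _ x_pow] by simp
qed

lemma ps_inj:
  assumes "\<And>l. c l \<in> carrier K" "\<And>l. d l \<in> carrier K" "ps c = ps d" "l \<le> m"
  shows "c l = d l"
proof -
  have "ps c \<oplus> (\<ominus>\<^bsub>K\<^esub> \<one>\<^bsub>K\<^esub>) \<odot> ps d = \<zero>"
    using assms by (simp add: smult_l_minus A.r_neg)
  moreover have "ps c \<oplus> (\<ominus>\<^bsub>K\<^esub> \<one>\<^bsub>K\<^esub>) \<odot> ps d = ps (\<lambda>l. c l \<oplus>\<^bsub>K\<^esub> (\<ominus>\<^bsub>K\<^esub> \<one>\<^bsub>K\<^esub>) \<otimes>\<^bsub>K\<^esub> d l)"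
    using assms(1,2) by (simp add: ps_smult ps_add)
  ultimately have "ps (\<lambda>l. c l \<oplus>\<^bsub>K\<^esub> (\<ominus>\<^bsub>K\<^esub> \<one>\<^bsub>K\<^esub>) \<otimes>\<^bsub>K\<^esub> d l) = \<zero>" by (rule trans[OF sym, rotated])
  then have "c l \<oplus>\<^bsub>K\<^esub> (\<ominus>\<^bsub>K\<^esub> \<one>\<^bsub>K\<^esub>) \<otimes>\<^bsub>K\<^esub> d l = \<zero>\<^bsub>K\<^esub>"
    using assms by (intro ps_eq_zeroD[OF _ _ assms(4)]) auto
  then show ?thesis using assms by (simp add: K.l_minus) (metis K.minus_equality K.minus_minus K.a_inv_closed)
qed

lemma ps_finsum:
  assumes "finite I" "\<And>i l. i \<in> I \<Longrightarrow> c i l \<in> carrier K"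
  shows "(\<Oplus>i\<in>I. ps (c i)) = ps (\<lambda>l. \<Oplus>\<^bsub>K\<^esub>i\<in>I. c i l)"
  using assms
proof (induction I)
  case empty
  then show ?case by (simp add: ps_zero)
next
  case (insert i I)
  have "(\<lambda>i. ps (c i)) \<in> I \<rightarrow> carrier A" "ps (c i) \<in> carrier A" using insert.prems by auto
  moreover have "(\<Oplus>\<^bsub>K\<^esub>i\<in>I. c i l) \<in> carrier K" for l using insert.prems by (intro K.finsum_closed) auto
  ultimately show ?case using insert by (simp add: ps_add Pi_iff)
qed

text \<open>The coefficients of the i-th power of the formal power series with coefficients
  \<open>c\<close>, without truncation at \<open>m\<close>.\<close>

primrec pw :: "(nat \<Rightarrow> 'k) \<Rightarrow> nat \<Rightarrow> nat \<Rightarrow> 'k"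
  where "pw c 0 = (\<lambda>l. if l = 0 then \<one>\<^bsub>K\<^esub> else \<zero>\<^bsub>K\<^esub>)"
  | "pw c (Suc i) = (\<lambda>l. \<Oplus>\<^bsub>K\<^esub>j\<in>{..l}. c j \<otimes>\<^bsub>K\<^esub> pw c i (l - j))"

context
  fixes c :: "nat \<Rightarrow> 'k"
  assumes c: "\<And>l. c l \<in> carrier K"
begin

lemma pw_closed [simp]: "pw c i l \<in> carrier K"
  by (induction i arbitrary: l) (auto intro!: K.finsum_closed simp: c)

lemma ps_pow: "ps c [^] i = ps (pw c i)"
proof (induction i)
  case 0
  have "ps (pw c 0) = ps (\<lambda>l. if 0 = l then \<one>\<^bsub>K\<^esub> else \<zero>\<^bsub>K\<^esub>)" by (rule ps_cong) auto
  then show ?case using ps_single[of 0 "\<one>\<^bsub>K\<^esub>"] by simp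
next
  case (Suc i)
  have "ps c [^] Suc i = ps c \<otimes> ps (pw c i)"
    using Suc A.nat_pow_Suc2[of "ps c" i] c by simp
  then show ?case using ps_mult[of c "pw c i"] c by simp
qed

lemma pw_below:
  assumes "c 0 = \<zero>\<^bsub>K\<^esub>" "l < i"
  shows "pw c i l = \<zero>\<^bsub>K\<^esub>"
  using assms(2)
proof (induction i arbitrary: l)
  case (Suc i)
  have "c j \<otimes>\<^bsub>K\<^esub> pw c i (l - j) = \<zero>\<^bsub>K\<^esub>" if "j \<le> l" for j
    using Suc assms(1) c that by (cases "j = 0") auto
  then have "pw c (Suc i) l = (\<Oplus>\<^bsub>K\<^esub>j\<in>{..l}. \<zero>\<^bsub>K\<^esub>)"
    unfolding pw.simps by (intro K.finsum_cong') auto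
  then show ?case by simp
qed simp

lemma pw_diag:
  assumes "c 0 = \<zero>\<^bsub>K\<^esub>"
  shows "pw c i i = c 1 [^]\<^bsub>K\<^esub> i"
proof (induction i)
  case (Suc i)
  have "pw c (Suc i) (Suc i) = (\<Oplus>\<^bsub>K\<^esub>j\<in>{..Suc i}. if 1 = j then c j \<otimes>\<^bsub>K\<^esub> pw c i (Suc i - j) else \<zero>\<^bsub>K\<^esub>)"
    unfolding pw.simps
  proof (rule K.finsum_cong')
    fix j assume "j \<in> {..Suc i}"
    then show "c j \<otimes>\<^bsub>K\<^esub> pw c i (Suc i - j) = (if 1 = j then c j \<otimes>\<^bsub>K\<^esub> pw c i (Suc i - j) else \<zero>\<^bsub>K\<^esub>)"
      using assms c pw_below[OF assms, of "Suc i - j" i] by (cases "j = 0") auto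
  qed (auto simp: c)
  also have "\<dots> = c 1 \<otimes>\<^bsub>K\<^esub> pw c i (Suc i - 1)"
    by (rule K.finsum_singleton) (auto simp: c)
  finally show ?case using Suc c by (simp add: K.m_comm)
qed simp

end

section \<open>The group of coefficients as polynomials under substitution\<close>

definition hx :: "(nat \<Rightarrow> 'k) \<Rightarrow> nat \<Rightarrow> 'k"
  where "hx \<alpha> l = (if l \<in> {1..m} then \<alpha> l else \<zero>\<^bsub>K\<^esub>)"

abbreviation "pev \<alpha> \<equiv> ps (hx \<alpha>)"

abbreviation "H \<equiv> H_group K m"

lemma H_carrier: "carrier H = {\<alpha> \<in> {1..m} \<rightarrow>\<^sub>E carrier K. \<alpha> 1 \<noteq> \<zero>\<^bsub>K\<^esub>}"
  by (simp add: H_group_def)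

lemma hx_closed [simp]: "\<alpha> \<in> carrier H \<Longrightarrow> hx \<alpha> l \<in> carrier K"
  by (auto simp: hx_def H_carrier)

lemma hx_0 [simp]: "hx \<alpha> 0 = \<zero>\<^bsub>K\<^esub>"
  by (simp add: hx_def)

lemma hx_1: "hx \<alpha> 1 = \<alpha> 1"
  using m by (simp add: hx_def)

lemma pev_inj:
  assumes "\<alpha> \<in> carrier H" "\<beta> \<in> carrier H" "pev \<alpha> = pev \<beta>"
  shows "\<alpha> = \<beta>"
proof (rule extensionalityI)
  show "\<alpha> \<in> extensional {1..m}" "\<beta> \<in> extensional {1..m}" using assms by (auto simp: H_carrier PiE_def)
  fix l assume "l \<in> {1..m}"
  moreover from this have "hx \<alpha> l = hx \<beta> l" using ps_inj[OF hx_closed[OF assms(1)] hx_closed[OF assms(2)] assms(3)] by simp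
  ultimately show "\<alpha> l = \<beta> l" by (simp add: hx_def)
qed

lemma compositions_finite: "finite (compositions i l)"
proof (rule finite_subset)
  show "compositions i l \<subseteq> {js. set js \<subseteq> {..l} \<and> length js = i}"
    using member_le_sum_list by (fastforce simp: compositions_def)
qed (rule finite_lists_length_eq, simp)

lemma compositions_Suc: "compositions (Suc i) l = (\<Union>j\<in>{1..l}. (#) j ` compositions i (l - j))"
proof
  show "compositions (Suc i) l \<subseteq> (\<Union>j\<in>{1..l}. (#) j ` compositions i (l - j))"
  proof
    fix js assume js: "js \<in> compositions (Suc i) l"
    then obtain j js' where "js = j # js'" by (cases js) (auto simp: compositions_def)
    then show "js \<in> (\<Union>j\<in>{1..l}. (#) j ` compositions i (l - j))"
      using js by (intro UN_I[of j] image_eqI[of _ _ js']) (auto simp: compositions_def)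
  qed
  show "(\<Union>j\<in>{1..l}. (#) j ` compositions i (l - j)) \<subseteq> compositions (Suc i) l"
    by (auto simp: compositions_def)
qed

text \<open>The inner sum in the multiplication of \<open>H_group\<close> is a coefficient of a
  power of the polynomial; the recursion splits off the first entry of a composition. The bound on
  \<open>l\<close> keeps all entries in the index range of \<alpha>.\<close>

lemma pw_compositions:
  assumes \<alpha>: "\<alpha> \<in> carrier H" and "l \<le> m"
  shows "(\<Oplus>\<^bsub>K\<^esub>js\<in>compositions i l. \<Otimes>\<^bsub>K\<^esub>s\<in>{..<i}. \<alpha> (js ! s)) = pw (hx \<alpha>) i l"
  using assms(2)
proof (induction i arbitrary: l)
  case 0
  have "compositions 0 l = (if l = 0 then {[]} else {})" by (auto simp: compositions_def)
  then show ?case by simp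
next
  case (Suc i)
  have \<alpha>K: "\<alpha> j \<in> carrier K" if "1 \<le> j" "j \<le> m" for j using \<alpha> that by (auto simp: H_carrier)
  have mem: "\<alpha> (js ! s) \<in> carrier K" if "js \<in> compositions i' l'" "s < i'" "l' \<le> m" for js s i' l'
  proof (rule \<alpha>K)
    have "js ! s \<in> set js" using that by (auto simp: compositions_def)
    then show "1 \<le> js ! s" "js ! s \<le> m"
      using that member_le_sum_list[of "js ! s" js] by (auto simp: compositions_def Suc_le_eq)
  qed
  let ?P = "\<lambda>i js. \<Otimes>\<^bsub>K\<^esub>s\<in>{..<i}. \<alpha> (js ! s)"
  have Pc: "?P i' js \<in> carrier K" if "js \<in> compositions i' l'" "l' \<le> m" for i' l' js
    using mem[OF that(1) _ that(2)] by (intro K.finprod_closed) auto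
  have P_Cons: "?P (Suc i) (j # js) = \<alpha> j \<otimes>\<^bsub>K\<^esub> ?P i js"
    if js: "js \<in> compositions i l'" "l' \<le> m" and j: "\<alpha> j \<in> carrier K" for j js l'
  proof -
    have f: "(\<lambda>s. \<alpha> ((j # js) ! s)) \<in> Suc ` {..<i} \<rightarrow> carrier K" using mem[OF js(1) _ js(2)] by auto
    have "?P (Suc i) (j # js) = (\<Otimes>\<^bsub>K\<^esub>s\<in>insert 0 (Suc ` {..<i}). \<alpha> ((j # js) ! s))"
      by (simp only: lessThan_Suc_eq_insert_0)
    also have "\<dots> = \<alpha> j \<otimes>\<^bsub>K\<^esub> (\<Otimes>\<^bsub>K\<^esub>s\<in>Suc ` {..<i}. \<alpha> ((j # js) ! s))"
      using f j by (subst K.finprod_insert) auto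
    also have "(\<Otimes>\<^bsub>K\<^esub>s\<in>Suc ` {..<i}. \<alpha> ((j # js) ! s)) = ?P i js"
      using f by (subst K.finprod_reindex) auto
    finally show ?thesis .
  qed
  have "(\<Oplus>\<^bsub>K\<^esub>js\<in>compositions (Suc i) l. ?P (Suc i) js) =
      (\<Oplus>\<^bsub>K\<^esub>j\<in>{1..l}. \<Oplus>\<^bsub>K\<^esub>js\<in>(#) j ` compositions i (l - j). ?P (Suc i) js)"
    unfolding compositions_Suc
  proof (rule K.add.finprod_UN_disjoint)
    show "pairwise (\<lambda>j j'. disjnt ((#) j ` compositions i (l - j)) ((#) j' ` compositions i (l - j'))) {1..l}"
      by (auto simp: pairwise_def disjnt_def)
    fix j js assume "j \<in> {1..l}" "js \<in> (#) j ` compositions i (l - j)"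
    then have "js \<in> compositions (Suc i) l" unfolding compositions_Suc by blast
    then show "?P (Suc i) js \<in> carrier K" using Pc Suc.prems by simp
  qed (auto simp: compositions_finite)
  also have "\<dots> = (\<Oplus>\<^bsub>K\<^esub>j\<in>{1..l}. hx \<alpha> j \<otimes>\<^bsub>K\<^esub> pw (hx \<alpha>) i (l - j))"
  proof (rule K.finsum_cong')
    fix j assume j: "j \<in> {1..l}"
    then have aj: "\<alpha> j \<in> carrier K" "hx \<alpha> j = \<alpha> j" using \<alpha>K Suc.prems by (auto simp: hx_def)
    have lj: "l - j \<le> m" using Suc.prems by simp
    have "(\<Oplus>\<^bsub>K\<^esub>js\<in>(#) j ` compositions i (l - j). ?P (Suc i) js) =
        (\<Oplus>\<^bsub>K\<^esub>js\<in>compositions i (l - j). ?P (Suc i) (j # js))"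
      using P_Cons[OF _ lj aj(1)] Pc[OF _ lj] aj by (intro K.finsum_reindex) auto
    also have "\<dots> = (\<Oplus>\<^bsub>K\<^esub>js\<in>compositions i (l - j). \<alpha> j \<otimes>\<^bsub>K\<^esub> ?P i js)"
      using P_Cons[OF _ lj aj(1)] Pc[OF _ lj] aj by (intro K.finsum_cong') auto
    also have "\<dots> = \<alpha> j \<otimes>\<^bsub>K\<^esub> (\<Oplus>\<^bsub>K\<^esub>js\<in>compositions i (l - j). ?P i js)"
      using Pc[OF _ lj] aj compositions_finite by (intro K.finsum_rdistr[symmetric]) auto
    finally show "(\<Oplus>\<^bsub>K\<^esub>js\<in>(#) j ` compositions i (l - j). ?P (Suc i) js) =
        hx \<alpha> j \<otimes>\<^bsub>K\<^esub> pw (hx \<alpha>) i (l - j)"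
      using Suc.IH[OF lj] aj by simp
  qed (use \<alpha> in auto)
  also have "\<dots> = (\<Oplus>\<^bsub>K\<^esub>j\<in>{..l}. hx \<alpha> j \<otimes>\<^bsub>K\<^esub> pw (hx \<alpha>) i (l - j))"
    by (rule K.add.finprod_mono_neutral_cong_left) (use \<alpha> in \<open>auto simp: not_less_eq_eq\<close>)
  finally show ?case by simp
qed

text \<open>The multiplication of \<open>H_group\<close> is substitution of polynomials without constant term.\<close>

lemma pev_comp:
  assumes \<phi>: "\<phi> \<in> alg_auts K A" and \<alpha>: "\<alpha> \<in> carrier H" and \<beta>: "\<beta> \<in> carrier H" and \<phi>x: "\<phi> x = pev \<beta>"
  shows "\<beta> \<otimes>\<^bsub>H\<^esub> \<alpha> \<in> carrier H" and "\<phi> (pev \<alpha>) = pev (\<beta> \<otimes>\<^bsub>H\<^esub> \<alpha>)"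
proof -
  have hom: "\<phi> \<in> ring_hom A A" and lin: "\<And>c y. \<lbrakk>c \<in> carrier K; y \<in> carrier A\<rbrakk> \<Longrightarrow> \<phi> (c \<odot> y) = c \<odot> \<phi> y"
    using \<phi> by (auto simp: alg_auts_def)
  have \<phi>c: "\<phi> y \<in> carrier A" if "y \<in> carrier A" for y using ring_hom_closed[OF hom that] .
  have \<phi>pow: "\<phi> (x [^] i) = pev \<beta> [^] i" for i :: nat
  proof (induction i)
    case 0
    then show ?case using ring_hom_one[OF hom] by simp
  next
    case (Suc i)
    then show ?case using ring_hom_mult[OF hom, of "x [^] i" x] \<phi>x by simp
  qed
  have \<phi>sum: "\<phi> (\<Oplus>i\<in>I. f i) = (\<Oplus>i\<in>I. \<phi> (f i))" if "finite I" "f \<in> I \<rightarrow> carrier A" for I and f :: "nat \<Rightarrow> 'a"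
    using that
  proof (induction I)
    case empty
    show ?case using ring_hom_zero[OF hom A.ring_axioms A.ring_axioms] by simp
  next
    case (insert i I)
    then have "f \<in> I \<rightarrow> carrier A" "f i \<in> carrier A" "(\<lambda>i. \<phi> (f i)) \<in> I \<rightarrow> carrier A" using \<phi>c by auto
    then show ?case using insert \<phi>c ring_hom_add[OF hom] by (simp add: A.finsum_closed)
  qed
  have mult: "(\<beta> \<otimes>\<^bsub>H\<^esub> \<alpha>) l = (\<Oplus>\<^bsub>K\<^esub>i\<in>{1..l}. \<alpha> i \<otimes>\<^bsub>K\<^esub> pw (hx \<beta>) i l)" if l: "l \<in> {1..m}" for l
  proof -
    have "(\<beta> \<otimes>\<^bsub>H\<^esub> \<alpha>) l = (\<Oplus>\<^bsub>K\<^esub>i\<in>{1..l}. \<alpha> i \<otimes>\<^bsub>K\<^esub>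
       (\<Oplus>\<^bsub>K\<^esub>js\<in>compositions i l. \<Otimes>\<^bsub>K\<^esub>s\<in>{..<i}. \<beta> (js ! s)))"
      using l by (simp add: H_group_def)
    then show ?thesis using pw_compositions[OF \<beta>, of l] l by simp
  qed
  have \<alpha>K: "\<alpha> i \<in> carrier K" if "i \<in> {1..m}" for i using \<alpha> that by (auto simp: H_carrier)
  have pwc: "pw (hx \<beta>) i l \<in> carrier K" for i l using \<beta> by simp
  have closed: "(\<Oplus>\<^bsub>K\<^esub>i\<in>{1..l}. \<alpha> i \<otimes>\<^bsub>K\<^esub> pw (hx \<beta>) i l) \<in> carrier K" if "l \<in> {1..m}" for l
    using that \<alpha>K \<beta> by (intro K.finsum_closed) auto
  have "(\<beta> \<otimes>\<^bsub>H\<^esub> \<alpha>) 1 = \<alpha> 1 \<otimes>\<^bsub>K\<^esub> \<beta> 1"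
    using mult[of 1] m \<alpha>K[of 1] \<beta> pw_diag[of "hx \<beta>" 1] hx_1[of \<beta>] hx_closed[OF \<beta>, of 1]
    by (simp del: pw.simps)
  moreover have "\<alpha> 1 \<otimes>\<^bsub>K\<^esub> \<beta> 1 \<noteq> \<zero>\<^bsub>K\<^esub>"
  proof
    assume "\<alpha> 1 \<otimes>\<^bsub>K\<^esub> \<beta> 1 = \<zero>\<^bsub>K\<^esub>"
    then have "\<alpha> 1 = \<zero>\<^bsub>K\<^esub> \<or> \<beta> 1 = \<zero>\<^bsub>K\<^esub>"
      using \<alpha>K[of 1] m \<beta> by (intro K.integral) (auto simp: H_carrier)
    then show False using \<alpha> \<beta> by (auto simp: H_carrier)
  qed
  moreover have "(\<beta> \<otimes>\<^bsub>H\<^esub> \<alpha>) \<in> extensional {1..m}" by (simp add: H_group_def)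
  ultimately show mH: "\<beta> \<otimes>\<^bsub>H\<^esub> \<alpha> \<in> carrier H"
    using mult closed by (auto simp: H_carrier PiE_def)
  have "\<phi> (pev \<alpha>) = (\<Oplus>i\<in>{..m}. \<phi> (hx \<alpha> i \<odot> x [^] i))"
    unfolding ps_def[of "hx \<alpha>"] using \<alpha> by (intro \<phi>sum) auto
  also have "\<dots> = (\<Oplus>i\<in>{..m}. ps (\<lambda>l. hx \<alpha> i \<otimes>\<^bsub>K\<^esub> pw (hx \<beta>) i l))"
    using \<alpha> \<beta> by (intro A.finsum_cong') (auto simp: lin \<phi>pow ps_pow ps_smult)
  also have "\<dots> = ps (\<lambda>l. \<Oplus>\<^bsub>K\<^esub>i\<in>{..m}. hx \<alpha> i \<otimes>\<^bsub>K\<^esub> pw (hx \<beta>) i l)"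
    using \<alpha> \<beta> by (intro ps_finsum) auto
  also have "\<dots> = pev (\<beta> \<otimes>\<^bsub>H\<^esub> \<alpha>)"
  proof (rule ps_cong)
    fix l assume l: "l \<le> m"
    show "(\<Oplus>\<^bsub>K\<^esub>i\<in>{..m}. hx \<alpha> i \<otimes>\<^bsub>K\<^esub> pw (hx \<beta>) i l) = hx (\<beta> \<otimes>\<^bsub>H\<^esub> \<alpha>) l"
    proof (cases "l = 0")
      case True
      have "hx \<alpha> i \<otimes>\<^bsub>K\<^esub> pw (hx \<beta>) i l = \<zero>\<^bsub>K\<^esub>" for i
        using \<alpha> \<beta> True pw_below[of "hx \<beta>" l i] by (cases "i = 0") auto
      then show ?thesis using True by simp
    next
      case False
      then have l': "l \<in> {1..m}" using l by auto
      have "(\<Oplus>\<^bsub>K\<^esub>i\<in>{..m}. hx \<alpha> i \<otimes>\<^bsub>K\<^esub> pw (hx \<beta>) i l) = (\<Oplus>\<^bsub>K\<^esub>i\<in>{1..l}. \<alpha> i \<otimes>\<^bsub>K\<^esub> pw (hx \<beta>) i l)"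
      proof (rule K.add.finprod_mono_neutral_cong_right)
        fix i assume "i \<in> {..m} - {1..l}"
        then show "hx \<alpha> i \<otimes>\<^bsub>K\<^esub> pw (hx \<beta>) i l = \<zero>\<^bsub>K\<^esub>"
          using \<alpha> \<beta> pw_below[of "hx \<beta>" l i] by (cases "i = 0") auto
      qed (use l' \<alpha>K pwc in \<open>auto simp: hx_def\<close>)
      then show ?thesis using mult[OF l'] l' by (simp add: hx_def)
    qed
  qed (use mH in simp)
  finally show "\<phi> (pev \<alpha>) = pev (\<beta> \<otimes>\<^bsub>H\<^esub> \<alpha>)" .
qed

text \<open>Only the product of the \<open>m\<close> linear terms survives, all others have degree
  above \<open>m\<close>. This is the origin of the factor by which \<open>ex_Fix\<close> rescales
  the socles.\<close>

lemma pev_pow_top: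
  assumes "\<alpha> \<in> carrier H"
  shows "pev \<alpha> [^] m = (\<alpha> 1 [^]\<^bsub>K\<^esub> m) \<odot> x [^] m"
proof -
  have c: "\<alpha> 1 \<in> carrier K" using assms m by (auto simp: H_carrier)
  have "pev \<alpha> [^] m = ps (pw (hx \<alpha>) m)" using assms by (intro ps_pow) auto
  also have "\<dots> = ps (\<lambda>l. if m = l then \<alpha> 1 [^]\<^bsub>K\<^esub> m else \<zero>\<^bsub>K\<^esub>)"
    using assms c pw_below[of "hx \<alpha>"] pw_diag[of "hx \<alpha>" m] hx_1[of \<alpha>]
    by (intro ps_cong) (auto simp: order_le_less simp del: pw.simps)
  finally show ?thesis using ps_single[of m "\<alpha> 1 [^]\<^bsub>K\<^esub> m"] c by simp
qed

text \<open>
  An automorphism sends \<open>x\<close> to a polynomial in \<open>x\<close> without constant term as soon as it sends it to a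
  polynomial in \<open>x\<close>, since \<open>x\<close> is nilpotent; the linear coefficient is nonzero since \<open>x\<^sup>m \<noteq> 0\<close>.
\<close>

lemma aut_coefficients:
  assumes \<phi>: "\<phi> \<in> alg_auts K A" and c: "\<And>l. c l \<in> carrier K" and "c 0 = \<zero>\<^bsub>K\<^esub>" and \<phi>x: "\<phi> x = ps c"
  shows "\<exists>\<alpha>\<in>carrier H. \<phi> x = pev \<alpha>"
proof -
  have hom: "\<phi> \<in> ring_hom A A" and bij: "inj_on \<phi> (carrier A)"
    using \<phi> by (auto simp: alg_auts_def Bij_def bij_betw_def)
  have \<phi>pow: "\<phi> (x [^] i) = ps c [^] i" for i :: nat
  proof (induction i)
    case 0
    then show ?case using ring_hom_one[OF hom] by simp
  next
    case (Suc i)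
    then show ?case using ring_hom_mult[OF hom, of "x [^] i" x] \<phi>x by simp
  qed
  let ?\<alpha> = "\<lambda>l\<in>{1..m}. c l"
  have eq: "ps c = pev ?\<alpha>" using assms by (intro ps_cong) (auto simp: hx_def not_less_eq_eq)
  \<comment> \<open>Without a linear term the m-th power of the image would only have terms of
    degree above \<open>m\<close>, and the nonzero \<open>x [^] m\<close> would be sent to
    zero.\<close>
  have "c 1 \<noteq> \<zero>\<^bsub>K\<^esub>"
  proof
    assume c1: "c 1 = \<zero>\<^bsub>K\<^esub>"
    have "pw c m l = \<zero>\<^bsub>K\<^esub>" if "l \<le> m" for l
      using that pw_below[of c l m] pw_diag[of c m] assms(3) c c1 m
      by (cases "l = m") (auto simp: K.nat_pow_zero simp del: pw.simps)
    then have "ps (pw c m) = ps (\<lambda>l. \<zero>\<^bsub>K\<^esub>)" by (intro ps_cong) auto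
    then have "\<phi> (x [^] m) = \<zero>" using \<phi>pow[of m] ps_pow[of c m] c ps_zero by simp
    also have "\<zero> = \<phi> \<zero>" using ring_hom_zero[OF hom A.ring_axioms A.ring_axioms] by simp
    finally show False using bij x_pow by (auto dest: inj_onD)
  qed
  then have "?\<alpha> \<in> carrier H" using c m by (auto simp: H_carrier)
  then show ?thesis using eq \<phi>x by auto
qed

definition coeffs :: "('a \<Rightarrow> 'a) \<Rightarrow> nat \<Rightarrow> 'k"
  where "coeffs \<phi> = (THE \<alpha>. \<alpha> \<in> carrier H \<and> \<phi> x = pev \<alpha>)"

lemma coeffsI: "\<lbrakk>\<alpha> \<in> carrier H; \<phi> x = pev \<alpha>\<rbrakk> \<Longrightarrow> coeffs \<phi> = \<alpha>"
  unfolding coeffs_def using pev_inj by (intro the_equality) auto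

lemma coeffs_compose:
  assumes \<phi>: "\<phi> \<in> alg_auts K A" and \<alpha>: "\<alpha> \<in> carrier H" "\<psi> x = pev \<alpha>" and \<beta>: "\<beta> \<in> carrier H" "\<phi> x = pev \<beta>"
  shows "coeffs (compose (carrier A) \<phi> \<psi>) = coeffs \<phi> \<otimes>\<^bsub>H\<^esub> coeffs \<psi>"
  using pev_comp[OF \<phi> \<alpha>(1) \<beta>] coeffsI[of \<alpha> \<psi>, OF \<alpha>] coeffsI[of \<beta> \<phi>, OF \<beta>] \<alpha>(2)
  by (intro coeffsI) (auto simp: compose_eq)

end

section \<open>Automorphism groups\<close>

text \<open>Both groups are images of one set under maps with equal fibres. This allows classes of
  automorphisms to be compared with coefficient tuples through representatives.\<close>

lemma is_iso_of_surjections: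
  assumes f: "f ` S = carrier G" and g: "g ` S = carrier H"
    and fibre: "\<And>x y. \<lbrakk>x \<in> S; y \<in> S\<rbrakk> \<Longrightarrow> f x = f y \<longleftrightarrow> g x = g y"
    and closed: "\<And>x y. \<lbrakk>x \<in> S; y \<in> S\<rbrakk> \<Longrightarrow> p x y \<in> S"
    and fp: "\<And>x y. \<lbrakk>x \<in> S; y \<in> S\<rbrakk> \<Longrightarrow> f (p x y) = f x \<otimes>\<^bsub>G\<^esub> f y"
    and gp: "\<And>x y. \<lbrakk>x \<in> S; y \<in> S\<rbrakk> \<Longrightarrow> g (p x y) = g x \<otimes>\<^bsub>H\<^esub> g y"
  shows "G \<cong> H"
proof -
  define h where "h c = g (SOME x. x \<in> S \<and> f x = c)" for c
  have h: "h (f x) = g x" if "x \<in> S" for x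
  proof -
    have "(SOME y. y \<in> S \<and> f y = f x) \<in> S \<and> f (SOME y. y \<in> S \<and> f y = f x) = f x"
      by (rule someI[of _ x]) (use that in simp)
    then show ?thesis unfolding h_def using fibre[OF _ that] by blast
  qed
  have "h \<in> hom G H"
  proof (rule homI)
    fix c assume "c \<in> carrier G"
    then obtain x where "x \<in> S" "c = f x" using f by blast
    then show "h c \<in> carrier H" using h g by auto
    fix d assume "d \<in> carrier G"
    then obtain y where "y \<in> S" "d = f y" using f by blast
    then show "h (c \<otimes>\<^bsub>G\<^esub> d) = h c \<otimes>\<^bsub>H\<^esub> h d"
      using \<open>x \<in> S\<close> \<open>c = f x\<close> h fp gp closed by metis
  qed
  moreover have "inj_on h (carrier G)"
  proof (rule inj_onI)
    fix c d assume "c \<in> carrier G" "d \<in> carrier G" "h c = h d"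
    moreover from this obtain x y where "x \<in> S" "c = f x" "y \<in> S" "d = f y" using f by blast
    ultimately show "c = d" using h fibre by simp
  qed
  moreover have "h ` carrier G = carrier H"
    using h unfolding f[symmetric] g[symmetric] by (auto simp: image_iff)
  ultimately have "h \<in> iso G H" by (simp add: iso_def bij_betw_def)
  then show ?thesis by (auto simp: is_iso_def)
qed

context kalg
begin

lemma pow_nonzero:
  fixes i :: nat
  assumes "c \<in> carrier K" "c \<noteq> \<zero>\<^bsub>K\<^esub>"
  shows "c [^]\<^bsub>K\<^esub> i \<noteq> \<zero>\<^bsub>K\<^esub>"
  using assms by (induction i) (auto simp: K.integral_iff)

lemma alg_autD:
  assumes "\<phi> \<in> alg_auts K A"
  shows "y \<in> carrier A \<Longrightarrow> \<phi> y \<in> carrier A"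
    and "\<lbrakk>y \<in> carrier A; z \<in> carrier A\<rbrakk> \<Longrightarrow> \<phi> (y \<otimes> z) = \<phi> y \<otimes> \<phi> z"
    and "\<lbrakk>y \<in> carrier A; z \<in> carrier A\<rbrakk> \<Longrightarrow> \<phi> (y \<oplus> z) = \<phi> y \<oplus> \<phi> z"
    and "\<phi> \<one> = \<one>" and "\<phi> \<zero> = \<zero>"
    and "\<lbrakk>c \<in> carrier K; y \<in> carrier A\<rbrakk> \<Longrightarrow> \<phi> (c \<odot> y) = c \<odot> \<phi> y"
    and "bij_betw \<phi> (carrier A) (carrier A)" and "\<phi> \<in> extensional (carrier A)"
  using assms ring_hom_zero[OF _ A.ring_axioms A.ring_axioms, of \<phi>]
  by (auto simp: alg_auts_def Bij_def ring_hom_def)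

lemma alg_autI:
  assumes "\<And>y. y \<in> carrier A \<Longrightarrow> \<phi> y \<in> carrier A"
    and "\<And>y z. \<lbrakk>y \<in> carrier A; z \<in> carrier A\<rbrakk> \<Longrightarrow> \<phi> (y \<otimes> z) = \<phi> y \<otimes> \<phi> z"
    and "\<And>y z. \<lbrakk>y \<in> carrier A; z \<in> carrier A\<rbrakk> \<Longrightarrow> \<phi> (y \<oplus> z) = \<phi> y \<oplus> \<phi> z"
    and "\<phi> \<one> = \<one>"
    and "\<And>c y. \<lbrakk>c \<in> carrier K; y \<in> carrier A\<rbrakk> \<Longrightarrow> \<phi> (c \<odot> y) = c \<odot> \<phi> y"
    and "bij_betw \<phi> (carrier A) (carrier A)" and "\<phi> \<in> extensional (carrier A)"
  shows "\<phi> \<in> alg_auts K A"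
  using assms by (auto simp: alg_auts_def Bij_def ring_hom_def)

lemma alg_auts_compose:
  assumes "\<phi> \<in> alg_auts K A" "\<psi> \<in> alg_auts K A"
  shows "compose (carrier A) \<phi> \<psi> \<in> alg_auts K A"
  using alg_autD[OF assms(1)] alg_autD[OF assms(2)]
  by (intro alg_autI) (auto simp: compose_eq intro: bij_betw_compose)

lemma alg_auts_inverse:
  assumes \<phi>: "\<phi> \<in> alg_auts K A"
  shows "(\<lambda>x\<in>carrier A. inv_into (carrier A) \<phi> x) \<in> alg_auts K A"
    and "x \<in> carrier A \<Longrightarrow> \<phi> (inv_into (carrier A) \<phi> x) = x"
proof -
  note D = alg_autD[OF \<phi>]
  let ?g = "inv_into (carrier A) \<phi>"
  have bij: "bij_betw ?g (carrier A) (carrier A)" using bij_betw_inv_into[OF D(7)] .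
  have g: "?g x \<in> carrier A" "\<phi> (?g x) = x" if "x \<in> carrier A" for x
    using that D(7) bij by (auto simp: bij_betw_def f_inv_into_f)
  then show "x \<in> carrier A \<Longrightarrow> \<phi> (?g x) = x" by blast
  have inj: "y = z" if "y \<in> carrier A" "z \<in> carrier A" "\<phi> y = \<phi> z" for y z
    using that D(7) by (auto simp: bij_betw_def dest: inj_onD)
  have "?g (y \<otimes> z) = ?g y \<otimes> ?g z" if "y \<in> carrier A" "z \<in> carrier A" for y z
    by (rule inj) (use that g D(2) in simp_all)
  moreover have "?g (y \<oplus> z) = ?g y \<oplus> ?g z" if "y \<in> carrier A" "z \<in> carrier A" for y z
    by (rule inj) (use that g D(3) in simp_all)
  moreover have "?g (c \<odot> y) = c \<odot> ?g y" if "c \<in> carrier K" "y \<in> carrier A" for c y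
    by (rule inj) (use that g D(6) in simp_all)
  moreover have "?g \<one> = \<one>" by (rule inj) (use g D(4) in simp_all)
  moreover have "bij_betw (\<lambda>x\<in>carrier A. ?g x) (carrier A) (carrier A)"
    using bij by (subst bij_betw_cong[where g = ?g]) simp_all
  ultimately show "(\<lambda>x\<in>carrier A. ?g x) \<in> alg_auts K A"
    using g(1) by (intro alg_autI) simp_all
qed

lemma alg_auts_id: "(\<lambda>x\<in>carrier A. x) \<in> alg_auts K A"
  by (rule alg_autI) (auto simp: bij_betw_def inj_on_def)

lemma alg_aut_mult: "\<lbrakk>\<phi> \<in> alg_auts K A; \<psi> \<in> alg_auts K A\<rbrakk> \<Longrightarrow>
    \<phi> \<otimes>\<^bsub>alg_aut_group K A\<^esub> \<psi> = compose (carrier A) \<phi> \<psi>"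
  by (simp add: alg_aut_group_def BijGroup_def alg_auts_def)

lemma alg_aut_carrier: "carrier (alg_aut_group K A) = alg_auts K A"
  by (simp add: alg_aut_group_def)

lemma alg_aut_one: "\<one>\<^bsub>alg_aut_group K A\<^esub> = (\<lambda>x\<in>carrier A. x)"
  by (simp add: alg_aut_group_def BijGroup_def)

lemma alg_aut_group: "group (alg_aut_group K A)"
proof -
  have "subgroup (alg_auts K A) (BijGroup (carrier A))"
  proof (rule subgroup.intro)
    show "alg_auts K A \<subseteq> carrier (BijGroup (carrier A))" by (auto simp: alg_auts_def BijGroup_def)
    show "\<phi> \<otimes>\<^bsub>BijGroup (carrier A)\<^esub> \<psi> \<in> alg_auts K A" if "\<phi> \<in> alg_auts K A" "\<psi> \<in> alg_auts K A" for \<phi> \<psi>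
      using alg_auts_compose[OF that] that by (simp add: BijGroup_def alg_auts_def)
    show "\<one>\<^bsub>BijGroup (carrier A)\<^esub> \<in> alg_auts K A" using alg_auts_id by (simp add: BijGroup_def)
    show "inv\<^bsub>BijGroup (carrier A)\<^esub> \<phi> \<in> alg_auts K A" if "\<phi> \<in> alg_auts K A" for \<phi>
      using alg_auts_inverse(1)[OF that] inv_BijGroup[of \<phi> "carrier A"] that by (simp add: alg_auts_def)
  qed
  then show ?thesis
    unfolding alg_aut_group_def by (rule subgroup.subgroup_is_group[OF _ group_BijGroup])
qed

definition inner :: "'a \<Rightarrow> 'a \<Rightarrow> 'a"
  where "inner u = (\<lambda>x\<in>carrier A. u \<otimes> x \<otimes> inv u)"

lemma inner_auts_eq: "inner_auts A = inner ` Units A"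
  by (auto simp: inner_auts_def inner_def)

lemma inner_compose:
  assumes "u \<in> Units A" "v \<in> Units A"
  shows "compose (carrier A) (inner u) (inner v) = inner (u \<otimes> v)"
proof -
  have c: "u \<in> carrier A" "inv u \<in> carrier A" "v \<in> carrier A" "inv v \<in> carrier A" using assms by auto
  have "u \<otimes> (v \<otimes> (inv v \<otimes> inv u)) = u \<otimes> ((v \<otimes> inv v) \<otimes> inv u)" using c by (simp only: A.m_assoc A.m_closed)
  then have 1: "(u \<otimes> v) \<otimes> (inv v \<otimes> inv u) = \<one>" using assms c by (simp add: A.m_assoc)
  have "inv v \<otimes> (inv u \<otimes> (u \<otimes> v)) = inv v \<otimes> ((inv u \<otimes> u) \<otimes> v)" using c by (simp only: A.m_assoc A.m_closed)
  then have 2: "(inv v \<otimes> inv u) \<otimes> (u \<otimes> v) = \<one>" using assms c by (simp add: A.m_assoc)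
  have "inv (u \<otimes> v) = inv v \<otimes> inv u" using A.inv_unique'[OF _ _ 1 2] c by simp
  then show ?thesis using c by (simp add: compose_def inner_def fun_eq_iff A.m_assoc)
qed

lemma inner_one: "inner \<one> = (\<lambda>x\<in>carrier A. x)"
  by (auto simp: inner_def fun_eq_iff)

lemma inner_aut:
  assumes u: "u \<in> Units A"
  shows "inner u \<in> alg_auts K A"
proof (rule alg_autI)
  have uc: "u \<in> carrier A" "inv u \<in> carrier A" using u by auto
  have iu: "inv u \<otimes> (u \<otimes> z) = z" if "z \<in> carrier A" for z
    using u uc that by (simp add: A.m_assoc[symmetric])
  show "inner u (y \<otimes> z) = inner u y \<otimes> inner u z" if "y \<in> carrier A" "z \<in> carrier A" for y z
    using that uc iu by (simp add: inner_def A.m_assoc)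
  show "inner u (y \<oplus> z) = inner u y \<oplus> inner u z" if "y \<in> carrier A" "z \<in> carrier A" for y z
    using that uc by (simp add: inner_def A.r_distr A.l_distr)
  show "inner u (c \<odot> y) = c \<odot> inner u y" if "c \<in> carrier K" "y \<in> carrier A" for c y
    using that uc by (simp add: inner_def smult_mult_r smult_mult_l)
  show "inner u \<one> = \<one>" using u uc by (simp add: inner_def)
  have v: "inv u \<in> Units A" using u by simp
  have 1: "inner (inv u) (inner u y) = y" "inner u (inner (inv u) y) = y" if "y \<in> carrier A" for y
    using inner_compose[OF v u] inner_compose[OF u v] inner_one that u
    by (auto simp: compose_def fun_eq_iff dest!: spec[of _ y] split: if_splits)
  have c: "inner w y \<in> carrier A" if "w \<in> Units A" "y \<in> carrier A" for w y
    using that by (auto simp: inner_def)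
  show "bij_betw (inner u) (carrier A) (carrier A)"
    by (rule bij_betw_byWitness[of _ "inner (inv u)"]) (use 1 c u v in auto)
qed (use u in \<open>auto simp: inner_def\<close>)

lemma aut_inner:
  assumes \<phi>: "\<phi> \<in> alg_auts K A" and u: "u \<in> Units A"
  shows "\<phi> u \<in> Units A" and "compose (carrier A) \<phi> (inner u) = compose (carrier A) (inner (\<phi> u)) \<phi>"
proof -
  note D = alg_autD[OF \<phi>]
  have uc: "u \<in> carrier A" "inv u \<in> carrier A" using u by auto
  have 1: "\<phi> u \<otimes> \<phi> (inv u) = \<one>" "\<phi> (inv u) \<otimes> \<phi> u = \<one>"
    using D(2)[OF uc] D(2)[OF uc(2,1)] D(4) u by auto
  then show U: "\<phi> u \<in> Units A" using D(1) uc by (auto simp: Units_def)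
  have "inv (\<phi> u) = \<phi> (inv u)" using A.inv_unique'[OF _ _ 1] D(1) uc by metis
  then show "compose (carrier A) \<phi> (inner u) = compose (carrier A) (inner (\<phi> u)) \<phi>"
    using D(1,2) uc by (auto simp: compose_def inner_def fun_eq_iff)
qed

text \<open>By \<open>aut_inner\<close>, conjugating the inner automorphism of \<open>u\<close> by
  \<phi> gives the inner automorphism of \<open>\<phi> u\<close>.\<close>

lemma inner_auts_normal: "inner_auts A \<lhd> alg_aut_group K A"
proof -
  interpret G: group "alg_aut_group K A" by (rule alg_aut_group)
  have in_aut: "\<phi> \<in> alg_auts K A" if "\<phi> \<in> inner_auts A" for \<phi> using that inner_aut by (auto simp: inner_auts_eq)
  have sub: "subgroup (inner_auts A) (alg_aut_group K A)"
  proof (rule G.subgroupI)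
    show "inner_auts A \<subseteq> carrier (alg_aut_group K A)" using in_aut by (auto simp: alg_aut_carrier)
    show "inner_auts A \<noteq> {}" by (auto simp: inner_auts_eq)
    show "\<phi> \<otimes>\<^bsub>alg_aut_group K A\<^esub> \<psi> \<in> inner_auts A" if "\<phi> \<in> inner_auts A" "\<psi> \<in> inner_auts A" for \<phi> \<psi>
      using that in_aut alg_aut_mult inner_compose by (auto simp: inner_auts_eq)
    show "inv\<^bsub>alg_aut_group K A\<^esub> \<phi> \<in> inner_auts A" if "\<phi> \<in> inner_auts A" for \<phi>
    proof -
      obtain u where u: "u \<in> Units A" "\<phi> = inner u" using \<open>\<phi> \<in> _\<close> by (auto simp: inner_auts_eq)
      have v: "inv u \<in> Units A" using u by simp
      have "inner (inv u) \<otimes>\<^bsub>alg_aut_group K A\<^esub> \<phi> = \<one>\<^bsub>alg_aut_group K A\<^esub>"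
        using u v inner_aut alg_aut_mult inner_compose[OF v u(1)] inner_one by (simp add: alg_aut_one)
      then have "inv\<^bsub>alg_aut_group K A\<^esub> \<phi> = inner (inv u)"
        using G.inv_equality u v inner_aut by (simp add: alg_aut_carrier)
      then show ?thesis using v by (auto simp: inner_auts_eq)
    qed
  qed
  moreover have "\<phi> \<otimes>\<^bsub>alg_aut_group K A\<^esub> h \<otimes>\<^bsub>alg_aut_group K A\<^esub> inv\<^bsub>alg_aut_group K A\<^esub> \<phi> \<in> inner_auts A"
    if \<phi>: "\<phi> \<in> carrier (alg_aut_group K A)" and h: "h \<in> inner_auts A" for \<phi> h
  proof -
    obtain u where u: "u \<in> Units A" "h = inner u" using h by (auto simp: inner_auts_eq)
    have \<phi>a: "\<phi> \<in> alg_auts K A" using \<phi> by (simp add: alg_aut_carrier)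
    note i = aut_inner[OF \<phi>a u(1)]
    have "\<phi> \<otimes>\<^bsub>alg_aut_group K A\<^esub> h = inner (\<phi> u) \<otimes>\<^bsub>alg_aut_group K A\<^esub> \<phi>"
      using i u \<phi>a inner_aut alg_aut_mult by simp
    then have "\<phi> \<otimes>\<^bsub>alg_aut_group K A\<^esub> h \<otimes>\<^bsub>alg_aut_group K A\<^esub> inv\<^bsub>alg_aut_group K A\<^esub> \<phi> = inner (\<phi> u)"
      using \<phi> i(1) inner_aut G.m_assoc by (simp add: alg_aut_carrier[symmetric] G.r_inv)
    then show ?thesis using i(1) by (auto simp: inner_auts_eq)
  qed
  ultimately show ?thesis by (simp add: G.normal_inv_iff)
qed

lemma inner_coset_eq_iff:
  assumes \<phi>: "\<phi> \<in> alg_auts K A" and \<psi>: "\<psi> \<in> alg_auts K A"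
  shows "inner_auts A #>\<^bsub>alg_aut_group K A\<^esub> \<phi> = inner_auts A #>\<^bsub>alg_aut_group K A\<^esub> \<psi> \<longleftrightarrow>
    (\<exists>u\<in>Units A. \<phi> = compose (carrier A) (inner u) \<psi>)"
proof -
  interpret N: normal "inner_auts A" "alg_aut_group K A" by (rule inner_auts_normal)
  have c: "\<phi> \<in> carrier (alg_aut_group K A)" "\<psi> \<in> carrier (alg_aut_group K A)" using assms by (auto simp: alg_aut_carrier)
  have mem: "\<phi> \<in> inner_auts A #>\<^bsub>alg_aut_group K A\<^esub> \<psi> \<longleftrightarrow> (\<exists>u\<in>Units A. \<phi> = compose (carrier A) (inner u) \<psi>)"
    using \<psi> inner_aut alg_aut_mult by (auto simp: r_coset_def inner_auts_eq)
  show ?thesis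
    using mem N.rcos_self[OF c(1) N.is_subgroup] N.repr_independence[OF _ c(2) N.is_subgroup] by metis
qed

lemma OutK_mult:
  assumes "\<phi> \<in> alg_auts K A" "\<psi> \<in> alg_auts K A"
  shows "(inner_auts A #>\<^bsub>alg_aut_group K A\<^esub> \<phi>) \<otimes>\<^bsub>OutK K A\<^esub> (inner_auts A #>\<^bsub>alg_aut_group K A\<^esub> \<psi>) =
    inner_auts A #>\<^bsub>alg_aut_group K A\<^esub> compose (carrier A) \<phi> \<psi>"
  using normal.rcos_sum[OF inner_auts_normal, of \<phi> \<psi>] assms alg_aut_mult
  by (simp add: OutK_def Out_def FactGroup_def alg_aut_carrier)

end


section \<open>Truncated polynomials\<close>

context nilpotent_element
begin

lemma x_ps:
  assumes g: "\<And>l. g l \<in> carrier K"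
  shows "x \<otimes> ps g = ps (\<lambda>l. if l = 0 then \<zero>\<^bsub>K\<^esub> else g (l - 1))"
proof -
  let ?d = "\<lambda>l::nat. if 1 = l then \<one>\<^bsub>K\<^esub> else \<zero>\<^bsub>K\<^esub>"
  have "ps ?d = \<one>\<^bsub>K\<^esub> \<odot> x [^] (1::nat)" by (rule ps_single) (use m in auto)
  then have "x \<otimes> ps g = ps ?d \<otimes> ps g" by simp
  also have "\<dots> = ps (\<lambda>l. \<Oplus>\<^bsub>K\<^esub>i\<in>{..l}. ?d i \<otimes>\<^bsub>K\<^esub> g (l - i))" by (rule ps_mult) (use g in auto)
  also have "\<dots> = ps (\<lambda>l. if l = 0 then \<zero>\<^bsub>K\<^esub> else g (l - 1))"
  proof (rule ps_cong)
    fix l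
    have "(\<Oplus>\<^bsub>K\<^esub>i\<in>{..l}. ?d i \<otimes>\<^bsub>K\<^esub> g (l - i)) = (\<Oplus>\<^bsub>K\<^esub>i\<in>{..l}. if 1 = i then g (l - i) else \<zero>\<^bsub>K\<^esub>)"
      using g by (intro K.finsum_cong') auto
    also have "\<dots> = (if l = 0 then \<zero>\<^bsub>K\<^esub> else g (l - 1))"
    proof (cases "l = 0")
      case False
      then show ?thesis using K.finsum_singleton[of 1 "{..l}" "\<lambda>i. g (l - i)"] g by simp
    qed simp
    finally show "(\<Oplus>\<^bsub>K\<^esub>i\<in>{..l}. ?d i \<otimes>\<^bsub>K\<^esub> g (l - i)) = (if l = 0 then \<zero>\<^bsub>K\<^esub> else g (l - 1))" .
  qed (use g in auto)
  finally show ?thesis .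
qed

lemma ps_commute:
  assumes g: "\<And>l. g l \<in> carrier K" and u: "u \<in> carrier A" "u \<otimes> x = x \<otimes> u"
  shows "u \<otimes> ps g = ps g \<otimes> u"
proof -
  have pow: "u \<otimes> x [^] l = x [^] l \<otimes> u" for l :: nat
  proof (induction l)
    case (Suc l)
    have "u \<otimes> x [^] Suc l = (u \<otimes> x [^] l) \<otimes> x" using u by (simp add: A.m_assoc)
    also have "\<dots> = x [^] l \<otimes> (u \<otimes> x)" using Suc u by (simp add: A.m_assoc)
    finally show ?case using u by (simp add: A.m_assoc)
  qed (use u in simp)
  have c: "(\<lambda>l. g l \<odot> x [^] l) \<in> {..m} \<rightarrow> carrier A" using g by simp
  have "u \<otimes> ps g = (\<Oplus>l\<in>{..m}. u \<otimes> (g l \<odot> x [^] l))"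
    unfolding ps_def by (rule A.finsum_rdistr[OF _ u(1) c]) simp
  also have "\<dots> = (\<Oplus>l\<in>{..m}. (g l \<odot> x [^] l) \<otimes> u)"
    using g u pow by (intro A.finsum_cong') (auto simp: smult_mult_l smult_mult_r)
  also have "\<dots> = ps g \<otimes> u"
    unfolding ps_def by (rule A.finsum_ldistr[OF _ u(1) c, symmetric]) simp
  finally show ?thesis .
qed

text \<open>Multiplication by \<open>x\<close> shifts the coefficients upwards, so it forces all of
  them below the top one to vanish.\<close>

lemma ps_x_zero:
  assumes g: "\<And>l. g l \<in> carrier K" and z: "ps g \<otimes> x = \<zero>"
  shows "ps g = g m \<odot> x [^] m"
proof -
  have z': "ps (\<lambda>l. if l = 0 then \<zero>\<^bsub>K\<^esub> else g (l - 1)) = \<zero>"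
    using x_ps[of g, OF g] ps_commute[of g x, OF g] z by simp
  have "g i = \<zero>\<^bsub>K\<^esub>" if "i < m" for i
    using ps_eq_zeroD[OF _ z', of "Suc i"] g that by simp
  then have "ps g = ps (\<lambda>l. if m = l then g m else \<zero>\<^bsub>K\<^esub>)" using g by (intro ps_cong) auto
  also have "\<dots> = g m \<odot> x [^] m" by (rule ps_single) (use g in auto)
  finally show ?thesis .
qed

lemma ps_split:
  assumes c: "\<And>l. c l \<in> carrier K"
  shows "ps c = c 0 \<odot> \<one> \<oplus> x \<otimes> ps (\<lambda>l. c (Suc l))"
proof -
  have "x \<otimes> ps (\<lambda>l. c (Suc l)) = ps (\<lambda>l. if l = 0 then \<zero>\<^bsub>K\<^esub> else c (Suc (l - 1)))"
    by (rule x_ps) (rule c)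
  moreover have "c 0 \<odot> \<one> = ps (\<lambda>l. if 0 = l then c 0 else \<zero>\<^bsub>K\<^esub>)" using ps_single[of 0 "c 0"] c by simp
  ultimately have "c 0 \<odot> \<one> \<oplus> x \<otimes> ps (\<lambda>l. c (Suc l)) =
      ps (\<lambda>l. (if 0 = l then c 0 else \<zero>\<^bsub>K\<^esub>) \<oplus>\<^bsub>K\<^esub> (if l = 0 then \<zero>\<^bsub>K\<^esub> else c (Suc (l - 1))))"
    using c by (simp add: ps_add)
  also have "\<dots> = ps c" using c by (intro ps_cong) auto
  finally show ?thesis by simp
qed

lemma powers_total:
  assumes span: "carrier A = sp (range (\<lambda>i::nat. x [^] i))" and "u \<in> carrier A"
  shows "\<exists>c. (\<forall>l. c l \<in> carrier K) \<and> u = ps c"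
proof -
  have sub: "range (\<lambda>i::nat. x [^] i) \<subseteq> carrier A" by auto
  have "u \<in> sp (range (\<lambda>i::nat. x [^] i))" using assms by simp
  then show ?thesis
  proof induction
    case zero
    then show ?case using ps_zero by (intro exI[of _ "\<lambda>l. \<zero>\<^bsub>K\<^esub>"]) simp
  next
    case (step k u y)
    then obtain c i where c: "\<forall>l. c l \<in> carrier K" "y = ps c" "u = x [^] (i::nat)" by auto
    show ?case
    proof (cases "i \<le> m")
      case True
      then have "k \<odot> u = ps (\<lambda>l. if i = l then k else \<zero>\<^bsub>K\<^esub>)" using ps_single step(1) c(3) by simp
      then have "k \<odot> u \<oplus> y = ps (\<lambda>l. (if i = l then k else \<zero>\<^bsub>K\<^esub>) \<oplus>\<^bsub>K\<^esub> c l)"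
        using c step(1) by (simp add: ps_add)
      then show ?thesis using c step(1) by (intro exI[of _ "\<lambda>l. (if i = l then k else \<zero>\<^bsub>K\<^esub>) \<oplus>\<^bsub>K\<^esub> c l"]) auto
    next
      case False
      then have "k \<odot> u \<oplus> y = ps c" using c step(1) pow_zero by simp
      then show ?thesis using c by blast
    qed
  qed
qed

lemma alg_aut_determined:
  assumes span: "carrier A = sp (range (\<lambda>i::nat. x [^] i))"
    and \<phi>: "\<phi> \<in> alg_auts K A" and \<psi>: "\<psi> \<in> alg_auts K A" and eq: "\<phi> x = \<psi> x"
  shows "\<phi> = \<psi>"
proof (rule extensionalityI)
  note D = alg_autD[OF \<phi>] and E = alg_autD[OF \<psi>]
  show "\<phi> \<in> extensional (carrier A)" "\<psi> \<in> extensional (carrier A)" using D(8) E(8) .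
  have pow: "\<phi> (x [^] i) = \<psi> (x [^] i)" for i :: nat
    by (induction i) (use D E eq in simp_all)
  have sub: "range (\<lambda>i::nat. x [^] i) \<subseteq> carrier A" by auto
  fix u assume "u \<in> carrier A"
  then have "u \<in> sp (range (\<lambda>i::nat. x [^] i))" using span by simp
  then show "\<phi> u = \<psi> u"
  proof induction
    case (step k b y)
    then show ?case using D E pow sp_closed[OF sub step(3)] by auto
  qed (use D E in simp)
qed

text \<open>Triangularity: the k-th power of \<open>pev \<alpha>\<close> starts with a nonzero
  multiple of \<open>x [^] k\<close>. Descending induction from the vanishing power
  \<open>x [^] Suc m\<close> recovers the powers of \<open>x\<close>.\<close>

lemma span_pev:
  assumes span: "carrier A = sp (range (\<lambda>i::nat. x [^] i))" and \<alpha>: "\<alpha> \<in> carrier H"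
  shows "carrier A = sp (range (\<lambda>i::nat. pev \<alpha> [^] i))"
proof
  have p: "pev \<alpha> \<in> carrier A" using \<alpha> by simp
  have sub: "range (\<lambda>i::nat. pev \<alpha> [^] i) \<subseteq> carrier A" using p by auto
  have \<alpha>1: "\<alpha> 1 \<in> carrier K" "\<alpha> 1 \<noteq> \<zero>\<^bsub>K\<^esub>" using \<alpha> m by (auto simp: H_carrier)
  let ?V = "sp (range (\<lambda>i::nat. pev \<alpha> [^] i))"
  have "x [^] l \<in> ?V" if "k \<le> l" "k \<le> Suc m" for k l :: nat
    using that(2,1)
  proof (induction k arbitrary: l rule: inc_induct)
    case base
    then show ?case using pow_zero[of l] sp.zero by simp
  next
    case (step k)
    show ?case
    proof (cases "l = k")
      case False
      then show ?thesis using step by simp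
    next
      case True
      have km: "k \<le> m" using step by simp
      \<comment> \<open>What remains of the k-th power after its leading term; terms of degree below
        \<open>k\<close> do not occur.\<close>
      define c where "c l = (if l = k then \<zero>\<^bsub>K\<^esub> else pw (hx \<alpha>) k l)" for l
      have c: "c l \<in> carrier K" for l using \<alpha> by (simp add: c_def)
      have d: "pw (hx \<alpha>) k k = \<alpha> 1 [^]\<^bsub>K\<^esub> k" using pw_diag[of "hx \<alpha>" k] hx_1[of \<alpha>] \<alpha> by (simp del: pw.simps)
      have dK: "\<alpha> 1 [^]\<^bsub>K\<^esub> k \<in> carrier K" using \<alpha>1 by simp
      have d0: "\<alpha> 1 [^]\<^bsub>K\<^esub> k \<noteq> \<zero>\<^bsub>K\<^esub>" using \<alpha>1 by (metis pow_nonzero)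
      have "pev \<alpha> [^] k = ps (\<lambda>l. (if k = l then \<alpha> 1 [^]\<^bsub>K\<^esub> k else \<zero>\<^bsub>K\<^esub>) \<oplus>\<^bsub>K\<^esub> c l)"
        using \<alpha> d dK c by (simp add: ps_pow) (intro ps_cong, auto simp: c_def)
      also have "\<dots> = (\<alpha> 1 [^]\<^bsub>K\<^esub> k) \<odot> x [^] k \<oplus> ps c"
        using ps_single[OF km dK] dK c by (subst ps_add[symmetric]) auto
      finally have eq: "pev \<alpha> [^] k = (\<alpha> 1 [^]\<^bsub>K\<^esub> k) \<odot> x [^] k \<oplus> ps c" .
      have "(\<Oplus>l\<in>D. c l \<odot> x [^] l) \<in> ?V" if "finite D" for D
        using that
      proof (induction D)
        case empty
        then show ?case by (simp add: sp.zero)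
      next
        case (insert i D)
        have "c i \<odot> x [^] i \<in> ?V"
        proof (cases "i \<le> k")
          case True
          then have "c i = \<zero>\<^bsub>K\<^esub>" using pw_below[of "hx \<alpha>" i k] \<alpha> by (simp add: c_def del: pw.simps)
          then show ?thesis by (simp add: sp.zero)
        next
          case False
          then show ?thesis using step.IH[of i] sp_smult[OF sub c] by simp
        qed
        then show ?case using insert c sp_add[OF sub] by (simp add: Pi_iff)
      qed
      then have "ps c \<in> ?V" unfolding ps_def by simp
      moreover have "pev \<alpha> [^] k \<in> ?V" by (rule sp_base[OF sub]) blast
      ultimately have "pev \<alpha> [^] k \<ominus> ps c \<in> ?V" by (rule sp_minus[OF sub, rotated])
      moreover have "pev \<alpha> [^] k \<ominus> ps c = (\<alpha> 1 [^]\<^bsub>K\<^esub> k) \<odot> x [^] k"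
        unfolding eq using dK c by (simp add: A.minus_eq A.a_assoc A.r_neg)
      ultimately have xV: "(\<alpha> 1 [^]\<^bsub>K\<^esub> k) \<odot> x [^] k \<in> ?V" by metis
      have "inv\<^bsub>K\<^esub> (\<alpha> 1 [^]\<^bsub>K\<^esub> k) \<in> carrier K" using dK d0 by (simp add: K.field_Units del: One_nat_def)
      from sp_smult[OF sub this xV] have "x [^] k \<in> ?V"
        unfolding smult_inv_cancel[OF dK d0 A.nat_pow_closed[OF x]] .
      then show ?thesis unfolding True .
    qed
  qed
  from this[of 0] have xV: "range (\<lambda>i::nat. x [^] i) \<subseteq> ?V" by auto
  have "y \<in> ?V" if "y \<in> sp (range (\<lambda>i::nat. x [^] i))" for y
    using that
  proof induction
    case (step k b y)
    then have "b \<in> ?V" using xV by blast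
    from sp_add[OF sub sp_smult[OF sub step(1) this] step.IH] show ?case .
  qed (rule sp.zero)
  then show "carrier A \<subseteq> ?V" using span by auto
  show "?V \<subseteq> carrier A" using sp_closed[OF sub] by auto
qed

lemma pev_nilpotent:
  assumes \<alpha>: "\<alpha> \<in> carrier H"
  shows "nilpotent_element A K (pev \<alpha>) m"
proof (intro nilpotent_element.intro nilpotent_element_axioms.intro kalg_axioms m)
  let ?y = "pev \<alpha>"
  show "?y \<in> carrier A" using \<alpha> by simp
  have \<alpha>1: "\<alpha> 1 \<in> carrier K" "\<alpha> 1 \<noteq> \<zero>\<^bsub>K\<^esub>" using \<alpha> m by (auto simp: H_carrier)
  have ym: "?y [^] m = (\<alpha> 1 [^]\<^bsub>K\<^esub> m) \<odot> x [^] m" by (rule pev_pow_top[OF \<alpha>])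
  show "?y [^] m \<noteq> \<zero>"
  proof
    assume "?y [^] m = \<zero>"
    then have "\<alpha> 1 [^]\<^bsub>K\<^esub> m = \<zero>\<^bsub>K\<^esub>"
      using ym smult_eq_zeroD[OF _ _ _ x_pow] \<alpha>1 by (metis K.nat_pow_closed A.nat_pow_closed x)
    then show False using \<alpha>1 by (metis pow_nonzero)
  qed
  have "?y [^] Suc m = ps (pw (hx \<alpha>) (Suc m))" using \<alpha> by (intro ps_pow) auto
  also have "\<dots> = ps (\<lambda>l. \<zero>\<^bsub>K\<^esub>)"
    using pw_below[of "hx \<alpha>" _ "Suc m"] \<alpha> by (intro ps_cong) (auto simp del: pw.simps)
  finally show "?y [^] Suc m = \<zero>" using ps_zero by simp
qed

text \<open>Substitution of \<open>pev \<alpha>\<close> for \<open>x\<close>: well defined because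
  coefficients up to \<open>m\<close> are unique, and bijective because \<open>pev \<alpha>\<close>
  is again a generator with the same nilpotency.\<close>

lemma ex_alg_aut:
  assumes span: "carrier A = sp (range (\<lambda>i::nat. x [^] i))" and \<alpha>: "\<alpha> \<in> carrier H"
  shows "\<exists>\<phi>\<in>alg_auts K A. \<phi> x = pev \<alpha>"
proof -
  interpret Y: nilpotent_element A K "pev \<alpha>" m by (rule pev_nilpotent[OF \<alpha>])
  define \<phi> where "\<phi> = (\<lambda>u\<in>carrier A. Y.ps (SOME c. (\<forall>l. c l \<in> carrier K) \<and> u = ps c))"
  have \<phi>: "\<phi> (ps c) = Y.ps c" if c: "\<And>l. c l \<in> carrier K" for c
  proof -
    let ?d = "SOME d. (\<forall>l. d l \<in> carrier K) \<and> ps c = ps d"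
    have d: "(\<forall>l. ?d l \<in> carrier K) \<and> ps c = ps ?d" by (rule someI[of _ c]) (use c in simp)
    then have "Y.ps ?d = Y.ps c" using ps_inj[of c ?d] c by (intro Y.ps_cong) auto
    then show ?thesis using c by (simp add: \<phi>_def)
  qed
  note tot = powers_total[OF span] and totY = Y.powers_total[OF span_pev[OF span \<alpha>]]
  let ?d = "\<lambda>i l. if i = l then \<one>\<^bsub>K\<^esub> else \<zero>\<^bsub>K\<^esub>"
  have d: "\<phi> (x [^] i) = pev \<alpha> [^] i" if "i \<le> m" for i :: nat
    using ps_single[OF that, of "\<one>\<^bsub>K\<^esub>"] Y.ps_single[OF that, of "\<one>\<^bsub>K\<^esub>"] \<phi>[of "?d i"] by simp
  have "\<phi> \<in> alg_auts K A"
  proof (rule alg_autI)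
    show \<phi>c: "\<phi> u \<in> carrier A" if u: "u \<in> carrier A" for u
    proof -
      obtain c where c: "\<And>l. c l \<in> carrier K" "u = ps c" using tot[OF u] by auto
      show ?thesis unfolding c(2) \<phi>[OF c(1)] using c(1) by simp
    qed
    show "\<phi> (u \<otimes> w) = \<phi> u \<otimes> \<phi> w" if uw: "u \<in> carrier A" "w \<in> carrier A" for u w
    proof -
      obtain c where c: "\<And>l. c l \<in> carrier K" "u = ps c" using tot[OF uw(1)] by auto
      obtain c' where c': "\<And>l. c' l \<in> carrier K" "w = ps c'" using tot[OF uw(2)] by auto
      show ?thesis unfolding c(2) c'(2) using c(1) c'(1) by (simp add: ps_mult Y.ps_mult \<phi>)
    qed
    show "\<phi> (u \<oplus> w) = \<phi> u \<oplus> \<phi> w" if uw: "u \<in> carrier A" "w \<in> carrier A" for u w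
    proof -
      obtain c where c: "\<And>l. c l \<in> carrier K" "u = ps c" using tot[OF uw(1)] by auto
      obtain c' where c': "\<And>l. c' l \<in> carrier K" "w = ps c'" using tot[OF uw(2)] by auto
      show ?thesis unfolding c(2) c'(2) using c(1) c'(1) by (simp add: ps_add Y.ps_add \<phi>)
    qed
    show "\<phi> (k \<odot> u) = k \<odot> \<phi> u" if k: "k \<in> carrier K" and u: "u \<in> carrier A" for k u
    proof -
      obtain c where c: "\<And>l. c l \<in> carrier K" "u = ps c" using tot[OF u] by auto
      show ?thesis unfolding c(2) using c(1) k by (simp add: ps_smult Y.ps_smult \<phi>)
    qed
    show "\<phi> \<one> = \<one>" using d[of 0] by simp
    show "bij_betw \<phi> (carrier A) (carrier A)"
      unfolding bij_betw_def
    proof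
      show "inj_on \<phi> (carrier A)"
      proof (rule inj_onI)
        fix u w assume u: "u \<in> carrier A" and w: "w \<in> carrier A" and eq: "\<phi> u = \<phi> w"
        obtain c where c: "\<And>l. c l \<in> carrier K" "u = ps c" using tot[OF u] by auto
        obtain c' where c': "\<And>l. c' l \<in> carrier K" "w = ps c'" using tot[OF w] by auto
        have "Y.ps c = Y.ps c'" using eq c c' \<phi> by simp
        then show "u = w" unfolding c(2) c'(2) using Y.ps_inj[of c c'] c(1) c'(1) by (intro ps_cong) auto
      qed
      show "\<phi> ` carrier A = carrier A"
      proof
        show "\<phi> ` carrier A \<subseteq> carrier A" using \<phi>c by blast
        show "carrier A \<subseteq> \<phi> ` carrier A"
        proof
          fix w assume "w \<in> carrier A"
          then obtain c where c: "\<And>l. c l \<in> carrier K" "w = Y.ps c" using totY by auto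
          then have "w = \<phi> (ps c)" using \<phi> by simp
          then show "w \<in> \<phi> ` carrier A" using c(1) by simp
        qed
      qed
    qed
  qed (simp add: \<phi>_def)
  moreover have "\<phi> x = pev \<alpha>" using d[of 1] m \<alpha> by simp
  ultimately show ?thesis by blast
qed

theorem alg_aut_group_iso_H:
  assumes span: "carrier A = sp (range (\<lambda>i::nat. x [^] i))"
  shows "alg_aut_group K A \<cong> H"
proof -
  have ex: "\<exists>\<alpha>\<in>carrier H. \<phi> x = pev \<alpha>" if \<phi>: "\<phi> \<in> alg_auts K A" for \<phi>
  proof -
    obtain c where c: "\<And>l. c l \<in> carrier K" "\<phi> x = ps c"
      using powers_total[OF span alg_autD(1)[OF \<phi> x]] by auto
    \<comment> \<open>The top power of \<open>x\<close> sees constant terms only: multiplying it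
      repeatedly by the image of \<open>x\<close> produces powers of \<open>c 0\<close>, but that
      image is nilpotent.\<close>
    have "c 0 = \<zero>\<^bsub>K\<^esub>"
    proof (rule ccontr)
      assume c0: "c 0 \<noteq> \<zero>\<^bsub>K\<^esub>"
      have "x [^] m \<otimes> (x \<otimes> y) = \<zero>" if "y \<in> carrier A" for y
        using that x_Suc by (simp add: A.m_assoc[symmetric])
      then have xm: "x [^] m \<otimes> ps c = c 0 \<odot> x [^] m"
        using ps_split[of c, OF c(1)] c(1) by (simp add: A.r_distr smult_mult_r)
      have pc: "ps c \<in> carrier A" using c(1) by simp
      have xmi: "x [^] m \<otimes> ps c [^] i = (c 0 [^]\<^bsub>K\<^esub> i) \<odot> x [^] m" for i :: nat
      proof (induction i)
        case (Suc i)
        have "x [^] m \<otimes> ps c [^] Suc i = (x [^] m \<otimes> ps c [^] i) \<otimes> ps c" using pc by (simp add: A.m_assoc)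
        then show ?case using Suc xm pc c(1) by (simp add: smult_mult_l smult_assoc1)
      qed simp
      have "ps c [^] i = \<phi> (x [^] i)" for i :: nat
        by (induction i) (use alg_autD[OF \<phi>] c(2) in simp_all)
      then have "ps c [^] Suc m = \<zero>" using x_Suc alg_autD(5)[OF \<phi>] by metis
      then have "(c 0 [^]\<^bsub>K\<^esub> Suc m) \<odot> x [^] m = \<zero>" using xmi[of "Suc m"] by simp
      then have "c 0 [^]\<^bsub>K\<^esub> Suc m = \<zero>\<^bsub>K\<^esub>" using smult_eq_zeroD[OF _ _ _ x_pow] c(1) by (metis K.nat_pow_closed A.nat_pow_closed x)
      then show False using c0 c(1) by (metis pow_nonzero)
    qed
    then show ?thesis using aut_coefficients[OF \<phi> c(1) _ c(2)] by blast
  qed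
  note ex' = ex_alg_aut[OF span]
  show ?thesis
  proof (rule is_iso_of_surjections[where S = "alg_auts K A" and f = "\<lambda>\<phi>. \<phi>" and g = coeffs
        and p = "compose (carrier A)"])
    show "coeffs ` alg_auts K A = carrier H"
    proof
      show "coeffs ` alg_auts K A \<subseteq> carrier H" using ex coeffsI by force
      show "carrier H \<subseteq> coeffs ` alg_auts K A" 
      proof
        fix \<alpha> assume \<alpha>: "\<alpha> \<in> carrier H"
        obtain \<phi> where \<phi>: "\<phi> \<in> alg_auts K A" "\<phi> x = pev \<alpha>" using ex'[OF \<alpha>] by blast
        show "\<alpha> \<in> coeffs ` alg_auts K A" using coeffsI[of \<alpha> \<phi>, OF \<alpha> \<phi>(2)] \<phi>(1) by blast
      qed
    qed
    show "\<phi> = \<psi> \<longleftrightarrow> coeffs \<phi> = coeffs \<psi>" if "\<phi> \<in> alg_auts K A" "\<psi> \<in> alg_auts K A" for \<phi> \<psi>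
      using ex[OF that(1)] ex[OF that(2)] coeffsI alg_aut_determined[OF span that] by metis
    show "coeffs (compose (carrier A) \<phi> \<psi>) = coeffs \<phi> \<otimes>\<^bsub>H\<^esub> coeffs \<psi>"
      if "\<phi> \<in> alg_auts K A" "\<psi> \<in> alg_auts K A" for \<phi> \<psi>
      using ex[OF that(1)] ex[OF that(2)] coeffs_compose[OF that(1)] by metis
  qed (use alg_auts_compose alg_aut_mult in \<open>auto simp: alg_aut_carrier\<close>)
qed

end

lemma (in field) trunc_poly:
  fixes d :: nat
  assumes "0 < d"
  defines "T \<equiv> trunc_poly_algebra R (d + 1)"
  shows "\<exists>x. nilpotent_element T R x d \<and> carrier T = kalg.sp T R (range (\<lambda>i::nat. x [^]\<^bsub>T\<^esub> i))"
proof -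
  interpret P: UP_domain R "UP R" by unfold_locales
  let ?P = "UP R"
  let ?m = "\<lambda>i. up_ring.monom ?P \<one> i"
  let ?I = "PIdl\<^bsub>?P\<^esub> (?m (Suc d))"
  have mc: "?m i \<in> carrier ?P" for i by simp
  interpret I: ideal ?I ?P by (rule P.P.cgenideal_ideal) simp
  have lm: "left_module R ?P"
    by (intro left_module.intro left_module_axioms.intro ring_axioms P.P.abelian_group_axioms)
      (simp_all add: P.smult_l_distr P.smult_r_distr P.smult_assoc1)
  interpret L: left_module R ?P by (rule lm)
  \<comment> \<open>Scalar multiplication is multiplication by a constant polynomial, so the ideal
    is also a subspace.\<close>
  have smI: "a \<odot>\<^bsub>?P\<^esub> p \<in> ?I" if "a \<in> carrier R" "p \<in> ?I" for a p
    using I.I_l_closed[OF that(2), of "up_ring.monom ?P a 0"] that P.monom_mult_is_smult I.a_Hcarr by simp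
  have N: "submodule ?I R ?P"
    using smI I.a_subset I.zero_closed I.a_closed by (intro L.submoduleI) auto
  have Teq: "T = quot ?P ?I" by (simp add: T_def trunc_poly_algebra_def)
  interpret Q: left_module R T unfolding Teq by (rule L.quot_left_module[OF N])
  let ?c = "\<lambda>p. ?I +>\<^bsub>?P\<^esub> p"
  have Tc: "carrier T = {?c p | p. p \<in> carrier ?P}" unfolding Teq by (rule L.quot_carrier[OF N])
  have Tmult: "?c p \<otimes>\<^bsub>T\<^esub> ?c q = ?c (p \<otimes>\<^bsub>?P\<^esub> q)" if "p \<in> carrier ?P" "q \<in> carrier ?P" for p q
    unfolding Teq quot_simps using I.rcoset_mult_add[OF that] .
  have Tadd: "?c p \<oplus>\<^bsub>T\<^esub> ?c q = ?c (p \<oplus>\<^bsub>?P\<^esub> q)" if "p \<in> carrier ?P" "q \<in> carrier ?P" for p q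
    unfolding Teq using L.quot_add[OF N that] .
  have Tsm: "a \<odot>\<^bsub>T\<^esub> ?c p = ?c (a \<odot>\<^bsub>?P\<^esub> p)" if "a \<in> carrier R" "p \<in> carrier ?P" for a p
    unfolding Teq using L.quot_smult[OF N that] .
  have Tone: "\<one>\<^bsub>T\<^esub> = ?c \<one>\<^bsub>?P\<^esub>" unfolding Teq by (simp add: quot_simps)
  have Tzero: "\<zero>\<^bsub>T\<^esub> = ?I" unfolding Teq by (simp add: quot_simps)
  have ringT: "ring T"
  proof (rule ringI)
    show "abelian_group T" by (rule Q.M.abelian_group_axioms)
    show "monoid T"
      by (rule monoidI) (auto simp: Tc Tmult Tone P.P.m_assoc)
    show "(y \<oplus>\<^bsub>T\<^esub> z) \<otimes>\<^bsub>T\<^esub> w = y \<otimes>\<^bsub>T\<^esub> w \<oplus>\<^bsub>T\<^esub> z \<otimes>\<^bsub>T\<^esub> w"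
      if "y \<in> carrier T" "z \<in> carrier T" "w \<in> carrier T" for y z w
      using that by (auto simp: Tc Tmult Tadd P.P.l_distr)
    show "w \<otimes>\<^bsub>T\<^esub> (y \<oplus>\<^bsub>T\<^esub> z) = w \<otimes>\<^bsub>T\<^esub> y \<oplus>\<^bsub>T\<^esub> w \<otimes>\<^bsub>T\<^esub> z"
      if "y \<in> carrier T" "z \<in> carrier T" "w \<in> carrier T" for y z w
      using that by (auto simp: Tc Tmult Tadd P.P.r_distr)
  qed
  have P1: "(a \<odot>\<^bsub>?P\<^esub> p) \<otimes>\<^bsub>?P\<^esub> q = a \<odot>\<^bsub>?P\<^esub> (p \<otimes>\<^bsub>?P\<^esub> q)"
    if "a \<in> carrier R" "p \<in> carrier ?P" "q \<in> carrier ?P" for a p q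
    using that by (simp add: P.smult_assoc2)
  have P2: "p \<otimes>\<^bsub>?P\<^esub> (a \<odot>\<^bsub>?P\<^esub> q) = a \<odot>\<^bsub>?P\<^esub> (p \<otimes>\<^bsub>?P\<^esub> q)"
    if "a \<in> carrier R" "p \<in> carrier ?P" "q \<in> carrier ?P" for a p q
    using P1[of a q p] that P.P.m_comm[of p "a \<odot>\<^bsub>?P\<^esub> q"] P.P.m_comm[of p q] by simp
  have "module R T"
    by (intro module.intro module_axioms.intro cring_axioms Q.M.abelian_group_axioms)
      (simp_all add: Q.smult_closed Q.smult_l_distr Q.smult_r_distr Q.smult_assoc1 Q.smult_one)
  moreover have "(a \<odot>\<^bsub>T\<^esub> y) \<otimes>\<^bsub>T\<^esub> z = a \<odot>\<^bsub>T\<^esub> (y \<otimes>\<^bsub>T\<^esub> z)" "y \<otimes>\<^bsub>T\<^esub> (a \<odot>\<^bsub>T\<^esub> z) = a \<odot>\<^bsub>T\<^esub> (y \<otimes>\<^bsub>T\<^esub> z)"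
    if "a \<in> carrier R" "y \<in> carrier T" "z \<in> carrier T" for a y z
    using that by (auto simp: Tc Tmult Tsm P1 P2)
  ultimately have kalgT: "kalg T R"
    by (intro kalg.intro kalg_axioms.intro ringT field_axioms) auto
  interpret T: kalg T R by (rule kalgT)
  let ?x = "?c (?m 1)"
  have xT: "?x \<in> carrier T" using mc Tc by blast
  have pow: "?x [^]\<^bsub>T\<^esub> i = ?c (?m i)" for i :: nat
  proof (induction i)
    case 0
    then show ?case by (simp add: Tone P.monom_one)
  next
    case (Suc i)
    then have "?x [^]\<^bsub>T\<^esub> Suc i = ?c (?m i \<otimes>\<^bsub>?P\<^esub> ?m 1)" using Tmult mc by simp
    also have "?m i \<otimes>\<^bsub>?P\<^esub> ?m 1 = ?m (Suc i)" using P.monom_mult[of \<one> \<one> i 1] by simp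
    finally show ?case .
  qed
  have "?m (Suc d) \<in> ?I" by (rule P.P.cgenideal_self) simp
  then have x0: "?x [^]\<^bsub>T\<^esub> Suc d = \<zero>\<^bsub>T\<^esub>"
    using pow[of "Suc d"] L.coset_eq_zero_iff[OF N mc] Tzero by simp
  \<comment> \<open>Nonzero multiples of the monomial of degree \<open>Suc d\<close> have degree
    above \<open>d\<close>.\<close>
  have "?m d \<notin> ?I"
  proof
    assume "?m d \<in> ?I"
    then obtain q where q: "q \<in> carrier ?P" "?m d = q \<otimes>\<^bsub>?P\<^esub> ?m (Suc d)"
      unfolding cgenideal_def by blast
    have m0: "?m i \<noteq> \<zero>\<^bsub>?P\<^esub>" for i using P.monom_inj P.monom_zero by (metis one_closed one_not_zero zero_closed inj_onD P.coeff_monom P.coeff_zero)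
    then have "q \<noteq> \<zero>\<^bsub>?P\<^esub>" using q P.P.l_null mc by metis
    then have "deg R (?m d) = deg R q + deg R (?m (Suc d))" using q m0 P.deg_mult by simp
    then show False using P.deg_monom[of \<one>] by simp
  qed
  then have xd: "?x [^]\<^bsub>T\<^esub> d \<noteq> \<zero>\<^bsub>T\<^esub>"
    using pow[of d] L.coset_eq_zero_iff[OF N mc] Tzero by simp
  have "nilpotent_element T R ?x d"
    by (intro nilpotent_element.intro nilpotent_element_axioms.intro kalgT xT x0 xd) (use assms in simp)
  moreover have "carrier T = T.sp (range (\<lambda>i::nat. ?x [^]\<^bsub>T\<^esub> i))"
  proof
    have sub: "range (\<lambda>i::nat. ?x [^]\<^bsub>T\<^esub> i) \<subseteq> carrier T" using xT by auto
    show "T.sp (range (\<lambda>i::nat. ?x [^]\<^bsub>T\<^esub> i)) \<subseteq> carrier T" using T.sp_closed[OF sub] by blast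
    have fin: "?c (\<Oplus>\<^bsub>?P\<^esub>i\<in>D. up_ring.monom ?P (f i) i) \<in> T.sp (range (\<lambda>i::nat. ?x [^]\<^bsub>T\<^esub> i))"
      if "finite D" "\<And>i. f i \<in> carrier R" for f :: "nat \<Rightarrow> 'a" and D
      using that(1)
    proof (induction D)
      case empty
      then show ?case using L.coset_zero[OF N] Tzero T.sp.zero by simp
    next
      case (insert i D)
      have mi: "up_ring.monom ?P (f i) i = f i \<odot>\<^bsub>?P\<^esub> ?m i" using that(2) P.monom_mult_smult[of "f i" \<one> i] by simp
      have s: "(\<Oplus>\<^bsub>?P\<^esub>i\<in>D. up_ring.monom ?P (f i) i) \<in> carrier ?P" using that(2) by (intro P.P.finsum_closed) auto
      have "?c (\<Oplus>\<^bsub>?P\<^esub>i\<in>insert i D. up_ring.monom ?P (f i) i) = f i \<odot>\<^bsub>T\<^esub> ?c (?m i) \<oplus>\<^bsub>T\<^esub> ?c (\<Oplus>\<^bsub>?P\<^esub>i\<in>D. up_ring.monom ?P (f i) i)"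
        using insert.hyps that(2) s Tadd Tsm mi by (simp add: P.P.finsum_insert Pi_iff)
      also have "?c (?m i) = ?x [^]\<^bsub>T\<^esub> i" using pow by simp
      finally show ?case using T.sp.step[OF that(2)[of i] _ insert.IH, of "?x [^]\<^bsub>T\<^esub> i"] by auto
    qed
    show "carrier T \<subseteq> T.sp (range (\<lambda>i::nat. ?x [^]\<^bsub>T\<^esub> i))"
    proof
      fix y assume "y \<in> carrier T"
      then obtain p where p: "p \<in> carrier ?P" "y = ?c p" using Tc by auto
      then show "y \<in> T.sp (range (\<lambda>i::nat. ?x [^]\<^bsub>T\<^esub> i))"
        using fin[of "{..deg R p}" "up_ring.coeff ?P p"] P.up_repr[OF p(1)] P.coeff_closed[OF p(1)] by simp
    qed
  qed
  ultimately show ?thesis by blast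
qed

section \<open>Twisting arrow systems\<close>

context brauer_algebra
begin

lemma tau_closed: "x \<in> carrier A \<Longrightarrow> \<tau> x \<in> carrier K"
  and tau_add: "\<lbrakk>x \<in> carrier A; y \<in> carrier A\<rbrakk> \<Longrightarrow> \<tau> (x \<oplus> y) = \<tau> x \<oplus>\<^bsub>K\<^esub> \<tau> y"
  and tau_comm: "\<lbrakk>x \<in> carrier A; y \<in> carrier A\<rbrakk> \<Longrightarrow> \<tau> (x \<otimes> y) = \<tau> (y \<otimes> x)"
  and tau_smult: "\<lbrakk>c \<in> carrier K; x \<in> carrier A\<rbrakk> \<Longrightarrow> \<tau> (c \<odot> x) = c \<otimes>\<^bsub>K\<^esub> \<tau> x"
  and tau_nondeg: "\<lbrakk>x \<in> carrier A; x \<noteq> \<zero>\<rbrakk> \<Longrightarrow> \<exists>y\<in>carrier A. \<tau> (y \<otimes> x) \<noteq> \<zero>\<^bsub>K\<^esub>"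
  using tau unfolding symmetrizing_def by blast+

text \<open>The left inverse again has nonzero characters, so it has a left inverse of its own,
  which can only be \<open>x\<close>.\<close>

lemma unit_if_chi_nonzero:
  assumes x: "x \<in> carrier A" "\<And>j. j \<in> edges \<Gamma> \<Longrightarrow> \<chi> j x \<noteq> \<zero>\<^bsub>K\<^esub>"
  shows "x \<in> Units A"
proof -
  obtain y where y: "y \<in> carrier A" "y \<otimes> x = \<one>" using left_inverse[of x] x by auto
  have "\<chi> j y \<noteq> \<zero>\<^bsub>K\<^esub>" if j: "j \<in> edges \<Gamma>" for j
  proof
    assume "\<chi> j y = \<zero>\<^bsub>K\<^esub>"
    then have "\<chi> j (y \<otimes> x) = \<zero>\<^bsub>K\<^esub>" using chi_mult[OF j] j x(1) y(1) by simp
    then show False using y(2) chi_one[OF j] by simp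
  qed
  then obtain z where z: "z \<in> carrier A" "z \<otimes> y = \<one>" using left_inverse[of y] y(1) by auto
  have "z \<otimes> (y \<otimes> x) = (z \<otimes> y) \<otimes> x" using x(1) y(1) z(1) by (simp only: A.m_assoc)
  then have "z = x" using x y z by simp
  then show ?thesis using x y z by (auto simp: Units_def)
qed

text \<open>Around a vertex that is not exceptional, \<open>j\<close> returns only as the last
  factor, so \<open>e j\<close> pushes \<open>g\<close> through all earlier levels.\<close>

lemma e_F_soc:
  assumes j: "j \<in> edges \<Gamma>" "w \<in> j" and w: "w \<noteq> exceptional \<Gamma>" and g: "g \<in> F w j 0"
  shows "e j \<otimes> g \<in> F w j (branch_length \<Gamma> w)"
proof -
  have gc: "g \<in> carrier A" using F_closed[OF j _ g] by simp
  have lw: "len w = val w" using len_eq[OF j] w by simp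
  have "e j \<otimes> g \<in> F w j s" if "s \<le> branch_length \<Gamma> w" for s
    using that
  proof (induction s)
    case 0
    then show ?case using F_left[OF j _ _ g] j by simp
  next
    case (Suc s)
    have "j \<noteq> (\<rho> w ^^ Suc s) j"
    proof
      assume "j = (\<rho> w ^^ Suc s) j"
      then have "Suc s mod val w = 0 mod val w" using rot_eq_iff[OF j, of "Suc s" 0] by simp
      then show False using Suc.prems lw by (simp add: len_def)
    qed
    then have "e j \<otimes> (e j \<otimes> g) \<in> F w j (Suc s)"
      using e_F_step[OF j, of s j "e j \<otimes> g"] Suc j by (simp add: len_def)
    moreover have "e j \<otimes> (e j \<otimes> g) = e j \<otimes> g" using j gc by (simp add: A.m_assoc[symmetric])
    ultimately show ?case by simp
  qed
  then show ?thesis by simp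
qed

text \<open>The summand from the other vertex \<open>w\<close> of \<open>j\<close> contributes
  nothing new: if \<open>i\<close> differs from \<open>j\<close> it misses \<open>w\<close>, so
  \<open>e i\<close> kills the summand; if they are equal the summand falls into the socle, common
  to both chains, provided that \<open>w\<close> is not exceptional.\<close>

lemma comp_rad:
  assumes j: "j \<in> edges \<Gamma>" "u \<in> j" and i: "i \<in> edges \<Gamma>" "u \<in> i"
    and y: "y \<in> carrier A" "e i \<otimes> y = y" "y \<otimes> e j = y" "\<chi> j y = \<zero>\<^bsub>K\<^esub>"
    and ex: "\<And>w. \<lbrakk>i = j; w \<in> j; w \<noteq> u\<rbrakk> \<Longrightarrow> w \<noteq> exceptional \<Gamma>"
  shows "y \<in> F u j 0"
proof -
  obtain w where w: "w \<noteq> u" "j = {u, w}" "w \<in> j" using edge_other[OF j] .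
  obtain f g where fg: "f \<in> F u j 0" "g \<in> F w j 0" "y = f \<oplus> g" using rad_sum[OF j(1) w(2) y(1,3,4)] by auto
  have c: "f \<in> carrier A" "g \<in> carrier A" using F_closed[OF j _ fg(1)] F_closed[OF j(1) w(3) _ fg(2)] by auto
  have "y = e i \<otimes> f \<oplus> e i \<otimes> g" using y(2) fg(3) c i by (simp add: A.r_distr)
  moreover have "e i \<otimes> f \<in> F u j 0" using F_left[OF j _ _ fg(1)] i by simp
  moreover have "e i \<otimes> g \<in> F u j 0"
  proof (cases "i = j")
    case True
    have "e j \<otimes> g \<in> F w j (branch_length \<Gamma> w)" using e_F_soc[OF j(1) w(3) ex[OF True w(3,1)] fg(2)] .
    then have "e j \<otimes> g \<in> F u j (branch_length \<Gamma> u)" using filt_soc[OF j(1) j(2) w(3)] by simp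
    then show ?thesis using F_mono[OF j, of 0 "branch_length \<Gamma> u"] True by (auto simp: len_def)
  next
    case False
    then have "w \<notin> i" using edge_unique[OF i(1) j(1) i(2) _ j(2) w(3)] w(1) by auto
    then show ?thesis using e_F0_zero[OF j(1) w(3) i(1) _ fg(2)] F_zero[OF j] by simp
  qed
  ultimately show ?thesis using F_add[OF j] by simp
qed

context
  fixes a
  assumes as: "arrow_system a"
begin

lemma soc_kill:
  assumes j: "j \<in> edges \<Gamma>" "u \<in> j" and x: "x \<in> carrier A" "\<chi> j x = \<zero>\<^bsub>K\<^esub>"
  shows "x \<otimes> path a u j (len u) = \<zero>"
proof -
  have p: "path a u j (len u) \<in> F u j (branch_length \<Gamma> u)"
    using path_mem[OF as j, of "branch_length \<Gamma> u"] by (simp add: len_def)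
  have "(\<rho> u ^^ Suc (branch_length \<Gamma> u)) j = j" using rot_len[OF j] unfolding len_def .
  then have "x \<otimes> path a u j (len u) \<in> F u j (Suc (branch_length \<Gamma> u))"
    using F_kill[OF j _ x(1) _ p] x(2) by (simp add: len_def)
  then show ?thesis using F_len[OF j] unfolding len_def by blast
qed

lemma soc_nonzero: "\<lbrakk>j \<in> edges \<Gamma>; u \<in> j\<rbrakk> \<Longrightarrow> path a u j (len u) \<noteq> \<zero>"
  using path_notin[OF as, of j u "branch_length \<Gamma> u"] F_len[of j u] by (simp add: len_def)

lemma smult_if_rad_kills:
  assumes j: "j \<in> edges \<Gamma>" and y: "y \<in> carrier A"
    and kill: "\<And>x. \<lbrakk>x \<in> carrier A; \<chi> j x = \<zero>\<^bsub>K\<^esub>\<rbrakk> \<Longrightarrow> x \<otimes> y = \<zero>" and x: "x \<in> carrier A"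
  shows "x \<otimes> y = \<chi> j x \<odot> y"
proof -
  have c: "\<chi> j x \<in> carrier K" using j x by simp
  have "\<chi> j (x \<ominus> \<chi> j x \<odot> \<one>) = \<zero>\<^bsub>K\<^esub>" using j x c by (simp add: chi_minus chi_smult chi_one)
  then have "(x \<ominus> \<chi> j x \<odot> \<one>) \<otimes> y = \<zero>" using kill x c by simp
  moreover have "(x \<ominus> \<chi> j x \<odot> \<one>) \<otimes> y = x \<otimes> y \<ominus> \<chi> j x \<odot> y"
    using x y c by (simp add: A.minus_eq A.l_distr A.l_minus smult_one_mult)
  ultimately show ?thesis using diff_eq_zeroD[of "x \<otimes> y" "\<chi> j x \<odot> y"] x y c by simp
qed

lemma tau_soc:
  assumes j: "j \<in> edges \<Gamma>" "u \<in> j"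
  shows "\<tau> (path a u j (len u)) \<noteq> \<zero>\<^bsub>K\<^esub>"
proof
  let ?p = "path a u j (len u)"
  assume z: "\<tau> ?p = \<zero>\<^bsub>K\<^esub>"
  have p: "?p \<in> carrier A" by (rule path_closed[OF as j])
  obtain y where y: "y \<in> carrier A" "\<tau> (y \<otimes> ?p) \<noteq> \<zero>\<^bsub>K\<^esub>" using tau_nondeg[OF p soc_nonzero[OF j]] by blast
  have "y \<otimes> ?p = \<chi> j y \<odot> ?p" by (rule smult_if_rad_kills[OF j(1) p soc_kill[OF j] y(1)])
  then show False using y z j p tau_smult by simp
qed

text \<open>The scalar is the ratio of the values of \<tau>. The difference \<open>d\<close> has
  trace zero, and so have its left multiples, which are scalar multiples of \<open>d\<close>;
  nondegeneracy gives d = 0.\<close>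

lemma soc_scalar:
  assumes j: "j \<in> edges \<Gamma>" "u \<in> j" and y: "y \<in> carrier A"
    and kill: "\<And>x. \<lbrakk>x \<in> carrier A; \<chi> j x = \<zero>\<^bsub>K\<^esub>\<rbrakk> \<Longrightarrow> x \<otimes> y = \<zero>"
  obtains \<gamma> where "\<gamma> \<in> carrier K" "y = \<gamma> \<odot> path a u j (len u)" "\<tau> y = \<gamma> \<otimes>\<^bsub>K\<^esub> \<tau> (path a u j (len u))"
proof -
  let ?p = "path a u j (len u)"
  have p: "?p \<in> carrier A" by (rule path_closed[OF as j])
  have tp: "\<tau> ?p \<in> carrier K" "\<tau> ?p \<noteq> \<zero>\<^bsub>K\<^esub>" "\<tau> y \<in> carrier K" using tau_closed[OF p] tau_soc[OF j] tau_closed[OF y] by auto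
  define \<gamma> where "\<gamma> = \<tau> y \<otimes>\<^bsub>K\<^esub> inv\<^bsub>K\<^esub> (\<tau> ?p)"
  have \<gamma>: "\<gamma> \<in> carrier K" "\<tau> y = \<gamma> \<otimes>\<^bsub>K\<^esub> \<tau> ?p" using tp by (auto simp: \<gamma>_def K.field_Units K.m_assoc)
  define d where "d = y \<ominus> \<gamma> \<odot> ?p"
  have d: "d \<in> carrier A" "d \<oplus> \<gamma> \<odot> ?p = y" using y p \<gamma> by (auto simp: d_def diff_add_cancel)
  have "\<tau> d \<oplus>\<^bsub>K\<^esub> \<tau> y = \<tau> y" using tau_add[OF d(1), of "\<gamma> \<odot> ?p"] d p \<gamma> tau_smult by simp
  then have td: "\<tau> d = \<zero>\<^bsub>K\<^esub>" using tau_closed[OF d(1)] tp(3) by simp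
  have dk: "x \<otimes> d = \<zero>" if x: "x \<in> carrier A" "\<chi> j x = \<zero>\<^bsub>K\<^esub>" for x
  proof -
    have "x \<otimes> d \<oplus> \<gamma> \<odot> (x \<otimes> ?p) = x \<otimes> y" using d p \<gamma> x by (metis A.r_distr smult_closed smult_mult_r)
    then show ?thesis using soc_kill[OF j x] kill[OF x] x d \<gamma> by simp
  qed
  have "d = \<zero>"
  proof (rule ccontr)
    assume "d \<noteq> \<zero>"
    then obtain x where x: "x \<in> carrier A" "\<tau> (x \<otimes> d) \<noteq> \<zero>\<^bsub>K\<^esub>" using tau_nondeg[OF d(1)] by blast
    have "x \<otimes> d = \<chi> j x \<odot> d" by (rule smult_if_rad_kills[OF j(1) d(1) dk x(1)])
    then show False using x j d td tau_smult by simp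
  qed
  then have "y = \<gamma> \<odot> ?p" using d p \<gamma> by simp
  then show thesis using that[OF \<gamma>(1) _ \<gamma>(2)] by simp
qed

text \<open>The socle paths at consecutive edges are the two products of the same two factors; hence
  \<tau> agrees on them.\<close>

lemma path_turn:
  assumes j: "j \<in> edges \<Gamma>" "u \<in> j"
  shows "path a u (\<rho> u j) (len u) = a u j \<otimes> path a u (\<rho> u j) (branch_length \<Gamma> u)"
    and "path a u j (len u) = path a u (\<rho> u j) (branch_length \<Gamma> u) \<otimes> a u j"
proof -
  let ?l = "branch_length \<Gamma> u"
  have "(\<rho> u ^^ ?l) (\<rho> u j) = j" using rot_len[OF j] unfolding len_def by (simp add: funpow_swap1)
  then show "path a u (\<rho> u j) (len u) = a u j \<otimes> path a u (\<rho> u j) ?l" unfolding len_def by simp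
  show "path a u j (len u) = path a u (\<rho> u j) ?l \<otimes> a u j"
    using path_comp[OF as j, of 1 ?l] path_1[OF as j] unfolding len_def by simp
qed

lemma tau_rot:
  assumes j: "j \<in> edges \<Gamma>" "u \<in> j"
  shows "\<tau> (path a u j (len u)) = \<tau> (path a u (\<rho> u j) (len u))"
proof -
  have j': "\<rho> u j \<in> edges \<Gamma>" "u \<in> \<rho> u j" using j by auto
  show ?thesis
    using path_turn[OF j] tau_comm[OF arrow(1)[OF as j] path_closed[OF as j']] by simp
qed

text \<open>Along the edges around \<open>u\<close>, the form \<tau> is constant both on the socle
  paths and on the elements \<open>q j\<close>. As it determines elements of the socle, the ratio
  cannot change.\<close>

lemma ratio_const:
  assumes q: "\<And>j. \<lbrakk>j \<in> edges \<Gamma>; u \<in> j\<rbrakk> \<Longrightarrow> q j \<in> carrier A"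
    and kill: "\<And>j x. \<lbrakk>j \<in> edges \<Gamma>; u \<in> j; x \<in> carrier A; \<chi> j x = \<zero>\<^bsub>K\<^esub>\<rbrakk> \<Longrightarrow> x \<otimes> q j = \<zero>"
    and trace: "\<And>j. \<lbrakk>j \<in> edges \<Gamma>; u \<in> j\<rbrakk> \<Longrightarrow> \<tau> (q j) = \<tau> (q (\<rho> u j))"
    and \<kappa>: "\<kappa> \<in> carrier K" and j: "j \<in> edges \<Gamma>" "u \<in> j" and eq: "q j = \<kappa> \<odot> path a u j (len u)"
    and i: "i \<in> edges \<Gamma>" "u \<in> i"
  shows "q i = \<kappa> \<odot> path a u i (len u)"
proof -
  have "q ((\<rho> u ^^ t) j) = \<kappa> \<odot> path a u ((\<rho> u ^^ t) j) (len u)" for t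
  proof (induction t)
    case (Suc t)
    let ?i = "(\<rho> u ^^ t) j"
    have i: "?i \<in> edges \<Gamma>" "u \<in> ?i" using rot_edge[OF j] rot_vertex[OF j] by auto
    then have i': "\<rho> u ?i \<in> edges \<Gamma>" "u \<in> \<rho> u ?i" by auto
    obtain \<gamma> where \<gamma>: "\<gamma> \<in> carrier K" "q (\<rho> u ?i) = \<gamma> \<odot> path a u (\<rho> u ?i) (len u)"
      "\<tau> (q (\<rho> u ?i)) = \<gamma> \<otimes>\<^bsub>K\<^esub> \<tau> (path a u (\<rho> u ?i) (len u))"
      by (rule soc_scalar[OF i' q[OF i'] kill[OF i']])
    have "\<gamma> \<otimes>\<^bsub>K\<^esub> \<tau> (path a u (\<rho> u ?i) (len u)) = \<kappa> \<otimes>\<^bsub>K\<^esub> \<tau> (path a u (\<rho> u ?i) (len u))"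
      using trace[OF i] \<gamma>(3) Suc \<kappa> tau_smult path_closed[OF as i] tau_rot[OF i] by simp
    then have "\<gamma> = \<kappa>"
      using tau_soc[OF i'] tau_closed[OF path_closed[OF as i']] \<gamma>(1) \<kappa> K.m_rcancel by blast
    then show ?case using \<gamma>(2) by simp
  qed (use eq in simp)
  then show ?thesis using rot_surj[OF j i] by auto
qed

lemma F_arrow_zero:
  assumes i: "i \<in> edges \<Gamma>" "u \<in> i" and w: "w \<in> \<rho> u i" "w \<noteq> u" and x: "x \<in> F w (\<rho> u i) 0"
  shows "x \<otimes> a u i = \<zero>"
proof -
  have j: "\<rho> u i \<in> edges \<Gamma>" using i by simp
  have "a w (\<rho> u i) \<in> F w (\<rho> u i) 0" "a w (\<rho> u i) \<notin> F w (\<rho> u i) 1"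
    using arrow_mem[OF as j w(1)] path_notin[OF as j w(1), of 0] path_1[OF as j w(1)] len_pos by auto
  then obtain b where b: "b \<in> carrier A" "x = b \<otimes> a w (\<rho> u i)" using F_gen[OF j w(1) _ _ x] by blast
  then show ?thesis
    using arrow(1)[OF as i] arrow(1)[OF as j w(1)] arrow_mult_zero[OF as i w] by (simp add: A.m_assoc)
qed

text \<open>The exponent is a successor because the path of length zero is \<open>e j\<close> and
  the zeroth power is the unit.\<close>

lemma path_pow:
  assumes j: "j \<in> edges \<Gamma>" "u \<in> j"
  shows "path a u j (Suc k * val u) = path a u j (val u) [^] Suc k"
proof (induction k)
  case 0
  then show ?case using path_closed[OF as j] by simp
next
  case (Suc k)
  have "(\<rho> u ^^ (Suc k * val u)) j = j" using rot_eq_iff[OF j, of "Suc k * val u" 0] by simp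
  then have "path a u j (Suc k * val u + val u) = path a u j (val u) \<otimes> path a u j (Suc k * val u)"
    using path_comp[OF as j, of "Suc k * val u" "val u"] by simp
  also have "\<dots> = path a u j (val u) [^] Suc (Suc k)"
    unfolding Suc by (rule A.nat_pow_Suc2[OF path_closed[OF as j], symmetric])
  finally show ?case by (simp add: add.commute)
qed

text \<open>Only the arrow at the marked edge \<open>mk u\<close> is changed, so that one turn
  around \<open>u\<close> starting there acquires the single right factor
  \<open>Y u\<close>.\<close>

definition twist_arrows where
  "twist_arrows mk Y u j = (if j = mk u then a u j \<otimes> Y u else a u j)"

context
  fixes mk and Y :: "'v \<Rightarrow> 'a" and \<gamma> :: "'v \<Rightarrow> 'k"
  assumes mk: "\<And>u j. \<lbrakk>j \<in> edges \<Gamma>; u \<in> j\<rbrakk> \<Longrightarrow> mk u \<in> edges \<Gamma> \<and> u \<in> mk u"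
    and \<gamma>: "\<And>u. \<gamma> u \<in> carrier K" "\<And>u. \<gamma> u \<noteq> \<zero>\<^bsub>K\<^esub>"
    and Y: "\<And>u j. \<lbrakk>j \<in> edges \<Gamma>; u \<in> j\<rbrakk> \<Longrightarrow> Y u \<in> carrier A"
      "\<And>u j. \<lbrakk>j \<in> edges \<Gamma>; u \<in> j\<rbrakk> \<Longrightarrow> \<exists>r\<in>F u (mk u) 0. Y u = \<gamma> u \<odot> e (mk u) \<oplus> r"
begin

abbreviation "b \<equiv> twist_arrows mk Y"

lemma twist_closed:
  assumes j: "j \<in> edges \<Gamma>" "u \<in> j"
  shows "b u j \<in> carrier A" and "e (\<rho> u j) \<otimes> b u j = b u j" and "b u j \<otimes> e j = b u j"
    and "i \<in> edges \<Gamma> \<Longrightarrow> \<chi> i (b u j) = \<zero>\<^bsub>K\<^esub>"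
proof -
  note ar = arrow[OF as j]
  have b: "b u j = a u j \<otimes> Y u \<or> b u j = a u j" by (simp add: twist_arrows_def)
  then show "b u j \<in> carrier A" by (elim disjE) (use ar Y(1)[OF j] in simp_all)
  show "e (\<rho> u j) \<otimes> b u j = b u j"
    using b by (elim disjE) (use ar Y(1)[OF j] j in \<open>simp_all add: A.m_assoc[symmetric]\<close>)
  show "\<chi> i (b u j) = \<zero>\<^bsub>K\<^esub>" if "i \<in> edges \<Gamma>"
    using b by (elim disjE) (use chi_arrow[OF as that j] chi_mult[OF that] ar(1) Y(1)[OF j] that in simp_all)
  show "b u j \<otimes> e j = b u j"
  proof (cases "j = mk u")
    case True
    obtain r where r: "r \<in> F u j 0" "Y u = \<gamma> u \<odot> e j \<oplus> r" using Y(2)[OF j] True by auto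
    have "r \<in> carrier A" "r \<otimes> e j = r" using F_closed[OF j _ r(1)] F_e[OF j _ r(1)] by auto
    then have "Y u \<otimes> e j = Y u" using r(2) j \<gamma>(1)[of u] by (simp add: A.l_distr smult_mult_l)
    then show ?thesis using True ar(1) Y(1)[OF j] j by (simp add: twist_arrows_def A.m_assoc)
  qed (use ar in \<open>simp add: twist_arrows_def\<close>)
qed

text \<open>The change of paths is triangular with nonzero diagonal, since \<open>Y u\<close> is a
  nonzero multiple of the idempotent plus a radical term that moves paths down the chain. This
  carries the conditions on an arrow system over to the new arrows.\<close>

lemma twist_path_leading:
  assumes j: "j \<in> edges \<Gamma>" "u \<in> j" and "t \<le> len u"
  shows "path b u j t \<in> carrier A \<and>
    (\<exists>\<mu>\<in>carrier K. \<mu> \<noteq> \<zero>\<^bsub>K\<^esub> \<and> (\<exists>x\<in>F u j t. path b u j t = \<mu> \<odot> path a u j t \<oplus> x))"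
  using \<open>t \<le> len u\<close>
proof (induction t)
  case 0
  have "path b u j 0 = \<one>\<^bsub>K\<^esub> \<odot> path a u j 0 \<oplus> \<zero>" using j by simp
  then show ?case using F_zero[OF j, of 0] j by (metis K.one_closed K.one_not_zero e_closed path.simps(1) zero_le)
next
  case (Suc t)
  let ?i = "(\<rho> u ^^ t) j" let ?p = "path a u j t" and ?P = "path a u j (Suc t)"
  have i: "?i \<in> edges \<Gamma>" "u \<in> ?i" using rot_edge[OF j] rot_vertex[OF j] by auto
  have t: "t < len u" using Suc by simp
  obtain \<mu> x where \<mu>: "\<mu> \<in> carrier K" "\<mu> \<noteq> \<zero>\<^bsub>K\<^esub>" "x \<in> F u j t" "path b u j t = \<mu> \<odot> ?p \<oplus> x"
    using Suc by auto
  have pc: "?p \<in> carrier A" "?P \<in> carrier A" "x \<in> carrier A" "path b u j t \<in> carrier A"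
    using path_closed[OF as j, of t] path_closed[OF as j, of "Suc t"] F_closed[OF j _ \<mu>(3)] t Suc
    by (simp_all only: less_imp_le)
  note bc = twist_closed[OF i]
  have ac: "a u ?i \<in> carrier A" using arrow(1)[OF as i] .
  have bk: "z \<in> F u j t \<Longrightarrow> a u ?i \<otimes> z \<in> F u j (Suc t)" "z \<in> F u j t \<Longrightarrow> b u ?i \<otimes> z \<in> F u j (Suc t)" for z
    using F_kill[OF j t ac, of z] F_kill[OF j t bc(1), of z] chi_arrow[OF as _ i] bc(4) rot_edge[OF j, of "Suc t"] by auto
  have "\<exists>\<nu>\<in>carrier K. \<nu> \<noteq> \<zero>\<^bsub>K\<^esub> \<and> (\<exists>y\<in>F u j (Suc t). b u ?i \<otimes> ?p = \<nu> \<odot> ?P \<oplus> y)"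
  proof (cases "?i = mk u")
    case False
    then have "b u ?i \<otimes> ?p = \<one>\<^bsub>K\<^esub> \<odot> ?P \<oplus> \<zero>" using pc by (simp add: twist_arrows_def)
    then show ?thesis using F_zero[OF j, of "Suc t"] t by (metis K.one_closed K.one_not_zero Suc_leI)
  next
    case True
    obtain r where r: "r \<in> F u ?i 0" "Y u = \<gamma> u \<odot> e ?i \<oplus> r" using Y(2)[OF j] True by auto
    have rc: "r \<in> carrier A" "r \<otimes> e ?i = r" using F_closed[OF i _ r(1)] F_e[OF i _ r(1)] by auto
    have rp: "r \<otimes> ?p \<in> F u j t"
    proof (cases t)
      case 0
      then show ?thesis using r(1) rc by simp
    next
      case (Suc s)
      then show ?thesis
        using F_kill[OF j, of s r ?p] path_mem[OF as j, of s] filt_rad[OF i r(1)] rc t by simp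
    qed
    have "b u ?i \<otimes> ?p = a u ?i \<otimes> (Y u \<otimes> ?p)"
      using True ac pc Y(1)[OF j] by (simp add: twist_arrows_def A.m_assoc)
    also have "Y u \<otimes> ?p = \<gamma> u \<odot> ?p \<oplus> r \<otimes> ?p"
      using r(2) rc pc i \<gamma>(1)[of u] path_e_left[OF as j, of t] by (simp add: A.l_distr smult_mult_l)
    also have "a u ?i \<otimes> (\<gamma> u \<odot> ?p \<oplus> r \<otimes> ?p) = \<gamma> u \<odot> ?P \<oplus> a u ?i \<otimes> (r \<otimes> ?p)"
      using ac rc pc \<gamma>(1)[of u] by (simp add: A.r_distr smult_mult_r)
    finally show ?thesis using \<gamma> bk(1)[OF rp] by blast
  qed
  then obtain \<nu> y where \<nu>: "\<nu> \<in> carrier K" "\<nu> \<noteq> \<zero>\<^bsub>K\<^esub>" "y \<in> F u j (Suc t)" "b u ?i \<otimes> ?p = \<nu> \<odot> ?P \<oplus> y" by blast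
  have yc: "y \<in> carrier A" using F_closed[OF j _ \<nu>(3)] t by simp
  have "path b u j (Suc t) = b u ?i \<otimes> (\<mu> \<odot> ?p \<oplus> x)" using \<mu>(4) by simp
  also have "\<dots> = \<mu> \<odot> (\<nu> \<odot> ?P \<oplus> y) \<oplus> b u ?i \<otimes> x"
    using bc(1) pc \<mu>(1) \<nu>(4) by (simp add: A.r_distr smult_mult_r del: path.simps)
  also have "\<dots> = (\<mu> \<otimes>\<^bsub>K\<^esub> \<nu>) \<odot> ?P \<oplus> (\<mu> \<odot> y \<oplus> b u ?i \<otimes> x)"
    using bc(1) pc yc \<mu>(1) \<nu>(1) by (simp add: smult_r_distr smult_assoc1 A.a_assoc del: path.simps)
  finally have "path b u j (Suc t) = (\<mu> \<otimes>\<^bsub>K\<^esub> \<nu>) \<odot> ?P \<oplus> (\<mu> \<odot> y \<oplus> b u ?i \<otimes> x)" .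
  moreover have "\<mu> \<odot> y \<oplus> b u ?i \<otimes> x \<in> F u j (Suc t)"
    using F_add[OF j] F_smult[OF j _ \<mu>(1) \<nu>(3)] bk(2)[OF \<mu>(3)] t by simp
  moreover have "\<mu> \<otimes>\<^bsub>K\<^esub> \<nu> \<noteq> \<zero>\<^bsub>K\<^esub>" "\<mu> \<otimes>\<^bsub>K\<^esub> \<nu> \<in> carrier K" using \<mu> \<nu> by (auto simp: K.integral_iff)
  moreover have "path b u j (Suc t) \<in> carrier A" using bc(1) pc by simp
  ultimately show ?case by blast
qed

lemma twist_arrow_system: "arrow_system b"
proof -
  have mem: "path b u j (Suc t) \<in> F u j t \<and> path b u j (Suc t) \<notin> F u j (Suc t)"
    if j: "j \<in> edges \<Gamma>" "u \<in> j" and t: "t < len u" for u j t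
  proof -
    let ?P = "path a u j (Suc t)"
    obtain \<mu> x where \<mu>: "\<mu> \<in> carrier K" "\<mu> \<noteq> \<zero>\<^bsub>K\<^esub>" "x \<in> F u j (Suc t)" "path b u j (Suc t) = \<mu> \<odot> ?P \<oplus> x"
      using twist_path_leading[OF j, of "Suc t"] t by auto
    have P: "?P \<in> carrier A" "?P \<in> F u j t" "?P \<notin> F u j (Suc t)"
      using path_closed[OF as j, of "Suc t"] path_mem[OF as j t] path_notin[OF as j t] by (simp_all only: not_False_eq_True)
    have xc: "x \<in> carrier A" "x \<in> F u j t" using F_closed[OF j _ \<mu>(3)] F_Suc[OF j t] \<mu>(3) t by auto
    have "path b u j (Suc t) \<in> F u j t"
      unfolding \<mu>(4) using F_add[OF j _ F_smult[OF j _ \<mu>(1) P(2)] xc(2)] t by simp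
    moreover have "path b u j (Suc t) \<notin> F u j (Suc t)"
    proof
      assume "path b u j (Suc t) \<in> F u j (Suc t)"
      then have "(\<mu> \<odot> ?P \<oplus> x) \<ominus> x \<in> F u j (Suc t)" using F_minus[OF j _ _ \<mu>(3)] t unfolding \<mu>(4) by simp
      moreover have "(\<mu> \<odot> ?P \<oplus> x) \<ominus> x = \<mu> \<odot> ?P"
        using P(1) xc(1) \<mu>(1) by (simp add: A.minus_eq A.a_assoc A.r_neg del: path.simps)
      ultimately show False using F_smult_mem[OF j _ \<mu>(1) P(1) P(3)] t \<mu>(2) by simp
    qed
    ultimately show ?thesis by blast
  qed
  have zero: "b w (\<rho> u j) \<otimes> b u j = \<zero>" if j: "j \<in> edges \<Gamma>" "u \<in> j" and w: "w \<in> \<rho> u j" "w \<noteq> u" for u j w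
  proof -
    let ?i = "\<rho> u j"
    have i: "?i \<in> edges \<Gamma>" "w \<in> ?i" using j w by auto
    have c: "a w ?i \<in> carrier A" "a u j \<in> carrier A" "Y w \<in> carrier A" "Y u \<in> carrier A"
      using arrow(1)[OF as j] arrow(1)[OF as i] Y(1)[OF j] Y(1)[OF i] by auto
    have 0: "a w ?i \<otimes> a u j = \<zero>" using arrow_mult_zero[OF as j w] .
    \<comment> \<open>The radical part of \<open>Y w\<close> lies in the chain at \<open>w\<close>
      and kills the arrow at \<open>u\<close>, so \<open>Y w\<close> acts on it as a scalar.\<close>
    have 1: "b w ?i \<otimes> a u j = \<zero>"
    proof (cases "?i = mk w")
      case True
      obtain r where r: "r \<in> F w ?i 0" "Y w = \<gamma> w \<odot> e ?i \<oplus> r" using Y(2)[OF i] True by auto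
      have rc: "r \<in> carrier A" using F_closed[OF i _ r(1)] by simp
      have "Y w \<otimes> a u j = \<gamma> w \<odot> a u j"
        using r(2) rc c i \<gamma>(1)[of w] arrow(2)[OF as j] F_arrow_zero[OF j w r(1)] by (simp add: A.l_distr smult_mult_l)
      then have "b w ?i \<otimes> a u j = \<gamma> w \<odot> (a w ?i \<otimes> a u j)"
        using True c \<gamma>(1)[of w] by (simp add: twist_arrows_def A.m_assoc smult_mult_r)
      then show ?thesis using 0 \<gamma>(1)[of w] by simp
    qed (use 0 in \<open>simp add: twist_arrows_def\<close>)
    have bc: "b w ?i \<in> carrier A" using twist_closed(1)[OF i] .
    show ?thesis
    proof (cases "j = mk u")
      case True
      then have "b w ?i \<otimes> b u j = (b w ?i \<otimes> a u j) \<otimes> Y u"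
        using c bc twist_arrows_def[of mk Y u j] by (simp add: A.m_assoc)
      then show ?thesis using 1 c by simp
    next
      case False
      then show ?thesis using 1 twist_arrows_def[of mk Y u j] by simp
    qed
  qed
  show ?thesis unfolding arrow_system_def using twist_closed mem zero by blast
qed

lemma twist_path:
  assumes u: "mk u \<in> edges \<Gamma>" "u \<in> mk u" and "Suc t \<le> val u"
  shows "path b u (mk u) (Suc t) = path a u (mk u) (Suc t) \<otimes> Y u"
  using assms(3)
proof (induction t)
  case 0
  have "b u (mk u) \<otimes> e (mk u) = b u (mk u)" "a u (mk u) \<otimes> e (mk u) = a u (mk u)"
    using twist_closed(3)[OF u] arrow(3)[OF as u] by auto
  then show ?case by (simp add: twist_arrows_def)
next
  case (Suc t)
  let ?i = "(\<rho> u ^^ Suc t) (mk u)"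
  have i: "?i \<in> edges \<Gamma>" "u \<in> ?i" using rot_edge[OF u, of "Suc t"] rot_vertex[OF u, of "Suc t"] by auto
  have "?i \<noteq> mk u"
  proof
    assume "?i = mk u"
    then have "Suc t mod val u = 0 mod val u" using rot_eq_iff[OF u, of "Suc t" 0] by simp
    then show False using Suc.prems by simp
  qed
  then have "b u ?i = a u ?i" unfolding twist_arrows_def by simp
  then have "path b u (mk u) (Suc (Suc t)) = a u ?i \<otimes> (path a u (mk u) (Suc t) \<otimes> Y u)"
    using Suc by (simp only: path.simps(2))
  then show ?case
    using arrow(1)[OF as i] path_closed[OF as u, of "Suc t"] Y(1)[OF u]
    by (simp only: path.simps(2)[of a u "mk u" "Suc t"] A.m_assoc)
qed

end

end

end

section \<open>Automorphisms that fix the idempotents\<close>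

context brauer_algebra
begin

definition Fix where
  "Fix = {\<phi> \<in> alg_auts K A. \<forall>j\<in>edges \<Gamma>. \<phi> (e j) = e j}"

lemma FixD:
  assumes "\<phi> \<in> Fix"
  shows "\<phi> \<in> alg_auts K A" and "j \<in> edges \<Gamma> \<Longrightarrow> \<phi> (e j) = e j"
  using assms by (auto simp: Fix_def)

text \<open>An automorphism that fixes \<open>e j\<close> preserves its corner and reflects
  invertibility. Suppose the character vanished on a corner element \<open>y\<close> but not on its
  image. Then \<phi> would send \<open>(\<one> \<ominus> e j) \<oplus> y\<close> to an element with
  nonzero characters, which is left invertible; so this element would be left invertible itself,
  although \<chi> at \<open>j\<close> vanishes on it.\<close>

lemma chi_Fix:
  assumes \<phi>: "\<phi> \<in> Fix" and j: "j \<in> edges \<Gamma>" and x: "x \<in> carrier A"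
  shows "\<chi> j (\<phi> x) = \<chi> j x"
proof -
  note D = alg_autD[OF FixD(1)[OF \<phi>]] and f = FixD(2)[OF \<phi>]
  have ej: "e j \<in> carrier A" using j by simp
  define y where "y = e j \<otimes> x \<otimes> e j \<ominus> \<chi> j x \<odot> e j"
  have cx: "\<chi> j x \<in> carrier K" using j x by simp
  have y: "y \<in> carrier A" "y \<otimes> e j = y" "\<chi> j y = \<zero>\<^bsub>K\<^esub>"
    using j x cx by (simp_all add: y_def A.minus_eq A.l_distr A.l_minus A.m_assoc smult_mult_l
        chi_minus[unfolded A.minus_eq] chi_mult chi_smult chi_e K.minus_eq K.r_neg)
  have \<phi>y: "\<phi> y \<in> carrier A" "\<phi> y \<otimes> e j = \<phi> y" using D(1)[OF y(1)] D(2)[OF y(1) ej] y(2) f[OF j] by auto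
  have 0: "\<chi> j (\<phi> y) = \<zero>\<^bsub>K\<^esub>"
  proof (rule ccontr)
    assume k: "\<chi> j (\<phi> y) \<noteq> \<zero>\<^bsub>K\<^esub>"
    let ?s = "(\<one> \<ominus> e j) \<oplus> y"
    have sc: "?s \<in> carrier A" using y ej by simp
    have m: "\<phi> (\<one> \<ominus> e j) = \<one> \<ominus> e j"
    proof -
      have "\<phi> (\<one> \<ominus> e j) \<oplus> e j = \<one>" using D(3)[of "\<one> \<ominus> e j" "e j"] D(4) f[OF j] ej by (simp add: diff_add_cancel)
      then have "\<phi> (\<one> \<ominus> e j) \<oplus> e j = (\<one> \<ominus> e j) \<oplus> e j" using ej by (simp add: diff_add_cancel)
      then show ?thesis using A.add.r_cancel[OF _ D(1) _ ] ej by (metis A.add.r_cancel A.minus_closed A.one_closed D(1))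
    qed
    have \<phi>s: "\<phi> ?s = (\<one> \<ominus> e j) \<oplus> \<phi> y" using D(3)[of "\<one> \<ominus> e j" y] m y ej by simp
    have "\<chi> i (\<phi> ?s) \<noteq> \<zero>\<^bsub>K\<^esub>" if i: "i \<in> edges \<Gamma>" for i
    proof (cases "i = j")
      case True
      then show ?thesis using \<phi>s k j ej \<phi>y by (simp add: chi_add chi_minus chi_one chi_e K.minus_eq K.r_neg)
    next
      case False
      then have "\<chi> i (\<phi> y) = \<zero>\<^bsub>K\<^esub>" using chi_off[OF i j False \<phi>y] by simp
      then show ?thesis using \<phi>s i j ej \<phi>y False by (simp add: chi_add chi_minus chi_one chi_e K.minus_eq)
    qed
    then obtain b where b: "b \<in> carrier A" "b \<otimes> \<phi> ?s = \<one>" using left_inverse[OF D(1)[OF sc]] by auto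
    obtain b' where b': "b' \<in> carrier A" "\<phi> b' = b" using D(7) b(1) unfolding bij_betw_def by (metis imageE)
    have "\<phi> (b' \<otimes> ?s) = \<phi> \<one>" using D(2)[OF b'(1) sc] b' b(2) D(4) by simp
    then have "b' \<otimes> ?s = \<one>" using D(7) b'(1) sc unfolding bij_betw_def by (metis A.m_closed A.one_closed inj_onD)
    then have "\<chi> j b' \<otimes>\<^bsub>K\<^esub> \<chi> j ?s = \<one>\<^bsub>K\<^esub>" using chi_mult[OF j b'(1) sc] chi_one[OF j] by simp
    moreover have "\<chi> j ?s = \<zero>\<^bsub>K\<^esub>" using j ej y by (simp add: chi_add chi_minus chi_one chi_e K.minus_eq K.r_neg)
    ultimately show False using j b' by simp
  qed
  have "y \<oplus> \<chi> j x \<odot> e j = e j \<otimes> x \<otimes> e j" using ej x cx by (simp add: y_def diff_add_cancel)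
  then have "\<phi> y \<oplus> \<chi> j x \<odot> e j = e j \<otimes> \<phi> x \<otimes> e j"
    using D(3)[OF y(1), of "\<chi> j x \<odot> e j"] D(6)[OF cx ej] D(2)[of "e j \<otimes> x" "e j"] D(2)[OF ej x] f[OF j] ej x cx by simp
  then have "\<chi> j (\<phi> y \<oplus> \<chi> j x \<odot> e j) = \<chi> j (e j \<otimes> \<phi> x \<otimes> e j)" by simp
  then show ?thesis using 0 j ej x cx \<phi>y(1) D(1)[OF x] by (simp add: chi_add chi_mult chi_smult chi_e)
qed

lemma Fix_compose: "\<lbrakk>\<phi> \<in> Fix; \<psi> \<in> Fix\<rbrakk> \<Longrightarrow> compose (carrier A) \<phi> \<psi> \<in> Fix"
  unfolding Fix_def using alg_auts_compose by (auto simp: compose_eq)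

text \<open>The sum \<open>u\<close> of all \<open>e i \<otimes> \<phi> (e i)\<close> intertwines
  the two systems of idempotents, and all its characters equal one, so it is a unit.\<close>

lemma ex_Fix_in_coset:
  assumes \<phi>: "\<phi> \<in> alg_auts K A" and chi: "\<And>j x. \<lbrakk>j \<in> edges \<Gamma>; x \<in> carrier A\<rbrakk> \<Longrightarrow> \<chi> j (\<phi> x) = \<chi> j x"
  shows "\<exists>u\<in>Units A. compose (carrier A) (inner u) \<phi> \<in> Fix"
proof -
  note D = alg_autD[OF \<phi>]
  let ?g = "\<lambda>i. e i \<otimes> \<phi> (e i)"
  have g: "?g i \<in> carrier A" if "i \<in> edges \<Gamma>" for i using D(1) that by simp
  have gE: "?g \<in> edges \<Gamma> \<rightarrow> carrier A" using g by blast
  define u where "u = (\<Oplus>i\<in>edges \<Gamma>. ?g i)"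
  have uc: "u \<in> carrier A" unfolding u_def by (rule A.finsum_closed[OF gE])
  have eu: "e j \<otimes> u = ?g j" and ue: "u \<otimes> \<phi> (e j) = ?g j" if j: "j \<in> edges \<Gamma>" for j
  proof -
    have "e j \<otimes> u = (\<Oplus>i\<in>edges \<Gamma>. e j \<otimes> ?g i)" unfolding u_def using j by (intro A.finsum_rdistr finite_edges gE) simp
    also have "\<dots> = (\<Oplus>i\<in>edges \<Gamma>. if j = i then ?g i else \<zero>)"
      using j D(1) by (intro A.finsum_cong') (auto simp: A.m_assoc[symmetric] e_orth)
    also have "\<dots> = ?g j" by (rule A.finsum_singleton[OF j finite_edges gE])
    finally show "e j \<otimes> u = ?g j" .
    have "u \<otimes> \<phi> (e j) = (\<Oplus>i\<in>edges \<Gamma>. ?g i \<otimes> \<phi> (e j))" unfolding u_def using j D(1) by (intro A.finsum_ldistr finite_edges gE) simp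
    also have "\<dots> = (\<Oplus>i\<in>edges \<Gamma>. if j = i then ?g i else \<zero>)"
    proof (rule A.finsum_cong')
      fix i assume i: "i \<in> edges \<Gamma>"
      have "?g i \<otimes> \<phi> (e j) = e i \<otimes> \<phi> (e i \<otimes> e j)" using i j D(1) D(2) by (simp add: A.m_assoc)
      then show "?g i \<otimes> \<phi> (e j) = (if j = i then ?g i else \<zero>)" using i j D(5) e_orth[OF i j] by auto
    qed (use g in auto)
    also have "\<dots> = ?g j" by (rule A.finsum_singleton[OF j finite_edges gE])
    finally show "u \<otimes> \<phi> (e j) = ?g j" .
  qed
  have "\<chi> j u \<noteq> \<zero>\<^bsub>K\<^esub>" if j: "j \<in> edges \<Gamma>" for j
  proof -
    have "\<chi> j (e j) \<otimes>\<^bsub>K\<^esub> \<chi> j u = \<chi> j (e j) \<otimes>\<^bsub>K\<^esub> \<chi> j (\<phi> (e j))"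
      using arg_cong[OF eu[OF j], of "\<chi> j"] j uc D(1) by (simp add: chi_mult)
    then show ?thesis using j uc chi[OF j, of "e j"] by (simp add: chi_e)
  qed
  then have u: "u \<in> Units A" using unit_if_chi_nonzero[OF uc] by blast
  have "compose (carrier A) (inner u) \<phi> (e j) = e j" if j: "j \<in> edges \<Gamma>" for j
  proof -
    have "compose (carrier A) (inner u) \<phi> (e j) = (u \<otimes> \<phi> (e j)) \<otimes> inv u" using j D(1) by (simp add: compose_eq inner_def)
    also have "\<dots> = e j \<otimes> (u \<otimes> inv u)" unfolding ue[OF j] eu[OF j, symmetric] using j uc u by (simp add: A.m_assoc)
    finally show ?thesis using j u by simp
  qed
  then show ?thesis unfolding Fix_def using alg_auts_compose[OF inner_aut[OF u] \<phi>] u by auto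
qed

context
  fixes a j0
  assumes as: "arrow_system a" and j0: "j0 \<in> edges \<Gamma>" "exceptional \<Gamma> \<in> j0"
begin

abbreviation "v \<equiv> exceptional \<Gamma>"

definition cyc where "cyc = path a v j0 (val v)"

lemma cyc_closed [simp]: "cyc \<in> carrier A" unfolding cyc_def by (rule path_closed[OF as j0])

lemma len_exc: "len v = m * val v" using len_eq[OF j0] by simp

lemma cyc_pow: "0 < k \<Longrightarrow> cyc [^] k = path a v j0 (k * val v)"
  using path_pow[OF as j0, of "k - 1"] by (simp add: cyc_def)

lemma cyc_e: "e j0 \<otimes> cyc = cyc" "cyc \<otimes> e j0 = cyc"
  using path_e_left[OF as j0, of "val v"] path_e_right[OF as j0, of "val v"] rot_deg[OF j0] by (auto simp: cyc_def)

lemma cyc_mem: "cyc \<in> F v j0 0"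
proof -
  obtain d where d: "val v = Suc d" using deg_pos[OF j0] gr0_conv_Suc by blast
  then have "d < len v" using deg_le_len[OF j0] by simp
  then show ?thesis using path_mem[OF as j0, of d] F_mono[OF j0, of 0 d] d unfolding cyc_def by auto
qed

lemma cyc_nilpotent: "nilpotent_element A K cyc m"
proof (intro nilpotent_element.intro nilpotent_element_axioms.intro)
  show "kalg A K" by (rule kalg_axioms)
  show "cyc \<in> carrier A" by simp
  show "1 \<le> m" by (rule multiplicity)
  have "cyc [^] m = path a v j0 (len v)" using cyc_pow[of m] multiplicity len_exc by simp
  then show "cyc [^] m \<noteq> \<zero>" using soc_nonzero[OF as j0] by simp
  have "len v < Suc m * val v" using len_exc deg_pos[OF j0] by simp
  then show "cyc [^] Suc m = \<zero>" using cyc_pow[of "Suc m"] path_beyond[OF as j0] by simp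
qed

interpretation N: nilpotent_element A K cyc m by (rule cyc_nilpotent)

lemma cyc_top: "cyc [^] m = path a v j0 (len v)"
  using cyc_pow[of m] multiplicity len_exc by simp

lemma ps_corner:
  assumes f: "\<And>l. f l \<in> carrier K" "f 0 = \<zero>\<^bsub>K\<^esub>"
  shows "N.ps f \<in> F v j0 0" "e j0 \<otimes> N.ps f = N.ps f" "N.ps f \<otimes> e j0 = N.ps f"
proof -
  let ?g = "\<lambda>l. f (Suc l)"
  have g: "N.ps ?g \<in> carrier A" using f by simp
  have "cyc \<otimes> N.ps ?g = N.ps (\<lambda>l. if l = 0 then \<zero>\<^bsub>K\<^esub> else f (Suc (l - 1)))" by (rule N.x_ps) (use f in simp)
  also have "\<dots> = N.ps f" using f by (intro N.ps_cong) auto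
  finally have 1: "N.ps f = cyc \<otimes> N.ps ?g" by simp
  have 2: "N.ps f = N.ps ?g \<otimes> cyc" unfolding 1 by (rule N.ps_commute) (use f in auto)
  show "N.ps f \<in> F v j0 0" unfolding 2 using F_left[OF j0 _ g cyc_mem] by simp
  show "e j0 \<otimes> N.ps f = N.ps f" unfolding 1 using g j0 cyc_e(1) by (simp add: A.m_assoc[symmetric])
  show "N.ps f \<otimes> e j0 = N.ps f" unfolding 2 using g j0 cyc_e(2) by (simp add: A.m_assoc)
qed

text \<open>The edge \<open>j0\<close> is met exactly after complete turns, where the path is a
  power of the cycle; at all other levels \<open>e j0\<close> pushes the element down.\<close>

lemma F_corner_ps:
  assumes "s \<le> len v" "x \<in> F v j0 s" "e j0 \<otimes> x = x"
  shows "\<exists>f. (\<forall>l. f l \<in> carrier K) \<and> f 0 = \<zero>\<^bsub>K\<^esub> \<and> x = N.ps f"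
  using assms
proof (induction s arbitrary: x rule: inc_induct)
  case base
  then have "x = \<zero>" using F_len[OF j0] by simp
  then show ?case using N.ps_zero by (intro exI[of _ "\<lambda>_. \<zero>\<^bsub>K\<^esub>"]) simp
next
  case (step s)
  have s: "s < len v" using step by simp
  show ?case
  proof (cases "(\<rho> v ^^ Suc s) j0 = j0")
    case False
    then have "e j0 \<otimes> x \<in> F v j0 (Suc s)" using e_F_step[OF j0 s j0(1) _ step.prems(1)] by auto
    then show ?thesis using step.IH step.prems(2) by simp
  next
    case True
    then have "Suc s mod val v = 0 mod val v" using rot_eq_iff[OF j0, of "Suc s" 0] by simp
    then have "val v dvd Suc s" by (simp add: dvd_eq_mod_eq_0)
    then obtain k where k: "Suc s = k * val v" by (metis dvd_def mult.commute)
    have k0: "0 < k" using k by (cases k) auto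
    have "k * val v \<le> m * val v" unfolding k[symmetric] len_exc[symmetric] using s by simp
    then have km: "k \<le> m" using deg_pos[OF j0] by simp
    obtain r x' where r: "r \<in> carrier K" "x' \<in> F v j0 (Suc s)" "x = r \<odot> path a v j0 (Suc s) \<oplus> x'"
      by (rule F_decomp[OF as j0 s step.prems(1)])
    then have x: "x = r \<odot> cyc [^] k \<oplus> x'" unfolding k cyc_pow[OF k0] by simp
    have x'c: "x' \<in> carrier A" using F_closed[OF j0 _ r(2)] s by simp
    have ec: "e j0 \<otimes> cyc [^] k = cyc [^] k"
      using path_e_left[OF as j0, of "Suc s"] True unfolding k cyc_pow[OF k0] by simp
    have "r \<odot> cyc [^] k \<oplus> e j0 \<otimes> x' = r \<odot> cyc [^] k \<oplus> x'"
      using step.prems(2) x x'c r(1) j0 ec by (simp add: A.r_distr smult_mult_r)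
    then have "e j0 \<otimes> x' = x'" using x'c r(1) j0 by (simp add: A.add.l_cancel)
    then obtain f where f: "\<forall>l. f l \<in> carrier K" "f 0 = \<zero>\<^bsub>K\<^esub>" "x' = N.ps f" using step.IH[OF r(2)] by auto
    have "r \<odot> cyc [^] k = N.ps (\<lambda>l. if k = l then r else \<zero>\<^bsub>K\<^esub>)" using N.ps_single[OF km r(1)] by simp
    then have "x = N.ps (\<lambda>l. (if k = l then r else \<zero>\<^bsub>K\<^esub>) \<oplus>\<^bsub>K\<^esub> f l)" using x f r(1) by (simp add: N.ps_add)
    then show ?thesis using f r(1) k0 by (intro exI[of _ "\<lambda>l. (if k = l then r else \<zero>\<^bsub>K\<^esub>) \<oplus>\<^bsub>K\<^esub> f l"]) auto
  qed
qed

text \<open>The other vertex of \<open>j0\<close> is not exceptional, so \<open>comp_rad\<close>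
  places the radical of the corner in the chain at \<open>v\<close>.\<close>

lemma corner_ps:
  assumes y: "y \<in> carrier A" "e j0 \<otimes> y = y" "y \<otimes> e j0 = y" "\<chi> j0 y = \<zero>\<^bsub>K\<^esub>"
  shows "\<exists>f. (\<forall>l. f l \<in> carrier K) \<and> f 0 = \<zero>\<^bsub>K\<^esub> \<and> y = N.ps f"
  using F_corner_ps[of 0 y] comp_rad[OF j0 j0 y] y(2) by simp

lemma Fix_cyc_ps:
  assumes \<phi>: "\<phi> \<in> Fix"
  shows "\<exists>f. (\<forall>l. f l \<in> carrier K) \<and> f 0 = \<zero>\<^bsub>K\<^esub> \<and> \<phi> cyc = N.ps f"
proof (rule corner_ps)
  note D = alg_autD[OF FixD(1)[OF \<phi>]] and f = FixD(2)[OF \<phi> j0(1)]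
  have ej: "e j0 \<in> carrier A" using j0 by simp
  show "\<phi> cyc \<in> carrier A" using D(1) by simp
  show "e j0 \<otimes> \<phi> cyc = \<phi> cyc" "\<phi> cyc \<otimes> e j0 = \<phi> cyc"
    using D(2)[OF ej cyc_closed] D(2)[OF cyc_closed ej] f cyc_e by auto
  show "\<chi> j0 (\<phi> cyc) = \<zero>\<^bsub>K\<^esub>" using chi_Fix[OF \<phi> j0(1) cyc_closed] filt_rad[OF j0 cyc_mem] by simp
qed

lemma Fix_coeffs:
  assumes \<phi>: "\<phi> \<in> Fix"
  shows "\<exists>\<alpha>\<in>carrier N.H. \<phi> cyc = N.pev \<alpha>"
  using Fix_cyc_ps[OF \<phi>] N.aut_coefficients[OF FixD(1)[OF \<phi>]] by blast

theorem ex_Fix: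
  assumes \<alpha>: "\<alpha> \<in> carrier N.H"
  shows "\<exists>\<phi>\<in>Fix. \<phi> cyc = N.pev \<alpha>"
proof -
  have hc: "N.hx \<alpha> l \<in> carrier K" for l using \<alpha> by simp
  \<comment> \<open>The polynomial of \<alpha> divided by the variable: multiplying the cycle by its
    value at the cycle gives \<open>N.pev \<alpha>\<close>.\<close>
  define h where "h l = N.hx \<alpha> (Suc l)" for l
  have h: "h l \<in> carrier K" for l using hc by (simp add: h_def)
  define \<alpha>1 where "\<alpha>1 = \<alpha> 1"
  have \<alpha>1: "\<alpha>1 \<in> carrier K" "\<alpha>1 \<noteq> \<zero>\<^bsub>K\<^esub>" "h 0 = \<alpha>1"
    using \<alpha> multiplicity N.hx_1[of \<alpha>] by (auto simp: \<alpha>1_def N.H_carrier h_def)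
  \<comment> \<open>The factor by which the m-th power of the cycle, a socle generator, will change;
    the other vertices are scaled to match it.\<close>
  define \<kappa> where "\<kappa> = \<alpha>1 [^]\<^bsub>K\<^esub> m"
  have \<kappa>: "\<kappa> \<in> carrier K" "\<kappa> \<noteq> \<zero>\<^bsub>K\<^esub>" using \<alpha>1 pow_nonzero by (auto simp: \<kappa>_def)
  let ?g = "\<lambda>l. h (Suc l)"
  define z where "z = cyc \<otimes> N.ps ?g"
  have ej: "e j0 \<in> carrier A" using j0 by simp
  have psh: "N.ps h \<in> carrier A" "N.ps ?g \<in> carrier A" using h by auto
  have z: "z = N.ps (\<lambda>l. if l = 0 then \<zero>\<^bsub>K\<^esub> else h (Suc (l - 1)))"
    unfolding z_def by (rule N.x_ps) (rule h)
  have zF: "z \<in> F v j0 0" "z \<otimes> e j0 = z" unfolding z by (rule ps_corner; use h in simp)+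
  have psh_eq: "N.ps h = \<alpha>1 \<odot> \<one> \<oplus> z" using N.ps_split[of h, OF h] \<alpha>1(3) by (simp add: z_def)
  \<comment> \<open>The constant term of \<open>N.ps h\<close> is a multiple of the unit; right
    multiplication by \<open>e j0\<close> makes it a multiple of \<open>e j0\<close>.\<close>
  define Y0 where "Y0 = N.ps h \<otimes> e j0"
  have Y0: "Y0 \<in> carrier A" "Y0 = \<alpha>1 \<odot> e j0 \<oplus> z"
    using psh \<alpha>1 ej zF(2) psh_eq z_def by (simp_all add: Y0_def A.l_distr smult_one_mult)
  have "cyc \<otimes> N.ps h = N.ps (\<lambda>l. if l = 0 then \<zero>\<^bsub>K\<^esub> else h (l - 1))" by (rule N.x_ps) (rule h)
  also have "\<dots> = N.pev \<alpha>" using hc by (intro N.ps_cong) (auto simp: h_def)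
  finally have cY: "cyc \<otimes> Y0 = N.pev \<alpha>"
    using psh ej ps_corner(3)[of "N.hx \<alpha>", OF hc] by (simp add: Y0_def A.m_assoc[symmetric])
  define mk where "mk u = (if u = v then j0 else (SOME j. j \<in> edges \<Gamma> \<and> u \<in> j))" for u
  define Y where "Y u = (if u = v then Y0 else \<kappa> \<odot> e (mk u))" for u
  define \<gamma> where "\<gamma> u = (if u = v then \<alpha>1 else \<kappa>)" for u
  have mk: "mk u \<in> edges \<Gamma> \<and> u \<in> mk u" if "j \<in> edges \<Gamma>" "u \<in> j" for u j
    using that j0 someI[of "\<lambda>j. j \<in> edges \<Gamma> \<and> u \<in> j" j] by (simp add: mk_def)
  have \<gamma>: "\<gamma> u \<in> carrier K" "\<gamma> u \<noteq> \<zero>\<^bsub>K\<^esub>" for u using \<alpha>1 \<kappa> by (simp_all add: \<gamma>_def)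
  have Y1: "Y u \<in> carrier A" if "j \<in> edges \<Gamma>" "u \<in> j" for u j using mk[OF that] Y0 \<kappa> by (simp add: Y_def)
  have Y2: "\<exists>r\<in>F u (mk u) 0. Y u = \<gamma> u \<odot> e (mk u) \<oplus> r" if "j \<in> edges \<Gamma>" "u \<in> j" for u j
  proof (cases "u = v")
    case True
    then show ?thesis using Y0(2) zF(1) by (auto simp: Y_def \<gamma>_def mk_def)
  next
    case False
    then have "Y u = \<gamma> u \<odot> e (mk u) \<oplus> \<zero>" using mk[OF that] \<kappa> by (simp add: Y_def \<gamma>_def)
    then show ?thesis using F_zero[of "mk u" u 0] mk[OF that] by blast
  qed
  let ?b = "twist_arrows a mk Y"
  note T = as mk \<gamma> Y1 Y2
  have bs: "arrow_system ?b" by (rule twist_arrow_system[OF T])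
  have tp: "path ?b u (mk u) (val u) = path a u (mk u) (val u) \<otimes> Y u" if "j \<in> edges \<Gamma>" "u \<in> j" for u j
  proof -
    have mu: "mk u \<in> edges \<Gamma>" "u \<in> mk u" "0 < val u" using mk[OF that] deg_pos[OF that] by auto
    obtain d where d: "val u = Suc d" using mu(3) gr0_conv_Suc by blast
    have "path ?b u (mk u) (Suc d) = path a u (mk u) (Suc d) \<otimes> Y u"
      by (rule twist_path[OF T mu(1,2)]) (use d in simp_all)
    then show ?thesis unfolding d .
  qed
  have cb: "path ?b v j0 (val v) = N.pev \<alpha>" using tp[OF j0] cY by (simp add: mk_def Y_def cyc_def)
  \<comment> \<open>By \<open>ratio_const\<close> the marked edge suffices. Away from
    \<open>v\<close> the socle path is one turn and receives \<kappa> directly; at \<open>v\<close>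
    it is the m-th power of one turn.\<close>
  have soc: "path ?b u j (len u) = \<kappa> \<odot> path a u j (len u)" if j: "j \<in> edges \<Gamma>" "u \<in> j" for j u
  proof (rule ratio_const[OF as, where q = "\<lambda>j. path ?b u j (len u)"])
    show mk': "mk u \<in> edges \<Gamma>" "u \<in> mk u" using mk[OF j] by auto
    show "path ?b u (mk u) (len u) = \<kappa> \<odot> path a u (mk u) (len u)"
    proof (cases "u = v")
      case False
      then have l: "len u = val u" using len_eq[OF j] by simp
      have "path a u (mk u) (val u) \<otimes> e (mk u) = path a u (mk u) (val u)" by (rule path_e_right[OF as mk'])
      then show ?thesis
        unfolding l using tp[OF j] False \<kappa> mk' path_closed[OF as mk'] by (simp add: Y_def smult_mult_r)
    next
      case True
      have m: "m = Suc (m - 1)" using multiplicity by simp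
      have "path ?b v j0 (len v) = path ?b v j0 (val v) [^] m"
        unfolding len_exc using path_pow[OF bs j0, of "m - 1"] m by simp
      also have "\<dots> = \<kappa> \<odot> cyc [^] m" unfolding cb \<kappa>_def \<alpha>1_def by (rule N.pev_pow_top[OF \<alpha>])
      finally show ?thesis using True cyc_top by (simp add: mk_def)
    qed
    show "path ?b u i (len u) \<in> carrier A" if "i \<in> edges \<Gamma>" "u \<in> i" for i by (rule path_closed[OF bs that])
    show "x \<otimes> path ?b u i (len u) = \<zero>" if "i \<in> edges \<Gamma>" "u \<in> i" "x \<in> carrier A" "\<chi> i x = \<zero>\<^bsub>K\<^esub>" for i x
      by (rule soc_kill[OF bs that])
    show "\<tau> (path ?b u i (len u)) = \<tau> (path ?b u (\<rho> u i) (len u))" if "i \<in> edges \<Gamma>" "u \<in> i" for i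
      by (rule tau_rot[OF bs that])
  qed (rule \<kappa>(1) j)+
  from ex_automorphism[OF as bs \<kappa> soc] obtain \<phi> where \<phi>1: "\<phi> \<in> alg_auts K A"
    and "\<forall>j\<in>edges \<Gamma>. \<forall>u\<in>j. \<forall>t\<le>len u. \<phi> (path a u j t) = path ?b u j t" by (rule bexE)
  then have \<phi>2: "\<phi> (path a u j t) = path ?b u j t" if "j \<in> edges \<Gamma>" "u \<in> j" "t \<le> len u" for j u t
    using that by simp
  note \<phi> = \<phi>1 \<phi>2
  have "\<phi> (e j) = e j" if j: "j \<in> edges \<Gamma>" for j
  proof -
    obtain u where "u \<in> j" using edges[OF j] by auto
    then show ?thesis using \<phi>(2)[OF j, of u 0] by simp
  qed
  moreover have "\<phi> cyc = N.pev \<alpha>" using \<phi>(2)[OF j0 deg_le_len[OF j0]] cb by (simp add: cyc_def)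
  ultimately show ?thesis using \<phi>(1) by (auto simp: Fix_def)
qed

text \<open>Both automorphisms fix \<open>e j0\<close>, so \<open>u\<close> commutes with it, and
  \<open>u \<otimes> e j0\<close> is a scalar multiple of \<open>e j0\<close> plus a polynomial in
  the cycle. Therefore \<open>u\<close> commutes with the cycle and with every polynomial in
  it.\<close>

lemma cyc_eq_if_same_coset:
  assumes \<phi>: "\<phi> \<in> Fix" and \<psi>: "\<psi> \<in> Fix" and u: "u \<in> Units A" "\<phi> = compose (carrier A) (inner u) \<psi>"
  shows "\<phi> cyc = \<psi> cyc"
proof -
  note D = alg_autD[OF FixD(1)[OF \<psi>]]
  have uc: "u \<in> carrier A" "inv u \<in> carrier A" using u by auto
  have ej: "e j0 \<in> carrier A" "e j0 \<otimes> e j0 = e j0" using j0 by auto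
  have act: "\<phi> x \<otimes> u = u \<otimes> \<psi> x" if "x \<in> carrier A" for x
    using that D(1)[OF that] u uc by (simp add: compose_eq inner_def A.m_assoc)
  have ue: "e j0 \<otimes> u = u \<otimes> e j0" using act[OF ej(1)] FixD(2)[OF \<phi> j0(1)] FixD(2)[OF \<psi> j0(1)] by simp
  define k where "k = \<chi> j0 u"
  have k: "k \<in> carrier K" using j0 uc by (simp add: k_def)
  define y where "y = u \<otimes> e j0 \<ominus> k \<odot> e j0"
  have "e j0 \<otimes> (u \<otimes> e j0) = u \<otimes> e j0" using ue uc ej by (simp add: A.m_assoc[symmetric]) (simp add: A.m_assoc)
  then have y: "y \<in> carrier A" "e j0 \<otimes> y = y" "y \<otimes> e j0 = y" "\<chi> j0 y = \<zero>\<^bsub>K\<^esub>"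
    using uc ej j0 k by (simp_all add: y_def k_def[symmetric] A.minus_eq A.l_distr A.r_distr A.l_minus A.r_minus A.m_assoc
        smult_mult_l smult_mult_r chi_minus[unfolded A.minus_eq] chi_mult chi_smult chi_e K.minus_eq K.r_neg)
  obtain f where f: "\<And>l. f l \<in> carrier K" "f 0 = \<zero>\<^bsub>K\<^esub>" "y = N.ps f" using corner_ps[OF y] by auto
  have uy: "u \<otimes> e j0 = y \<oplus> k \<odot> e j0" using uc ej k by (simp add: y_def diff_add_cancel)
  have "cyc \<otimes> y = y \<otimes> cyc" unfolding f(3) by (rule N.ps_commute) (use f in auto)
  then have "cyc \<otimes> (u \<otimes> e j0) = (u \<otimes> e j0) \<otimes> cyc"
    unfolding uy using y(1) k ej cyc_e by (simp add: A.l_distr A.r_distr smult_mult_l smult_mult_r)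
  then have uc': "u \<otimes> cyc = cyc \<otimes> u"
    using uc ej ue cyc_e by (metis A.m_assoc cyc_closed)
  obtain g where g: "\<And>l. g l \<in> carrier K" "\<psi> cyc = N.ps g" using Fix_cyc_ps[OF \<psi>] by auto
  have "u \<otimes> \<psi> cyc = \<psi> cyc \<otimes> u" unfolding g(2) by (rule N.ps_commute) (use g uc uc' in auto)
  then have "\<phi> cyc \<otimes> u = \<psi> cyc \<otimes> u" using act[OF cyc_closed] by simp
  then have "\<phi> cyc \<otimes> (u \<otimes> inv u) = \<psi> cyc \<otimes> (u \<otimes> inv u)"
    using uc D(1)[OF cyc_closed] alg_autD(1)[OF FixD(1)[OF \<phi>] cyc_closed] by (simp only: A.m_assoc[symmetric])
  then show ?thesis using u D(1)[OF cyc_closed] alg_autD(1)[OF FixD(1)[OF \<phi>] cyc_closed] by simp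
qed

end

end

section \<open>Growing a tree\<close>

context brauer_tree
begin

text \<open>Vertices are attached one at a time, which is the order in which \<open>ex_good\<close>
  extends the conjugating unit.\<close>

inductive subtree :: "'v \<Rightarrow> 'v set \<Rightarrow> bool" for r where
  single: "subtree r {r}"
| grow: "\<lbrakk>subtree r W; w \<in> W; u \<notin> W; {w, u} \<in> edges \<Gamma>\<rbrakk> \<Longrightarrow> subtree r (insert u W)"

lemma subtree_walk:
  assumes "subtree r W" "x \<in> W" "y \<in> W"
  shows "\<exists>vs. vs \<noteq> [] \<and> distinct vs \<and> set vs \<subseteq> W \<and> hd vs = x \<and> last vs = y \<and>
    successively (\<lambda>x y. {x, y} \<in> edges \<Gamma>) vs"
  using assms
proof (induction arbitrary: x y)
  case single
  then show ?case by (intro exI[of _ "[r]"]) auto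
next
  case (grow W w u)
  consider "x = u" "y = u" | "x = u" "y \<in> W" | "x \<in> W" "y = u" | "x \<in> W" "y \<in> W"
    using grow.prems by blast
  then show ?case
  proof cases
    case 1
    then show ?thesis by (intro exI[of _ "[u]"]) auto
  next
    case 2
    obtain vs where "vs \<noteq> []" "distinct vs" "set vs \<subseteq> W" "hd vs = w" "last vs = y"
      "successively (\<lambda>x y. {x, y} \<in> edges \<Gamma>) vs" using grow.IH[OF grow.hyps(2) 2(2)] by blast
    then show ?thesis
      using 2 grow.hyps(3,4) by (intro exI[of _ "u # vs"]) (auto simp: successively_Cons insert_commute)
  next
    case 3
    obtain vs where "vs \<noteq> []" "distinct vs" "set vs \<subseteq> W" "hd vs = x" "last vs = w"
      "successively (\<lambda>x y. {x, y} \<in> edges \<Gamma>) vs" using grow.IH[OF 3(1) grow.hyps(2)] by blast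
    then show ?thesis
      using 3 grow.hyps(3,4) by (intro exI[of _ "vs @ [u]"]) (auto simp: successively_append_iff)
  next
    case 4
    obtain vs where "vs \<noteq> []" "distinct vs" "set vs \<subseteq> W" "hd vs = x" "last vs = y"
      "successively (\<lambda>x y. {x, y} \<in> edges \<Gamma>) vs" using grow.IH[OF 4] by blast
    then show ?thesis by (intro exI[of _ vs]) auto
  qed
qed

text \<open>A simple walk inside \<open>W\<close> between two distinct attaching vertices would
  close through \<open>u\<close> to a cycle of length at least three.\<close>

lemma subtree_attach_unique:
  assumes W: "subtree r W" and u: "u \<notin> W" and x: "x \<in> W" "{x, u} \<in> edges \<Gamma>" and y: "y \<in> W" "{y, u} \<in> edges \<Gamma>"
  shows "x = y"
proof (rule ccontr)
  assume "x \<noteq> y"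
  obtain vs where vs: "vs \<noteq> []" "distinct vs" "set vs \<subseteq> W" "hd vs = x" "last vs = y"
    "\<And>i. Suc i < length vs \<Longrightarrow> {vs ! i, vs ! Suc i} \<in> edges \<Gamma>"
    using subtree_walk[OF W x(1) y(1)] unfolding successively_conv_nth by blast
  have l2: "length vs \<ge> 2"
  proof (rule ccontr)
    assume "\<not> ?thesis"
    then have "length vs = 1" using vs(1) by (cases "length vs") auto
    then obtain z where "vs = [z]" by (cases vs) auto
    then show False using vs(4,5) \<open>x \<noteq> y\<close> by simp
  qed
  have "distinct (u # vs)" "length (u # vs) \<ge> 3" using vs u l2 by auto
  then obtain i where i: "i < length (u # vs)" "{(u # vs) ! i, (u # vs) ! (Suc i mod length (u # vs))} \<notin> edges \<Gamma>"
    using acyclic[of "u # vs"] by blast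
  have "i = 0 \<or> (\<exists>k. i = Suc k \<and> Suc k < length vs) \<or> (\<exists>k. i = Suc k \<and> Suc k = length vs)"
    using i(1) by (cases i) auto
  then consider "i = 0" | k where "i = Suc k" "Suc k < length vs" | k where "i = Suc k" "Suc k = length vs"
    by blast
  then show False
  proof cases
    case 1
    then show False using i(2) vs(1,4) x(2) l2 by (simp add: hd_conv_nth[symmetric] insert_commute)
  next
    case 2
    then show False using i(2) vs(6)[of k] by simp
  next
    case 3
    have "vs ! k = y" using vs(1,5) 3 by (metis diff_Suc_1 last_conv_nth)
    then have 1: "(u # vs) ! i = y" using 3(1) by simp
    have "Suc i mod length (u # vs) = 0" using 3 by simp
    then show False using i(2) y(2) unfolding 1 by simp
  qed
qed

text \<open>A maximal subtree is closed under adjacency, and by connectedness it contains every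
  vertex.\<close>

lemma subtree_vertices:
  assumes r: "r \<in> vertices \<Gamma>"
  shows "subtree r (vertices \<Gamma>)"
proof -
  have sub: "W \<subseteq> vertices \<Gamma> \<and> r \<in> W" if "subtree r W" for W
    using that
  proof induction
    case (grow W w u)
    then show ?case using edges[OF grow.hyps(4)] by (auto simp: doubleton_eq_iff)
  qed (use r in simp)
  have "finite {W. subtree r W}" by (rule finite_subset[of _ "Pow (vertices \<Gamma>)"]) (use sub finite_vertices in auto)
  moreover have "{W. subtree r W} \<noteq> {}" using subtree.single by blast
  ultimately obtain W where W: "subtree r W" "\<And>W'. subtree r W' \<Longrightarrow> W \<subseteq> W' \<Longrightarrow> W' = W"
    using finite_has_maximal[of "{W. subtree r W}"] by auto
  have "y \<in> W" if "(r, y) \<in> {(x, y). {x, y} \<in> edges \<Gamma>}\<^sup>*" for y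
    using that
  proof induction
    case base
    then show ?case using sub[OF W(1)] by simp
  next
    case (step y z)
    show ?case
    proof (rule ccontr)
      assume z: "z \<notin> W"
      have "subtree r (insert z W)" using subtree.grow[OF W(1) step.IH z] step.hyps(2) by simp
      then show False using W(2)[of "insert z W"] z by blast
    qed
  qed
  then have "vertices \<Gamma> \<subseteq> W" using connected[OF r] by blast
  then show ?thesis using sub[OF W(1)] W(1) by (simp add: subset_antisym)
qed

end


section \<open>The kernel of the action on the cycle at the exceptional vertex\<close>

context brauer_algebra
begin

context
  fixes a j0
  assumes as: "arrow_system a" and j0: "j0 \<in> edges \<Gamma>" "exceptional \<Gamma> \<in> j0"
begin

context
  fixes \<theta>
  assumes \<theta>: "\<theta> \<in> Fix" and \<theta>c: "\<theta> (cyc a j0) = cyc a j0"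
begin

lemma theta:
  shows theta_closed: "y \<in> carrier A \<Longrightarrow> \<theta> y \<in> carrier A"
    and theta_mult: "\<lbrakk>y \<in> carrier A; z \<in> carrier A\<rbrakk> \<Longrightarrow> \<theta> (y \<otimes> z) = \<theta> y \<otimes> \<theta> z"
    and theta_add: "\<lbrakk>y \<in> carrier A; z \<in> carrier A\<rbrakk> \<Longrightarrow> \<theta> (y \<oplus> z) = \<theta> y \<oplus> \<theta> z"
    and theta_zero: "\<theta> \<zero> = \<zero>"
    and theta_smult: "\<lbrakk>k \<in> carrier K; y \<in> carrier A\<rbrakk> \<Longrightarrow> \<theta> (k \<odot> y) = k \<odot> \<theta> y"
    and theta_e: "j \<in> edges \<Gamma> \<Longrightarrow> \<theta> (e j) = e j"
    and theta_chi: "\<lbrakk>j \<in> edges \<Gamma>; y \<in> carrier A\<rbrakk> \<Longrightarrow> \<chi> j (\<theta> y) = \<chi> j y"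
  using alg_autD[OF FixD(1)[OF \<theta>]] FixD(2)[OF \<theta>] chi_Fix[OF \<theta>] by auto

lemma theta_surj: "x \<in> carrier A \<Longrightarrow> \<exists>y\<in>carrier A. x = \<theta> y"
  using alg_autD(7)[OF FixD(1)[OF \<theta>]] unfolding bij_betw_def by blast

lemma theta_soc_kill:
  assumes j: "j \<in> edges \<Gamma>" "u \<in> j" and x: "x \<in> carrier A" "\<chi> j x = \<zero>\<^bsub>K\<^esub>"
  shows "x \<otimes> \<theta> (path a u j (len u)) = \<zero>"
proof -
  obtain y where y: "y \<in> carrier A" "x = \<theta> y" using theta_surj[OF x(1)] by blast
  have "\<chi> j y = \<zero>\<^bsub>K\<^esub>" using theta_chi[OF j(1) y(1)] x(2) y(2) by simp
  then have "y \<otimes> path a u j (len u) = \<zero>" by (rule soc_kill[OF as j y(1)])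
  then show ?thesis using theta_mult[OF y(1) path_closed[OF as j]] theta_zero y(2) by metis
qed

lemma theta_soc_rot:
  assumes j: "j \<in> edges \<Gamma>" "u \<in> j" and eq: "\<theta> (path a u j (len u)) = path a u j (len u)"
    and i: "i \<in> edges \<Gamma>" "u \<in> i"
  shows "\<theta> (path a u i (len u)) = path a u i (len u)"
proof -
  have "\<tau> (\<theta> (path a u j (len u))) = \<tau> (\<theta> (path a u (\<rho> u j) (len u)))" if j: "j \<in> edges \<Gamma>" "u \<in> j" for j
  proof -
    let ?p = "path a u (\<rho> u j) (branch_length \<Gamma> u)"
    have "a u j \<in> carrier A" "?p \<in> carrier A" using arrow(1)[OF as j] path_closed[OF as] j by auto
    then show ?thesis
      using path_turn[OF as j] theta_mult theta_closed tau_comm[of "\<theta> (a u j)" "\<theta> ?p"] by simp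
  qed
  note trace = this
  have "\<theta> (path a u i (len u)) = \<one>\<^bsub>K\<^esub> \<odot> path a u i (len u)"
    by (rule ratio_const[OF as, where q = "\<lambda>j. \<theta> (path a u j (len u))", OF _ theta_soc_kill trace _ j _ i])
      (use eq theta_closed path_closed[OF as] j in auto)
  then show ?thesis using path_closed[OF as i] by simp
qed

lemma theta_soc_edge:
  assumes j: "j \<in> edges \<Gamma>" "u \<in> j" "w \<in> j" and eq: "\<theta> (path a u j (len u)) = path a u j (len u)"
  shows "\<theta> (path a w j (len w)) = path a w j (len w)"
proof -
  obtain \<gamma> where \<gamma>: "\<gamma> \<in> carrier K" "path a w j (len w) = \<gamma> \<odot> path a u j (len u)"
    by (rule soc_scalar[OF as j(1,2) path_closed[OF as j(1,3)] soc_kill[OF as j(1,3)]])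
  then show ?thesis using eq theta_smult path_closed[OF as j(1,2)] by simp
qed

text \<open>The m-th power of the cycle is a socle path fixed by \<theta>. The trace form carries
  this around a vertex, proportionality of the two socle paths of an edge carries it along the edge,
  and the graph is connected.\<close>

lemma theta_soc:
  assumes j: "j \<in> edges \<Gamma>" "u \<in> j"
  shows "\<theta> (path a u j (len u)) = path a u j (len u)"
proof -
  let ?P = "\<lambda>u. \<forall>j\<in>edges \<Gamma>. u \<in> j \<longrightarrow> \<theta> (path a u j (len u)) = path a u j (len u)"
  have pow: "\<theta> (cyc a j0 [^] k) = cyc a j0 [^] k" for k :: nat
    by (induction k) (use theta_mult \<theta>c cyc_closed[OF as j0] alg_autD(4)[OF FixD(1)[OF \<theta>]] in simp_all)
  have "\<theta> (path a (exceptional \<Gamma>) j0 (len (exceptional \<Gamma>))) = path a (exceptional \<Gamma>) j0 (len (exceptional \<Gamma>))"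
    using pow[of m] unfolding cyc_top[OF as j0] .
  then have P0: "?P (exceptional \<Gamma>)" using theta_soc_rot[OF j0] by blast
  have "?P w" if "(exceptional \<Gamma>, w) \<in> {(x, y). {x, y} \<in> edges \<Gamma>}\<^sup>*" for w
    using that
  proof induction
    case base
    show ?case by (rule P0)
  next
    case (step y z)
    then have yz: "{y, z} \<in> edges \<Gamma>" by simp
    then have "\<theta> (path a z {y, z} (len z)) = path a z {y, z} (len z)"
      using theta_soc_edge[OF yz, of y z] step.IH by simp
    then show ?case using theta_soc_rot[OF yz, of z] by blast
  qed
  then show ?thesis using connected[OF exceptional edge_vertices[OF j]] j by blast
qed

text \<open>Arrows and their images under \<theta> have the same characters, so both move elements
  down the chains.\<close>

lemma theta_path_mem:
  assumes j: "j \<in> edges \<Gamma>" "u \<in> j" and x: "x \<in> F u j s" and "s + t \<le> len u"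
  shows "\<theta> (path a u ((\<rho> u ^^ s) j) t) \<otimes> x \<in> F u j (s + t)"
  using assms(4)
proof (induction t)
  case 0
  show ?case using F_left[OF j _ _ x] rot_edge[OF j] 0 theta_e by simp
next
  case (Suc t)
  let ?i = "(\<rho> u ^^ (s + t)) j" and ?p = "\<theta> (path a u ((\<rho> u ^^ s) j) t)"
  have s: "(\<rho> u ^^ s) j \<in> edges \<Gamma>" "u \<in> (\<rho> u ^^ s) j" using rot_edge[OF j] rot_vertex[OF j] by auto
  have i: "?i \<in> edges \<Gamma>" "u \<in> ?i" using rot_edge[OF j] rot_vertex[OF j] by auto
  have ii: "(\<rho> u ^^ t) ((\<rho> u ^^ s) j) = ?i" by (metis add.commute comp_apply funpow_add)
  have c: "a u ?i \<in> carrier A" "path a u ((\<rho> u ^^ s) j) t \<in> carrier A" "x \<in> carrier A"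
    using arrow(1)[OF as i] path_closed[OF as s] F_closed[OF j _ x] Suc.prems by auto
  have ch: "\<chi> ((\<rho> u ^^ Suc (s + t)) j) (\<theta> (a u ?i)) = \<zero>\<^bsub>K\<^esub>"
    using theta_chi[OF rot_edge[OF j, of "Suc (s + t)"] c(1)] chi_arrow[OF as rot_edge[OF j, of "Suc (s + t)"] i] by simp
  have "\<theta> (a u ?i) \<otimes> (?p \<otimes> x) \<in> F u j (Suc (s + t))"
    by (rule F_kill[OF j _ _ ch]) (use Suc theta_closed c in auto)
  then show ?case using c theta_mult theta_closed ii by (simp add: A.m_assoc)
qed

text \<open>The units of the corner of \<open>e i\<close>; one for each edge, they will be the
  diagonal blocks of the conjugating unit.\<close>

definition corner_unit where
  "corner_unit i z \<longleftrightarrow> z \<in> carrier A \<and> e i \<otimes> z = z \<and> z \<otimes> e i = z \<and> \<chi> i z \<noteq> \<zero>\<^bsub>K\<^esub>"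

lemma soc_corner:
  assumes j: "j \<in> edges \<Gamma>" "u \<in> j" and z: "z \<in> carrier A" "e j \<otimes> z = z"
  shows "path a u j (len u) \<otimes> z = \<chi> j z \<odot> path a u j (len u)"
proof -
  let ?p = "path a u j (len u)"
  have p: "?p \<in> carrier A" "?p \<otimes> e j = ?p" using path_closed[OF as j] path_e_right[OF as j] by auto
  have k: "\<chi> j z \<in> carrier K" using j z by simp
  have "?p \<in> F u j (branch_length \<Gamma> u)" using path_mem[OF as j, of "branch_length \<Gamma> u"] by (simp add: len_def)
  moreover have "\<chi> j (z \<ominus> \<chi> j z \<odot> \<one>) = \<zero>\<^bsub>K\<^esub>" using j z k by (simp add: chi_minus chi_smult chi_one)
  ultimately have "?p \<otimes> (z \<ominus> \<chi> j z \<odot> \<one>) = \<zero>" using soc_mult_rad[OF j] z k by simp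
  moreover have "?p \<otimes> (z \<ominus> \<chi> j z \<odot> \<one>) = ?p \<otimes> z \<ominus> \<chi> j z \<odot> ?p"
    using p z k by (simp add: A.minus_eq A.r_distr A.r_minus smult_mult_r mult_smult_one)
  ultimately show ?thesis using diff_eq_zeroD[of "?p \<otimes> z" "\<chi> j z \<odot> ?p"] p z k by simp
qed

text \<open>If \<theta> is to be conjugation, the unit at the start of an arrow must determine one
  at its end. A factor \<open>y\<close> exists because the left side lies in the chain generated by
  the arrow. It is a unit: otherwise the left side would lie one level deeper and completing the
  turn would give zero, whereas \<theta> fixes the socle path and \<open>z\<close> multiplies it by
  a nonzero scalar.\<close>

lemma ex_next:
  assumes i: "i \<in> edges \<Gamma>" "u \<in> i" and z: "corner_unit i z"
  shows "\<exists>y. corner_unit (\<rho> u i) y \<and> \<theta> (a u i) \<otimes> z = y \<otimes> a u i"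
proof -
  let ?i = "\<rho> u i"
  have i': "?i \<in> edges \<Gamma>" "u \<in> ?i" using i by auto
  have zc: "z \<in> carrier A" "e i \<otimes> z = z" "z \<otimes> e i = z" "\<chi> i z \<noteq> \<zero>\<^bsub>K\<^esub>" "\<chi> i z \<in> carrier K" using z i by (auto simp: corner_unit_def)
  have ac: "a u i \<in> carrier A" "e ?i \<otimes> a u i = a u i" "\<theta> (a u i) \<in> carrier A"
    using arrow[OF as i] theta_closed by auto
  have ea: "e ?i \<otimes> \<theta> (a u i) = \<theta> (a u i)" using theta_mult[of "e ?i" "a u i"] theta_e[OF i'(1)] ac i' by simp
  define x where "x = \<theta> (a u i) \<otimes> z"
  have x: "x \<in> carrier A" "e ?i \<otimes> x = x" "x \<otimes> e i = x" "\<chi> i x = \<zero>\<^bsub>K\<^esub>"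
    using ac ea zc i i' theta_chi[OF i(1) ac(1)] chi_arrow[OF as i(1) i]
    by (simp_all add: x_def A.m_assoc[symmetric] chi_mult) (simp add: A.m_assoc)
  show ?thesis
  proof (cases "len u = 1")
    \<comment> \<open>Here the arrow itself spans the socle. The case is separate because the other
      vertex of the edge may be exceptional, which \<open>comp_rad\<close> excludes.\<close>
    case True
    then have "val u = 1" using deg_le_len[OF i] deg_pos[OF i] by simp
    then have ii: "?i = i" using rot_deg[OF i] by simp
    have p: "path a u i (len u) = a u i" using True path_1[OF as i] by simp
    have "x = \<chi> i z \<odot> a u i" unfolding x_def using theta_soc[OF i] soc_corner[OF i zc(1,2)] unfolding p by simp
    then have "x = (\<chi> i z \<odot> e i) \<otimes> a u i" using ac ii zc i by (simp add: smult_mult_l)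
    moreover have "corner_unit i (\<chi> i z \<odot> e i)"
      using zc i by (simp add: corner_unit_def smult_mult_l smult_mult_r chi_smult chi_e)
    ultimately show ?thesis using ii by (auto simp: x_def)
  next
    case False
    have xF: "x \<in> F u i 0"
    proof (rule comp_rad[OF i i' x])
      fix w assume *: "?i = i" "w \<in> i" "w \<noteq> u"
      then have "val u = 1" using rot_fixed[OF i] by simp
      then have "u = exceptional \<Gamma>" using False len_eq[OF i] by (auto split: if_splits)
      then show "w \<noteq> exceptional \<Gamma>" using * by simp
    qed
    have "a u i \<in> F u i 0" "a u i \<notin> F u i 1"
      using arrow_mem[OF as i] path_notin[OF as i, of 0] path_1[OF as i] len_pos by auto
    then obtain y' where y': "y' \<in> carrier A" "x = y' \<otimes> a u i" using F_gen[OF i _ _ xF] by blast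
    define y where "y = e ?i \<otimes> y' \<otimes> e ?i"
    have eac: "e ?i \<in> carrier A" using i' by simp
    have y: "y \<in> carrier A" "e ?i \<otimes> y = y" "y \<otimes> e ?i = y" "\<chi> ?i y = \<chi> ?i y'"
      using y' eac i' by (simp_all add: y_def A.m_assoc[symmetric] chi_mult chi_e) (simp add: A.m_assoc)
    have xy: "x = y \<otimes> a u i"
      using x(2) y' ac eac by (simp add: y_def A.m_assoc)
    have "\<chi> ?i y \<noteq> \<zero>\<^bsub>K\<^esub>"
    proof
      assume "\<chi> ?i y = \<zero>\<^bsub>K\<^esub>"
      then have x1: "x \<in> F u i (Suc 0)"
        using F_kill[OF i, of 0 y "a u i"] len_pos y arrow_mem[OF as i] xy by simp
      obtain l where l: "len u = Suc l" by (simp add: len_def)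
      have "\<theta> (path a u ((\<rho> u ^^ Suc 0) i) l) \<otimes> x \<in> F u i (Suc 0 + l)"
        by (rule theta_path_mem[OF i x1]) (use l in simp)
      then have "\<theta> (path a u ?i l) \<otimes> x = \<zero>" using F_len[OF i] l by simp
      moreover have "\<theta> (path a u ?i l) \<otimes> x = \<theta> (path a u i (len u)) \<otimes> z"
        using path_comp[OF as i, of 1 l] path_1[OF as i] theta_mult[OF path_closed[OF as i', of l] ac(1)]
          theta_closed path_closed[OF as i'] ac zc l by (simp add: x_def A.m_assoc)
      ultimately have "\<chi> i z \<odot> path a u i (len u) = \<zero>"
        using theta_soc[OF i] soc_corner[OF i zc(1,2)] by simp
      then show False using smult_eq_zeroD[OF zc(5) path_closed[OF as i] _ soc_nonzero[OF as i]] zc(4) by simp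
    qed
    then show ?thesis using y xy by (auto simp: corner_unit_def x_def)
  qed
qed

text \<open>The transport is iterated without end; after a full turn the unit need not be
  \<open>z\<close> again, and \<open>closing\<close> deals with the difference.\<close>

lemma ex_around:
  assumes i: "i \<in> edges \<Gamma>" "u \<in> i" and z: "corner_unit i z"
  shows "\<exists>y. y 0 = z \<and> (\<forall>t. corner_unit ((\<rho> u ^^ t) i) (y t) \<and>
    \<theta> (a u ((\<rho> u ^^ t) i)) \<otimes> y t = y (Suc t) \<otimes> a u ((\<rho> u ^^ t) i))"
proof -
  define y where "y = rec_nat z (\<lambda>t x. SOME y. corner_unit (\<rho> u ((\<rho> u ^^ t) i)) y \<and>
    \<theta> (a u ((\<rho> u ^^ t) i)) \<otimes> x = y \<otimes> a u ((\<rho> u ^^ t) i))"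
  have step: "corner_unit (\<rho> u ((\<rho> u ^^ t) i)) (y (Suc t)) \<and>
      \<theta> (a u ((\<rho> u ^^ t) i)) \<otimes> y t = y (Suc t) \<otimes> a u ((\<rho> u ^^ t) i)"
    if "corner_unit ((\<rho> u ^^ t) i) (y t)" for t
    unfolding y_def nat.rec(2) using ex_next[OF rot_edge[OF i] rot_vertex[OF i] that[unfolded y_def]] by (rule someI_ex)
  have "corner_unit ((\<rho> u ^^ t) i) (y t)" for t
    by (induction t) (use z step in \<open>simp_all add: y_def\<close>)
  then show ?thesis using step by (intro exI[of _ y]) (simp add: y_def)
qed

lemma around_path:
  assumes i: "i \<in> edges \<Gamma>" "u \<in> i" and y: "\<And>t. corner_unit ((\<rho> u ^^ t) i) (y t)"
    "\<And>t. \<theta> (a u ((\<rho> u ^^ t) i)) \<otimes> y t = y (Suc t) \<otimes> a u ((\<rho> u ^^ t) i)"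
  shows "\<theta> (path a u i t) \<otimes> y 0 = y t \<otimes> path a u i t"
proof (induction t)
  case 0
  then show ?case using y(1)[of 0] i theta_e by (simp add: corner_unit_def)
next
  case (Suc t)
  have ac: "a u ((\<rho> u ^^ t) i) \<in> carrier A" by (rule arrow(1)[OF as rot_edge[OF i] rot_vertex[OF i]])
  have c: "path a u i t \<in> carrier A" "y t \<in> carrier A" "y 0 \<in> carrier A" "y (Suc t) \<in> carrier A"
    using path_closed[OF as i] y(1) by (auto simp: corner_unit_def)
  have "\<theta> (path a u i (Suc t)) \<otimes> y 0 = \<theta> (a u ((\<rho> u ^^ t) i)) \<otimes> (y t \<otimes> path a u i t)"
    using ac c theta_mult theta_closed Suc by (simp add: A.m_assoc)
  also have "\<dots> = (\<theta> (a u ((\<rho> u ^^ t) i)) \<otimes> y t) \<otimes> path a u i t"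
    using ac c theta_closed by (simp add: A.m_assoc)
  also have "\<dots> = y (Suc t) \<otimes> path a u i (Suc t)" unfolding y(2) using ac c by (simp add: A.m_assoc)
  finally show ?case .
qed

text \<open>The element at \<open>i\<close> obtained after one turn around \<open>u\<close> acts like the initial one on the last arrow.\<close>

lemma closing:
  assumes i: "i \<in> edges \<Gamma>" "u \<in> i" and z: "corner_unit i z" and y: "corner_unit i y"
    and h: "h \<in> edges \<Gamma>" "u \<in> h" "\<rho> u h = i" and hv: "h = (\<rho> u ^^ (val u - 1)) i"
    and turn: "\<theta> (path a u i (val u)) \<otimes> z = y \<otimes> path a u i (val u)"
    and start: "u = exceptional \<Gamma> \<Longrightarrow> i = j0 \<and> z = e j0"
  shows "y \<otimes> a u h = z \<otimes> a u h"
proof -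
  have zc: "z \<in> carrier A" "e i \<otimes> z = z" "z \<otimes> e i = z" using z by (auto simp: corner_unit_def)
  have yc: "y \<in> carrier A" "e i \<otimes> y = y" "y \<otimes> e i = y" using y by (auto simp: corner_unit_def)
  have ei: "e i \<in> carrier A" using i by simp
  have ac: "a u h \<in> carrier A" using arrow(1)[OF as h(1,2)] .
  have pc: "path a u i t \<in> carrier A" for t by (rule path_closed[OF as i])
  define q where "q = y \<ominus> z"
  have q: "q \<in> carrier A" "e i \<otimes> q = q" "q \<otimes> e i = q"
    using zc yc ei by (simp_all add: q_def A.minus_eq A.l_distr A.r_distr A.l_minus A.r_minus)
  have qdiff: "q \<otimes> x = y \<otimes> x \<ominus> z \<otimes> x" if "x \<in> carrier A" for x
    using that zc yc by (simp add: q_def A.minus_eq A.l_distr A.l_minus)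
  obtain w where w: "w \<noteq> u" "i = {u, w}" "w \<in> i" using edge_other[OF i] .
  have kill: "g \<otimes> a u h = \<zero>" if "g \<in> F w i 0" for g
    using F_arrow_zero[OF as h(1,2), of w g] w h(3) that by simp
  have "q \<otimes> a u h = \<zero>"
  proof (cases "u = exceptional \<Gamma>")
    case False
    have l: "len u = val u" using len_eq[OF i] False by simp
    have "\<chi> i z \<odot> path a u i (len u) = y \<otimes> path a u i (len u)"
      using turn theta_soc[OF i] soc_corner[OF i zc(1,2)] unfolding l by simp
    also have "\<dots> = \<chi> i y \<odot> path a u i (len u)"
      by (rule smult_if_rad_kills[OF as i(1) pc soc_kill[OF as i] yc(1)])
    finally have eq: "\<chi> i z \<odot> path a u i (len u) = \<chi> i y \<odot> path a u i (len u)" .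
    have k: "\<chi> i z \<in> carrier K" "\<chi> i y \<in> carrier K" using i zc yc by auto
    have "\<chi> i q \<odot> path a u i (len u) = \<zero>"
      using smult_if_rad_kills[OF as i(1) pc soc_kill[OF as i] q(1)] qdiff[OF pc]
        smult_if_rad_kills[OF as i(1) pc soc_kill[OF as i] yc(1)]
        smult_if_rad_kills[OF as i(1) pc soc_kill[OF as i] zc(1)] eq k pc by (simp add: minus_self)
    then have \<chi>q: "\<chi> i q = \<zero>\<^bsub>K\<^esub>" using smult_eq_zeroD[OF _ pc _ soc_nonzero[OF as i]] i q by simp
    \<comment> \<open>As \<open>u\<close> is not exceptional, the corner element \<open>q\<close> of
      the radical lies in the chain at the other vertex \<open>w\<close>, whose elements kill the
      arrow at \<open>u\<close>.\<close>
    have "q \<in> F w i 0"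
      by (rule comp_rad[OF i(1) w(3) i(1) w(3) q \<chi>q]) (use w False in auto)
    then show ?thesis by (rule kill)
  next
    case True
    have ij: "i = j0" "z = e j0" using start[OF True] by auto
    let ?c = "cyc a j0"
    have c: "?c = path a u i (val u)" using True ij by (simp add: cyc_def[OF as j0])
    interpret N: nilpotent_element A K ?c m by (rule cyc_nilpotent[OF as j0])
    \<comment> \<open>Since \<open>z\<close> is the idempotent and \<theta> fixes the cycle, the
      turn shows that \<open>q\<close> annihilates the cycle. Hence \<open>q\<close> is a multiple
      of the top power, whose product with an arrow is a path that is too long.\<close>
    have "?c = y \<otimes> ?c" using turn \<theta>c cyc_e(2)[OF as j0] ij unfolding c[symmetric] by simp
    then have qc: "q \<otimes> ?c = \<zero>"
      using qdiff[of ?c] cyc_e(1)[OF as j0] ij by (simp add: minus_self)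
    have "q \<otimes> ?c [^] m = \<zero>"
    proof -
      have "?c [^] m = ?c \<otimes> ?c [^] (m - 1)" using A.nat_pow_Suc2[of ?c "m - 1"] multiplicity by simp
      then have "q \<otimes> ?c [^] m = (q \<otimes> ?c) \<otimes> ?c [^] (m - 1)" using q(1) by (simp add: A.m_assoc)
      then show ?thesis using qc by simp
    qed
    then have "\<chi> i q \<odot> path a u i (len u) = \<zero>"
      using smult_if_rad_kills[OF as i(1) pc soc_kill[OF as i] q(1)] cyc_top[OF as j0] True ij by simp
    then have \<chi>q: "\<chi> i q = \<zero>\<^bsub>K\<^esub>" using smult_eq_zeroD[OF _ pc _ soc_nonzero[OF as i]] i q by simp
    obtain f where f: "\<And>l. f l \<in> carrier K" "f 0 = \<zero>\<^bsub>K\<^esub>" "q = N.ps f"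
      using corner_ps[OF as j0, of q] q \<chi>q ij by auto
    have "q = f m \<odot> ?c [^] m" using N.ps_x_zero[of f, OF f(1)] qc unfolding f(3) by simp
    then have "q \<otimes> a u h = f m \<odot> (path a u i (len u) \<otimes> a u h)"
      using cyc_top[OF as j0] True ij f(1) ac pc by (simp add: smult_mult_l)
    also have "path a u i (len u) \<otimes> a u h = path a u h (1 + len u)"
      using path_comp[OF as h(1,2), of 1 "len u"] path_1[OF as h(1,2)] h(3) by simp
    also have "\<dots> = \<zero>" by (rule path_beyond[OF as h(1,2)]) simp
    finally show ?thesis using f(1) by simp
  qed
  then show ?thesis using qdiff[OF ac] diff_eq_zeroD[of "y \<otimes> a u h" "z \<otimes> a u h"] yc zc ac by simp
qed

text \<open>Expresses that conjugation by the sum of the \<open>z j\<close> agrees with \<theta> on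
  the arrows at \<open>u\<close>.\<close>

definition good where
  "good z u \<longleftrightarrow> (\<forall>i\<in>edges \<Gamma>. u \<in> i \<longrightarrow> \<theta> (a u i) \<otimes> z i = z (\<rho> u i) \<otimes> a u i)"

text \<open>The unit at \<open>i\<close> is kept and transported to the other edges at
  \<open>u\<close>; only the arrow that returns to \<open>i\<close> needs \<open>closing\<close>. At
  the exceptional vertex the start has to be \<open>e j0\<close>, which is why the growth begins
  there.\<close>

lemma ex_good_at:
  assumes i: "i \<in> edges \<Gamma>" "u \<in> i" and z: "\<And>j. j \<in> edges \<Gamma> \<Longrightarrow> corner_unit j (z j)"
    and start: "u = exceptional \<Gamma> \<Longrightarrow> i = j0 \<and> z i = e j0"
  shows "\<exists>z'. (\<forall>j\<in>edges \<Gamma>. corner_unit j (z' j)) \<and> (\<forall>j. u \<notin> j \<or> j = i \<longrightarrow> z' j = z j) \<and> good z' u"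
proof -
  obtain y where y: "y 0 = z i" "\<And>t. corner_unit ((\<rho> u ^^ t) i) (y t)"
    "\<And>t. \<theta> (a u ((\<rho> u ^^ t) i)) \<otimes> y t = y (Suc t) \<otimes> a u ((\<rho> u ^^ t) i)"
    using ex_around[OF i z[OF i(1)]] by blast
  \<comment> \<open>The sequence \<open>y\<close> need not be periodic, so each edge is assigned its
    first position after \<open>i\<close>.\<close>
  define ix where "ix j = (LEAST t. j = (\<rho> u ^^ t) i)" for j
  have ix: "ix ((\<rho> u ^^ t) i) = t" if "t < val u" for t
    unfolding ix_def
  proof (rule Least_equality)
    show "t \<le> s" if "(\<rho> u ^^ t) i = (\<rho> u ^^ s) i" for s
      using rot_eq_iff[OF i, of t s] that \<open>t < val u\<close> by (metis mod_less mod_less_eq_dividend)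
  qed simp
  define z' where "z' j = (if j \<in> edges \<Gamma> \<and> u \<in> j then y (ix j) else z j)" for j
  have z't: "z' ((\<rho> u ^^ t) i) = y t" if "t < val u" for t
    using ix[OF that] rot_edge[OF i] rot_vertex[OF i] by (simp add: z'_def)
  have d: "0 < val u" by (rule deg_pos[OF i])
  have "corner_unit j (z' j)" if j: "j \<in> edges \<Gamma>" for j
  proof (cases "u \<in> j")
    case True
    then obtain t where "t < val u" "j = (\<rho> u ^^ t) i" using rot_surj[OF i j] by auto
    then show ?thesis using z't y(2) by simp
  qed (use z[OF j] in \<open>simp add: z'_def\<close>)
  moreover have z'i: "z' i = z i" using z't[of 0] d y(1) by simp
  moreover have "z' j = z j" if "u \<notin> j" for j using that by (simp add: z'_def)
  moreover have "good z' u"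
    unfolding good_def
  proof (intro ballI impI)
    fix j assume j: "j \<in> edges \<Gamma>" "u \<in> j"
    then obtain t where t: "t < val u" "j = (\<rho> u ^^ t) i" using rot_surj[OF i j] by auto
    show "\<theta> (a u j) \<otimes> z' j = z' (\<rho> u j) \<otimes> a u j"
    proof (cases "Suc t < val u")
      case True
      then show ?thesis using y(3)[of t] z't[of t] z't[of "Suc t"] t by simp
    next
      case False
      then have tv: "Suc t = val u" "t = val u - 1" using t by auto
      have ri: "\<rho> u j = i" using rot_deg[OF i] unfolding t(2) tv(1)[symmetric] by simp
      have yi: "corner_unit i (y (val u))" using y(2)[of "val u"] rot_deg[OF i] by simp
      have "y (val u) \<otimes> a u j = z i \<otimes> a u j"
      proof (rule closing[OF i z[OF i(1)] yi j ri])
        show "j = (\<rho> u ^^ (val u - 1)) i" using t(2) tv(2) by simp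
        show "\<theta> (path a u i (val u)) \<otimes> z i = y (val u) \<otimes> path a u i (val u)"
          using around_path[OF i, of y "val u"] y by simp
      qed (use start in blast)
      then show ?thesis using y(3)[of t] z't[OF t(1)] t(2) tv(1) ri z'i by simp
    qed
  qed
  ultimately show ?thesis by (intro exI[of _ z']) blast
qed

text \<open>A new vertex \<open>u\<close> is joined to \<open>W\<close> by a single edge, whose unit
  is kept; the other edges at \<open>u\<close> meet no vertex of \<open>W\<close>, so changing their
  units spoils nothing. This is where the absence of cycles enters.\<close>

lemma ex_good:
  assumes "subtree (exceptional \<Gamma>) W"
  shows "\<exists>z. (\<forall>j\<in>edges \<Gamma>. corner_unit j (z j)) \<and> (\<forall>u\<in>W. good z u)"
  using assms
proof induction
  case single
  have "corner_unit j (e j)" if "j \<in> edges \<Gamma>" for j using that by (simp add: corner_unit_def chi_e)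
  then show ?case using ex_good_at[OF j0, of e] by auto
next
  case (grow W w u)
  let ?i = "{w, u}"
  obtain z where z: "\<forall>j\<in>edges \<Gamma>. corner_unit j (z j)" "\<forall>u\<in>W. good z u" using grow.IH by blast
  have vW: "exceptional \<Gamma> \<in> W" using grow.hyps(1) by induction auto
  obtain z' where z': "\<forall>j\<in>edges \<Gamma>. corner_unit j (z' j)" "\<And>j. u \<notin> j \<or> j = ?i \<Longrightarrow> z' j = z j" "good z' u"
    using ex_good_at[OF grow.hyps(4), of u z] z(1) grow.hyps(3) vW by auto
  have same: "z' j = z j" if j: "j \<in> edges \<Gamma>" "x \<in> j" "x \<in> W" for j x
  proof (cases "u \<in> j")
    case True
    have "x \<noteq> u" using that grow.hyps(3) by auto
    then have "j = {x, u}" using edge_other[OF j(1) True] j(2) by auto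
    then have "x = w" using subtree_attach_unique[OF grow.hyps(1,3) j(3) _ grow.hyps(2,4)] j(1) by simp
    then show ?thesis using z'(2) \<open>j = {x, u}\<close> by simp
  qed (use z'(2) in simp)
  have "good z' x" if x: "x \<in> W" for x
    using z(2) x same rot_closed unfolding good_def by metis
  then show ?case using z' by blast
qed

theorem inner_if_fixes_cyc: "\<exists>u\<in>Units A. \<theta> = inner u"
proof -
  obtain z where z: "\<And>j. j \<in> edges \<Gamma> \<Longrightarrow> corner_unit j (z j)" and good: "\<And>u. u \<in> vertices \<Gamma> \<Longrightarrow> good z u"
    using ex_good[OF subtree_vertices[OF exceptional]] by blast
  have zc: "z j \<in> carrier A" "e j \<otimes> z j = z j" "z j \<otimes> e j = z j" "\<chi> j (z j) \<noteq> \<zero>\<^bsub>K\<^esub>" if "j \<in> edges \<Gamma>" for j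
    using z[OF that] by (auto simp: corner_unit_def)
  have zE: "z \<in> edges \<Gamma> \<rightarrow> carrier A" using zc by blast
  define U where "U = (\<Oplus>j\<in>edges \<Gamma>. z j)"
  have Uc: "U \<in> carrier A" unfolding U_def by (rule A.finsum_closed[OF zE])
  have zero: "e i \<otimes> z j = \<zero>" "z j \<otimes> e i = \<zero>" if "i \<in> edges \<Gamma>" "j \<in> edges \<Gamma>" "i \<noteq> j" for i j
  proof -
    have "e i \<otimes> z j = (e i \<otimes> e j) \<otimes> z j" using zc[OF that(2)] that by (simp add: A.m_assoc)
    then show "e i \<otimes> z j = \<zero>" using e_orth[OF that] zc(1)[OF that(2)] by simp
    have "z j \<otimes> e i = z j \<otimes> (e j \<otimes> e i)" using zc[OF that(2)] that by (simp add: A.m_assoc[symmetric])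
    then show "z j \<otimes> e i = \<zero>" using e_orth[OF that(2,1)] that(3) zc(1)[OF that(2)] by simp
  qed
  have eU: "e j \<otimes> U = z j" and Ue: "U \<otimes> e j = z j" if j: "j \<in> edges \<Gamma>" for j
  proof -
    have "e j \<otimes> U = (\<Oplus>i\<in>edges \<Gamma>. e j \<otimes> z i)" unfolding U_def using j by (intro A.finsum_rdistr finite_edges zE) simp
    also have "\<dots> = (\<Oplus>i\<in>edges \<Gamma>. if j = i then z i else \<zero>)"
      using j zc zero by (intro A.finsum_cong') auto
    also have "\<dots> = z j" by (rule A.finsum_singleton[OF j finite_edges zE])
    finally show "e j \<otimes> U = z j" .
    have "U \<otimes> e j = (\<Oplus>i\<in>edges \<Gamma>. z i \<otimes> e j)" unfolding U_def using j by (intro A.finsum_ldistr finite_edges zE) simp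
    also have "\<dots> = (\<Oplus>i\<in>edges \<Gamma>. if j = i then z i else \<zero>)"
      using j zc zero by (intro A.finsum_cong') auto
    also have "\<dots> = z j" by (rule A.finsum_singleton[OF j finite_edges zE])
    finally show "U \<otimes> e j = z j" .
  qed
  have "\<chi> j U \<noteq> \<zero>\<^bsub>K\<^esub>" if j: "j \<in> edges \<Gamma>" for j
    using arg_cong[OF eU[OF j], of "\<chi> j"] chi_mult[OF j _ Uc, of "e j"] chi_e[OF j j] zc(4)[OF j] j Uc by auto
  then have U: "U \<in> Units A" by (rule unit_if_chi_nonzero[OF Uc])
  have path: "\<theta> (path a u j t) \<otimes> U = U \<otimes> path a u j t" if j: "j \<in> edges \<Gamma>" "u \<in> j" for u j t
  proof -
    have gu: "good z u" by (rule good[OF edge_vertices[OF j]])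
    have pc: "path a u j t \<in> carrier A" for t by (rule path_closed[OF as j])
    have 1: "\<theta> (path a u j t) \<otimes> z j = z ((\<rho> u ^^ t) j) \<otimes> path a u j t" for t
    proof (induction t)
      case 0
      then show ?case using zc[OF j(1)] theta_e[OF j(1)] by simp
    next
      case (Suc t)
      let ?i = "(\<rho> u ^^ t) j"
      have i: "?i \<in> edges \<Gamma>" "u \<in> ?i" using rot_edge[OF j] rot_vertex[OF j] by auto
      have ac: "a u ?i \<in> carrier A" by (rule arrow(1)[OF as i])
      have i': "\<rho> u ?i \<in> edges \<Gamma>" using i by simp
      have "\<theta> (path a u j (Suc t)) \<otimes> z j = \<theta> (a u ?i) \<otimes> (z ?i \<otimes> path a u j t)"
        using Suc theta_mult theta_closed ac pc zc(1)[OF j(1)] by (simp add: A.m_assoc)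
      also have "\<dots> = (\<theta> (a u ?i) \<otimes> z ?i) \<otimes> path a u j t"
        using theta_closed ac pc zc(1)[OF i(1)] by (simp add: A.m_assoc)
      also have "\<theta> (a u ?i) \<otimes> z ?i = z (\<rho> u ?i) \<otimes> a u ?i" using gu i unfolding good_def by blast
      also have "(z (\<rho> u ?i) \<otimes> a u ?i) \<otimes> path a u j t = z ((\<rho> u ^^ Suc t) j) \<otimes> path a u j (Suc t)"
        using ac pc zc(1)[OF i'] by (simp add: A.m_assoc)
      finally show ?case .
    qed
    let ?i = "(\<rho> u ^^ t) j"
    have i: "?i \<in> edges \<Gamma>" using rot_edge[OF j] by simp
    have "\<theta> (path a u j t) \<otimes> e j = \<theta> (path a u j t)"
      using theta_mult[OF pc, of "e j"] path_e_right[OF as j] theta_e[OF j(1)] j by simp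
    then have "\<theta> (path a u j t) \<otimes> U = \<theta> (path a u j t) \<otimes> (e j \<otimes> U)"
      using theta_closed[OF pc] j Uc by (simp add: A.m_assoc[symmetric])
    also have "\<dots> = (U \<otimes> e ?i) \<otimes> path a u j t" unfolding eU[OF j(1)] Ue[OF i] by (rule 1)
    also have "\<dots> = U \<otimes> path a u j t" using path_e_left[OF as j] Uc pc i by (simp add: A.m_assoc)
    finally show ?thesis .
  qed
  have all: "\<theta> x \<otimes> U = U \<otimes> x" if "x \<in> carrier A" for x
  proof -
    \<comment> \<open>The relation of an arrow system with itself serves as the statement that the
      paths span \<open>A\<close>.\<close>
    have "\<theta> x \<otimes> U = U \<otimes> x" if "(x, y) \<in> psp (gens_all a a)" for x y
      using that
    proof induction
      case zero
      then show ?case using theta_zero Uc by simp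
    next
      case (step k b b' x y)
      then obtain u j t where b: "b = path a u j t" "j \<in> edges \<Gamma>" "u \<in> j" unfolding gens_all_def by auto
      have bc: "b \<in> carrier A" unfolding b(1) by (rule path_closed[OF as b(2,3)])
      have xc: "x \<in> carrier A" using psp_closed[OF gens_all_closed[OF as as] step(3)] by simp
      have "\<theta> b \<otimes> U = U \<otimes> b" unfolding b(1) by (rule path[OF b(2,3)])
      then show ?case
        using step.IH step(1) bc xc Uc theta_add theta_smult theta_closed
        by (simp add: A.l_distr A.r_distr smult_mult_l smult_mult_r)
    qed
    then show ?thesis using gens_all_total[OF as as that] by blast
  qed
  have "\<theta> = inner U"
  proof (rule extensionalityI)
    show "\<theta> \<in> extensional (carrier A)" by (rule alg_autD(8)[OF FixD(1)[OF \<theta>]])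
    show "inner U \<in> extensional (carrier A)" by (simp add: inner_def)
    fix x assume x: "x \<in> carrier A"
    have "\<theta> x \<otimes> (U \<otimes> inv U) = (U \<otimes> x) \<otimes> inv U"
      using all[OF x] theta_closed[OF x] Uc U by (simp only: A.m_assoc[symmetric] A.Units_inv_closed)
    then show "\<theta> x = inner U x" using theta_closed[OF x] x U by (simp add: inner_def)
  qed
  then show ?thesis using U by blast
qed

end

text \<open>For the harder direction, the inverse of \<psi> composed with \<phi> fixes the cycle and
  is thus inner by some \<open>u\<close>; moving \<psi> to the other side replaces \<open>u\<close>
  by \<open>\<psi> u\<close>.\<close>

lemma same_coset_iff_cyc_eq:
  assumes \<phi>: "\<phi> \<in> Fix" and \<psi>: "\<psi> \<in> Fix"
  shows "(\<exists>u\<in>Units A. \<phi> = compose (carrier A) (inner u) \<psi>) \<longleftrightarrow> \<phi> (cyc a j0) = \<psi> (cyc a j0)"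
proof
  assume "\<exists>u\<in>Units A. \<phi> = compose (carrier A) (inner u) \<psi>"
  then show "\<phi> (cyc a j0) = \<psi> (cyc a j0)" using cyc_eq_if_same_coset[OF as j0 \<phi> \<psi>] by blast
next
  assume eq: "\<phi> (cyc a j0) = \<psi> (cyc a j0)"
  note D = alg_autD[OF FixD(1)[OF \<psi>]] and E = alg_autD[OF FixD(1)[OF \<phi>]]
  let ?g = "\<lambda>x\<in>carrier A. inv_into (carrier A) \<psi> x"
  have inj: "inj_on \<psi> (carrier A)" using D(7) by (simp add: bij_betw_def)
  have g: "?g (\<psi> x) = x" if "x \<in> carrier A" for x using that D(1)[OF that] inj by simp
  have \<psi>g: "\<psi> (?g x) = x" if "x \<in> carrier A" for x using that alg_auts_inverse(2)[OF FixD(1)[OF \<psi>] that] by simp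
  have ga: "?g \<in> alg_auts K A" by (rule alg_auts_inverse(1)[OF FixD(1)[OF \<psi>]])
  have gF: "?g \<in> Fix"
  proof -
    have "?g (e j) = e j" if "j \<in> edges \<Gamma>" for j using g[of "e j"] FixD(2)[OF \<psi> that] that by simp
    then show ?thesis using ga by (simp add: Fix_def)
  qed
  define \<theta> where "\<theta> = compose (carrier A) ?g \<phi>"
  have \<theta>: "\<theta> \<in> Fix" unfolding \<theta>_def by (rule Fix_compose[OF gF \<phi>])
  have cc: "cyc a j0 \<in> carrier A" by (rule cyc_closed[OF as j0])
  have "\<theta> (cyc a j0) = cyc a j0" using eq g[OF cc] cc by (simp add: \<theta>_def compose_eq)
  then obtain u where u: "u \<in> Units A" "\<theta> = inner u" using inner_if_fixes_cyc[OF \<theta>] by blast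
  have "\<phi> = compose (carrier A) \<psi> \<theta>"
  proof (rule extensionalityI)
    show "\<phi> x = compose (carrier A) \<psi> \<theta> x" if "x \<in> carrier A" for x
      using that \<psi>g[OF E(1)[OF that]] by (simp add: \<theta>_def compose_eq)
  qed (use E(8) in \<open>simp_all add: compose_def\<close>)
  then have "\<phi> = compose (carrier A) (inner (\<psi> u)) \<psi>"
    using aut_inner(2)[OF FixD(1)[OF \<psi>] u(1)] u(2) by simp
  then show "\<exists>u\<in>Units A. \<phi> = compose (carrier A) (inner u) \<psi>" using aut_inner(1)[OF FixD(1)[OF \<psi>] u(1)] by blast
qed

end

text \<open>\<open>Fix\<close> is the common source: cosets map it onto \<open>OutK\<close>,
  coefficients of the image of the cycle map it onto \<open>H_group\<close>. The hypothesis,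
  supplied by \<open>fixes_simples_iff\<close>, is the link to the simple modules.\<close>

theorem OutK_iso_H:
  assumes fs: "\<And>\<phi>. \<phi> \<in> alg_auts K A \<Longrightarrow>
    fixes_simples A \<phi> \<longleftrightarrow> (\<forall>j\<in>edges \<Gamma>. \<forall>x\<in>carrier A. \<chi> j (\<phi> x) = \<chi> j x)"
  shows "OutK K A \<cong> H_group K m"
proof -
  obtain a where as: "arrow_system a" using ex_arrow_system by blast
  have "\<exists>j0\<in>edges \<Gamma>. exceptional \<Gamma> \<in> j0"
  proof -
    have "edges \<Gamma> \<noteq> {}" using card_edges by auto
    then obtain j where j: "j \<in> edges \<Gamma>" by blast
    then obtain x where x: "x \<in> j" using edges[OF j] by auto
    have "(exceptional \<Gamma>, x) \<in> {(x, y). {x, y} \<in> edges \<Gamma>}\<^sup>*" using connected[OF exceptional edge_vertices[OF j x]] .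
    then show ?thesis
    proof (cases rule: converse_rtranclE)
      case base
      then show ?thesis using j x by blast
    qed auto
  qed
  then obtain j0 where j0: "j0 \<in> edges \<Gamma>" "exceptional \<Gamma> \<in> j0" by blast
  interpret N: nilpotent_element A K "cyc a j0" m by (rule cyc_nilpotent[OF as j0])
  interpret G: group "alg_aut_group K A" by (rule alg_aut_group)
  let ?f = "\<lambda>\<phi>. inner_auts A #>\<^bsub>alg_aut_group K A\<^esub> \<phi>"
  show ?thesis
  proof (rule is_iso_of_surjections[where S = Fix and f = ?f and g = N.coeffs and p = "compose (carrier A)"])
    have "fixes_simples A \<phi>" if "\<phi> \<in> Fix" for \<phi> using fs[OF FixD(1)[OF that]] chi_Fix[OF that] by blast
    moreover have "?f \<phi> \<in> ?f ` Fix" if \<phi>: "\<phi> \<in> alg_auts K A" "fixes_simples A \<phi>" for \<phi>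
    proof -
      obtain u where u: "u \<in> Units A" "compose (carrier A) (inner u) \<phi> \<in> Fix"
        using ex_Fix_in_coset[OF \<phi>(1)] fs[OF \<phi>(1)] \<phi>(2) by blast
      have "?f (compose (carrier A) (inner u) \<phi>) = ?f \<phi>"
        using inner_coset_eq_iff[OF FixD(1)[OF u(2)] \<phi>(1)] u(1) by blast
      then show ?thesis using u(2) by (metis imageI)
    qed
    ultimately show "?f ` Fix = carrier (OutK K A)" using FixD(1) by (auto simp: OutK_def)
    show "N.coeffs ` Fix = carrier (H_group K m)"
    proof
      show "N.coeffs ` Fix \<subseteq> carrier (H_group K m)"
      proof
        fix \<alpha> assume "\<alpha> \<in> N.coeffs ` Fix"
        then obtain \<phi> where \<phi>: "\<phi> \<in> Fix" "\<alpha> = N.coeffs \<phi>" by blast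
        obtain \<beta> where "\<beta> \<in> carrier N.H" "\<phi> (cyc a j0) = N.pev \<beta>" using Fix_coeffs[OF as j0 \<phi>(1)] by blast
        then show "\<alpha> \<in> carrier (H_group K m)" using N.coeffsI[of \<beta> \<phi>] \<phi>(2) by simp
      qed
      show "carrier (H_group K m) \<subseteq> N.coeffs ` Fix"
      proof
        fix \<alpha> assume \<alpha>: "\<alpha> \<in> carrier (H_group K m)"
        obtain \<phi> where \<phi>: "\<phi> \<in> Fix" "\<phi> (cyc a j0) = N.pev \<alpha>" using ex_Fix[OF as j0 \<alpha>] by blast
        show "\<alpha> \<in> N.coeffs ` Fix" using N.coeffsI[of \<alpha> \<phi>, OF \<alpha> \<phi>(2)] \<phi>(1) by blast
      qed
    qed
    show "?f \<phi> = ?f \<psi> \<longleftrightarrow> N.coeffs \<phi> = N.coeffs \<psi>" if F: "\<phi> \<in> Fix" "\<psi> \<in> Fix" for \<phi> \<psi>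
    proof -
      obtain \<alpha> where \<alpha>: "\<alpha> \<in> carrier N.H" "\<phi> (cyc a j0) = N.pev \<alpha>" using Fix_coeffs[OF as j0 F(1)] by blast
      obtain \<beta> where \<beta>: "\<beta> \<in> carrier N.H" "\<psi> (cyc a j0) = N.pev \<beta>" using Fix_coeffs[OF as j0 F(2)] by blast
      have "?f \<phi> = ?f \<psi> \<longleftrightarrow> \<phi> (cyc a j0) = \<psi> (cyc a j0)"
        using inner_coset_eq_iff[OF FixD(1)[OF F(1)] FixD(1)[OF F(2)]] same_coset_iff_cyc_eq[OF as j0 F] by simp
      also have "\<dots> \<longleftrightarrow> \<alpha> = \<beta>" using N.pev_inj[OF \<alpha>(1) \<beta>(1)] \<alpha>(2) \<beta>(2) by auto
      also have "\<dots> \<longleftrightarrow> N.coeffs \<phi> = N.coeffs \<psi>" using N.coeffsI[of \<alpha> \<phi>, OF \<alpha>] N.coeffsI[of \<beta> \<psi>, OF \<beta>] by simp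
      finally show ?thesis .
    qed
    show "compose (carrier A) \<phi> \<psi> \<in> Fix" if "\<phi> \<in> Fix" "\<psi> \<in> Fix" for \<phi> \<psi> using Fix_compose[OF that] .
    show "?f (compose (carrier A) \<phi> \<psi>) = ?f \<phi> \<otimes>\<^bsub>OutK K A\<^esub> ?f \<psi>" if "\<phi> \<in> Fix" "\<psi> \<in> Fix" for \<phi> \<psi>
      using OutK_mult[OF FixD(1)[OF that(1)] FixD(1)[OF that(2)]] by simp
    show "N.coeffs (compose (carrier A) \<phi> \<psi>) = N.coeffs \<phi> \<otimes>\<^bsub>H_group K m\<^esub> N.coeffs \<psi>" if "\<phi> \<in> Fix" "\<psi> \<in> Fix" for \<phi> \<psi>
      using Fix_coeffs[OF as j0 that(1)] Fix_coeffs[OF as j0 that(2)] N.coeffs_compose[OF FixD(1)[OF that(1)]] by metis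
  qed
qed

end

section \<open>Automorphisms that fix the simple modules\<close>

lemma twist_left_module:
  fixes M :: "('a, 'b, 'm) module_scheme"
  assumes M: "left_module A M" and A: "kalg A K" and \<phi>: "\<phi> \<in> alg_auts K A"
  shows "left_module A (twist \<phi> M)"
proof -
  interpret M: left_module A M by (rule M)
  interpret A: kalg A K by (rule A)
  note D = A.alg_autD[OF \<phi>]
  have "abelian_group (twist \<phi> M)"
    using M.M.abelian_group_axioms
    by (simp add: abelian_group_def abelian_group_axioms_def abelian_monoid_def twist_def)
  then show ?thesis
    by (intro left_module.intro left_module_axioms.intro M.R.ring_axioms)
      (simp_all add: twist_def D M.smult_closed M.smult_l_distr M.smult_r_distr M.smult_assoc1 M.smult_one)
qed

context basic_simples
begin

text \<open>Twisting composes the character of \<open>S j\<close> with \<phi>, and isomorphic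
  one-dimensional modules have equal characters. Conversely, if the characters agree, the identity
  map is an isomorphism.\<close>

lemma fixes_simples_iff:
  assumes \<phi>: "\<phi> \<in> alg_auts K A"
  shows "fixes_simples A \<phi> \<longleftrightarrow> (\<forall>j\<in>J. \<forall>x\<in>carrier A. chr j (\<phi> x) = chr j x)"
proof
  interpret kalg A K by (rule kalg)
  note D = alg_autD[OF \<phi>]
  assume fs: "fixes_simples A \<phi>"
  show "\<forall>j\<in>J. \<forall>x\<in>carrier A. chr j (\<phi> x) = chr j x"
  proof (intro ballI)
    fix j x assume j: "j \<in> J" and x: "x \<in> carrier A"
    let ?T = "twist \<phi> (S j)"
    have T: "left_module A ?T" by (rule twist_left_module[OF S_left_module[OF j] kalg_axioms \<phi>])
    obtain h where h: "h \<in> lmod_hom A ?T (S j)" "bij_betw h (carrier ?T) (carrier (S j))"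
      using fs simple_S[OF j] unfolding fixes_simples_def lmod_iso_def by blast
    have g: "gen j \<in> carrier ?T" using idem_gen(2)[OF j] by (simp add: twist_def)
    have c: "chr j x \<in> carrier K" using chr(1)[OF j x] .
    have "x \<odot>\<^bsub>?T\<^esub> gen j = (chr j x \<odot> \<one>) \<odot>\<^bsub>?T\<^esub> gen j" by (rule chr_iso_invariant[OF j T h x g])
    then have "\<phi> x \<odot>\<^bsub>S j\<^esub> gen j = (chr j x \<odot> \<one>) \<odot>\<^bsub>S j\<^esub> gen j"
      using D(4) D(6)[OF c, of "\<one>"] by (simp add: twist_def)
    then show "chr j (\<phi> x) = chr j x" by (rule chr_eqI[OF j D(1)[OF x] c])
  qed
next
  interpret kalg A K by (rule kalg)
  note D = alg_autD[OF \<phi>]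
  assume inv: "\<forall>j\<in>J. \<forall>x\<in>carrier A. chr j (\<phi> x) = chr j x"
  show "fixes_simples A \<phi>"
    unfolding fixes_simples_def
  proof (intro allI impI)
    fix T :: "('a, 'a set) module" assume T: "simple_lmod A T"
    then have lm: "left_module A T" by (simp add: simple_lmod_def)
    obtain j h where j: "j \<in> J" and h: "h \<in> lmod_hom A T (S j)" "bij_betw h (carrier T) (carrier (S j))"
      using simple_char[OF T] by blast
    have eq: "\<phi> x \<odot>\<^bsub>T\<^esub> t = x \<odot>\<^bsub>T\<^esub> t" if "x \<in> carrier A" "t \<in> carrier T" for x t
      using chr_iso_invariant[OF j lm h that] chr_iso_invariant[OF j lm h D(1)[OF that(1)] that(2)] inv j that(1) by simp
    have "(\<lambda>t. t) \<in> lmod_hom A (twist \<phi> T) T" using eq by (simp add: lmod_hom_def twist_def)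
    moreover have "bij_betw (\<lambda>t. t) (carrier (twist \<phi> T)) (carrier T)" by (simp add: twist_def bij_betw_def)
    ultimately show "lmod_iso A (twist \<phi> T) T" unfolding lmod_iso_def by blast
  qed
qed

end

lemma (in brauer_tree) branch_edges:
  assumes j: "j \<in> edges \<Gamma>" "u \<in> j"
  shows "set (branch \<Gamma> j u) \<subseteq> edges \<Gamma>"
proof -
  have "u \<in> vertices \<Gamma>" using edges[OF j(1)] j(2) by auto
  then have "(rotation \<Gamma> u ^^ i) j \<in> edges_at \<Gamma> u" for i
    using cyclic_on_funpow(1)[OF rotation_cyclic] j by (simp add: edges_at_def)
  from this[of "Suc _"] show ?thesis unfolding branch_def edges_at_def by auto
qed

theorem theorem11p5:
  fixes K :: "'k ring" and A :: "('k, 'a) module" and \<Gamma> :: "'v brauer_tree" and m n :: nat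
  assumes "algebraically_closed K"
    and "\<exists>p::nat. p > 0 \<and> [p] \<cdot>\<^bsub>K\<^esub> \<one>\<^bsub>K\<^esub> = \<zero>\<^bsub>K\<^esub>"
    and "brauer_tree \<Gamma> m n"
    and "fd_algebra K A"
    and "basic_algebra A"
    and "brauer_tree_algebra K A \<Gamma>"
  shows "OutK K A \<cong> alg_aut_group K (trunc_poly_algebra K (m + 1)) \<and>
    alg_aut_group K (trunc_poly_algebra K (m + 1)) \<cong> H_group K m"
proof -
  interpret T: brauer_tree \<Gamma> m n by fact
  interpret FA: fd_algebra K A by fact
  let ?T = "trunc_poly_algebra K (m + 1)"
  let ?Q = "\<lambda>P j. quot ((P j)\<lparr>carrier := lmod_rad A (P j)\<rparr>) (lmod_soc A (P j))"
  have sym: "symmetric_algebra K A" using assms(6) by (simp add: brauer_tree_algebra_def)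
  obtain \<tau> where \<tau>: "kalg.symmetrizing A K \<tau>" using FA.ex_symmetrizing[OF sym] by blast
  from assms(5) obtain E where E: "finite E" "\<forall>e\<in>E. primitive_idempotent A e"
    "\<forall>e\<in>E. \<forall>f\<in>E. e \<noteq> f \<longrightarrow> e \<otimes>\<^bsub>A\<^esub> f = \<zero>\<^bsub>A\<^esub>" "(\<Oplus>\<^bsub>A\<^esub>e\<in>E. e) = \<one>\<^bsub>A\<^esub>"
    "\<forall>e\<in>E. \<forall>f\<in>E. e \<noteq> f \<longrightarrow> \<not> lmod_iso A (left_ideal_lmod A e) (left_ideal_lmod A f)"
    unfolding basic_algebra_def by blast
  from assms(6) obtain S :: "'v set \<Rightarrow> ('a, 'a set) module" and P :: "'v set \<Rightarrow> ('a, 'a) module" where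
      S: "\<forall>j\<in>edges \<Gamma>. simple_lmod A (S j)"
        "\<forall>j\<in>edges \<Gamma>. \<forall>j'\<in>edges \<Gamma>. lmod_iso A (S j) (S j') \<longrightarrow> j = j'"
        "\<forall>T :: ('a, 'a set) module. simple_lmod A T \<longrightarrow> (\<exists>j\<in>edges \<Gamma>. lmod_iso A T (S j))"
      and P: "\<forall>j\<in>edges \<Gamma>. (\<exists>\<pi>. projective_cover A (P j) \<pi> (S j)) \<and>
        lmod_soc A (P j) \<subseteq> lmod_rad A (P j) \<and>
        (\<exists>U v w. j = {v, w} \<and>
            U v <+>\<^bsub>?Q P j\<^esub> U w = carrier (?Q P j) \<and> U v \<inter> U w = {\<zero>\<^bsub>?Q P j\<^esub>} \<and>
            (\<forall>u\<in>{v, w}. submodule (U u) A (?Q P j) \<and> uniserial A ((?Q P j)\<lparr>carrier := U u\<rparr>) \<and>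
               factors_from_top A ((?Q P j)\<lparr>carrier := U u\<rparr>) (map S (branch \<Gamma> j u))))"
    unfolding brauer_tree_algebra_def Let_def by (elim conjE exE) (rule that)
  have "\<forall>j\<in>edges \<Gamma>. \<exists>\<pi>. projective_cover A (P j) \<pi> (S j)" using P by blast
  from bchoice[OF this] obtain \<pi> where \<pi>: "\<forall>j\<in>edges \<Gamma>. projective_cover A (P j) (\<pi> j) (S j)" by (rule exE)
  interpret B: symmetric_simples A K "edges \<Gamma>" E S P \<pi> \<tau>
  proof (intro symmetric_simples.intro basic_simples.intro symmetric_simples_axioms.intro basic_simples_axioms.intro)
    show "fd_algebra K A" "algebraically_closed K" by fact+
    show "e = f" if "e \<in> E" "f \<in> E" "lmod_iso A (left_ideal_lmod A e) (left_ideal_lmod A f)" for e f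
      using E(5) that by blast
  qed (use E(1-4) S \<pi> \<tau> in blast)+
  have "\<forall>j\<in>edges \<Gamma>. \<exists>G v w. j = {v, w} \<and> B.branch_filtrations j (branch \<Gamma> j) v w G"
  proof
    fix j assume j: "j \<in> edges \<Gamma>"
    have soc: "lmod_soc A (P j) \<subseteq> lmod_rad A (P j)" using bspec[OF P j] by (elim conjE)
    obtain U v w where U: "j = {v, w}" "U v <+>\<^bsub>?Q P j\<^esub> U w = carrier (?Q P j)" "U v \<inter> U w = {\<zero>\<^bsub>?Q P j\<^esub>}"
      "\<forall>u\<in>{v, w}. submodule (U u) A (?Q P j) \<and> uniserial A ((?Q P j)\<lparr>carrier := U u\<rparr>) \<and>
         factors_from_top A ((?Q P j)\<lparr>carrier := U u\<rparr>) (map S (branch \<Gamma> j u))"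
      using bspec[OF P j] by (elim conjE exE) (rule that)
    have br: "set (branch \<Gamma> j u) \<subseteq> edges \<Gamma>" if "u \<in> {v, w}" for u using T.branch_edges[OF j] that U(1) by simp
    have "\<exists>G. B.branch_filtrations j (branch \<Gamma> j) v w G"
      by (rule B.ex_filtrations[where U = U and Q = "?Q P j", OF j soc refl U(2,3)]) (rule bspec[OF U(4)] br, assumption)+
    then show "\<exists>G v w. j = {v, w} \<and> B.branch_filtrations j (branch \<Gamma> j) v w G" using U(1) by blast
  qed
  from bchoice[OF this] obtain G where
    "\<forall>j\<in>edges \<Gamma>. \<exists>v w. j = {v, w} \<and> B.branch_filtrations j (branch \<Gamma> j) v w (G j)" by (rule exE)
  note G = this[unfolded B.branch_filtrations_def]
  have Gf: "kalg.filtration A K (B.idem j) (map B.chr (branch \<Gamma> j u @ [j])) (G j u)"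
    "G j u 0 \<subseteq> B.rad_part j" "G j u (branch_length \<Gamma> u) = B.soc_part j"
    if j: "j \<in> edges \<Gamma>" "u \<in> j" for j u
    using bspec[OF G j(1)] j(2) by (auto simp: branch_def)
  \<comment> \<open>The two ends of \<open>j\<close> may have been chosen in the opposite order;
    commutativity of addition repairs this.\<close>
  have Gs: "\<exists>a\<in>G j u 0. \<exists>b\<in>G j w 0. x = a \<oplus>\<^bsub>A\<^esub> b"
    if j: "j \<in> edges \<Gamma>" "j = {u, w}" and x: "x \<in> B.rad_part j" for j u w x
  proof -
    obtain v' w' where vw: "j = {v', w'}" "\<exists>a\<in>G j v' 0. \<exists>b\<in>G j w' 0. x = a \<oplus>\<^bsub>A\<^esub> b"
      using bspec[OF G j(1)] x by blast
    have uw: "u = v' \<and> w = w' \<or> u = w' \<and> w = v'" using j(2) vw(1) by (auto simp: doubleton_eq_iff)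
    obtain a b where ab: "a \<in> G j v' 0" "b \<in> G j w' 0" "x = a \<oplus>\<^bsub>A\<^esub> b" using vw(2) by blast
    have "a \<in> B.rad_part j" "b \<in> B.rad_part j" using ab Gf(2)[OF j(1)] vw(1) by blast+
    then have "x = b \<oplus>\<^bsub>A\<^esub> a" using ab(3) by (simp add: B.rad_part_def FA.A.a_comm)
    then show ?thesis using uw ab by blast
  qed
  have Gi: "G j u 0 \<inter> G j w 0 \<subseteq> B.soc_part j" if j: "j \<in> edges \<Gamma>" "j = {u, w}" for j u w
  proof -
    obtain v' w' where vw: "j = {v', w'}" "G j v' 0 \<inter> G j w' 0 \<subseteq> B.soc_part j"
      using bspec[OF G j(1)] by blast
    have "u = v' \<and> w = w' \<or> u = w' \<and> w = v'" using j(2) vw(1) by (auto simp: doubleton_eq_iff)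
    then show ?thesis using vw(2) by blast
  qed
  have fin: "finite (edges \<Gamma>)" using T.card_edges by (metis card.infinite not_one_le_zero)
  \<comment> \<open>The chains were chosen edge by edge, so the arguments of \<open>G\<close> are
    exchanged to fit the locale.\<close>
  interpret X: brauer_algebra A K \<Gamma> m n B.idem B.chr \<tau> "\<lambda>u j. G j u"
  proof (intro brauer_algebra.intro brauer_algebra_axioms.intro)
    show "kalg A K" by (rule FA.kalg)
    show "brauer_tree \<Gamma> m n" by fact
    show "B.chr j x = \<zero>\<^bsub>K\<^esub>" if "j \<in> edges \<Gamma>" "u \<in> j" "x \<in> G j u 0" for j u x
      using Gf(2)[OF that(1,2)] that(3) by (auto simp: B.rad_part_def)
    show "\<exists>a\<in>G j u 0. \<exists>b\<in>G j w 0. x = a \<oplus>\<^bsub>A\<^esub> b"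
      if "j \<in> edges \<Gamma>" "j = {u, w}" "x \<in> carrier A" "x \<otimes>\<^bsub>A\<^esub> B.idem j = x" "B.chr j x = \<zero>\<^bsub>K\<^esub>" for j u w x
      by (rule Gs[OF that(1,2)]) (use that in \<open>simp add: B.rad_part_def\<close>)
    show "G j u 0 \<inter> G j w 0 \<subseteq> G j u (branch_length \<Gamma> u)" if "j \<in> edges \<Gamma>" "j = {u, w}" "u \<noteq> w" for j u w
      using Gi[OF that(1,2)] Gf(3)[OF that(1), of u] that(2) by simp
    show "G j u (branch_length \<Gamma> u) = G j w (branch_length \<Gamma> w)" if "j \<in> edges \<Gamma>" "u \<in> j" "w \<in> j" for j u w
      using Gf(3)[OF that(1,2)] Gf(3)[OF that(1,3)] by simp
    show "\<exists>y\<in>carrier A. y \<otimes>\<^bsub>A\<^esub> x = \<one>\<^bsub>A\<^esub>"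
      if "x \<in> carrier A" "\<And>j. j \<in> edges \<Gamma> \<Longrightarrow> B.chr j x \<noteq> \<zero>\<^bsub>K\<^esub>" for x by (rule B.left_inverse[OF that])
    show "kalg.filtration A K (B.idem j) (map B.chr (branch \<Gamma> j u @ [j])) (G j u)" if "j \<in> edges \<Gamma>" "u \<in> j" for j u
      by (rule Gf(1)[OF that])
  qed (fact fin \<tau> B.idem_carrier B.idem_orth B.sum_idem B.chr(1) B.chr_add B.chr_mult B.chr_smult
      B.chr_idem B.chr_one)+
  have OutK: "OutK K A \<cong> H_group K m"
    by (rule X.OutK_iso_H[OF B.fixes_simples_iff])

  obtain x where x: "nilpotent_element ?T K x m" "carrier ?T = kalg.sp ?T K (range (\<lambda>i::nat. x [^]\<^bsub>?T\<^esub> i))"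
    using field.trunc_poly[OF FA.K.field_axioms, of m] T.multiplicity by auto
  have H: "alg_aut_group K ?T \<cong> H_group K m"
    by (rule nilpotent_element.alg_aut_group_iso_H[OF x])
  \<comment> \<open>Reversing an isomorphism needs a group on one side; the group laws are known for
    the automorphisms of the truncated polynomial algebra.\<close>
  have "group (alg_aut_group K ?T)"
    using kalg.alg_aut_group[of ?T K] x(1) by (simp add: nilpotent_element_def)
  then have "H_group K m \<cong> alg_aut_group K ?T" using H by (rule group.iso_sym)
  then show ?thesis using H OutK iso_trans by blast
qed

end
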